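(* Let $n\ge 2$ and $k\ge 2$ be integers, and let $\Sigma\subset\mathbb{R}^n$ be a compact $C^k$ hypersurface. Then there exists an arbitrarily small $C^k$ perturbation $\Sigma'$ of $\Sigma$ such that for every $R>1$ and every $\varepsilon>0$ there exist $f\in L^2(\Sigma')$ and a weight $w:\mathbb{R}^n\to[0,1]$ with \[\int_{B_R}\big|\mathcal{E}_{\Sigma'}f(x)\big|^2w(x)\,dx\;\ge\; C_\varepsilon^{-1}\, R^{\frac{n-1}{n-1+k}-\varepsilon}\,\|f\|_{L^2(\Sigma')}^2\,\|\mathcal{M}w\|_{L^\infty(\mathbb{S}^{n-1})},\] where $C_\varepsilon$ is a constant depending only on $\varepsilon$ (and on $n,k,\Sigma'$), not on $R$.
   Context: For a compact hypersurface $\Sigma$ with surface measure $d\sigma$, the Fourier extension operator is $\mathcal{E}_\Sigma f(x)=(f\,d\sigma)^{\vee}(x)=\int_\Sigma f(\sigma)e^{2\pi i x\cdot\sigma}\,d\sigma(\sigma)$. For a nonnegative weight $w$ on $\mathbb{R}^n$ and $\nu\in\mathbb{S}^{n-1}$, $\mathcal{M}w(\nu)=\sup\int_T w$, the supremum over all tubes $T$ of radius $1$ and infinite length (unit tubes) parallel to $\nu$. $B_R$ is a ball of radius $R$ (centered at the origin). "Arbitrarily small $C^k$ perturbation" means: for every $\rho>0$ one can choose $\Sigma'$ within distance $\rho$ of $\Sigma$ in the $C^k$ topology. *)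

theory Defs
  imports "HOL-Analysis.Analysis" "HOL-Probability.Essential_Supremum"
begin

(* Normalising constant of the s-dimensional Hausdorff measure
   (so that H^s agrees with s-dimensional surface/Lebesgue measure). *)
definition hausdorff_const :: "real \<Rightarrow> real" where
  "hausdorff_const s = pi powr (s / 2) / (Gamma (s / 2 + 1) * 2 powr s)"

definition hausdorff_outer :: "real \<Rightarrow> 'a::metric_space set \<Rightarrow> ennreal" where
  "hausdorff_outer s A =
     (SUP \<delta>\<in>{0<..}. INF C\<in>{C :: nat \<Rightarrow> 'a set. A \<subseteq> (\<Union>i. C i) \<and>
                                 (\<forall>i. bounded (C i) \<and> diameter (C i) \<le> \<delta>)}.
        (\<Sum>i. ennreal (hausdorff_const s * diameter (C i) powr s)))"

definition surface_measure :: "(real^'n) set \<Rightarrow> (real^'n) measure" where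
  "surface_measure S = measure_of UNIV (sets borel)
      (\<lambda>A. hausdorff_outer (real CARD('n) - 1) (A \<inter> S))"

definition Ck_derivs :: "nat \<Rightarrow> (real^'n) set \<Rightarrow> (real^'n \<Rightarrow> real)
                          \<Rightarrow> ('n list \<Rightarrow> real^'n \<Rightarrow> real) \<Rightarrow> bool" where
  "Ck_derivs k U g D \<longleftrightarrow>
     (\<forall>x\<in>U. D [] x = g x) \<and>
     (\<forall>al. length al \<le> k \<longrightarrow> continuous_on U (D al)) \<and>
     (\<forall>al i x. length al < k \<and> x \<in> U \<longrightarrow>
        ((\<lambda>t. D al (x + t *\<^sub>R axis i 1)) has_real_derivative D (i # al) x) (at 0))"

definition Ck_on :: "nat \<Rightarrow> (real^'n) set \<Rightarrow> (real^'n \<Rightarrow> real) \<Rightarrow> bool" where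
  "Ck_on k U g \<longleftrightarrow> (\<exists>D. Ck_derivs k U g D)"

definition Ck_hypersurface :: "nat \<Rightarrow> (real^'n) set \<Rightarrow> bool" where
  "Ck_hypersurface k S \<longleftrightarrow>
     (\<forall>p\<in>S. \<exists>U F. open U \<and> p \<in> U \<and> Ck_on k U F \<and>
        S \<inter> U = {x\<in>U. F x = 0} \<and>
        (\<forall>x\<in>S \<inter> U. \<exists>F'. (F has_derivative F') (at x) \<and> F' \<noteq> (\<lambda>h. 0)))"

definition Ck_close_to_id :: "nat \<Rightarrow> real \<Rightarrow> (real^'n \<Rightarrow> real^'n) \<Rightarrow> bool" where
  "Ck_close_to_id k \<rho> \<Phi> \<longleftrightarrow>
     (\<forall>j. \<exists>D. Ck_derivs k UNIV (\<lambda>x. \<Phi> x $ j - x $ j) D \<and>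
              (\<forall>al x. length al \<le> k \<longrightarrow> \<bar>D al x\<bar> \<le> \<rho>))"

definition fourier_ext :: "(real^'n) measure \<Rightarrow> (real^'n \<Rightarrow> complex) \<Rightarrow> real^'n \<Rightarrow> complex" where
  "fourier_ext \<sigma> f x = (LINT s|\<sigma>. f s * cis (2 * pi * (x \<bullet> s)))"

definition tube :: "real^'n \<Rightarrow> real^'n \<Rightarrow> (real^'n) set" where
  "tube \<nu> a = {x. \<exists>t::real. dist x (a + t *\<^sub>R \<nu>) < 1}"

definition tube_max :: "(real^'n \<Rightarrow> real) \<Rightarrow> real^'n \<Rightarrow> ennreal" where
  "tube_max w \<nu> = (SUP a. \<integral>\<^sup>+ x. indicator (tube \<nu> a) x * ennreal (w x) \<partial>lborel)"

definition Linf_sphere :: "(real^'n \<Rightarrow> ennreal) \<Rightarrow> ennreal" where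
  "Linf_sphere g = esssup (surface_measure (sphere (0::real^'n) 1)) g"

end

theory Submission
  imports Defs "HOL-Probability.Probability"
begin

text \<open>
  The perturbation is a shear along one coordinate axis that makes \<open>\<Sigma>'\<close> pass through many points of
  a generalised arithmetic progression \<open>\<tau> + (\<Sum>i<d. (m i / L) u i)\<close>, \<open>0 \<le> m i < L\<close>, with random
  generators \<open>u i\<close>. Take \<open>f\<close> to be the indicator of small caps of \<open>\<Sigma>'\<close> around these points and
  \<open>w\<close> the indicator of the set of \<open>x\<close> with \<open>|x| < R\<close>, \<open>R \<approx> L^d\<close>, for which every \<open>x \<bullet> u i\<close> is close
  to a multiple of \<open>L\<close>: there all phases agree, so the extension of \<open>f\<close> has no cancellation, and
  a pigeonhole argument bounds the volume of this set from below by about \<open>R^n / L^d\<close>.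

  If a unit tube contained more than about \<open>L^q\<close> of the set, then a lacunary chain of \<open>q\<close> distances
  \<open>k j\<close> along its direction \<open>\<nu>\<close> would make all the numbers \<open>k j (\<nu> \<bullet> u i)\<close> close to multiples of \<open>L\<close>.
  For random generators a fixed chain does this with probability about \<open>L^(-q d)\<close>, and
  a union bound over directions and chains excludes it as soon as \<open>q\<^sup>2 / 2\<close> exceeds about \<open>n d\<close>. Hence
  \<open>q \<approx> sqrt d\<close> suffices and \<open>L^q\<close> is at most \<open>R^\<epsilon>\<close> for large \<open>d\<close>.

  A bump of width \<open>h\<close> and small \<open>C^k\<close> norm moves the surface by about \<open>h^k\<close>, so the \<open>L^d\<close> points of the
  progression can be caught by about \<open>h^(1-n)\<close> bumps as long as \<open>h^(n-1+k) \<approx> L^(-d)\<close>; the resulting number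
  of hits \<open>L^(d (n-1) / (n-1+k))\<close> is the gain. Doing this on disjoint patches of \<open>\<Sigma>\<close>, one for each pair of
  a dimension and a length \<open>L\<close>, serves all \<open>R\<close> and \<open>\<epsilon>\<close> with a single \<open>\<Sigma>'\<close>.
\<close>

section \<open>Hausdorff measure on hypersurfaces\<close>

text \<open>With \<open>f\<close> and \<open>w\<close> the indicators of sets \<open>B\<close> and
  \<open>W\<close>, the inequality asks for a lower bound on the surface measure of \<open>B\<close>
  times the volume of \<open>W\<close>, divided by the largest volume of \<open>W\<close> in a tube.
  On a ball of radius R, about L^d, aligned phases require caps of radius about 1/R. So N caps carry
  measure about N R^(1-n), the volume of \<open>W\<close> is about R^n / L^d = R^(n-1), and the
  product is N: this is why the number of hits is the gain.

  The obstacle is the order of choices. One surface has to serve every R and \<epsilon>, while d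
  must grow as \<epsilon> shrinks. Countably many scales therefore share one C^k budget and one
  piece of the surface, and this sharing may cost only a power of L whose exponent does not grow
  with d. Such a loss is harmless once d is large, because the admissible loss R^\<epsilon> is about
  L^(d \<epsilon>). A given R is compared with the available radii c L^d at the price of a factor
  depending on d alone; d is fixed by \<epsilon>, so all such factors go into the constant.\<close>

definition hausdorff_pre :: "real \<Rightarrow> real \<Rightarrow> 'a::metric_space set \<Rightarrow> ennreal" where
  "hausdorff_pre s \<delta> A =
     (INF C\<in>{C :: nat \<Rightarrow> 'a set. A \<subseteq> (\<Union>i. C i) \<and> (\<forall>i. bounded (C i) \<and> diameter (C i) \<le> \<delta>)}.
        (\<Sum>i. ennreal (hausdorff_const s * diameter (C i) powr s)))"

lemma hausdorff_outer_eq_SUP_pre: "hausdorff_outer s A = (SUP \<delta>\<in>{0<..}. hausdorff_pre s \<delta> A)"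
  unfolding hausdorff_outer_def hausdorff_pre_def ..

lemma hausdorff_pre_le:
  assumes "A \<subseteq> (\<Union>i. C i)" "\<And>i. bounded (C i)" "\<And>i. diameter (C i) \<le> \<delta>"
  shows "hausdorff_pre s \<delta> A \<le> (\<Sum>i. ennreal (hausdorff_const s * diameter (C i) powr s))"
  unfolding hausdorff_pre_def by (rule INF_lower) (use assms in auto)

lemma hausdorff_pre_close:
  assumes "hausdorff_pre s \<delta> A < e"
  obtains C where "A \<subseteq> (\<Union>i. C i)" "\<And>i. bounded (C i)" "\<And>i. diameter (C i) \<le> \<delta>"
    "(\<Sum>i. ennreal (hausdorff_const s * diameter (C i) powr s)) < e"
  using assms unfolding hausdorff_pre_def INF_less_iff by auto

lemma hausdorff_pre_mono: "A \<subseteq> B \<Longrightarrow> hausdorff_pre s \<delta> A \<le> hausdorff_pre s \<delta> B"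
  unfolding hausdorff_pre_def by (rule INF_superset_mono) auto

lemma hausdorff_pre_antimono: "\<delta> \<le> \<delta>' \<Longrightarrow> hausdorff_pre s \<delta>' A \<le> hausdorff_pre s \<delta> A"
  unfolding hausdorff_pre_def by (rule INF_superset_mono) (auto intro: order_trans)

lemma hausdorff_pre_le_outer: "0 < \<delta> \<Longrightarrow> hausdorff_pre s \<delta> A \<le> hausdorff_outer s A"
  unfolding hausdorff_outer_eq_SUP_pre by (rule SUP_upper) auto

lemma hausdorff_outer_mono: "A \<subseteq> B \<Longrightarrow> hausdorff_outer s A \<le> hausdorff_outer s B"
  unfolding hausdorff_outer_eq_SUP_pre by (rule SUP_mono) (auto intro: hausdorff_pre_mono)

lemma hausdorff_outer_empty [simp]: "hausdorff_outer s {} = 0"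
proof -
  have "hausdorff_pre s \<delta> {} \<le> 0" if "0 < \<delta>" for \<delta>
    using hausdorff_pre_le[of "{}" "\<lambda>_. {}" \<delta> s] that by simp
  then have "hausdorff_outer s {} \<le> 0"
    unfolding hausdorff_outer_eq_SUP_pre by (intro SUP_least) auto
  then show ?thesis by simp
qed

lemma hausdorff_pre_countably_subadditive:
  fixes A :: "nat \<Rightarrow> 'a::metric_space set"
  shows "hausdorff_pre s \<delta> (\<Union>i. A i) \<le> (\<Sum>i. hausdorff_pre s \<delta> (A i))"
proof (rule ennreal_le_epsilon)
  let ?w = "\<lambda>X::'a set. ennreal (hausdorff_const s * diameter X powr s)"
  fix e :: real assume e: "0 < e" "(\<Sum>n. hausdorff_pre s \<delta> (A n)) < top"
  then have *: "\<And>n. hausdorff_pre s \<delta> (A n) < hausdorff_pre s \<delta> (A n) + e * (1/2)^Suc n"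
    by (auto simp add: less_top dest!: ennreal_suminf_lessD)
  have "\<exists>C. A n \<subseteq> (\<Union>i. C i) \<and> (\<forall>i. bounded (C i) \<and> diameter (C i) \<le> \<delta>) \<and>
     (\<Sum>i. ?w (C i)) \<le> hausdorff_pre s \<delta> (A n) + e * (1/2)^Suc n" for n
    by (rule hausdorff_pre_close[OF *[of n]]) (metis less_imp_le)
  then obtain B where B: "\<And>n. A n \<subseteq> (\<Union>i. B n i)" "\<And>n i. bounded (B n i)"
    "\<And>n i. diameter (B n i) \<le> \<delta>"
    "\<And>n. (\<Sum>i. ?w (B n i)) \<le> hausdorff_pre s \<delta> (A n) + e * (1/2)^Suc n"
    by metis
  define C where "C = case_prod B \<circ> prod_decode"
  have AC: "(\<Union>i. A i) \<subseteq> (\<Union>i. C i)"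
    using B(1) by (auto simp add: C_def subset_eq) (metis prod.case prod_encode_inverse)
  have "hausdorff_pre s \<delta> (\<Union>i. A i) \<le> (\<Sum>i. ?w (C i))"
    by (rule hausdorff_pre_le[OF AC]) (auto simp: C_def B split: prod.split)
  also have "\<dots> = (\<Sum>n. \<Sum>i. ?w (B n i))"
  proof -
    have "(\<Sum>i. (\<lambda>(n,j). ?w (B n j)) (prod_decode i)) = (\<Sum>n. \<Sum>i. ?w (B n i))"
      by (rule suminf_ennreal_2dimen) auto
    moreover have "(\<lambda>i. (\<lambda>(n,j). ?w (B n j)) (prod_decode i)) = (\<lambda>i. ?w (C i))"
      by (auto simp: C_def fun_eq_iff split: prod.split)
    ultimately show ?thesis by simp
  qed
  also have "\<dots> \<le> (\<Sum>n. hausdorff_pre s \<delta> (A n) + e * (1/2) ^ Suc n)"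
    by (intro suminf_le allI B(4)) auto
  also have "... = (\<Sum>n. hausdorff_pre s \<delta> (A n)) + (\<Sum>n. ennreal e * ennreal ((1/2) ^ Suc n))"
    using \<open>0 < e\<close> by (subst suminf_add[symmetric])
                     (auto simp del: ennreal_suminf_cmult simp add: ennreal_mult[symmetric])
  also have "\<dots> = (\<Sum>n. hausdorff_pre s \<delta> (A n)) + e"
    unfolding ennreal_suminf_cmult
    by (subst suminf_ennreal_eq[OF zero_le_power power_half_series]) auto
  finally show "hausdorff_pre s \<delta> (\<Union>i. A i) \<le> (\<Sum>n. hausdorff_pre s \<delta> (A n)) + e" .
qed

lemma hausdorff_outer_countably_subadditive:
  fixes A :: "nat \<Rightarrow> 'a::metric_space set"
  shows "hausdorff_outer s (\<Union>i. A i) \<le> (\<Sum>i. hausdorff_outer s (A i))"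
proof -
  have "hausdorff_pre s \<delta> (\<Union>i. A i) \<le> (\<Sum>i. hausdorff_outer s (A i))" if "0 < \<delta>" for \<delta>
    by (rule order_trans[OF hausdorff_pre_countably_subadditive suminf_le])
       (auto intro: hausdorff_pre_le_outer that)
  then show ?thesis
    unfolding hausdorff_outer_eq_SUP_pre[of s "\<Union>i. A i"] by (intro SUP_least) auto
qed

lemma hausdorff_outer_Un_le:
  "hausdorff_outer s (A \<union> B) \<le> hausdorff_outer s A + hausdorff_outer s B"
proof -
  let ?F = "\<lambda>i::nat. if i = 0 then A else if i = 1 then B else {}"
  have "A \<union> B = (\<Union>i. ?F i)"
  proof -
    have "A \<subseteq> (\<Union>i. ?F i)" by (rule UN_upper[of 0, THEN subset_trans[rotated]]) auto
    moreover have "B \<subseteq> (\<Union>i. ?F i)" by (rule UN_upper[of 1, THEN subset_trans[rotated]]) auto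
    ultimately show ?thesis by (auto split: if_splits)
  qed
  then have "hausdorff_outer s (A \<union> B) \<le> (\<Sum>i. hausdorff_outer s (?F i))"
    using hausdorff_outer_countably_subadditive[of s ?F] by metis
  also have "\<dots> = (\<Sum>i\<in>{0,1}. hausdorff_outer s (?F i))"
    by (rule suminf_finite) auto
  finally show ?thesis by simp
qed

section \<open>Additivity on separated sets and measurability of Borel sets\<close>

lemma hausdorff_pre_separated:
  fixes A B :: "'a::metric_space set"
  assumes sep: "\<And>x y. x \<in> A \<Longrightarrow> y \<in> B \<Longrightarrow> \<delta> < dist x y" and "0 < \<delta>"
  shows "hausdorff_pre s \<delta> A + hausdorff_pre s \<delta> B \<le> hausdorff_pre s \<delta> (A \<union> B)"
  unfolding hausdorff_pre_def[of s \<delta> "A \<union> B"]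
proof (safe intro!: INF_greatest)
  let ?w = "\<lambda>X::'a set. ennreal (hausdorff_const s * diameter X powr s)"
  fix C :: "nat \<Rightarrow> 'a set" assume C: "A \<union> B \<subseteq> (\<Union>i. C i)" "\<forall>i. bounded (C i) \<and> diameter (C i) \<le> \<delta>"
  \<comment> \<open>A covering set has diameter at most \<delta>, so it meets only one of
    \<open>A\<close> and \<open>B\<close>: the cover splits into one of \<open>A\<close> and one of
    \<open>B\<close>. Discarded sets become empty, and these weigh nothing since
    \<open>0 powr s = 0\<close>.\<close>
  define CA where "CA = (\<lambda>i. if C i \<inter> A = {} then {} else C i)"
  define CB where "CB = (\<lambda>i. if C i \<inter> B = {} then {} else C i)"
  have le: "?w (CA i) + ?w (CB i) \<le> ?w (C i)" for i
  proof -
    have "C i \<inter> A = {} \<or> C i \<inter> B = {}"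
    proof (rule ccontr)
      assume "\<not> ?thesis"
      then obtain x y where "x \<in> C i" "x \<in> A" "y \<in> C i" "y \<in> B" by auto
      then have "\<delta> < dist x y" "dist x y \<le> diameter (C i)"
        using sep C(2) diameter_bounded_bound by blast+
      then show False using C(2)[rule_format, of i] by simp
    qed
    then show ?thesis by (auto simp: CA_def CB_def)
  qed
  have "A \<subseteq> (\<Union>i. CA i)"
  proof
    fix x assume "x \<in> A"
    with C(1) obtain i where "x \<in> C i" by auto
    with \<open>x \<in> A\<close> have "x \<in> CA i" by (auto simp: CA_def)
    then show "x \<in> (\<Union>i. CA i)" by auto
  qed
  then have 1: "hausdorff_pre s \<delta> A \<le> (\<Sum>i. ?w (CA i))"
    by (rule hausdorff_pre_le) (use C(2) \<open>0 < \<delta>\<close> in \<open>auto simp: CA_def\<close>)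
  have "B \<subseteq> (\<Union>i. CB i)"
  proof
    fix x assume "x \<in> B"
    with C(1) obtain i where "x \<in> C i" by auto
    with \<open>x \<in> B\<close> have "x \<in> CB i" by (auto simp: CB_def)
    then show "x \<in> (\<Union>i. CB i)" by auto
  qed
  then have 2: "hausdorff_pre s \<delta> B \<le> (\<Sum>i. ?w (CB i))"
    by (rule hausdorff_pre_le) (use C(2) \<open>0 < \<delta>\<close> in \<open>auto simp: CB_def\<close>)
  have "hausdorff_pre s \<delta> A + hausdorff_pre s \<delta> B \<le> (\<Sum>i. ?w (CA i)) + (\<Sum>i. ?w (CB i))"
    by (rule add_mono[OF 1 2])
  also have "\<dots> = (\<Sum>i. ?w (CA i) + ?w (CB i))"
    by (rule suminf_add) auto
  also have "\<dots> \<le> (\<Sum>i. ?w (C i))"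
    by (intro suminf_le le) auto
  finally show "hausdorff_pre s \<delta> A + hausdorff_pre s \<delta> B \<le> (\<Sum>i. ?w (C i))" .
qed

text \<open>The two suprema run over independent mesh sizes. A common size below both and below the
  separation settles each pair, and the suprema are then taken one after the other.\<close>

lemma hausdorff_outer_separated:
  fixes A B :: "'a::metric_space set"
  assumes sep: "\<And>x y. x \<in> A \<Longrightarrow> y \<in> B \<Longrightarrow> \<delta>0 \<le> dist x y" and "0 < \<delta>0"
  shows "hausdorff_outer s A + hausdorff_outer s B \<le> hausdorff_outer s (A \<union> B)"
proof -
  have *: "hausdorff_pre s \<delta> A + hausdorff_pre s \<delta>' B \<le> hausdorff_outer s (A \<union> B)"
    if "0 < \<delta>" "0 < \<delta>'" for \<delta> \<delta>'
  proof -
    define e where "e = min (\<delta>0 / 2) (min \<delta> \<delta>')"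
    have e: "0 < e" "e < \<delta>0" "e \<le> \<delta>" "e \<le> \<delta>'" using that assms(2) by (auto simp: e_def)
    have "hausdorff_pre s \<delta> A + hausdorff_pre s \<delta>' B \<le> hausdorff_pre s e A + hausdorff_pre s e B"
      by (intro add_mono hausdorff_pre_antimono e)
    also have "\<dots> \<le> hausdorff_pre s e (A \<union> B)"
      by (rule hausdorff_pre_separated) (use e sep in force)+
    also have "\<dots> \<le> hausdorff_outer s (A \<union> B)" by (rule hausdorff_pre_le_outer) (rule e)
    finally show ?thesis .
  qed
  have "hausdorff_outer s A + hausdorff_pre s \<delta>' B \<le> hausdorff_outer s (A \<union> B)" if "0 < \<delta>'" for \<delta>'
  proof -
    have "(SUP \<delta>\<in>{0<..}. hausdorff_pre s \<delta> A + hausdorff_pre s \<delta>' B) \<le> hausdorff_outer s (A \<union> B)"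
      by (rule SUP_least) (use * that in auto)
    then show ?thesis
      unfolding hausdorff_outer_eq_SUP_pre[of s A]
      by (subst (asm) ennreal_SUP_add_left) auto
  qed
  then have "(SUP \<delta>'\<in>{0<..}. hausdorff_outer s A + hausdorff_pre s \<delta>' B) \<le> hausdorff_outer s (A \<union> B)"
    by (intro SUP_least) auto
  then show ?thesis
    unfolding hausdorff_outer_eq_SUP_pre[of s B]
    by (subst ennreal_SUP_add_right) auto
qed

text \<open>Peels off one set at a time. The separation may shrink with \<open>i\<close>, since each
  step uses only the distance of one set from the union of the later ones.\<close>

lemma hausdorff_outer_separated_sum:
  fixes D :: "nat \<Rightarrow> 'a::metric_space set"
  assumes sep: "\<And>i. \<exists>\<delta>>0. \<forall>x\<in>D i. \<forall>j>i. \<forall>y\<in>D j. \<delta> \<le> dist x y"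
  shows "(\<Sum>i<N. hausdorff_outer s (D (m + i))) \<le> hausdorff_outer s (\<Union>i<N. D (m + i))"
proof (induction N arbitrary: m)
  case (Suc N)
  obtain \<delta> where d: "\<delta> > 0" "\<And>x y j. x \<in> D m \<Longrightarrow> j > m \<Longrightarrow> y \<in> D j \<Longrightarrow> \<delta> \<le> dist x y"
    using sep[of m] by blast
  have "(\<Sum>i<Suc N. hausdorff_outer s (D (m + i)))
      = hausdorff_outer s (D m) + (\<Sum>i<N. hausdorff_outer s (D (Suc m + i)))"
    by (subst sum.lessThan_Suc_shift) simp
  also have "\<dots> \<le> hausdorff_outer s (D m) + hausdorff_outer s (\<Union>i<N. D (Suc m + i))"
    by (intro add_left_mono Suc.IH)
  also have "\<dots> \<le> hausdorff_outer s (D m \<union> (\<Union>i<N. D (Suc m + i)))"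
  proof (rule hausdorff_outer_separated[OF _ d(1)])
    fix x y assume x: "x \<in> D m" and "y \<in> (\<Union>i<N. D (Suc m + i))"
    then obtain i where "y \<in> D (Suc m + i)" by auto
    then show "\<delta> \<le> dist x y" by (intro d(2)[OF x, of "Suc m + i"]) auto
  qed
  also have "D m \<union> (\<Union>i<N. D (Suc m + i)) = (\<Union>i<Suc N. D (m + i))"
    unfolding lessThan_Suc_eq_insert_0 by auto
  finally show ?case .
qed simp

text \<open>Caratheodory's layer argument. Neighbouring layers \<open>D i\<close> may touch, but
  those of equal parity are separated, so each parity sums to at most the measure of the union.
  Hence the layers are summable, and the union exceeds \<open>E m\<close> by at most the tail of a
  convergent series.\<close>

lemma hausdorff_outer_increasing_layers:
  fixes E :: "nat \<Rightarrow> 'a::metric_space set"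
  assumes inc: "incseq E"
    and sep: "\<And>m. \<exists>\<delta>>0. \<forall>x\<in>E m. \<forall>y. y \<in> (\<Union>i. E i) - E (Suc m) \<longrightarrow> \<delta> \<le> dist x y"
    and fin: "hausdorff_outer s (\<Union>i. E i) < \<infinity>"
  shows "hausdorff_outer s (\<Union>i. E i) \<le> (SUP m. hausdorff_outer s (E m))"
proof -
  let ?H = "hausdorff_outer s" and ?U = "\<Union>i. E i"
  define D where "D = (\<lambda>i. E (Suc i) - E i)"
  have mono: "i \<le> j \<Longrightarrow> E i \<subseteq> E j" for i j using inc by (auto simp: incseq_def)
  have sub: "(\<Sum>i<N. ?H (D (2 * i + c))) \<le> ?H ?U" for N c
  proof -
    have "(\<Sum>i<N. ?H (D (2 * (0 + i) + c))) \<le> ?H (\<Union>i<N. D (2 * (0 + i) + c))"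
    proof (rule hausdorff_outer_separated_sum[where D = "\<lambda>i. D (2 * i + c)" and m = 0])
      fix i
      obtain \<delta> where d: "\<delta> > 0" "\<And>x y. x\<in>E (Suc (2*i+c)) \<Longrightarrow> y \<in> ?U - E (Suc (Suc (2*i+c))) \<Longrightarrow> \<delta> \<le> dist x y"
        using sep[of "Suc (2*i+c)"] by blast
      show "\<exists>\<delta>>0. \<forall>x\<in>D (2 * i + c). \<forall>j>i. \<forall>y\<in>D (2 * j + c). \<delta> \<le> dist x y"
      proof (intro exI[of _ \<delta>] conjI ballI allI impI d)
        fix x j y assume a: "x \<in> D (2 * i + c)" "i < j" "y \<in> D (2 * j + c)"
        show "x \<in> E (Suc (2*i+c))" using a by (auto simp: D_def)
        have "E (Suc (Suc (2*i+c))) \<subseteq> E (2 * j + c)" by (rule mono) (use a in auto)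
        then show "y \<in> ?U - E (Suc (Suc (2*i+c)))" using a by (auto simp: D_def)
      qed
    qed
    also have "\<dots> \<le> ?H ?U" by (rule hausdorff_outer_mono) (auto simp: D_def)
    finally show ?thesis by simp
  qed
  have sumD: "(\<Sum>i. ?H (D i)) \<le> ?H ?U + ?H ?U"
  proof (rule suminf_le_const[OF summableI])
    fix N
    have "(\<Sum>i<N. ?H (D i)) \<le> (\<Sum>i<2*N. ?H (D i))" by (rule sum_mono2) auto
    also have "\<dots> = (\<Sum>i<N. ?H (D (2 * i + 0))) + (\<Sum>i<N. ?H (D (2 * i + 1)))"
      by (induction N) (auto simp: algebra_simps)
    also have "\<dots> \<le> ?H ?U + ?H ?U" by (intro add_mono sub)
    finally show "(\<Sum>i<N. ?H (D i)) \<le> ?H ?U + ?H ?U" .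
  qed
  then have finD: "(\<Sum>i. ?H (D i)) < \<infinity>"
    using fin by (metis ennreal_add_less_top infinity_ennreal_def order_le_less_trans)
  have tail: "(\<lambda>m. \<Sum>i. ?H (D (i + m))) \<longlonglongrightarrow> 0"
  proof -
    have "summable (\<lambda>i. enn2real (?H (D i)))"
    proof (rule summable_suminf_not_top)
      have f: "?H (D i) < top" for i
        using finD by (metis ennreal_suminf_lessD infinity_ennreal_def)
      have eq: "ennreal (enn2real (?H (D i))) = ?H (D i)" for i
        by (rule ennreal_enn2real[OF f])
      show "(\<Sum>i. ennreal (enn2real (?H (D i)))) \<noteq> top"
        unfolding eq using finD by simp
    qed auto
    then have t: "(\<lambda>m. \<Sum>i. enn2real (?H (D (i + m)))) \<longlonglongrightarrow> 0"
      by (rule suminf_exist_split2)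
    have f: "?H (D i) < top" for i
      using finD by (metis ennreal_suminf_lessD infinity_ennreal_def)
    have "(\<Sum>i. ?H (D (i + m))) = ennreal (\<Sum>i. enn2real (?H (D (i + m))))" for m
    proof -
      have "(\<Sum>i. ennreal (enn2real (?H (D (i + m))))) = ennreal (\<Sum>i. enn2real (?H (D (i + m))))"
        using summable_ignore_initial_segment[OF \<open>summable (\<lambda>i. enn2real (?H (D i)))\<close>, of m]
        by (intro suminf_ennreal2) auto
      then show ?thesis by (simp add: ennreal_enn2real[OF f])
    qed
    then show ?thesis using tendsto_ennrealI[OF t] by simp
  qed
  have cover: "?H ?U \<le> (SUP m. ?H (E m)) + (\<Sum>i. ?H (D (i + m)))" for m
  proof -
    have "?U \<subseteq> E m \<union> (\<Union>i. D (i + m))"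
    proof
      fix x assume "x \<in> ?U"
      then have ex: "\<exists>i. x \<in> E i" by auto
      define i where "i = (LEAST i. x \<in> E i)"
      have xi: "x \<in> E i" unfolding i_def using ex by (rule LeastI_ex)
      show "x \<in> E m \<union> (\<Union>i. D (i + m))"
      proof (cases "i \<le> m")
        case True then show ?thesis using mono[OF True] xi by auto
      next
        case False
        then have "x \<notin> E (i - 1)" using not_less_Least[of "i-1" "\<lambda>i. x \<in> E i"] by (auto simp: i_def)
        then have "x \<in> D ((i - 1 - m) + m)" using xi False by (auto simp: D_def)
        then show ?thesis by blast
      qed
    qed
    then have "?H ?U \<le> ?H (E m \<union> (\<Union>i. D (i + m)))" by (rule hausdorff_outer_mono)
    also have "\<dots> \<le> ?H (E m) + ?H (\<Union>i. D (i + m))" by (rule hausdorff_outer_Un_le)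
    also have "\<dots> \<le> (SUP m. ?H (E m)) + (\<Sum>i. ?H (D (i + m)))"
      by (intro add_mono hausdorff_outer_countably_subadditive SUP_upper) auto
    finally show ?thesis .
  qed
  have "(\<lambda>m. (SUP m. ?H (E m)) + (\<Sum>i. ?H (D (i + m)))) \<longlonglongrightarrow> (SUP m. ?H (E m)) + 0"
    by (intro tendsto_add tail) auto
  then show ?thesis
    using cover by (intro tendsto_lowerbound[where F = sequentially]) auto
qed

text \<open>\<open>A - F\<close> is exhausted by its points at distance at least
  \<open>1 / (m + 1)\<close> from \<open>F\<close>. These are separated from
  \<open>A \<inter> F\<close>, and the layer argument passes to the limit.\<close>

lemma hausdorff_closed_caratheodory:
  fixes F :: "'a::metric_space set"
  assumes F: "closed F"
  shows "hausdorff_outer s (A \<inter> F) + hausdorff_outer s (A - F) \<le> hausdorff_outer s A"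
\<comment> \<open>\<open>infdist\<close> to the empty set is 0 by convention and cannot describe the
  layers there; both exceptional cases are trivial.\<close>
proof (cases "F = {} \<or> hausdorff_outer s A = \<infinity>")
  case False
  then have F0: "F \<noteq> {}" and fin: "hausdorff_outer s A < \<infinity>" by (auto simp: less_top)
  define E where "E = (\<lambda>m::nat. {x\<in>A. 1 / real (Suc m) \<le> infdist x F})"
  have UE: "(\<Union>m. E m) = A - F"
  proof (intro equalityI subsetI)
    fix x assume x: "x \<in> A - F"
    then have "infdist x F > 0"
      by (simp add: F F0 infdist_pos_not_in_closed)
    then obtain m where "1 / real (Suc m) < infdist x F"
      using nat_approx_posE by blast
    then show "x \<in> (\<Union>m. E m)" using x by (auto simp: E_def intro: less_imp_le)
  next
    fix x assume "x \<in> (\<Union>m. E m)"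
    then obtain m where "x \<in> A" "1 / real (Suc m) \<le> infdist x F" by (auto simp: E_def)
    moreover have "0 < 1 / real (Suc m)" by simp
    ultimately show "x \<in> A - F" using F0 by (metis DiffI infdist_zero leD)
  qed
  have lip: "infdist x F - infdist y F \<le> dist x y" for x y
    using infdist_triangle[of x F y] by simp
  have sepE: "1 / real (Suc m) - 1 / real (Suc (Suc m)) \<le> dist x y"
    if "x \<in> E m" "y \<in> A" "y \<notin> E (Suc m)" for m x y
    using that lip[of x y] by (auto simp: E_def)
  have "hausdorff_outer s (\<Union>m. E m) \<le> (SUP m. hausdorff_outer s (E m))"
  proof (rule hausdorff_outer_increasing_layers)
    show "incseq E"
      unfolding incseq_def E_def
      by (auto intro: order_trans[rotated] simp: frac_le)
    show "\<exists>\<delta>>0. \<forall>x\<in>E m. \<forall>y. y \<in> \<Union> (range E) - E (Suc m) \<longrightarrow> \<delta> \<le> dist x y" for m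
      by (rule exI[of _ "1 / real (Suc m) - 1 / real (Suc (Suc m))"])
         (use sepE UE in \<open>auto simp: frac_less2\<close>)
    show "hausdorff_outer s (\<Union> (range E)) < \<infinity>"
      using fin hausdorff_outer_mono[of "A - F" A s] by (simp add: UE)
  qed
  then have "hausdorff_outer s (A \<inter> F) + hausdorff_outer s (A - F)
      \<le> hausdorff_outer s (A \<inter> F) + (SUP m. hausdorff_outer s (E m))"
    by (simp add: UE add_left_mono)
  also have "\<dots> = (SUP m. hausdorff_outer s (A \<inter> F) + hausdorff_outer s (E m))"
    by (simp add: ennreal_SUP_add_right)
  also have "\<dots> \<le> hausdorff_outer s A"
  proof (rule SUP_least)
    fix m
    have "hausdorff_outer s (A \<inter> F) + hausdorff_outer s (E m) \<le> hausdorff_outer s ((A \<inter> F) \<union> E m)"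
    proof (rule hausdorff_outer_separated)
      fix x y assume "x \<in> A \<inter> F" "y \<in> E m"
      then show "1 / real (Suc m) \<le> dist x y"
        using lip[of y x] by (simp add: E_def dist_commute)
    qed simp
    also have "\<dots> \<le> hausdorff_outer s A" by (rule hausdorff_outer_mono) (auto simp: E_def)
    finally show "hausdorff_outer s (A \<inter> F) + hausdorff_outer s (E m) \<le> hausdorff_outer s A" .
  qed
  finally show ?thesis .
qed auto

lemma measure_space_hausdorff:
  "measure_space (UNIV :: 'a::metric_space set) (sets borel) (hausdorff_outer s)"
proof -
  interpret sigma_algebra "UNIV :: 'a set" "Pow UNIV" by (rule sigma_algebra_Pow)
  let ?L = "lambda_system (UNIV::'a set) (Pow UNIV) (hausdorff_outer s)"
  have oms: "outer_measure_space (Pow (UNIV::'a set)) (hausdorff_outer s)"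
    unfolding outer_measure_space_def positive_def increasing_def countably_subadditive_def
    by (auto intro: hausdorff_outer_mono hausdorff_outer_countably_subadditive)
  have ms: "measure_space UNIV ?L (hausdorff_outer s)"
    using caratheodory_lemma[OF oms] .
  then have sa: "sigma_algebra UNIV ?L" by (simp add: measure_space_def)
  have closed: "F \<in> ?L" if "closed F" for F
  proof -
    have "hausdorff_outer s (A \<inter> F) + hausdorff_outer s (A - F) = hausdorff_outer s A" for A
    proof (rule antisym[OF hausdorff_closed_caratheodory[OF that]])
      have "A = (A \<inter> F) \<union> (A - F)" by auto
      then show "hausdorff_outer s A \<le> hausdorff_outer s (A \<inter> F) + hausdorff_outer s (A - F)"
        using hausdorff_outer_Un_le[of s "A \<inter> F" "A - F"] by simp
    qed
    then show ?thesis unfolding lambda_system_eq by blast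
  qed
  have "sets (borel :: 'a measure) \<subseteq> ?L"
  proof -
    have "sigma_sets UNIV (Collect closed) \<subseteq> ?L"
      by (rule sigma_algebra.sigma_sets_subset[OF sa]) (use closed in blast)
    then show ?thesis by (simp add: borel_eq_closed)
  qed
  moreover have "sigma_algebra UNIV (sets (borel :: 'a measure))"
    using sets.sigma_algebra_axioms[of borel] by simp
  ultimately show ?thesis
    using measure_down[OF ms] by blast
qed

lemma space_surface_measure [simp]: "space (surface_measure S) = UNIV"
  unfolding surface_measure_def by (simp add: space_measure_of_conv)

lemma sets_surface_measure [simp, measurable_cong]: "sets (surface_measure S) = sets borel"
  unfolding surface_measure_def using sets.sigma_sets_eq[of borel] by (subst sets_measure_of) auto

text \<open>\<open>measure_of\<close> yields the given set function only if it is a measure, and the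
  zero measure otherwise. Countable additivity on the Borel sets is what ties
  \<open>surface_measure\<close> to Hausdorff measure.\<close>

lemma emeasure_surface_measure:
  fixes S :: "(real^'n) set"
  assumes S: "S \<in> sets borel" and A: "A \<in> sets borel"
  shows "emeasure (surface_measure S) A = hausdorff_outer (real CARD('n) - 1) (A \<inter> S)"
proof -
  let ?s = "real CARD('n) - 1"
  note ms = measure_space_hausdorff[of ?s, where 'a = "real^'n"]
  show ?thesis
  proof (rule emeasure_measure_of[OF surface_measure_def])
    show "positive (sets (surface_measure S)) (\<lambda>A. hausdorff_outer ?s (A \<inter> S))"
      by (simp add: positive_def)
    show "countably_additive (sets (surface_measure S)) (\<lambda>A. hausdorff_outer ?s (A \<inter> S))"
      unfolding countably_additive_def
    proof (intro allI impI)
      fix F :: "nat \<Rightarrow> (real^'n) set"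
      assume F: "range F \<subseteq> sets (surface_measure S)" "disjoint_family F"
      have ca: "countably_additive (sets borel) (hausdorff_outer ?s :: (real^'n) set \<Rightarrow> ennreal)"
        using ms by (simp add: measure_space_def)
      have "(\<Sum>i. hausdorff_outer ?s (F i \<inter> S)) = hausdorff_outer ?s (\<Union>i. F i \<inter> S)"
        using ca[unfolded countably_additive_def, rule_format, of "\<lambda>i. F i \<inter> S"] F S
        by (auto simp: disjoint_family_on_def image_subset_iff)
      then show "(\<Sum>i. hausdorff_outer ?s (F i \<inter> S)) = hausdorff_outer ?s (\<Union> (range F) \<inter> S)"
        by simp
    qed
  qed (use A in auto)
qed

section \<open>Bounds for Hausdorff measure by projection along a coordinate axis\<close>

lemma emeasure_cbox_cart:
  fixes a b :: "real^'n"
  assumes "\<And>i. a$i \<le> b$i"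
  shows "emeasure lborel (cbox a b) = ennreal (\<Prod>i\<in>UNIV. b$i - a$i)"
proof -
  have "cbox a b \<noteq> {}" using assms by (auto simp: interval_ne_empty_cart)
  then have "measure lborel (cbox a b) = (\<Prod>i\<in>UNIV. b$i - a$i)" by (rule content_cbox_cart)
  then show ?thesis
    using emeasure_eq_ennreal_measure[of lborel "cbox a b"] emeasure_lborel_cbox_finite[of a b] by simp
qed

lemma hausdorff_const_pos: "0 \<le> s \<Longrightarrow> 0 < hausdorff_const s"
  unfolding hausdorff_const_def by (intro divide_pos_pos mult_pos_pos Gamma_real_pos) auto

text \<open>The source of all lower bounds for surface measure. A covering set of diameter
  \<open>d\<close> is enclosed in a box of width \<open>2 * d\<close> in the directions other than
  \<open>b\<close>. Given height 1 along \<open>b\<close>, these boxes cover the cylinder over the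
  projection of \<open>A\<close>, which contains \<open>E\<close>.\<close>

lemma emeasure_shadow_le_hausdorff:
  fixes A E :: "(real^'n) set"
  assumes n2: "CARD('n) \<ge> 2"
    and E: "\<And>x. x \<in> E \<Longrightarrow> 0 \<le> x$b \<and> x$b \<le> 1 \<and> (\<exists>a\<in>A. \<forall>j. j \<noteq> b \<longrightarrow> a$j = x$j)"
    and meas: "E \<in> sets borel"
  shows "emeasure lborel E \<le>
    ennreal (2^(CARD('n) - 1) / hausdorff_const (real CARD('n) - 1)) * hausdorff_outer (real CARD('n) - 1) A"
proof -
  let ?s = "real CARD('n) - 1"
  let ?hc = "hausdorff_const ?s"
  let ?K = "2^(CARD('n) - 1) / ?hc"
  have hc: "?hc > 0" using n2 by (intro hausdorff_const_pos) auto
  have "emeasure lborel E \<le> ennreal ?K * (\<Sum>i. ennreal (?hc * diameter (C i) powr ?s))"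
    if C: "A \<subseteq> (\<Union>i. C i)" "\<And>i. bounded (C i)" for C
  proof -
    define c where "c = (\<lambda>i. SOME x. x \<in> C i)"
    define Q where "Q = (\<lambda>i. if C i = {} then {} else
       cbox (\<chi> j. if j = b then 0 else c i $ j - diameter (C i)) (\<chi> j. if j = b then 1 else c i $ j + diameter (C i)))"
    have Q_le: "emeasure lborel (Q i) \<le> ennreal ?K * ennreal (?hc * diameter (C i) powr ?s)" for i
    proof (cases "C i = {}")
      case False
      define d where "d = diameter (C i)"
      have d0: "0 \<le> d" unfolding d_def by (rule diameter_ge_0) (rule C)
      have "emeasure lborel (Q i) = ennreal (\<Prod>j\<in>UNIV. (if j = b then 1 else 2 * d))"
        unfolding Q_def d_def[symmetric] using False d0
        by (auto simp: emeasure_cbox_cart intro!: arg_cong[where f=ennreal] prod.cong split: if_splits)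
      also have "(\<Prod>j\<in>UNIV. (if j = b then 1 else 2 * d)) = (2 * d) ^ (CARD('n) - 1)"
        by (subst prod.remove[of _ b]) (auto simp: card_Diff_singleton)
      also have "\<dots> = ?K * (?hc * d powr ?s)"
      proof -
        have "d powr ?s = d ^ (CARD('n) - 1)"
        proof (cases "d = 0")
          case False
          then have "d powr real (CARD('n) - 1) = d ^ (CARD('n) - 1)"
            using d0 by (intro powr_realpow) auto
          then show ?thesis using n2 by (simp add: of_nat_diff)
        qed (use n2 in auto)
        then show ?thesis using hc by (simp add: power_mult_distrib)
      qed
      also have "ennreal \<dots> = ennreal ?K * ennreal (?hc * d powr ?s)"
        using hc by (intro ennreal_mult) auto
      finally show ?thesis by (simp add: d_def)
    qed (simp add: Q_def)
    have "E \<subseteq> (\<Union>i. Q i)"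
    proof
      fix x assume "x \<in> E"
      with E obtain a where a: "0 \<le> x$b" "x$b \<le> 1" "a \<in> A" "\<And>j. j \<noteq> b \<Longrightarrow> a$j = x$j" by blast
      then obtain i where i: "a \<in> C i" using C by auto
      then have ci: "c i \<in> C i" unfolding c_def by (metis someI)
      have "\<bar>a$j - c i $ j\<bar> \<le> diameter (C i)" for j
      proof -
        have "\<bar>a$j - c i $ j\<bar> \<le> norm (a - c i)"
          by (metis component_le_norm_cart vector_minus_component)
        also have "\<dots> \<le> diameter (C i)"
          using diameter_bounded_bound[OF C(2) i ci] by (simp add: dist_norm)
        finally show ?thesis .
      qed
      then have "\<bar>x$j - c i $ j\<bar> \<le> diameter (C i)" if "j \<noteq> b" for j using a(4) that by metis
      then have "x \<in> cbox (\<chi> j. if j = b then 0 else c i $ j - diameter (C i)) (\<chi> j. if j = b then 1 else c i $ j + diameter (C i))"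
        using a(1,2) unfolding mem_box_cart by (auto simp: abs_diff_le_iff)
      then have "x \<in> Q i" using i unfolding Q_def by auto
      then show "x \<in> (\<Union>i. Q i)" by blast
    qed
    moreover have Qm: "range Q \<subseteq> sets lborel" by (auto simp: Q_def)
    ultimately have "emeasure lborel E \<le> emeasure lborel (\<Union>i. Q i)"
      by (intro emeasure_mono) auto
    also have "\<dots> \<le> (\<Sum>i. emeasure lborel (Q i))"
      by (rule emeasure_subadditive_countably[OF Qm])
    also have "\<dots> \<le> (\<Sum>i. ennreal ?K * ennreal (?hc * diameter (C i) powr ?s))"
      by (intro suminf_le Q_le) auto
    also have "\<dots> = ennreal ?K * (\<Sum>i. ennreal (?hc * diameter (C i) powr ?s))"
      by (rule ennreal_suminf_cmult)
    finally show ?thesis .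
  qed
  then have "emeasure lborel E / ennreal ?K \<le> hausdorff_pre ?s 1 A"
    unfolding hausdorff_pre_def using hc
    by (intro INF_greatest divide_le_posI_ennreal) (auto simp: mult.commute)
  also have "\<dots> \<le> hausdorff_outer ?s A" by (rule hausdorff_pre_le_outer) simp
  finally have "ennreal ?K * (emeasure lborel E / ennreal ?K) \<le> ennreal ?K * hausdorff_outer ?s A"
    by (intro mult_left_mono) auto
  moreover have "ennreal ?K * (emeasure lborel E / ennreal ?K) = emeasure lborel E"
    using hc by (subst ennreal_times_divide, subst mult.commute, intro mult_divide_eq_ennreal) auto
  ultimately show ?thesis by simp
qed

text \<open>A grid of mesh \<open>1 / N\<close> in the coordinates other than \<open>b\<close> cuts
  \<open>B\<close> into at most a constant times \<open>N ^ (n - 1)\<close> pieces. By the Lipschitz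
  bound their diameters are of order \<open>1 / N\<close>, so the total weight is bounded
  independently of \<open>N\<close>.\<close>

lemma hausdorff_lipschitz_graph_finite:
  fixes B :: "(real^'n) set" and M :: nat
  assumes n2: "CARD('n) \<ge> 2" and K: "0 \<le> K"
    and bd: "\<And>x j. x \<in> B \<Longrightarrow> \<bar>x$j\<bar> \<le> real M"
    and lip: "\<And>x y. x \<in> B \<Longrightarrow> y \<in> B \<Longrightarrow> dist x y \<le> K * (\<Sum>j\<in>UNIV - {b}. \<bar>x$j - y$j\<bar>)"
  shows "hausdorff_outer (real CARD('n) - 1) B < \<infinity>"
proof -
  let ?s = "real CARD('n) - 1" and ?n = "CARD('n)"
  let ?hc = "hausdorff_const ?s"
  let ?T = "?hc * (real (2 * M + 3) * (K * ?n)) ^ (?n - 1)"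
  have hc: "?hc > 0" using n2 by (intro hausdorff_const_pos) auto
  have pre: "hausdorff_pre ?s \<delta> B \<le> ennreal ?T" if "\<delta> > 0" for \<delta>
  proof -
    obtain N0 :: nat where "K * ?n / \<delta> < real N0" using reals_Archimedean2 by blast
    define N where "N = Suc N0"
    have N: "N \<ge> 1" "K * ?n / N \<le> \<delta>"
    proof -
      have "K * ?n / \<delta> \<le> real N" using \<open>K * ?n / \<delta> < real N0\<close> by (simp add: N_def)
      then show "K * ?n / N \<le> \<delta>" using that by (simp add: N_def field_simps)
    qed (simp add: N_def)
    define I where "I = (PiE (UNIV - {b}) (\<lambda>_. {- int (M * N) - 1 .. int (M * N) + 1}) :: ('n \<Rightarrow> int) set)"
    define f where "f = (\<lambda>x::real^'n. restrict (\<lambda>j. \<lfloor>N * x$j\<rfloor>) (UNIV - {b}))"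
    have "card {- int (M * N) - 1 .. int (M * N) + 1} = 2 * (M * N) + 3"
      by (simp only: card_atLeastAtMost_int)
    then have I: "finite I" "card I = (2 * (M * N) + 3) ^ (?n - 1)"
      unfolding I_def by (auto simp only: card_PiE finite_PiE finite finite_atLeastAtMost_int card_Diff_singleton prod_constant UNIV_I)
    obtain h where h: "bij_betw h {0..<card I} I" using ex_bij_betw_nat_finite[OF I(1)] by blast
    define C where "C = (\<lambda>i. if i < card I then {x\<in>B. f x = h i} else {})"
    have dia: "dist x y \<le> K * ?n / N" if "x \<in> B" "y \<in> B" "f x = f y" for x y
    proof -
      have "\<bar>x$j - y$j\<bar> \<le> 1 / N" if "j \<noteq> b" for j
      proof -
        have "\<lfloor>N * x$j\<rfloor> = \<lfloor>N * y$j\<rfloor>" using \<open>f x = f y\<close> that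
          by (auto simp: f_def fun_eq_iff restrict_def split: if_splits)
        then have "\<bar>N * x$j - N * y$j\<bar> \<le> 1" by linarith
        then have "real N * \<bar>x$j - y$j\<bar> \<le> 1"
          by (metis abs_mult abs_of_nat right_diff_distrib)
        then show ?thesis using N by (simp add: field_simps)
      qed
      then have "(\<Sum>j\<in>UNIV - {b}. \<bar>x$j - y$j\<bar>) \<le> (\<Sum>j\<in>UNIV - {b}. 1 / N)"
        by (intro sum_mono) auto
      also have "\<dots> \<le> ?n * (1 / N)"
        by (simp add: card_Diff_singleton divide_right_mono)
      finally have "K * (\<Sum>j\<in>UNIV - {b}. \<bar>x$j - y$j\<bar>) \<le> K * (?n * (1 / N))" using K by (rule mult_left_mono)
      then show ?thesis using lip[OF that(1,2)] by simp
    qed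
    have KN: "0 \<le> K * ?n / N" using K by simp
    have Cd: "diameter (C i) \<le> K * ?n / N" for i
      using dia KN by (intro diameter_le) (auto simp: C_def dist_norm split: if_splits)
    have Bb: "bounded B"
    proof (rule boundedI)
      fix x assume x: "x \<in> B"
      have "norm x \<le> (\<Sum>j\<in>UNIV. \<bar>x$j\<bar>)" by (rule norm_le_l1_cart)
      also have "\<dots> \<le> (\<Sum>j\<in>(UNIV::'n set). real M)" by (intro sum_mono bd x)
      finally show "norm x \<le> (\<Sum>j\<in>(UNIV::'n set). real M)" .
    qed
    have Cb: "bounded (C i)" for i by (rule bounded_subset[OF Bb]) (auto simp: C_def)
    have cov: "B \<subseteq> (\<Union>i. C i)"
    proof
      fix x assume x: "x \<in> B"
      have "f x \<in> I"
        unfolding I_def f_def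
      proof (rule restrict_PiE_iff[THEN iffD2], intro ballI)
        fix j
        have "\<bar>N * x$j\<bar> \<le> real (M * N)"
          using mult_right_mono[OF bd[OF x, of j], of "real N"] by (simp add: abs_mult mult.commute)
        then show "\<lfloor>N * x$j\<rfloor> \<in> {- int (M * N) - 1 .. int (M * N) + 1}"
          unfolding atLeastAtMost_iff le_floor_iff floor_le_iff by (simp add: abs_le_iff)
      qed
      then have "f x \<in> h ` {0..<card I}" using h by (simp add: bij_betw_def)
      then obtain i where "i < card I" "f x = h i" by auto
      then have "x \<in> C i" using x by (auto simp: C_def)
      then show "x \<in> (\<Union>i. C i)" by blast
    qed
    have "hausdorff_pre ?s \<delta> B \<le> (\<Sum>i. ennreal (?hc * diameter (C i) powr ?s))"
      by (rule hausdorff_pre_le[OF cov Cb]) (use Cd N(2) order_trans in blast)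
    also have "\<dots> = (\<Sum>i<card I. ennreal (?hc * diameter (C i) powr ?s))"
      by (rule suminf_finite) (auto simp: C_def)
    also have "\<dots> \<le> (\<Sum>i<card I. ennreal (?hc * (K * ?n / N) ^ (?n - 1)))"
    proof (intro sum_mono ennreal_leI mult_left_mono)
      fix i
      have "diameter (C i) powr ?s \<le> (K * ?n / N) powr ?s"
        using n2 by (intro powr_mono2 Cd diameter_ge_0 Cb) auto
      also have "\<dots> = (K * ?n / N) ^ (?n - 1)"
      proof (cases "K = 0")
        case False
        then have "(K * ?n / N) powr real (?n - 1) = (K * ?n / N) ^ (?n - 1)"
          using K N by (intro powr_realpow) auto
        then show ?thesis using n2 by (simp add: of_nat_diff)
      qed (use n2 in auto)
      finally show "diameter (C i) powr ?s \<le> (K * ?n / N) ^ (?n - 1)" .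
    qed (use hc in auto)
    also have "\<dots> = ennreal (?hc * (real (2 * (M * N) + 3) * (K * ?n / N)) ^ (?n - 1))"
    proof -
      have "(\<Sum>i<card I. ennreal (?hc * (K * ?n / N) ^ (?n - 1))) = ennreal (real (card I) * (?hc * (K * ?n / N) ^ (?n - 1)))"
        using hc KN by (subst sum_ennreal) auto
      also have "real (card I) * (?hc * (K * ?n / N) ^ (?n - 1)) = ?hc * (real (card I) * (K * ?n / N) ^ (?n - 1))"
        by (simp only: mult_ac)
      also have "\<dots> = ?hc * (real (2 * (M * N) + 3) * (K * ?n / N)) ^ (?n - 1)"
        unfolding I(2) of_nat_power power_mult_distrib ..
      finally show ?thesis .
    qed
    also have "\<dots> \<le> ennreal ?T"
    proof (intro ennreal_leI mult_left_mono power_mono)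
      have "real (2 * (M * N) + 3) \<le> real (2 * M + 3) * N"
        using N(1) by (simp add: algebra_simps flip: of_nat_mult)
      then have "real (2 * (M * N) + 3) * (K * ?n / N) \<le> (real (2 * M + 3) * N) * (K * ?n / N)"
        using KN by (rule mult_right_mono)
      then show "real (2 * (M * N) + 3) * (K * ?n / N) \<le> real (2 * M + 3) * (K * ?n)"
        using N by simp
    qed (use hc K KN in auto)
    finally show ?thesis .
  qed
  have "hausdorff_outer ?s B \<le> ennreal ?T"
    unfolding hausdorff_outer_eq_SUP_pre by (rule SUP_least) (use pre in blast)
  then show ?thesis by (metis ennreal_less_top infinity_ennreal_def order_le_less_trans)
qed

text \<open>For a null measure, an essential supremum over directions could not be bounded from
  below. The part of the sphere above a cube of half side 1/n already has positive measure.\<close>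

lemma surface_measure_sphere_pos:
  assumes n2: "CARD('n) \<ge> 2"
  shows "emeasure (surface_measure (sphere (0::real^'n) 1)) UNIV > 0"
proof -
  let ?n = "CARD('n)"
  let ?K = "2^(CARD('n) - 1) / hausdorff_const (real CARD('n) - 1)"
  obtain b :: 'n where True by auto
  define E :: "(real^'n) set" where "E = cbox (\<chi> j. if j = b then 0 else - (1/real ?n)) (\<chi> j. if j = b then 1 else 1/real ?n)"
  have "emeasure lborel E = ennreal (\<Prod>j\<in>UNIV. (if j = b then 1 else 2 / ?n))"
    unfolding E_def by (auto simp: emeasure_cbox_cart intro!: arg_cong[where f=ennreal] prod.cong)
  also have "\<dots> > 0" by (auto intro!: prod_pos)
  finally have pos: "emeasure lborel E > 0" .
  have "emeasure lborel E \<le> ennreal ?K * hausdorff_outer (real ?n - 1) (sphere (0::real^'n) 1)"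
  proof (rule emeasure_shadow_le_hausdorff[OF n2])
    fix x assume "x \<in> E"
    then have xE: "(if j = b then 0 else - (1/real ?n)) \<le> x$j" "x$j \<le> (if j = b then 1 else 1/real ?n)" for j
      by (simp_all add: E_def mem_box_cart)
    have "(x$j)\<^sup>2 \<le> (1/?n)\<^sup>2" if "j \<noteq> b" for j
      using xE[of j] that by (intro abs_le_square_iff[THEN iffD1]) (auto simp: abs_le_iff)
    then have "(\<Sum>j\<in>UNIV - {b}. (x$j)\<^sup>2) \<le> (\<Sum>j\<in>UNIV - {b}. (1/?n)\<^sup>2)" by (intro sum_mono) auto
    also have "\<dots> \<le> ?n * (1/?n)\<^sup>2"
      by (simp add: card_Diff_singleton mult_right_mono del: power_divide)
    also have "\<dots> \<le> 1" by (simp add: power2_eq_square)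
    finally have le: "(\<Sum>j\<in>UNIV - {b}. (x$j)\<^sup>2) \<le> 1" .
    define a where "a = (\<chi> j. if j = b then sqrt (1 - (\<Sum>j\<in>UNIV - {b}. (x$j)\<^sup>2)) else x$j)"
    have "(\<Sum>j\<in>UNIV. (a$j)\<^sup>2) = (a$b)\<^sup>2 + (\<Sum>j\<in>UNIV - {b}. (a$j)\<^sup>2)"
      by (subst sum.remove[of _ b]) auto
    also have "(\<Sum>j\<in>UNIV - {b}. (a$j)\<^sup>2) = (\<Sum>j\<in>UNIV - {b}. (x$j)\<^sup>2)" by (auto simp: a_def)
    also have "(a$b)\<^sup>2 = 1 - (\<Sum>j\<in>UNIV - {b}. (x$j)\<^sup>2)" using le by (simp add: a_def)
    finally have "norm a = 1" by (simp add: norm_vec_def L2_set_def)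
    then have "a \<in> sphere 0 1" by simp
    moreover have "\<forall>j. j \<noteq> b \<longrightarrow> a$j = x$j" by (simp add: a_def)
    ultimately have "\<exists>a\<in>sphere 0 1. \<forall>j. j \<noteq> b \<longrightarrow> a$j = x$j" by blast
    moreover have "0 \<le> x$b \<and> x$b \<le> 1"
      using xE[of b] by simp
    ultimately show "0 \<le> x$b \<and> x$b \<le> 1 \<and> (\<exists>a\<in>sphere 0 1. \<forall>j. j \<noteq> b \<longrightarrow> a$j = x$j)" by blast
  qed (simp add: E_def)
  with pos have "hausdorff_outer (real ?n - 1) (sphere (0::real^'n) 1) > 0"
    by (metis gr_zeroI leD mult_zero_right)
  then show ?thesis by (subst emeasure_surface_measure) (auto simp: borel_closed)
qed

section \<open>Tubes and the extension operator\<close>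

lemma open_tube: "open (tube \<nu> a)"
proof -
  have "tube \<nu> a = (\<Union>t. ball (a + t *\<^sub>R \<nu>) 1)" by (auto simp: tube_def dist_commute)
  then show ?thesis by auto
qed

lemma tube_borel [measurable]: "tube \<nu> a \<in> sets borel"
  by (rule borel_open[OF open_tube])

text \<open>Lower semicontinuity in the direction: tubes are open, so a point of
  \<open>tube \<nu> a\<close> lies in the tubes of all nearby directions, and Fatou's lemma applies.
  The upper bound for the essential supremum requires this measurability.\<close>

lemma borel_measurable_tube_max:
  fixes w :: "real^'n \<Rightarrow> real"
  assumes w[measurable]: "w \<in> borel_measurable borel"
  shows "tube_max w \<in> borel_measurable borel"
proof (rule borel_measurableI_greater)
  fix c
  have "closed {\<nu>. tube_max w \<nu> \<le> c}"
    unfolding closed_sequential_limits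
  proof (intro allI impI, elim conjE)
    fix X \<nu> assume X: "\<forall>i. X i \<in> {\<nu>. tube_max w \<nu> \<le> c}" and lim: "X \<longlonglongrightarrow> \<nu>"
    have "(\<integral>\<^sup>+ x. indicator (tube \<nu> a) x * ennreal (w x) \<partial>lborel) \<le> c" for a
    proof -
      have "(\<integral>\<^sup>+ x. indicator (tube \<nu> a) x * ennreal (w x) \<partial>lborel)
         \<le> (\<integral>\<^sup>+ x. liminf (\<lambda>i. indicator (tube (X i) a) x * ennreal (w x)) \<partial>lborel)"
      proof (rule nn_integral_mono)
        fix x
        show "indicator (tube \<nu> a) x * ennreal (w x) \<le> liminf (\<lambda>i. indicator (tube (X i) a) x * ennreal (w x))"
        proof (cases "x \<in> tube \<nu> a")
          case True
          then obtain t where t: "dist x (a + t *\<^sub>R \<nu>) < 1" by (auto simp: tube_def)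
          have "(\<lambda>i. dist x (a + t *\<^sub>R X i)) \<longlonglongrightarrow> dist x (a + t *\<^sub>R \<nu>)"
            by (intro tendsto_intros lim)
          then have "eventually (\<lambda>i. dist x (a + t *\<^sub>R X i) < 1) sequentially"
            using t by (rule order_tendstoD)
          then have "eventually (\<lambda>i. indicator (tube \<nu> a) x * ennreal (w x) \<le> indicator (tube (X i) a) x * ennreal (w x)) sequentially"
            by eventually_elim (auto simp: True indicator_def tube_def)
          then show ?thesis by (rule Liminf_bounded)
        qed simp
      qed
      also have "\<dots> \<le> liminf (\<lambda>i. \<integral>\<^sup>+ x. indicator (tube (X i) a) x * ennreal (w x) \<partial>lborel)"
        by (rule nn_integral_liminf) (use w tube_borel in auto)
      also have "\<dots> \<le> c"
      proof -
        have "(\<integral>\<^sup>+ x. indicator (tube (X i) a) x * ennreal (w x) \<partial>lborel) \<le> c" for i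
          using X unfolding tube_max_def by (auto simp: SUP_le_iff)
        then have "liminf (\<lambda>i. \<integral>\<^sup>+ x. indicator (tube (X i) a) x * ennreal (w x) \<partial>lborel) \<le> liminf (\<lambda>i::nat. c)"
          by (intro Liminf_mono) auto
        then show ?thesis by (simp add: Liminf_const)
      qed
      finally show ?thesis .
    qed
    then show "\<nu> \<in> {\<nu>. tube_max w \<nu> \<le> c}" unfolding tube_max_def by (auto intro: SUP_least)
  qed
  then have "open {\<nu>. c < tube_max w \<nu>}"
    by (simp add: closed_def Collect_neg_eq[symmetric] not_le)
  then show "{x \<in> space borel. c < tube_max w x} \<in> sets borel" by auto
qed

lemma Linf_sphere_tube_max_le:
  fixes w :: "real^'n \<Rightarrow> real"
  assumes w: "w \<in> borel_measurable borel"
    and le: "\<And>\<nu> a. norm \<nu> = 1 \<Longrightarrow> (\<integral>\<^sup>+ x. indicator (tube \<nu> a) x * ennreal (w x) \<partial>lborel) \<le> c"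
  shows "Linf_sphere (tube_max w) \<le> c"
  unfolding Linf_sphere_def
proof (rule esssup_I)
  show "tube_max w \<in> borel_measurable (surface_measure (sphere 0 1))"
    using borel_measurable_tube_max[OF w] by (subst measurable_cong_sets[OF sets_surface_measure refl])
  have "emeasure (surface_measure (sphere 0 1)) (- sphere (0::real^'n) 1) = 0"
    by (subst emeasure_surface_measure) (auto simp: borel_closed)
  then have "AE \<nu> in surface_measure (sphere (0::real^'n) 1). \<nu> \<in> sphere 0 1"
    by (intro AE_I[of _ _ "- sphere (0::real^'n) 1"]) (auto simp: borel_closed)
  then show "AE \<nu> in surface_measure (sphere (0::real^'n) 1). tube_max w \<nu> \<le> c"
    by eventually_elim (auto simp: tube_max_def intro!: SUP_least le)
qed

text \<open>The unit ball around \<open>a\<close> lies in the tube through \<open>a\<close> in every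
  direction, so the bound holds for each direction and then for the essential supremum of a
  constant.\<close>

lemma Linf_sphere_tube_max_ge:
  fixes w :: "real^'n \<Rightarrow> real"
  assumes n2: "CARD('n) \<ge> 2" and w: "w \<in> borel_measurable borel"
  shows "(\<integral>\<^sup>+ x. indicator (ball a 1) x * ennreal (w x) \<partial>lborel) \<le> Linf_sphere (tube_max w)"
proof -
  let ?e = "\<integral>\<^sup>+ x. indicator (ball a 1) x * ennreal (w x) \<partial>lborel"
  have "?e \<le> tube_max w \<nu>" for \<nu>
  proof -
    have "ball a 1 \<subseteq> tube \<nu> a" by (auto simp: tube_def dist_commute intro!: exI[of _ 0])
    then have "?e \<le> (\<integral>\<^sup>+ x. indicator (tube \<nu> a) x * ennreal (w x) \<partial>lborel)"
      by (intro nn_integral_mono mult_right_mono) (auto simp: indicator_def)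
    then show ?thesis unfolding tube_max_def by (auto intro: SUP_upper2)
  qed
  then have "esssup (surface_measure (sphere (0::real^'n) 1)) (\<lambda>_. ?e) \<le> Linf_sphere (tube_max w)"
    unfolding Linf_sphere_def by (intro esssup_mono) auto
  then show ?thesis
    using surface_measure_sphere_pos[OF n2] by (subst (asm) esssup_const) auto
qed

text \<open>After rotation by the phase of \<tau>, every point of \<open>B\<close> contributes a
  real part of at least 1/2, so nothing cancels.\<close>

lemma extension_lower_bound:
  fixes S B W :: "(real^'n) set" and \<tau> :: "real^'n"
  defines "\<sigma> \<equiv> surface_measure S"
  assumes B: "B \<in> sets borel" and fin: "emeasure \<sigma> B < \<infinity>"
    and phase: "\<And>s. s \<in> B \<Longrightarrow> \<exists>z::int. \<bar>x \<bullet> (s - \<tau>) - of_int z\<bar> \<le> 1/8"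
  shows "measure \<sigma> B / 2 \<le> cmod (fourier_ext \<sigma> (indicator B) x)"
proof -
  let ?g = "\<lambda>s. indicator B s * cis (2 * pi * (x \<bullet> s)) :: complex"
  let ?u = "cis (- 2 * pi * (x \<bullet> \<tau>))"
  have sets: "sets \<sigma> = sets borel" by (simp add: \<sigma>_def)
  have Bs: "B \<in> sets \<sigma>" using B sets by simp
  have int: "integrable \<sigma> (indicator B :: _ \<Rightarrow> real)" using fin Bs by (simp add: less_top[symmetric])
  have cism: "(\<lambda>s. cis (2 * pi * (x \<bullet> s))) \<in> borel_measurable \<sigma>"
    unfolding measurable_cong_sets[OF sets refl]
    by (intro borel_measurable_continuous_onI continuous_intros)
  have ig: "integrable \<sigma> ?g"
    by (rule Bochner_Integration.integrable_bound[OF int])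
       (use cism Bs in \<open>auto simp: norm_mult indicator_def intro!: borel_measurable_times\<close>)
  have "measure \<sigma> B / 2 = (LINT s|\<sigma>. indicator B s / 2)" using Bs by simp
  also have "\<dots> \<le> (LINT s|\<sigma>. Re (?u * ?g s))"
  proof (rule integral_mono)
    show "integrable \<sigma> (\<lambda>s. indicator B s / 2 :: real)" using int by simp
    show "integrable \<sigma> (\<lambda>s. Re (?u * ?g s))" by (intro integrable_Re integrable_mult_right ig)
    fix s
    show "indicator B s / 2 \<le> Re (?u * ?g s)"
    proof (cases "s \<in> B")
      case True
      obtain z :: int where z: "\<bar>x \<bullet> (s - \<tau>) - of_int z\<bar> \<le> 1/8" using phase[OF True] by blast
      let ?y = "x \<bullet> (s - \<tau>) - of_int z"
      have "Re (?u * ?g s) = cos (2 * pi * (x \<bullet> (s - \<tau>)))"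
        using True by (simp add: cis_mult inner_diff_right algebra_simps)
      also have "\<dots> = cos (2 * pi * ?y)"
      proof -
        have "cos (2 * pi * ?y + of_int z * (2 * pi)) = cos (2 * pi * ?y)"
          using cos.plus_of_int[of "2 * pi * ?y" z] by simp
        then show ?thesis by (simp add: algebra_simps)
      qed
      also have "\<dots> = cos \<bar>2 * pi * ?y\<bar>" by simp
      \<comment> \<open>The phase error is at most one eighth of a turn, that is pi/4, which is
        below pi/3.\<close>
      also have "\<dots> \<ge> cos (pi / 3)"
      proof (rule cos_monotone_0_pi_le)
        have "\<bar>2 * pi * ?y\<bar> = 2 * pi * \<bar>?y\<bar>" by (simp add: abs_mult)
        also have "\<dots> \<le> 2 * pi * (1/8)" by (intro mult_left_mono z) auto
        also have "\<dots> \<le> pi / 3" using pi_gt_zero by simp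
        finally show "\<bar>2 * pi * ?y\<bar> \<le> pi / 3" .
      qed auto
      finally show ?thesis using True by (simp add: cos_60)
    qed simp
  qed
  also have "\<dots> = Re (?u * (LINT s|\<sigma>. ?g s))"
    using ig by (subst integral_Re) auto
  also have "\<dots> \<le> cmod (?u * (LINT s|\<sigma>. ?g s))" by (rule complex_Re_le_cmod)
  also have "\<dots> = cmod (fourier_ext \<sigma> (indicator B) x)"
    by (simp add: norm_mult fourier_ext_def)
  finally show ?thesis .
qed

text \<open>With indicators, the squared norm of \<open>f\<close> is the measure \<open>m\<close> of
  \<open>B\<close>, and the left side is at least \<open>(m / 2)^2\<close> times the volume of
  \<open>W\<close>. After division by \<open>m\<close> the claim is the last assumption on
  \<open>K\<close>. The small ball inside \<open>W\<close> keeps the tube maximum positive.\<close>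

lemma extension_weight_pair:
  fixes S B W :: "(real^'n) set" and \<tau> :: "real^'n" and K T R :: real
  defines "\<sigma> \<equiv> surface_measure S"
  assumes n2: "CARD('n) \<ge> 2"
    and B: "B \<in> sets borel" and fin: "emeasure \<sigma> B < \<infinity>" and pos: "0 < measure \<sigma> B"
    and W: "W \<in> sets borel" "W \<subseteq> ball 0 R" "ball 0 \<eta> \<subseteq> W" "0 < \<eta>"
    and phase: "\<And>x s. x \<in> W \<Longrightarrow> s \<in> B \<Longrightarrow> \<exists>z::int. \<bar>x \<bullet> (s - \<tau>) - of_int z\<bar> \<le> 1/8"
    and tubes: "\<And>\<nu> a. norm \<nu> = 1 \<Longrightarrow> emeasure lborel (W \<inter> tube \<nu> a) \<le> ennreal T"
    and K: "0 \<le> K" "0 \<le> T" "4 * K * T \<le> measure \<sigma> B * measure lborel W"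
  shows "\<exists>(f :: real^'n \<Rightarrow> complex) (w :: real^'n \<Rightarrow> real).
              f \<in> borel_measurable \<sigma> \<and>
              (\<integral>\<^sup>+ s. ennreal ((cmod (f s))\<^sup>2) \<partial>\<sigma>) < \<infinity> \<and>
              (\<integral>\<^sup>+ s. ennreal ((cmod (f s))\<^sup>2) \<partial>\<sigma>) > 0 \<and>
              w \<in> borel_measurable lborel \<and> (\<forall>x. 0 \<le> w x \<and> w x \<le> 1) \<and>
              Linf_sphere (tube_max w) > 0 \<and>
              (\<integral>\<^sup>+ x\<in>ball 0 R. ennreal ((cmod (fourier_ext \<sigma> f x))\<^sup>2 * w x) \<partial>lborel)
                \<ge> ennreal K * (\<integral>\<^sup>+ s. ennreal ((cmod (f s))\<^sup>2) \<partial>\<sigma>) * Linf_sphere (tube_max w)"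
proof -
  let ?f = "indicator B :: real^'n \<Rightarrow> complex" and ?w = "indicator W :: real^'n \<Rightarrow> real"
  let ?m = "measure \<sigma> B"
  have sets: "sets \<sigma> = sets borel" by (simp add: \<sigma>_def)
  have Bs: "B \<in> sets \<sigma>" using B sets by simp
  have L2: "(\<integral>\<^sup>+ s. ennreal ((cmod (?f s))\<^sup>2) \<partial>\<sigma>) = emeasure \<sigma> B"
  proof -
    have "(\<lambda>s. ennreal ((cmod (?f s))\<^sup>2)) = indicator B" by (auto simp: indicator_def)
    then show ?thesis using Bs by simp
  qed
  have em: "emeasure \<sigma> B = ennreal ?m"
    using fin by (intro emeasure_eq_ennreal_measure) auto
  have wm: "?w \<in> borel_measurable borel" using W by simp
  have Wfin: "emeasure lborel W = ennreal (measure lborel W)"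
  proof (rule emeasure_eq_ennreal_measure)
    have "emeasure lborel W \<le> emeasure lborel (ball (0::real^'n) R)" by (rule emeasure_mono[OF W(2)]) auto
    also have "\<dots> < top" using emeasure_bounded_finite[OF bounded_ball] by simp
    finally show "emeasure lborel W \<noteq> top" by simp
  qed
  have Tub: "Linf_sphere (tube_max ?w) \<le> ennreal T"
  proof (rule Linf_sphere_tube_max_le[OF wm])
    fix \<nu> a :: "real^'n" assume "norm \<nu> = 1"
    have "(\<integral>\<^sup>+ x. indicator (tube \<nu> a) x * ennreal (?w x) \<partial>lborel) = (\<integral>\<^sup>+ x. indicator (W \<inter> tube \<nu> a) x \<partial>lborel)"
      by (intro nn_integral_cong) (auto simp: indicator_def)
    also have "\<dots> = emeasure lborel (W \<inter> tube \<nu> a)"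
      using W(1) tube_borel[of \<nu> a] by (intro nn_integral_indicator) auto
    also have "\<dots> \<le> ennreal T" by (rule tubes) fact
    finally show "(\<integral>\<^sup>+ x. indicator (tube \<nu> a) x * ennreal (?w x) \<partial>lborel) \<le> ennreal T" .
  qed
  have Lpos: "Linf_sphere (tube_max ?w) > 0"
  proof -
    let ?e = "min \<eta> 1"
    have "0 < emeasure lborel (ball (0::real^'n) ?e)"
      using W(4) content_ball_pos[of ?e "0::real^'n"] emeasure_bounded_finite[OF bounded_ball, of "0::real^'n" ?e]
      by (subst emeasure_eq_ennreal_measure) auto
    also have "\<dots> = (\<integral>\<^sup>+ x. indicator (ball (0::real^'n) ?e) x \<partial>lborel)" by simp
    also have "\<dots> \<le> (\<integral>\<^sup>+ x. indicator (ball (0::real^'n) 1) x * ennreal (?w x) \<partial>lborel)"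
      using W(3) by (intro nn_integral_mono) (auto simp: indicator_def subset_eq)
    also have "\<dots> \<le> Linf_sphere (tube_max ?w)" by (rule Linf_sphere_tube_max_ge[OF n2 wm])
    finally show ?thesis .
  qed
  have "ennreal K * emeasure \<sigma> B * Linf_sphere (tube_max ?w) \<le> ennreal K * ennreal ?m * ennreal T"
    unfolding em by (intro mult_left_mono Tub) auto
  also have "\<dots> = ennreal (K * ?m * T)" using K by (simp add: ennreal_mult)
  also have "\<dots> \<le> ennreal ((?m/2)\<^sup>2 * measure lborel W)"
  proof (rule ennreal_leI)
    have "?m * (4 * K * T) \<le> ?m * (?m * measure lborel W)" by (rule mult_left_mono[OF K(3)]) simp
    then show "K * ?m * T \<le> (?m/2)\<^sup>2 * measure lborel W" by (simp add: power2_eq_square algebra_simps)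
  qed
  also have "\<dots> = (\<integral>\<^sup>+ x. ennreal ((?m/2)\<^sup>2) * indicator W x \<partial>lborel)"
    using W by (subst nn_integral_cmult_indicator) (auto simp: Wfin ennreal_mult)
  also have "\<dots> \<le> (\<integral>\<^sup>+ x\<in>ball 0 R. ennreal ((cmod (fourier_ext \<sigma> ?f x))\<^sup>2 * ?w x) \<partial>lborel)"
  proof (rule nn_integral_mono)
    fix x
    show "ennreal ((?m/2)\<^sup>2) * indicator W x \<le> ennreal ((cmod (fourier_ext \<sigma> ?f x))\<^sup>2 * ?w x) * indicator (ball 0 R) x"
    proof (cases "x \<in> W")
      case True
      have "?m / 2 \<le> cmod (fourier_ext \<sigma> ?f x)"
        unfolding \<sigma>_def by (rule extension_lower_bound[OF B fin[unfolded \<sigma>_def] phase[OF True]])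
      then have "(?m / 2)\<^sup>2 \<le> (cmod (fourier_ext \<sigma> ?f x))\<^sup>2" by (intro power_mono) auto
      then show ?thesis using True W(2) by (auto simp: indicator_def intro!: ennreal_leI)
    qed simp
  qed
  finally have main: "ennreal K * emeasure \<sigma> B * Linf_sphere (tube_max ?w)
      \<le> (\<integral>\<^sup>+ x\<in>ball 0 R. ennreal ((cmod (fourier_ext \<sigma> ?f x))\<^sup>2 * ?w x) \<partial>lborel)" .
  show ?thesis
    by (rule exI[of _ ?f], rule exI[of _ ?w], unfold L2)
       (use main fin pos Bs W Lpos em in \<open>auto simp: split_indicator\<close>)
qed

section \<open>Functions of class $C^k$\<close>

text \<open>The coordinates are moved one at a time. Each move is a one-dimensional mean value
  estimate for \<open>F\<close> minus its expected linear part, and continuity of the partial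
  derivative makes the error small.\<close>

lemma has_derivative_of_continuous_partials:
  fixes F :: "real^'n \<Rightarrow> real"
  assumes U: "open U" "x \<in> U"
    and part: "\<And>i y. y \<in> U \<Longrightarrow> ((\<lambda>t. F (y + t *\<^sub>R axis i 1)) has_real_derivative G i y) (at 0)"
    and cont: "\<And>i. continuous_on U (G i)"
  shows "(F has_derivative (\<lambda>h. \<Sum>i\<in>UNIV. h$i * G i x)) (at x)"
proof -
  \<comment> \<open>\<open>P J h\<close> keeps the coordinates of \<open>h\<close> in
    \<open>J\<close>; the induction over \<open>J\<close> ends with
    \<open>P UNIV h = h\<close>.\<close>
  define P where "P = (\<lambda>J (h::real^'n). (\<chi> j. if j \<in> J then h$j else 0))"
  have main: "\<forall>e>0. \<exists>\<delta>>0. \<forall>h. norm h < \<delta> \<longrightarrow>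
      \<bar>F (x + P J h) - F x - (\<Sum>j\<in>J. h$j * G j x)\<bar> \<le> e * real (card J) * norm h" for J :: "'n set"
    using finite[of J]
  proof (induction J rule: finite_induct)
    case empty
    have "P {} h = 0" for h by (simp add: P_def vec_eq_iff)
    then show ?case by (auto intro: exI[of _ 1])
  next
    case (insert i J)
    show ?case
    proof (intro allI impI)
      fix e :: real assume e: "e > 0"
      obtain d1 where d1: "d1 > 0" "\<And>h. norm h < d1 \<Longrightarrow>
         \<bar>F (x + P J h) - F x - (\<Sum>j\<in>J. h$j * G j x)\<bar> \<le> e * real (card J) * norm h"
        using insert.IH e by blast
      obtain d2 where d2: "d2 > 0" "ball x d2 \<subseteq> U" using U openE by blast
      have "continuous (at x) (G i)" using cont[of i] U continuous_on_eq_continuous_at by blast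
      then obtain d3 where d3: "d3 > 0" "\<And>y. dist y x < d3 \<Longrightarrow> \<bar>G i y - G i x\<bar> < e"
        using e unfolding continuous_at_eps_delta dist_real_def by blast
      define d where "d = min d1 (min d2 d3)"
      show "\<exists>\<delta>>0. \<forall>h. norm h < \<delta> \<longrightarrow>
        \<bar>F (x + P (insert i J) h) - F x - (\<Sum>j\<in>insert i J. h$j * G j x)\<bar> \<le> e * real (card (insert i J)) * norm h"
      proof (intro exI[of _ d] conjI allI impI)
        show "d > 0" using d1 d2 d3 by (simp add: d_def)
        fix h :: "real^'n" assume h: "norm h < d"
        define y where "y = (\<lambda>t. x + P J h + t *\<^sub>R axis i 1)"
        have yin: "dist (y t) x \<le> norm h" if "t \<in> closed_segment 0 (h$i)" for t
        proof -
          have t: "\<bar>t\<bar> \<le> \<bar>h$i\<bar>" using that by (auto simp: closed_segment_eq_real_ivl split: if_splits)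
          have "norm (P J h + t *\<^sub>R axis i 1) \<le> norm h"
            by (rule norm_le_componentwise_cart) (use t insert.hyps in \<open>auto simp: P_def axis_def\<close>)
          then show ?thesis by (simp add: y_def dist_norm add.assoc)
        qed
        have "norm ((\<lambda>t. F (y t) - t * G i x) (h$i) - (\<lambda>t. F (y t) - t * G i x) 0) \<le> e * norm (h$i - 0)"
        proof (rule field_differentiable_bound[where S = "closed_segment 0 (h$i)" and f' = "\<lambda>t. G i (y t) - G i x"])
          fix t assume t: "t \<in> closed_segment 0 (h$i)"
          have "y t \<in> U" using yin[OF t] h d2 by (auto simp: d_def dist_commute)
          from part[OF this, of i]
          have "((\<lambda>s. F (y t + s *\<^sub>R axis i 1)) has_real_derivative G i (y t)) (at 0)" .
          moreover have "y t + s *\<^sub>R axis i 1 = y (s + t)" for s by (simp add: y_def scaleR_add_left)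
          ultimately have "((\<lambda>s. F (y (s + t))) has_real_derivative G i (y t)) (at 0)" by simp
          then have "((\<lambda>s. F (y s)) has_real_derivative G i (y t)) (at (0 + t))"
            by (subst DERIV_shift)
          then have A: "((\<lambda>s. F (y s)) has_real_derivative G i (y t)) (at t)" by simp
          have B: "((\<lambda>s. s * G i x) has_real_derivative G i x) (at t)"
            by (auto intro!: derivative_eq_intros)
          show "((\<lambda>t. F (y t) - t * G i x) has_real_derivative G i (y t) - G i x) (at t within closed_segment 0 (h$i))"
            using DERIV_diff[OF A B] by (rule has_field_derivative_at_within)
          show "norm (G i (y t) - G i x) \<le> e"
            using d3(2)[of "y t"] yin[OF t] h by (auto simp: d_def)
        qed auto
        then have "\<bar>F (y (h$i)) - h$i * G i x - F (y 0)\<bar> \<le> e * \<bar>h$i\<bar>" by simp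
        moreover have "e * \<bar>h$i\<bar> \<le> e * norm h"
          by (rule mult_left_mono[OF component_le_norm_cart]) (use e in simp)
        ultimately have a: "\<bar>F (y (h$i)) - F (y 0) - h$i * G i x\<bar> \<le> e * norm h" by linarith
        have b: "\<bar>F (x + P J h) - F x - (\<Sum>j\<in>J. h$j * G j x)\<bar> \<le> e * real (card J) * norm h"
          using d1(2) h by (auto simp: d_def)
        have c: "y 0 = x + P J h" by (simp add: y_def)
        have "P J h + h$i *\<^sub>R axis i 1 = P (insert i J) h"
          using insert.hyps by (auto simp: P_def axis_def vec_eq_iff)
        then have d: "y (h$i) = x + P (insert i J) h" by (simp add: y_def add.assoc)
        have "(\<Sum>j\<in>insert i J. h$j * G j x) = h$i * G i x + (\<Sum>j\<in>J. h$j * G j x)"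
          using insert.hyps by simp
        moreover have "e * real (card (insert i J)) * norm h = e * norm h + e * real (card J) * norm h"
          using insert.hyps by (simp add: algebra_simps)
        ultimately show "\<bar>F (x + P (insert i J) h) - F x - (\<Sum>j\<in>insert i J. h$j * G j x)\<bar> \<le> e * real (card (insert i J)) * norm h"
          using a b unfolding c d by linarith
      qed
    qed
  qed
  have PU: "P UNIV h = h" for h by (simp add: P_def vec_eq_iff)
  show ?thesis
    unfolding has_derivative_at_alt
  proof (intro conjI allI impI)
    show "bounded_linear (\<lambda>h. \<Sum>i\<in>UNIV. h$i * G i x)"
      by (intro bounded_linear_sum bounded_linear_mult_const bounded_linear_vec_nth)
    fix e :: real assume "e > 0"
    then have "e / CARD('n) > 0" by simp
    with main[of UNIV] obtain d where d: "d > 0" "\<And>h. norm h < d \<Longrightarrow>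
      \<bar>F (x + h) - F x - (\<Sum>j\<in>UNIV. h$j * G j x)\<bar> \<le> (e / CARD('n)) * CARD('n) * norm h"
      unfolding PU by blast
    show "\<exists>d>0. \<forall>y. norm (y - x) < d \<longrightarrow> norm (F y - F x - (\<Sum>i\<in>UNIV. (y - x)$i * G i x)) \<le> e * norm (y - x)"
      using d(1) d(2)[of "y - x" for y] by (intro exI[of _ d]) auto
  qed
qed

section \<open>Calculus of the class \<open>Ck_on\<close>\<close>

lemma Ck_on_0: "Ck_on 0 U g \<longleftrightarrow> continuous_on U g"
proof
  assume "Ck_on 0 U g"
  then obtain D where "\<And>x. x \<in> U \<Longrightarrow> D [] x = g x" "continuous_on U (D [])"
    by (auto simp: Ck_on_def Ck_derivs_def)
  then show "continuous_on U g" using continuous_on_cong by blast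
next
  assume "continuous_on U g"
  then show "Ck_on 0 U g" unfolding Ck_on_def Ck_derivs_def by (intro exI[of _ "\<lambda>_. g"]) auto
qed

lemma Ck_on_le: "Ck_on k U g \<Longrightarrow> j \<le> k \<Longrightarrow> Ck_on j U g"
  unfolding Ck_on_def Ck_derivs_def by (elim exE, rule_tac x = D in exI) auto

lemma Ck_on_subset:
  assumes "Ck_on k U g" "V \<subseteq> U"
  shows "Ck_on k V g"
proof -
  obtain D where "Ck_derivs k U g D" using assms(1) by (auto simp: Ck_on_def)
  then have "Ck_derivs k V g D"
    using assms(2) unfolding Ck_derivs_def by (auto intro: continuous_on_subset)
  then show ?thesis by (auto simp: Ck_on_def)
qed

lemma Ck_on_continuous: "Ck_on k U g \<Longrightarrow> continuous_on U g"
  using Ck_on_le[of k U g 0] by (simp add: Ck_on_0)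

text \<open>Turns the family of iterated derivatives into a recursion on \<open>k\<close>, by which
  products and compositions are treated. In \<open>Ck_derivs\<close> a list grows at its front, so
  its last entry is the derivative taken first; hence \<open>al @ [i]\<close> in one direction and
  \<open>last\<close> with \<open>butlast\<close> in the other.\<close>

lemma Ck_on_Suc:
  fixes g :: "real^'n \<Rightarrow> real"
  assumes U: "open U"
  shows "Ck_on (Suc k) U g \<longleftrightarrow> continuous_on U g \<and>
    (\<exists>G. \<forall>i. (\<forall>x\<in>U. ((\<lambda>t. g (x + t *\<^sub>R axis i 1)) has_real_derivative G i x) (at 0)) \<and> Ck_on k U (G i))"
    (is "?L \<longleftrightarrow> ?R")
proof
  assume L: ?L
  then obtain D where D: "\<And>x. x \<in> U \<Longrightarrow> D [] x = g x"
    "\<And>al. length al \<le> Suc k \<Longrightarrow> continuous_on U (D al)"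
    "\<And>al i x. length al < Suc k \<Longrightarrow> x \<in> U \<Longrightarrow>
        ((\<lambda>t. D al (x + t *\<^sub>R axis i 1)) has_real_derivative D (i # al) x) (at 0)"
    unfolding Ck_on_def Ck_derivs_def by blast
  have 1: "((\<lambda>t. g (x + t *\<^sub>R axis i 1)) has_real_derivative D [i] x) (at 0)" if "x \<in> U" for i x
  proof -
    have op: "open ((\<lambda>t. x + t *\<^sub>R axis i 1 :: real^'n) -` U)"
      by (intro open_vimage U continuous_intros)
    show ?thesis
      by (rule has_field_derivative_transform_within_open[OF D(3)[of "[]" x i] op])
         (use that D(1) in auto)
  qed
  have 2: "Ck_on k U (D [i])" for i
    unfolding Ck_on_def Ck_derivs_def
    by (rule exI[of _ "\<lambda>al. D (al @ [i])"]) (use D in auto)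
  show ?R using 1 2 Ck_on_continuous[OF L] by (intro conjI exI[of _ "\<lambda>i. D [i]"]) auto
next
  assume R: ?R
  then obtain G where G: "\<And>i x. x\<in>U \<Longrightarrow> ((\<lambda>t. g (x + t *\<^sub>R axis i 1)) has_real_derivative G i x) (at 0)"
    "\<And>i. Ck_on k U (G i)" by blast
  then obtain D where D: "\<And>i. Ck_derivs k U (G i) (D i)" unfolding Ck_on_def by metis
  define E where "E = (\<lambda>al. if al = [] then g else D (last al) (butlast al))"
  show ?L
    unfolding Ck_on_def Ck_derivs_def
  proof (intro exI[of _ E] conjI ballI allI impI)
    fix al :: "'n list" assume al: "length al \<le> Suc k"
    show "continuous_on U (E al)"
    proof (cases "al = []")
      case False
      then have "continuous_on U (D (last al) (butlast al))"
        using D[of "last al"] al by (auto simp: Ck_derivs_def)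
      then show ?thesis using False by (simp add: E_def)
    qed (use R in \<open>simp add: E_def\<close>)
  next
    fix al :: "'n list" and i x assume *: "length al < Suc k \<and> x \<in> U"
    show "((\<lambda>t. E al (x + t *\<^sub>R axis i 1)) has_real_derivative E (i # al) x) (at 0)"
    proof (cases "al = []")
      case True
      have "D i [] x = G i x" using D[of i] * by (auto simp: Ck_derivs_def)
      then show ?thesis using True G(1)[of x i] * by (simp add: E_def)
    next
      case False
      then have "length (butlast al) < k" using * by (cases al) auto
      then have "((\<lambda>t. D (last al) (butlast al) (x + t *\<^sub>R axis i 1)) has_real_derivative D (last al) (i # butlast al) x) (at 0)"
        using D[of "last al"] * unfolding Ck_derivs_def by blast
      then show ?thesis using False by (simp add: E_def)
    qed
  qed (simp add: E_def)
qed

lemma Ck_on_Suc_total: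
  fixes g :: "real^'n \<Rightarrow> real"
  assumes U: "open U" and g: "Ck_on (Suc k) U g"
  obtains G where "\<And>x. x \<in> U \<Longrightarrow> (g has_derivative (\<lambda>h. \<Sum>i\<in>UNIV. h$i * G i x)) (at x)"
    "\<And>i. Ck_on k U (G i)"
proof -
  obtain G where G: "\<And>i x. x\<in>U \<Longrightarrow> ((\<lambda>t. g (x + t *\<^sub>R axis i 1)) has_real_derivative G i x) (at 0)"
    "\<And>i. Ck_on k U (G i)"
    using g unfolding Ck_on_Suc[OF U] by blast
  show thesis
    by (rule that[OF has_derivative_of_continuous_partials[OF U]])
       (use G Ck_on_continuous in blast)+
qed

lemma Ck_on_const: "Ck_on k U (\<lambda>_. c)"
  unfolding Ck_on_def Ck_derivs_def
  by (rule exI[of _ "\<lambda>al _. if al = [] then c else 0"]) auto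

lemma Ck_on_add: "Ck_on k U f \<Longrightarrow> Ck_on k U g \<Longrightarrow> Ck_on k U (\<lambda>x. f x + g x)"
  unfolding Ck_on_def Ck_derivs_def
  by (elim exE, rule_tac x = "\<lambda>al x. D al x + Da al x" in exI)
     (auto intro!: continuous_intros derivative_eq_intros)

lemma Ck_on_sum: "finite I \<Longrightarrow> (\<And>i. i \<in> I \<Longrightarrow> Ck_on k U (f i)) \<Longrightarrow> Ck_on k U (\<lambda>x. \<Sum>i\<in>I. f i x)"
  by (induction I rule: finite_induct) (auto intro: Ck_on_const Ck_on_add)

lemma Ck_on_mult:
  fixes f g :: "real^'n \<Rightarrow> real"
  assumes U: "open U"
  shows "Ck_on k U f \<Longrightarrow> Ck_on k U g \<Longrightarrow> Ck_on k U (\<lambda>x. f x * g x)"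
proof (induction k arbitrary: f g)
  case 0 then show ?case by (auto simp: Ck_on_0 intro: continuous_intros)
next
  case (Suc k)
  obtain F where F: "\<And>i x. x\<in>U \<Longrightarrow> ((\<lambda>t. f (x + t *\<^sub>R axis i 1)) has_real_derivative F i x) (at 0)"
    "\<And>i. Ck_on k U (F i)" using Suc.prems(1) unfolding Ck_on_Suc[OF U] by blast
  obtain G where G: "\<And>i x. x\<in>U \<Longrightarrow> ((\<lambda>t. g (x + t *\<^sub>R axis i 1)) has_real_derivative G i x) (at 0)"
    "\<And>i. Ck_on k U (G i)" using Suc.prems(2) unfolding Ck_on_Suc[OF U] by blast
  have fg: "Ck_on k U f" "Ck_on k U g" using Suc.prems by (auto intro: Ck_on_le)
  show ?case
    unfolding Ck_on_Suc[OF U]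
  proof (intro conjI exI[of _ "\<lambda>i x. F i x * g x + f x * G i x"] allI ballI)
    show "continuous_on U (\<lambda>x. f x * g x)"
      using fg by (auto intro: continuous_intros Ck_on_continuous)
    show "Ck_on k U (\<lambda>x. F i x * g x + f x * G i x)" for i
      by (intro Ck_on_add Suc.IH F G fg)
    show "((\<lambda>t. f (x + t *\<^sub>R axis i 1) * g (x + t *\<^sub>R axis i 1)) has_real_derivative F i x * g x + f x * G i x) (at 0)"
      if "x \<in> U" for i x
      using DERIV_mult[OF F(1)[OF that] G(1)[OF that], of i i] by (simp add: algebra_simps)
  qed
qed

lemma continuous_on_components:
  fixes f :: "'a::topological_space \<Rightarrow> real^'n"
  assumes "\<And>j. continuous_on S (\<lambda>x. f x $ j)"
  shows "continuous_on S f"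
  using continuous_on_vec_lambda[of S "\<lambda>j x. f x $ j"] assms by simp

text \<open>The chain rule writes a partial derivative as a sum of products of \<open>P j i\<close>
  with \<open>G j\<close> composed with \<Psi>. The induction hypothesis is applied to the
  \<open>G j\<close>, which is why \<open>F\<close> stays arbitrary.\<close>

lemma Ck_on_compose:
  fixes F :: "real^'n \<Rightarrow> real" and \<Psi> :: "real^'n \<Rightarrow> real^'n"
  assumes U: "open U" and V: "open V" and im: "\<And>x. x \<in> V \<Longrightarrow> \<Psi> x \<in> U"
  shows "Ck_on k U F \<Longrightarrow> (\<And>j. Ck_on k V (\<lambda>x. \<Psi> x $ j)) \<Longrightarrow> Ck_on k V (\<lambda>x. F (\<Psi> x))"
proof (induction k arbitrary: F)
  case 0
  have "continuous_on V \<Psi>"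
    using 0(2) by (intro continuous_on_components) (simp add: Ck_on_0)
  then show ?case using 0(1) im by (auto simp: Ck_on_0 intro: continuous_on_compose2)
next
  case (Suc k)
  obtain G where G: "\<And>x. x \<in> U \<Longrightarrow> (F has_derivative (\<lambda>h. \<Sum>i\<in>UNIV. h$i * G i x)) (at x)"
    "\<And>i. Ck_on k U (G i)"
    by (rule Ck_on_Suc_total[OF U Suc.prems(1)], rule that) auto
  have "\<forall>j. \<exists>P. \<forall>i. (\<forall>x\<in>V. ((\<lambda>t. \<Psi> (x + t *\<^sub>R axis i 1) $ j) has_real_derivative P i x) (at 0)) \<and> Ck_on k V (P i)"
    using Suc.prems(2) unfolding Ck_on_Suc[OF V] by blast
  then obtain P where P: "\<And>j i x. x \<in> V \<Longrightarrow> ((\<lambda>t. \<Psi> (x + t *\<^sub>R axis i 1) $ j) has_real_derivative P j i x) (at 0)"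
    "\<And>j i. Ck_on k V (P j i)" by metis
  have Psi: "Ck_on k V (\<lambda>x. \<Psi> x $ j)" for j by (rule Ck_on_le[OF Suc.prems(2)]) simp
  have "continuous_on V \<Psi>"
    using Psi by (intro continuous_on_components Ck_on_continuous)
  then have cont: "continuous_on V (\<lambda>x. F (\<Psi> x))"
    using Ck_on_continuous[OF Suc.prems(1)] im by (auto intro: continuous_on_compose2)
  show ?case
    unfolding Ck_on_Suc[OF V]
  proof (intro conjI exI[of _ "\<lambda>i x. \<Sum>j\<in>UNIV. P j i x * G j (\<Psi> x)"] allI ballI cont)
    fix i
    show "Ck_on k V (\<lambda>x. \<Sum>j\<in>UNIV. P j i x * G j (\<Psi> x))"
      by (intro Ck_on_sum Ck_on_mult[OF V] P(2) Suc.IH[OF G(2)] Psi) auto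
    fix x assume x: "x \<in> V"
    have "((\<lambda>t. \<Psi> (x + t *\<^sub>R axis i 1)) has_derivative (\<lambda>t. \<chi> j. t * P j i x)) (at 0)"
    proof (rule has_derivative_componentwise_within[THEN iffD2], rule ballI)
      fix e :: "real^'n" assume "e \<in> Basis"
      then obtain j where e: "e = axis j 1" by (auto simp: Basis_vec_def)
      have "((\<lambda>t. \<Psi> (x + t *\<^sub>R axis i 1) $ j) has_derivative (\<lambda>t. t * P j i x)) (at 0)"
        using P(1)[OF x, of i j] by (simp add: has_field_derivative_def mult_commute_abs)
      then show "((\<lambda>t. \<Psi> (x + t *\<^sub>R axis i 1) \<bullet> e) has_derivative (\<lambda>t. (\<chi> j. t * P j i x) \<bullet> e)) (at 0)"
        by (simp add: e inner_axis)
    qed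
    moreover have "(F has_derivative (\<lambda>h. \<Sum>j\<in>UNIV. h$j * G j (\<Psi> x))) (at (\<Psi> (x + 0 *\<^sub>R axis i 1)))"
      using G(1)[OF im[OF x]] by simp
    ultimately have "((\<lambda>t. F (\<Psi> (x + t *\<^sub>R axis i 1))) has_derivative (\<lambda>t. \<Sum>j\<in>UNIV. (\<chi> j. t * P j i x)$j * G j (\<Psi> x))) (at 0)"
      by (rule has_derivative_compose)
    moreover have "(\<lambda>t. \<Sum>j\<in>UNIV. (\<chi> j. t * P j i x)$j * G j (\<Psi> x)) = (*) (\<Sum>j\<in>UNIV. P j i x * G j (\<Psi> x))"
      by (rule ext) (simp add: sum_distrib_left mult_ac)
    ultimately show "((\<lambda>t. F (\<Psi> (x + t *\<^sub>R axis i 1))) has_real_derivative (\<Sum>j\<in>UNIV. P j i x * G j (\<Psi> x))) (at 0)"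
      by (simp only: has_field_derivative_def)
  qed
qed

lemma Ck_on_component: "Ck_on k U (\<lambda>x::real^'n. x $ j)"
  unfolding Ck_on_def Ck_derivs_def
proof (intro exI[of _ "\<lambda>al x. if al = [] then x $ j else if al = [j] then 1 else 0"] conjI allI impI ballI)
  fix al :: "'n list" and i and x :: "real^'n"
  show "((\<lambda>t. if al = [] then (x + t *\<^sub>R axis i 1) $ j else if al = [j] then 1 else 0)
    has_real_derivative (if i # al = [] then x $ j else if i # al = [j] then 1 else 0)) (at 0)"
    by (cases "al = []"; cases "al = [j]"; cases "i = j")
       (auto simp: axis_def intro!: derivative_eq_intros)
  show "continuous_on U (\<lambda>x. if al = [] then x $ j else if al = [j] then 1 else 0)"
    by (cases "al = []"; cases "al = [j]") (auto intro!: continuous_intros)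
qed auto

text \<open>Since \<open>g\<close> does not see the coordinate \<open>b\<close>, the shear is
  inverted by subtracting the same \<open>g\<close>, and a defining function composed with the
  inverse defines the image.\<close>

lemma Ck_hypersurface_shear:
  fixes g :: "real^'n \<Rightarrow> real"
  assumes k: "k \<ge> 1" and hyp: "Ck_hypersurface k \<Sigma>" and g: "Ck_on k UNIV g"
    and inv: "\<And>x t. g (x + t *\<^sub>R axis b 1) = g x"
  shows "Ck_hypersurface k ((\<lambda>x. x + g x *\<^sub>R axis b 1) ` \<Sigma>)"
proof -
  let ?e = "axis b 1 :: real^'n"
  define \<Phi> where "\<Phi> = (\<lambda>x. x + g x *\<^sub>R ?e)"
  define \<Psi> where "\<Psi> = (\<lambda>x. x + (- g x) *\<^sub>R ?e)"
  have PP: "\<Psi> (\<Phi> x) = x" "\<Phi> (\<Psi> x) = x" for x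
    unfolding \<Phi>_def \<Psi>_def inv by simp_all
  have comp: "Ck_on k UNIV (\<lambda>x. \<Psi> x $ j)" for j
  proof -
    have "Ck_on k UNIV (\<lambda>x. x $ j + (- ?e $ j) * g x)"
      by (intro Ck_on_add Ck_on_component Ck_on_mult Ck_on_const g) auto
    then show ?thesis by (simp add: \<Psi>_def mult.commute)
  qed
  have contP: "continuous_on UNIV \<Psi>"
    unfolding \<Psi>_def by (intro continuous_intros Ck_on_continuous[OF g])
  obtain k' where k': "k = Suc k'" using k by (cases k) auto
  obtain G where G: "\<And>x. (g has_derivative (\<lambda>h. \<Sum>i\<in>UNIV. h$i * G i x)) (at x)"
    by (rule Ck_on_Suc_total[OF open_UNIV g[unfolded k']], rule that) auto
  have Gb: "G b x = 0" for x
  proof -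
    have "((\<lambda>t. g (x + t *\<^sub>R ?e)) has_derivative (\<lambda>t. \<Sum>i\<in>UNIV. (t *\<^sub>R ?e)$i * G i x)) (at 0)"
      by (rule has_derivative_compose[where g = g and s = UNIV])
         (use G[of x] in \<open>auto intro!: derivative_eq_intros\<close>)
    moreover have "(\<Sum>i\<in>UNIV. (t *\<^sub>R ?e)$i * G i x) = t * G b x" for t
      by (simp add: axis_def if_distrib[where f = "\<lambda>y. _ * y"] if_distrib[where f = "\<lambda>y. y * _"] cong: if_cong)
    ultimately have "((\<lambda>t. g x) has_derivative (\<lambda>t. t * G b x)) (at 0)"
      by (simp only: inv)
    then have "(\<lambda>t. t * G b x) = (\<lambda>t. 0)"
      by (rule has_derivative_unique) auto
    then show ?thesis by (metis mult_1)
  qed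
  show ?thesis
    unfolding Ck_hypersurface_def \<Phi>_def[symmetric]
  proof (intro ballI)
    fix y assume "y \<in> \<Phi> ` \<Sigma>"
    then obtain p where p: "p \<in> \<Sigma>" "y = \<Phi> p" by auto
    obtain U F where UF0: "open U \<and> p \<in> U \<and> Ck_on k U F \<and> \<Sigma> \<inter> U = {x\<in>U. F x = 0} \<and>
        (\<forall>x\<in>\<Sigma> \<inter> U. \<exists>F'. (F has_derivative F') (at x) \<and> F' \<noteq> (\<lambda>h. 0))"
      using bspec[OF hyp[unfolded Ck_hypersurface_def] p(1)] by (elim exE) (rule that)
    then have UF: "open U" "p \<in> U" "Ck_on k U F" "\<Sigma> \<inter> U = {x\<in>U. F x = 0}"
        "\<And>x. x\<in>\<Sigma> \<inter> U \<Longrightarrow> \<exists>F'. (F has_derivative F') (at x) \<and> F' \<noteq> (\<lambda>h. 0)"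
      by auto
    define V where "V = \<Psi> -` U"
    have V: "open V" unfolding V_def by (rule open_vimage[OF UF(1) contP])
    show "\<exists>U F. open U \<and> y \<in> U \<and> Ck_on k U F \<and> \<Phi> ` \<Sigma> \<inter> U = {x \<in> U. F x = 0} \<and>
        (\<forall>x\<in>\<Phi> ` \<Sigma> \<inter> U. \<exists>F'. (F has_derivative F') (at x) \<and> F' \<noteq> (\<lambda>h. 0))"
    proof (intro exI[of _ V] exI[of _ "\<lambda>x. F (\<Psi> x)"] conjI V)
      show "y \<in> V" using p UF(2) by (simp add: V_def PP)
      show "Ck_on k V (\<lambda>x. F (\<Psi> x))"
      proof (rule Ck_on_compose[OF UF(1) V _ UF(3)])
        show "Ck_on k V (\<lambda>x. \<Psi> x $ j)" for j
          using comp[of j] by (rule Ck_on_subset) simp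
      qed (simp add: V_def)
      have mem: "x \<in> \<Phi> ` \<Sigma> \<longleftrightarrow> \<Psi> x \<in> \<Sigma>" for x by (metis PP image_iff)
      show "\<Phi> ` \<Sigma> \<inter> V = {x \<in> V. F (\<Psi> x) = 0}"
      proof (rule set_eqI)
        fix x
        have "x \<in> \<Phi> ` \<Sigma> \<inter> V \<longleftrightarrow> \<Psi> x \<in> \<Sigma> \<inter> U" by (simp add: mem V_def)
        also have "\<dots> \<longleftrightarrow> x \<in> {x \<in> V. F (\<Psi> x) = 0}" unfolding UF(4) by (simp add: V_def)
        finally show "x \<in> \<Phi> ` \<Sigma> \<inter> V \<longleftrightarrow> x \<in> {x \<in> V. F (\<Psi> x) = 0}" .
      qed
      show "\<forall>x\<in>\<Phi> ` \<Sigma> \<inter> V. \<exists>F'. ((\<lambda>x. F (\<Psi> x)) has_derivative F') (at x) \<and> F' \<noteq> (\<lambda>h. 0)"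
      proof
      fix x assume "x \<in> \<Phi> ` \<Sigma> \<inter> V"
      then have "\<Psi> x \<in> \<Sigma> \<inter> U" by (simp add: mem V_def)
      then obtain F' where F': "(F has_derivative F') (at (\<Psi> x))" "F' \<noteq> (\<lambda>h. 0)" using UF(5) by blast
      let ?g' = "\<lambda>h. \<Sum>i\<in>UNIV. h$i * G i x"
      have "(\<Psi> has_derivative (\<lambda>h. h + (- ?g' h) *\<^sub>R ?e)) (at x)"
        unfolding \<Psi>_def
        by (rule has_derivative_add[OF has_derivative_ident has_derivative_scaleR_left[OF has_derivative_minus[OF G]]])
      from has_derivative_compose[OF this F'(1)]
      have d: "((\<lambda>x. F (\<Psi> x)) has_derivative (\<lambda>h. F' (h + (- ?g' h) *\<^sub>R ?e))) (at x)" .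
      have lin: "linear F'" using F'(1) by (rule has_derivative_linear)
      \<comment> \<open>The derivative of the inverse shear fixes \<open>?e\<close> because
        \<open>?g' ?e = 0\<close>. A vanishing composite therefore makes \<open>F'\<close> vanish at
        \<open>?e\<close> first, and then at every \<open>h\<close>.\<close>
      have "(\<lambda>h. F' (h + (- ?g' h) *\<^sub>R ?e)) \<noteq> (\<lambda>h. 0)"
      proof
        assume z: "(\<lambda>h. F' (h + (- ?g' h) *\<^sub>R ?e)) = (\<lambda>h. 0)"
        have ge: "?g' ?e = 0"
          using Gb by (simp add: axis_def if_distrib[where f = "\<lambda>y. y * _"] cong: if_cong)
        have Fe: "F' ?e = 0" using fun_cong[OF z, of ?e] unfolding ge by simp
        have "F' h = 0" for h
        proof -
          have "F' h + (- ?g' h) *\<^sub>R F' ?e = 0"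
            using fun_cong[OF z, of h] by (simp only: linear_add[OF lin] linear_cmul[OF lin])
          then show ?thesis using Fe by simp
        qed
        then show False using F'(2) by auto
      qed
      then show "\<exists>F'. ((\<lambda>x. F (\<Psi> x)) has_derivative F') (at x) \<and> F' \<noteq> (\<lambda>h. 0)" using d by blast
      qed
    qed
  qed
qed

section \<open>Superposition of bump functions\<close>

text \<open>One summable majorant \<open>c\<close> serves all derivatives up to order
  \<open>k\<close>, so the Weierstrass test justifies differentiation term by term at each
  order.\<close>

lemma Ck_derivs_suminf:
  fixes g :: "nat \<Rightarrow> real^'n \<Rightarrow> real"
  assumes D: "\<And>m. Ck_derivs k UNIV (g m) (D m)"
    and bd: "\<And>m al x. length al \<le> k \<Longrightarrow> \<bar>D m al x\<bar> \<le> c m" and c: "summable c"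
  shows "Ck_derivs k UNIV (\<lambda>x. \<Sum>m. g m x) (\<lambda>al x. \<Sum>m. D m al x)"
    and "length al \<le> k \<Longrightarrow> \<bar>\<Sum>m. D m al x\<bar> \<le> suminf c"
proof -
  show "length al \<le> k \<Longrightarrow> \<bar>\<Sum>m. D m al x\<bar> \<le> suminf c"
    using norm_suminf_le[of "\<lambda>m. D m al x" c] bd c by auto
  show "Ck_derivs k UNIV (\<lambda>x. \<Sum>m. g m x) (\<lambda>al x. \<Sum>m. D m al x)"
    unfolding Ck_derivs_def
  proof (intro conjI allI ballI impI)
    have "D m [] x = g m x" for m x using D[of m] by (auto simp: Ck_derivs_def)
    then show "(\<Sum>m. D m [] x) = (\<Sum>m. g m x)" for x by simp
  next
    fix al :: "'n list" assume al: "length al \<le> k"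
    have "uniform_limit UNIV (\<lambda>N x. \<Sum>m<N. D m al x) (\<lambda>x. \<Sum>m. D m al x) sequentially"
      by (rule Weierstrass_m_test[OF _ c]) (use bd al in auto)
    then show "continuous_on UNIV (\<lambda>x. \<Sum>m. D m al x)"
    proof (rule uniform_limit_theorem[rotated])
      have "continuous_on UNIV (D m al)" for m using D[of m] al by (auto simp: Ck_derivs_def)
      then show "\<forall>\<^sub>F N in sequentially. continuous_on UNIV (\<lambda>x. \<Sum>m<N. D m al x)"
        by (auto intro!: always_eventually continuous_intros)
    qed simp
  next
    fix al :: "'n list" and i x assume "length al < k \<and> x \<in> (UNIV :: (real^'n) set)"
    then have al: "length al < k" by simp
    show "((\<lambda>t. \<Sum>m. D m al (x + t *\<^sub>R axis i 1)) has_real_derivative (\<Sum>m. D m (i # al) x)) (at 0)"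
    proof -
      have "((\<lambda>t. \<Sum>m. D m al (x + t *\<^sub>R axis i 1)) has_real_derivative
          (\<Sum>m. D m (i # al) (x + 0 *\<^sub>R axis i 1))) (at 0)"
      proof (rule has_field_derivative_series'(2)[where S = UNIV and x0 = 0])
        fix m and t :: real
        have "((\<lambda>s. D m al ((x + t *\<^sub>R axis i 1) + s *\<^sub>R axis i 1)) has_real_derivative D m (i # al) (x + t *\<^sub>R axis i 1)) (at 0)"
          using D[of m] al unfolding Ck_derivs_def by blast
        then have "((\<lambda>s. D m al (x + (s + t) *\<^sub>R axis i 1)) has_real_derivative D m (i # al) (x + t *\<^sub>R axis i 1)) (at 0)"
          by (simp add: scaleR_add_left add_ac)
        then have "((\<lambda>s. D m al (x + s *\<^sub>R axis i 1)) has_real_derivative D m (i # al) (x + t *\<^sub>R axis i 1)) (at (0 + t))"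
          by (subst DERIV_shift)
        then show "((\<lambda>t. D m al (x + t *\<^sub>R axis i 1)) has_real_derivative D m (i # al) (x + t *\<^sub>R axis i 1)) (at t within UNIV)"
          by simp
      next
        show "uniformly_convergent_on UNIV (\<lambda>N t. \<Sum>m<N. D m (i # al) (x + t *\<^sub>R axis i 1))"
          by (rule Weierstrass_m_test'[OF _ c]) (use bd al in auto)
        show "summable (\<lambda>m. D m al (x + 0 *\<^sub>R axis i 1))"
          by (rule summable_comparison_test'[OF c]) (use bd al in auto)
      qed auto
      then show ?thesis by simp
    qed
  qed
qed

lemma DERIV_pos_part_power:
  fixes u :: real
  assumes e: "2 \<le> e"
  shows "((\<lambda>u. (max 0 u) ^ e) has_real_derivative real e * (max 0 u) ^ (e - 1)) (at u)"
proof -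
  consider "u > 0" | "u < 0" | "u = 0" by linarith
  then show ?thesis
  proof cases
    case 1
    have "((\<lambda>u. u ^ e) has_real_derivative real e * u ^ (e - 1)) (at u)"
      by (auto intro!: derivative_eq_intros)
    then have "((\<lambda>u. (max 0 u) ^ e) has_real_derivative real e * u ^ (e - 1)) (at u)"
      by (rule has_field_derivative_transform_within_open[of _ _ _ "{0<..}"]) (use 1 in auto)
    then show ?thesis using 1 by simp
  next
    case 2
    have "((\<lambda>u. 0) has_real_derivative 0) (at u)" by simp
    then have "((\<lambda>u. (max 0 u) ^ e) has_real_derivative 0) (at u)"
      by (rule has_field_derivative_transform_within_open[of _ _ _ "{..<0}"]) (use 2 e in auto)
    moreover have "real e * max 0 u ^ (e - 1) = 0" using 2 e by simp
    ultimately show ?thesis by (simp only:)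
  next
    case 3
    have "((\<lambda>u. (max 0 u) ^ e) has_real_derivative 0) (at (0::real))"
      unfolding CARAT_DERIV
    proof (intro exI[of _ "\<lambda>z. (max 0 z) ^ (e - 1)"] conjI allI)
      fix z :: real
      obtain e' where e': "e = Suc e'" "e' \<ge> 1" using e by (cases e) auto
      show "max 0 z ^ e - max 0 0 ^ e = max 0 z ^ (e - 1) * (z - 0)"
        using e' by (cases "z \<ge> 0") auto
      show "isCont (\<lambda>z::real. max 0 z ^ (e - 1)) 0" by (intro continuous_intros)
      show "max 0 (0::real) ^ (e - 1) = 0" using e' by simp
    qed
    moreover have "real e * max 0 u ^ (e - 1) = 0" using 3 e by simp
    ultimately show ?thesis using 3 by (simp only:)
  qed
qed

text \<open>The profile is the positive part of 1 - t^2 to the power k + 1. Each derivative lowers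
  the power by one and changes the polynomial factor; after \<open>r \<le> k\<close> derivatives at
  least one power is left, which vanishes continuously at the ends.\<close>

lemma exists_bump_function:
  fixes k :: nat
  obtains \<beta> :: "nat \<Rightarrow> real \<Rightarrow> real" and B :: real where
    "\<And>r. r \<le> k \<Longrightarrow> continuous_on UNIV (\<beta> r)"
    "\<And>r t. r < k \<Longrightarrow> (\<beta> r has_real_derivative \<beta> (Suc r) t) (at t)"
    "\<And>r t. r \<le> k \<Longrightarrow> \<bar>\<beta> r t\<bar> \<le> B"
    "\<And>r t. r \<le> k \<Longrightarrow> 1 \<le> \<bar>t\<bar> \<Longrightarrow> \<beta> r t = 0"
    "\<beta> 0 0 = 1" "1 \<le> B"
proof -
  \<comment> \<open>The polynomial factor of the derivative of order \<open>r\<close>; the recursion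
    is the product rule with one power of 1 - t^2 split off.\<close>
  define P :: "nat \<Rightarrow> real poly" where
    "P = rec_nat 1 (\<lambda>r p. pderiv p * [:1, 0, -1:] + smult (-2 * real (k + 1 - r)) ([:0, 1:] * p))"
  define m :: "real \<Rightarrow> real" where "m = (\<lambda>t. max 0 (1 - t\<^sup>2))"
  define \<beta> where "\<beta> = (\<lambda>r t. poly (P r) t * m t ^ (k + 1 - r))"
  have P0: "P 0 = 1" by (simp add: P_def)
  have PS: "poly (P (Suc r)) t = poly (pderiv (P r)) t * (1 - t\<^sup>2) - 2 * real (k + 1 - r) * t * poly (P r) t" for r t
    by (simp add: P_def power2_eq_square algebra_simps)
  have cont: "continuous_on S (\<beta> r)" for r S
    unfolding \<beta>_def m_def by (intro continuous_intros)
  have zero: "\<beta> r t = 0" if "r \<le> k" "1 \<le> \<bar>t\<bar>" for r t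
  proof -
    have "1 \<le> t\<^sup>2" using that(2) abs_le_square_iff[of 1 t] by simp
    then show ?thesis using that(1) by (simp add: \<beta>_def m_def)
  qed
  have deriv: "(\<beta> r has_real_derivative \<beta> (Suc r) t) (at t)" if "r < k" for r t
  proof -
    define e where "e = k + 1 - r"
    have e: "2 \<le> e" using that by (simp add: e_def)
    have 1: "((\<lambda>t::real. 1 - t\<^sup>2) has_real_derivative (- 2 * t)) (at t)"
      by (auto intro!: derivative_eq_intros)
    have 2: "((\<lambda>t. m t ^ e) has_real_derivative (real e * m t ^ (e - 1)) * (- 2 * t)) (at t)"
      unfolding m_def by (rule DERIV_chain2[OF DERIV_pos_part_power[OF e] 1])
    have "((\<lambda>t. poly (P r) t * m t ^ e) has_real_derivative
       poly (pderiv (P r)) t * m t ^ e + (real e * m t ^ (e - 1)) * (- 2 * t) * poly (P r) t) (at t)"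
      by (rule DERIV_mult[OF poly_DERIV 2])
    moreover have "poly (pderiv (P r)) t * m t ^ e + (real e * m t ^ (e - 1)) * (- 2 * t) * poly (P r) t
       = poly (P (Suc r)) t * m t ^ (e - 1)"
    proof (cases "1 - t\<^sup>2 \<ge> 0")
      case True
      then have mt: "m t = 1 - t\<^sup>2" by (simp add: m_def)
      obtain e' where e': "e = Suc e'" using e by (cases e) auto
      show ?thesis unfolding PS e_def[symmetric] mt e' by (simp add: algebra_simps)
    next
      case False
      then have "m t = 0" by (simp add: m_def)
      moreover have "e \<noteq> 0" "e - 1 \<noteq> 0" using e by auto
      ultimately show ?thesis by (simp only: power_0_left if_False mult_zero_right mult_zero_left add_0)
    qed
    ultimately show ?thesis unfolding \<beta>_def e_def by simp
  qed
  have "\<exists>B. \<forall>t. \<bar>\<beta> r t\<bar> \<le> B" if "r \<le> k" for r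
  proof -
    have "bounded (\<beta> r ` {-1..1})"
      by (intro compact_imp_bounded compact_continuous_image cont) auto
    then obtain B where B: "\<And>t. t \<in> {-1..1} \<Longrightarrow> \<bar>\<beta> r t\<bar> \<le> B" unfolding bounded_iff by (metis imageI real_norm_def)
    then have "0 \<le> B" by (metis abs_ge_zero atLeastAtMost_iff order_trans zero_le_one neg_le_0_iff_le)
    have "\<bar>\<beta> r t\<bar> \<le> B" for t
    proof (cases "t \<in> {-1..1}")
      case False
      then have "1 \<le> \<bar>t\<bar>" by (auto simp: not_le abs_if)
      then show ?thesis using zero[OF that, of t] \<open>0 \<le> B\<close> by simp
    qed (rule B)
    then show ?thesis by blast
  qed
  then obtain Bf where Bf: "\<And>r t. r \<le> k \<Longrightarrow> \<bar>\<beta> r t\<bar> \<le> Bf r" by metis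
  define B where "B = 1 + (\<Sum>r\<le>k. \<bar>Bf r\<bar>)"
  have "\<bar>\<beta> r t\<bar> \<le> B" if "r \<le> k" for r t
  proof -
    have "\<bar>\<beta> r t\<bar> \<le> \<bar>Bf r\<bar>" using Bf[OF that, of t] by linarith
    also have "\<dots> \<le> (\<Sum>r\<le>k. \<bar>Bf r\<bar>)" by (rule member_le_sum) (use that in auto)
    finally show ?thesis by (simp add: B_def)
  qed
  moreover have "1 \<le> B" by (simp add: B_def sum_nonneg)
  moreover have "\<beta> 0 0 = 1" by (simp add: \<beta>_def P0 m_def)
  ultimately show thesis using that[of \<beta> B] cont deriv zero by blast
qed

text \<open>Sums of products of one-dimensional bumps of radius \<open>1 / \<mu>\<close> in the
  coordinates other than \<open>b\<close>. By the separation at most one term is nonzero at any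
  point, so the bound does not grow with the number of nodes; each derivative costs one factor
  \<mu>.\<close>

lemma exists_bump_sum:
  fixes k :: nat and b :: "'n::finite"
  obtains B :: real where "1 \<le> B"
    "\<And>(H :: 'h set) (y :: 'h \<Rightarrow> real^'n) a \<mu> A. finite H \<Longrightarrow> 1 \<le> \<mu> \<Longrightarrow> 0 \<le> A \<Longrightarrow>
      (\<And>h. h \<in> H \<Longrightarrow> \<bar>a h\<bar> \<le> A) \<Longrightarrow>
      (\<And>h h'. h \<in> H \<Longrightarrow> h' \<in> H \<Longrightarrow> h \<noteq> h' \<Longrightarrow> \<exists>j. j \<noteq> b \<and> 2 / \<mu> \<le> \<bar>y h $ j - y h' $ j\<bar>) \<Longrightarrow>
      \<exists>g D. Ck_derivs k UNIV g D \<and> (\<forall>al x. length al \<le> k \<longrightarrow> \<bar>D al x\<bar> \<le> B * A * \<mu> ^ k) \<and>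
        (\<forall>h\<in>H. \<forall>x. (\<forall>j. j \<noteq> b \<longrightarrow> x $ j = y h $ j) \<longrightarrow> g x = a h) \<and>
        (\<forall>x. (\<forall>h\<in>H. \<exists>j. j \<noteq> b \<and> 1 / \<mu> \<le> \<bar>x $ j - y h $ j\<bar>) \<longrightarrow> g x = 0) \<and>
        (\<forall>x x'. (\<forall>j. j \<noteq> b \<longrightarrow> x $ j = x' $ j) \<longrightarrow> g x = g x')"
proof -
  obtain \<beta> B where \<beta>: "\<And>r. r \<le> k \<Longrightarrow> continuous_on UNIV (\<beta> r)"
    "\<And>r t. r < k \<Longrightarrow> (\<beta> r has_real_derivative \<beta> (Suc r) t) (at t)"
    "\<And>r t. r \<le> k \<Longrightarrow> \<bar>\<beta> r t\<bar> \<le> B"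
    "\<And>r t. r \<le> k \<Longrightarrow> 1 \<le> \<bar>t\<bar> \<Longrightarrow> \<beta> r t = 0"
    "\<beta> 0 0 = 1" "1 \<le> B"
    using exists_bump_function[of k] by blast
  let ?J = "UNIV - {b}"
  show thesis
  proof (rule that[of "B ^ CARD('n)"])
    show "1 \<le> B ^ CARD('n)" using \<beta>(6) by simp
    fix H :: "'h set" and y :: "'h \<Rightarrow> real^'n" and a :: "'h \<Rightarrow> real" and \<mu> A :: real
    assume H: "finite H" and lam: "1 \<le> \<mu>" and A: "0 \<le> A" and a: "\<And>h. h \<in> H \<Longrightarrow> \<bar>a h\<bar> \<le> A"
      and sep: "\<And>h h'. h \<in> H \<Longrightarrow> h' \<in> H \<Longrightarrow> h \<noteq> h' \<Longrightarrow> \<exists>j. j \<noteq> b \<and> 2 / \<mu> \<le> \<bar>y h $ j - y h' $ j\<bar>"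
    \<comment> \<open>\<open>count_list al j\<close> is the number of derivatives in direction
      \<open>j\<close>. A list containing \<open>b\<close> gives 0 in \<open>D\<close>, since no
      bump depends on that coordinate.\<close>
    define T where "T = (\<lambda>al h (x::real^'n). \<Prod>j\<in>?J. \<beta> (count_list al j) (\<mu> * (x $ j - y h $ j)))"
    define D where "D = (\<lambda>al x. if b \<in> set al then 0 else \<Sum>h\<in>H. a h * \<mu> ^ length al * T al h x)"
    define g where "g = D []"
    have cl: "count_list al j \<le> length al" for al :: "'n list" and j by (rule count_le_length)
    have T0: "T al h x = 0" if "length al \<le> k" "j \<noteq> b" "1 / \<mu> \<le> \<bar>x $ j - y h $ j\<bar>" for al h x j
    proof -
      have "1 \<le> \<bar>\<mu> * (x $ j - y h $ j)\<bar>"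
        unfolding abs_mult using that(3) lam by (simp add: field_simps)
      then have "\<beta> (count_list al j) (\<mu> * (x $ j - y h $ j)) = 0"
        using \<beta>(4) cl[of al j] that(1) by simp
      then show ?thesis unfolding T_def using that(2) by (intro prod_zero) auto
    qed
    have Tb: "\<bar>T al h x\<bar> \<le> B ^ CARD('n)" if "length al \<le> k" for al h x
    proof -
      have "\<bar>T al h x\<bar> \<le> (\<Prod>j\<in>?J. B)"
        unfolding T_def abs_prod
        by (intro prod_mono conjI \<beta>(3) order_trans[OF cl that]) auto
      also have "\<dots> \<le> B ^ CARD('n)"
        using \<beta>(6) by (auto simp: card_Diff_singleton intro!: power_increasing)
      finally show ?thesis .
    qed
    have one: "\<exists>h0\<in>H. \<forall>h\<in>H. h \<noteq> h0 \<longrightarrow> T al h x = 0" if "length al \<le> k" "H \<noteq> {}" for al x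
    proof (cases "\<exists>h0\<in>H. \<forall>j. j \<noteq> b \<longrightarrow> \<bar>x $ j - y h0 $ j\<bar> < 1 / \<mu>")
      case True
      then obtain h0 where h0: "h0 \<in> H" "\<And>j. j \<noteq> b \<Longrightarrow> \<bar>x $ j - y h0 $ j\<bar> < 1 / \<mu>" by blast
      have "T al h x = 0" if hh: "h \<in> H" "h \<noteq> h0" for h
      proof -
        obtain j where j: "j \<noteq> b" "2 / \<mu> \<le> \<bar>y h $ j - y h0 $ j\<bar>" using sep[OF hh(1) h0(1) hh(2)] by blast
        have "2 / \<mu> = 1 / \<mu> + 1 / \<mu>" by simp
        then have "1 / \<mu> \<le> \<bar>x $ j - y h $ j\<bar>" using j(2) h0(2)[OF j(1)] by linarith
        then show ?thesis using T0 \<open>length al \<le> k\<close> j(1) by blast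
      qed
      then show ?thesis using h0(1) by blast
    next
      case False
      then have "T al h x = 0" if "h \<in> H" for h
        using that T0[OF \<open>length al \<le> k\<close>] by (meson not_less)
      then show ?thesis using that(2) by blast
    qed
    have bound: "\<bar>D al x\<bar> \<le> B ^ CARD('n) * A * \<mu> ^ k" if al: "length al \<le> k" for al x
    proof (cases "b \<in> set al \<or> H = {}")
      case True
      then show ?thesis using A \<beta>(6) lam by (auto simp: D_def)
    next
      case False
      then obtain h0 where h0: "h0 \<in> H" "\<And>h. h \<in> H \<Longrightarrow> h \<noteq> h0 \<Longrightarrow> T al h x = 0"
        using one[OF al] by blast
      have "D al x = (\<Sum>h\<in>H. a h * \<mu> ^ length al * T al h x)" using False by (simp add: D_def)
      also have "\<dots> = (\<Sum>h\<in>{h0}. a h * \<mu> ^ length al * T al h x)"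
        using h0 by (intro sum.mono_neutral_right H) auto
      finally have "\<bar>D al x\<bar> = \<bar>a h0\<bar> * \<mu> ^ length al * \<bar>T al h0 x\<bar>"
        using lam by (simp add: abs_mult)
      also have "\<dots> \<le> A * \<mu> ^ k * B ^ CARD('n)"
        by (intro mult_mono a h0 Tb[OF al] power_increasing[OF al lam]) (use lam A in auto)
      finally show ?thesis by (simp add: mult_ac)
    qed
    have Ck: "Ck_derivs k UNIV g D"
      unfolding Ck_derivs_def
    proof (intro conjI ballI allI impI)
      fix al :: "'n list" assume al: "length al \<le> k"
      have "continuous_on UNIV (T al h)" for h
        unfolding T_def
      proof (intro continuous_on_prod)
        fix j
        have "continuous_on UNIV (\<beta> (count_list al j))" by (rule \<beta>(1)[OF order_trans[OF cl al]])
        then show "continuous_on UNIV (\<lambda>x::real^'n. \<beta> (count_list al j) (\<mu> * (x $ j - y h $ j)))"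
          by (rule continuous_on_compose2) (auto intro!: continuous_intros)
      qed
      then show "continuous_on UNIV (D al)"
        by (cases "b \<in> set al") (auto simp: D_def intro!: continuous_intros)
    next
      fix al :: "'n list" and i and x :: "real^'n" assume "length al < k \<and> x \<in> UNIV"
      then have al: "length al < k" by simp
      show "((\<lambda>t. D al (x + t *\<^sub>R axis i 1)) has_real_derivative D (i # al) x) (at 0)"
      proof (cases "b \<in> set al")
        case True then show ?thesis by (simp add: D_def)
      next
        case bal: False
        show ?thesis
        proof (cases "i = b")
          case True
          have "T al h (x + t *\<^sub>R axis i 1) = T al h x" for h t
            unfolding T_def by (rule prod.cong) (auto simp: True axis_def)
          then show ?thesis using bal True by (simp add: D_def)
        next
          case ib: False
          have dT: "((\<lambda>t. T al h (x + t *\<^sub>R axis i 1)) has_real_derivative \<mu> * T (i # al) h x) (at 0)" for h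
          proof -
            define R where "R = (\<Prod>j\<in>?J - {i}. \<beta> (count_list al j) (\<mu> * (x $ j - y h $ j)))"
            have 1: "T al h (x + t *\<^sub>R axis i 1) = \<beta> (count_list al i) (\<mu> * (x $ i + t - y h $ i)) * R" for t
            proof -
              have "T al h (x + t *\<^sub>R axis i 1) = \<beta> (count_list al i) (\<mu> * ((x + t *\<^sub>R axis i 1) $ i - y h $ i)) *
                (\<Prod>j\<in>?J - {i}. \<beta> (count_list al j) (\<mu> * ((x + t *\<^sub>R axis i 1) $ j - y h $ j)))"
                unfolding T_def by (rule prod.remove) (use ib in auto)
              also have "(\<Prod>j\<in>?J - {i}. \<beta> (count_list al j) (\<mu> * ((x + t *\<^sub>R axis i 1) $ j - y h $ j))) = R"
                unfolding R_def by (rule prod.cong) (auto simp: axis_def)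
              finally show ?thesis by (simp add: axis_def)
            qed
            have 2: "T (i # al) h x = \<beta> (Suc (count_list al i)) (\<mu> * (x $ i - y h $ i)) * R"
            proof -
              have "T (i # al) h x = \<beta> (count_list (i # al) i) (\<mu> * (x $ i - y h $ i)) *
                (\<Prod>j\<in>?J - {i}. \<beta> (count_list (i # al) j) (\<mu> * (x $ j - y h $ j)))"
                unfolding T_def by (rule prod.remove) (use ib in auto)
              also have "(\<Prod>j\<in>?J - {i}. \<beta> (count_list (i # al) j) (\<mu> * (x $ j - y h $ j))) = R"
                unfolding R_def by (rule prod.cong) auto
              finally show ?thesis by simp
            qed
            have c: "count_list al i < k" using cl[of al i] al by linarith
            have "((\<lambda>t. \<beta> (count_list al i) (\<mu> * (x $ i + t - y h $ i))) has_real_derivative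
               \<beta> (Suc (count_list al i)) (\<mu> * (x $ i + 0 - y h $ i)) * \<mu>) (at 0)"
            proof (rule DERIV_chain2[OF \<beta>(2)[OF c]])
              show "((\<lambda>t. \<mu> * (x $ i + t - y h $ i)) has_real_derivative \<mu>) (at 0)"
                by (auto intro!: derivative_eq_intros)
            qed
            then have "((\<lambda>t. \<beta> (count_list al i) (\<mu> * (x $ i + t - y h $ i)) * R) has_real_derivative
               \<beta> (Suc (count_list al i)) (\<mu> * (x $ i + 0 - y h $ i)) * \<mu> * R) (at 0)"
              by (rule DERIV_cmult_right)
            then show ?thesis unfolding 1 2 by (simp add: mult_ac)
          qed
          have "((\<lambda>t. \<Sum>h\<in>H. a h * \<mu> ^ length al * T al h (x + t *\<^sub>R axis i 1)) has_real_derivative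
              (\<Sum>h\<in>H. a h * \<mu> ^ length al * (\<mu> * T (i # al) h x))) (at 0)"
            by (intro DERIV_sum DERIV_cmult dT)
          then show ?thesis using bal ib by (simp add: D_def mult_ac)
        qed
      qed
    qed (simp add: g_def)
    have gv: "g x = a h" if "h \<in> H" "\<And>j. j \<noteq> b \<Longrightarrow> x $ j = y h $ j" for h x
    proof -
      have z: "T [] h' x = 0" if hh: "h' \<in> H" "h' \<noteq> h" for h'
      proof -
        obtain j where j: "j \<noteq> b" "2 / \<mu> \<le> \<bar>y h $ j - y h' $ j\<bar>"
          using sep[OF \<open>h \<in> H\<close> hh(1)] hh(2) by blast
        have "0 \<le> 1 / \<mu>" using lam by simp
        then have "1 / \<mu> \<le> \<bar>x $ j - y h' $ j\<bar>" using j \<open>\<And>j. j \<noteq> b \<Longrightarrow> x $ j = y h $ j\<close>[OF j(1)] by simp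
        then show ?thesis using T0[of "[]"] j(1) by simp
      qed
      have "g x = (\<Sum>h'\<in>H. a h' * T [] h' x)" by (simp add: g_def D_def)
      also have "\<dots> = (\<Sum>h'\<in>{h}. a h' * T [] h' x)"
        using that(1) z by (intro sum.mono_neutral_right H) auto
      also have "\<dots> = a h" unfolding T_def using that(2) \<beta>(5) by simp
      finally show ?thesis .
    qed
    have g0: "g x = 0" if "\<forall>h\<in>H. \<exists>j. j \<noteq> b \<and> 1 / \<mu> \<le> \<bar>x $ j - y h $ j\<bar>" for x
    proof -
      have "T [] h x = 0" if "h \<in> H" for h
        using \<open>\<forall>h\<in>H. \<exists>j. j \<noteq> b \<and> 1 / \<mu> \<le> \<bar>x $ j - y h $ j\<bar>\<close> that T0[of "[]"] by auto
      then show ?thesis by (simp add: g_def D_def)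
    qed
    have gi: "g x = g x'" if "\<forall>j. j \<noteq> b \<longrightarrow> x $ j = x' $ j" for x x'
    proof -
      have "T [] h x = T [] h x'" for h
        unfolding T_def by (rule prod.cong) (use that in auto)
      then show ?thesis by (simp add: g_def D_def)
    qed
    show "\<exists>g D. Ck_derivs k UNIV g D \<and> (\<forall>al x. length al \<le> k \<longrightarrow> \<bar>D al x\<bar> \<le> B ^ CARD('n) * A * \<mu> ^ k) \<and>
        (\<forall>h\<in>H. \<forall>x. (\<forall>j. j \<noteq> b \<longrightarrow> x $ j = y h $ j) \<longrightarrow> g x = a h) \<and>
        (\<forall>x. (\<forall>h\<in>H. \<exists>j. j \<noteq> b \<and> 1 / \<mu> \<le> \<bar>x $ j - y h $ j\<bar>) \<longrightarrow> g x = 0) \<and>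
        (\<forall>x x'. (\<forall>j. j \<noteq> b \<longrightarrow> x $ j = x' $ j) \<longrightarrow> g x = g x')"
      by (rule exI[of _ g], rule exI[of _ D]) (use Ck bound gv g0 gi in auto)
  qed
qed

text \<open>Scale \<open>m\<close> receives the share \<open>\<rho> / (m + 1)^2\<close> of the
  derivative budget. The separation between scales makes every other summand vanish at the nodes of
  scale \<open>m\<close>, so the infinite sum still interpolates.\<close>

lemma exists_interpolating_perturbation:
  fixes k :: nat and b :: "'n::finite"
  obtains B :: real where "1 \<le> B"
    "\<And>(H :: nat \<Rightarrow> 'h set) (y :: nat \<Rightarrow> 'h \<Rightarrow> real^'n) a \<mu> A \<rho>.
      0 < \<rho> \<Longrightarrow> (\<And>m. finite (H m)) \<Longrightarrow> (\<And>m. 1 \<le> \<mu> m) \<Longrightarrow> (\<And>m. 0 \<le> A m) \<Longrightarrow>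
      (\<And>m. B * A m * \<mu> m ^ k \<le> \<rho> / (real m + 1)\<^sup>2) \<Longrightarrow>
      (\<And>m h. h \<in> H m \<Longrightarrow> \<bar>a m h\<bar> \<le> A m) \<Longrightarrow>
      (\<And>m h h'. h \<in> H m \<Longrightarrow> h' \<in> H m \<Longrightarrow> h \<noteq> h' \<Longrightarrow> \<exists>j. j \<noteq> b \<and> 2 / \<mu> m \<le> \<bar>y m h $ j - y m h' $ j\<bar>) \<Longrightarrow>
      (\<And>m m' h h'. m \<noteq> m' \<Longrightarrow> h \<in> H m \<Longrightarrow> h' \<in> H m' \<Longrightarrow> \<exists>j. j \<noteq> b \<and> 1 / \<mu> m' \<le> \<bar>y m h $ j - y m' h' $ j\<bar>) \<Longrightarrow>
      \<exists>g D. Ck_derivs k UNIV g D \<and> (\<forall>al x. length al \<le> k \<longrightarrow> \<bar>D al x\<bar> \<le> \<rho>) \<and>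
        (\<forall>m. \<forall>h\<in>H m. \<forall>x. (\<forall>j. j \<noteq> b \<longrightarrow> x $ j = y m h $ j) \<longrightarrow> g x = a m h) \<and>
        (\<forall>x x'. (\<forall>j. j \<noteq> b \<longrightarrow> x $ j = x' $ j) \<longrightarrow> g x = g x')"
proof -
  obtain B where B: "1 \<le> B" "\<And>(H :: 'h set) (y :: 'h \<Rightarrow> real^'n) a \<mu> A. finite H \<Longrightarrow> 1 \<le> \<mu> \<Longrightarrow> 0 \<le> A \<Longrightarrow>
      (\<And>h. h \<in> H \<Longrightarrow> \<bar>a h\<bar> \<le> A) \<Longrightarrow>
      (\<And>h h'. h \<in> H \<Longrightarrow> h' \<in> H \<Longrightarrow> h \<noteq> h' \<Longrightarrow> \<exists>j. j \<noteq> b \<and> 2 / \<mu> \<le> \<bar>y h $ j - y h' $ j\<bar>) \<Longrightarrow>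
      \<exists>g D. Ck_derivs k UNIV g D \<and> (\<forall>al x. length al \<le> k \<longrightarrow> \<bar>D al x\<bar> \<le> B * A * \<mu> ^ k) \<and>
        (\<forall>h\<in>H. \<forall>x. (\<forall>j. j \<noteq> b \<longrightarrow> x $ j = y h $ j) \<longrightarrow> g x = a h) \<and>
        (\<forall>x. (\<forall>h\<in>H. \<exists>j. j \<noteq> b \<and> 1 / \<mu> \<le> \<bar>x $ j - y h $ j\<bar>) \<longrightarrow> g x = 0) \<and>
        (\<forall>x x'. (\<forall>j. j \<noteq> b \<longrightarrow> x $ j = x' $ j) \<longrightarrow> g x = g x')"
    by (rule exists_bump_sum[where k = k and b = b and 'h = 'h]) blast
  show thesis
  \<comment> \<open>The factor 3 pays for the sum pi^2/6 of the shares, which is estimated by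
    16/6.\<close>
  proof (rule that[of "3 * B"])
    show "1 \<le> 3 * B" using B(1) by simp
    fix H :: "nat \<Rightarrow> 'h set" and y :: "nat \<Rightarrow> 'h \<Rightarrow> real^'n" and a \<mu> A and \<rho> :: real
    assume rho: "0 < \<rho>" and H: "\<And>m. finite (H m)" and lam: "\<And>m. 1 \<le> \<mu> m" and A: "\<And>m. 0 \<le> A m"
      and BA: "\<And>m. 3 * B * A m * \<mu> m ^ k \<le> \<rho> / (real m + 1)\<^sup>2"
      and a: "\<And>m h. h \<in> H m \<Longrightarrow> \<bar>a m h\<bar> \<le> A m"
      and sep: "\<And>m h h'. h \<in> H m \<Longrightarrow> h' \<in> H m \<Longrightarrow> h \<noteq> h' \<Longrightarrow> \<exists>j. j \<noteq> b \<and> 2 / \<mu> m \<le> \<bar>y m h $ j - y m h' $ j\<bar>"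
      and sep': "\<And>m m' h h'. m \<noteq> m' \<Longrightarrow> h \<in> H m \<Longrightarrow> h' \<in> H m' \<Longrightarrow> \<exists>j. j \<noteq> b \<and> 1 / \<mu> m' \<le> \<bar>y m h $ j - y m' h' $ j\<bar>"
    define Q where "Q = (\<lambda>m g D. Ck_derivs k UNIV g D \<and> (\<forall>al x. length al \<le> k \<longrightarrow> \<bar>D al x\<bar> \<le> B * A m * \<mu> m ^ k) \<and>
        (\<forall>h\<in>H m. \<forall>x. (\<forall>j. j \<noteq> b \<longrightarrow> x $ j = y m h $ j) \<longrightarrow> g x = a m h) \<and>
        (\<forall>x. (\<forall>h\<in>H m. \<exists>j. j \<noteq> b \<and> 1 / \<mu> m \<le> \<bar>x $ j - y m h $ j\<bar>) \<longrightarrow> g x = 0) \<and>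
        (\<forall>x x'. (\<forall>j. j \<noteq> b \<longrightarrow> x $ j = x' $ j) \<longrightarrow> g x = g x'))"
    have "\<exists>g D. Q m g D" for m
      unfolding Q_def by (rule B(2)[OF H lam A a sep])
    then obtain g D where Q: "\<And>m. Q m (g m) (D m)" by metis
    have gD: "\<And>m. Ck_derivs k UNIV (g m) (D m)"
        "\<And>m al x. length al \<le> k \<Longrightarrow> \<bar>D m al x\<bar> \<le> B * A m * \<mu> m ^ k"
        "\<And>m h x. h \<in> H m \<Longrightarrow> (\<And>j. j \<noteq> b \<Longrightarrow> x $ j = y m h $ j) \<Longrightarrow> g m x = a m h"
        "\<And>m x. (\<And>h. h\<in>H m \<Longrightarrow> \<exists>j. j \<noteq> b \<and> 1 / \<mu> m \<le> \<bar>x $ j - y m h $ j\<bar>) \<Longrightarrow> g m x = 0"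
        "\<And>m x x'. (\<And>j. j \<noteq> b \<Longrightarrow> x $ j = x' $ j) \<Longrightarrow> g m x = g m x'"
      using Q unfolding Q_def by blast+
    define c where "c = (\<lambda>m::nat. \<rho> / 3 * (1 / (real m + 1)\<^sup>2))"
    have cs: "c sums (\<rho> / 3 * (pi\<^sup>2 / 6))"
      unfolding c_def using sums_mult[OF inverse_squares_sums, of "\<rho> / 3"] by (simp add: add.commute)
    have pi2: "pi\<^sup>2 \<le> 4\<^sup>2" using pi_less_4 by (intro power_mono) auto
    have "suminf c = \<rho> / 3 * (pi\<^sup>2 / 6)" using cs by (simp add: sums_iff)
    also have "\<dots> \<le> \<rho>" using rho pi2 mult_left_mono[of "pi\<^sup>2" 16 \<rho>] by (simp add: field_simps)
    finally have cle: "suminf c \<le> \<rho>" .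
    have bd: "\<bar>D m al x\<bar> \<le> c m" if "length al \<le> k" for m al x
    proof -
      have "c m = (\<rho> / (real m + 1)\<^sup>2) / 3" by (simp add: c_def)
      then show ?thesis using gD(2)[OF that, of m x] BA[of m] by simp
    qed
    have S1: "Ck_derivs k UNIV (\<lambda>x. \<Sum>m. g m x) (\<lambda>al x. \<Sum>m. D m al x)"
      by (rule Ck_derivs_suminf(1)[OF gD(1) _ sums_summable[OF cs]]) (rule bd)
    have S2: "\<bar>\<Sum>m. D m al x\<bar> \<le> suminf c" if "length al \<le> k" for al x
      by (rule Ck_derivs_suminf(2)[OF gD(1) _ sums_summable[OF cs] that]) (rule bd)
    have val: "(\<Sum>m. g m x) = a m h" if "h \<in> H m" "\<And>j. j \<noteq> b \<Longrightarrow> x $ j = y m h $ j" for m h x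
    proof -
      have "g m' x = 0" if mm: "m' \<noteq> m" for m'
      proof (rule gD(4))
        fix h' assume "h' \<in> H m'"
        then obtain j where "j \<noteq> b" "1 / \<mu> m' \<le> \<bar>y m h $ j - y m' h' $ j\<bar>"
          using sep'[of m m' h h'] mm \<open>h \<in> H m\<close> by blast
        then show "\<exists>j. j \<noteq> b \<and> 1 / \<mu> m' \<le> \<bar>x $ j - y m' h' $ j\<bar>"
          using \<open>\<And>j. j \<noteq> b \<Longrightarrow> x $ j = y m h $ j\<close> by metis
      qed
      then have "(\<Sum>m'. g m' x) = (\<Sum>m'\<in>{m}. g m' x)" by (intro suminf_finite) auto
      then show ?thesis using gD(3)[OF that] by simp
    qed
    show "\<exists>g D. Ck_derivs k UNIV g D \<and> (\<forall>al x. length al \<le> k \<longrightarrow> \<bar>D al x\<bar> \<le> \<rho>) \<and>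
        (\<forall>m. \<forall>h\<in>H m. \<forall>x. (\<forall>j. j \<noteq> b \<longrightarrow> x $ j = y m h $ j) \<longrightarrow> g x = a m h) \<and>
        (\<forall>x x'. (\<forall>j. j \<noteq> b \<longrightarrow> x $ j = x' $ j) \<longrightarrow> g x = g x')"
    proof (intro exI conjI allI impI ballI)
      show "Ck_derivs k UNIV (\<lambda>x. \<Sum>m. g m x) (\<lambda>al x. \<Sum>m. D m al x)" by (rule S1)
      show "\<bar>\<Sum>m. D m al x\<bar> \<le> \<rho>" if "length al \<le> k" for al x
        using S2[OF that, of x] cle by simp
      show "(\<Sum>m. g m x) = a m h" if "h \<in> H m" "\<forall>j. j \<noteq> b \<longrightarrow> x $ j = y m h $ j" for m h x
        using val that by blast
      show "(\<Sum>m. g m x) = (\<Sum>m. g m x')" if "\<forall>j. j \<noteq> b \<longrightarrow> x $ j = x' $ j" for x x'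
        using gD(5)[of x x'] that by simp
    qed
  qed
qed

section \<open>Hypersurfaces as local graphs\<close>

text \<open>A quantitative implicit function theorem: on a small cube the intermediate value theorem
  gives a root and the mean value theorem a Lipschitz constant. The Lipschitz bound involves only
  the coordinates other than \<open>b\<close>, and so also records that \<psi> does not depend on
  the coordinate \<open>b\<close>.\<close>

lemma hypersurface_local_graph:
  fixes \<Sigma> :: "(real^'n) set"
  assumes hyp: "Ck_hypersurface k \<Sigma>" and k: "k \<ge> 1" and p: "p \<in> \<Sigma>"
  obtains b :: 'n and r \<Lambda> :: real and \<psi> :: "real^'n \<Rightarrow> real"
  where "0 < r" "r \<le> 1" "0 \<le> \<Lambda>"
    "\<And>x y. \<bar>\<psi> x - \<psi> y\<bar> \<le> \<Lambda> * (\<Sum>j\<in>UNIV - {b}. \<bar>x$j - y$j\<bar>)"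
    "\<And>x. \<bar>\<psi> x - p$b\<bar> \<le> 1"
    "\<And>x. (\<And>j. j \<noteq> b \<Longrightarrow> \<bar>x$j - p$j\<bar> \<le> r) \<Longrightarrow> (\<chi> j. if j = b then \<psi> x else x$j) \<in> \<Sigma>"
proof -
  obtain U F where UF0: "open U \<and> p \<in> U \<and> Ck_on k U F \<and> \<Sigma> \<inter> U = {x\<in>U. F x = 0} \<and>
        (\<forall>x\<in>\<Sigma> \<inter> U. \<exists>F'. (F has_derivative F') (at x) \<and> F' \<noteq> (\<lambda>h. 0))"
    using bspec[OF hyp[unfolded Ck_hypersurface_def] p] by (elim exE) (rule that)
  then have UF: "open U" "p \<in> U" "Ck_on k U F" "\<Sigma> \<inter> U = {x\<in>U. F x = 0}" by auto
  obtain F' where F': "(F has_derivative F') (at p)" "F' \<noteq> (\<lambda>h. 0)" using UF0 p by blast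
  obtain k' where k': "k = Suc k'" using k by (cases k) auto
  obtain G where G: "\<And>x. x \<in> U \<Longrightarrow> (F has_derivative (\<lambda>h. \<Sum>i\<in>UNIV. h$i * G i x)) (at x)"
    "\<And>i. Ck_on k' U (G i)"
    by (rule Ck_on_Suc_total[OF UF(1) UF(3)[unfolded k']], rule that) auto
  have "F' = (\<lambda>h. \<Sum>i\<in>UNIV. h$i * G i p)"
    by (rule has_derivative_unique[OF F'(1) G(1)[OF UF(2)]])
  with F'(2) have "\<exists>b. G b p \<noteq> 0" by (metis (no_types, lifting) mult_zero_right sum.neutral)
  then obtain b where b: "G b p \<noteq> 0" by blast
  define c where "c = G b p"
  \<comment> \<open>Normalised so that the partial derivative along \<open>b\<close> is 1 at
    \<open>p\<close>; on the cube \<open>Q\<close> below it then stays above 1/2.\<close>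
  define F1 where "F1 = (\<lambda>x. F x / c)"
  define G1 where "G1 = (\<lambda>i x. G i x / c)"
  have c: "c \<noteq> 0" using b by (simp add: c_def)
  have dF1: "(F1 has_derivative (\<lambda>h. \<Sum>i\<in>UNIV. h$i * G1 i x)) (at x)" if "x \<in> U" for x
  proof -
    have "((\<lambda>x. inverse c * F x) has_derivative (\<lambda>h. inverse c * (\<Sum>i\<in>UNIV. h$i * G i x))) (at x)"
      by (rule has_derivative_mult_right[OF G(1)[OF that]])
    moreover have "(\<lambda>h::real^'n. inverse c * (\<Sum>i\<in>UNIV. h$i * G i x)) = (\<lambda>h. \<Sum>i\<in>UNIV. h$i * G1 i x)"
      by (rule ext) (simp add: G1_def sum_distrib_left field_simps)
    moreover have "(\<lambda>x. inverse c * F x) = F1" by (rule ext) (simp add: F1_def field_simps)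
    ultimately show ?thesis by simp
  qed
  have G1b: "G1 b p = 1" using c by (simp add: G1_def c_def)
  have "\<exists>d>0. \<forall>x. dist x p < d \<longrightarrow> \<bar>G1 i x - G1 i p\<bar> \<le> 1/2" for i
  proof -
    have "continuous_on U (G1 i)"
      unfolding G1_def using c by (intro continuous_intros Ck_on_continuous[OF G(2)]) auto
    then have "continuous (at p) (G1 i)" using UF continuous_on_eq_continuous_at by blast
    then obtain d where d: "d > 0" "\<And>y. dist y p < d \<Longrightarrow> \<bar>G1 i y - G1 i p\<bar> < 1/2"
      unfolding continuous_at_eps_delta dist_real_def by (metis half_gt_zero zero_less_one)
    then show ?thesis by (intro exI[of _ d]) (auto intro: less_imp_le)
  qed
  then obtain df where df: "\<And>i. df i > 0" "\<And>i x. dist x p < df i \<Longrightarrow> \<bar>G1 i x - G1 i p\<bar> \<le> 1/2" by metis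
  obtain d0 where d0: "d0 > 0" "ball p d0 \<subseteq> U" using UF openE by blast
  define d where "d = Min (insert d0 (range df))"
  have "d > 0" unfolding d_def using df d0 by (subst Min_gr_iff) auto
  moreover have "d \<le> d0" "d \<le> df i" for i unfolding d_def by (intro Min_le; auto)+
  ultimately have d: "d > 0" "d \<le> d0" "d \<le> df i" for i by auto
  define \<Lambda>0 where "\<Lambda>0 = 1 + (\<Sum>i\<in>UNIV. \<bar>G1 i p\<bar>)"
  have L0: "\<Lambda>0 \<ge> 1" by (simp add: \<Lambda>0_def sum_nonneg)
  define h where "h = min 1 (d / (2 * CARD('n)))"
  have h: "h > 0" "h \<le> 1" using d by (auto simp: h_def)
  define Q where "Q = {x::real^'n. \<forall>j. \<bar>x$j - p$j\<bar> \<le> h}"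
  have Qball: "dist x p < d" if "x \<in> Q" for x
  proof -
    have "dist x p \<le> (\<Sum>j\<in>UNIV. \<bar>(x - p)$j\<bar>)" unfolding dist_norm by (rule norm_le_l1_cart)
    also have "\<dots> \<le> (\<Sum>j\<in>(UNIV::'n set). h)" by (rule sum_mono) (use that in \<open>auto simp: Q_def\<close>)
    also have "\<dots> = CARD('n) * h" by simp
    also have "\<dots> \<le> CARD('n) * (d / (2 * CARD('n)))" by (intro mult_left_mono) (auto simp: h_def)
    also have "\<dots> < d" using d(1) by simp
    finally show ?thesis .
  qed
  have QU: "x \<in> U" if "x \<in> Q" for x using Qball[OF that] d(2) d0(2) by (auto simp: dist_commute)
  have GQ: "\<bar>G1 i x - G1 i p\<bar> \<le> 1/2" if "x \<in> Q" for i x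
    using df(2)[of x i] Qball[OF that] d(3)[of i] by linarith
  have Gb: "1/2 \<le> G1 b x" if "x \<in> Q" for x using GQ[OF that, of b] G1b by linarith
  have GL: "\<bar>G1 i x\<bar> \<le> \<Lambda>0" if "x \<in> Q" for i x
  proof -
    have "\<bar>G1 i p\<bar> \<le> (\<Sum>i\<in>UNIV. \<bar>G1 i p\<bar>)" by (rule member_le_sum) auto
    then show ?thesis using GQ[OF that, of i] unfolding \<Lambda>0_def by linarith
  qed
  have mvt: "\<exists>\<xi>\<in>Q. F1 y - F1 x = (\<Sum>i\<in>UNIV. (y - x)$i * G1 i \<xi>)" if "x \<in> Q" "y \<in> Q" for x y
  proof -
    define \<gamma> where "\<gamma> = (\<lambda>t::real. x + t *\<^sub>R (y - x))"
    have gQ: "\<gamma> t \<in> Q" if t: "0 \<le> t" "t \<le> 1" for t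
    proof -
      have "\<bar>\<gamma> t $ j - p$j\<bar> \<le> h" for j
      proof -
        have "\<gamma> t $ j - p$j = (1 - t) * (x$j - p$j) + t * (y$j - p$j)"
          by (simp add: \<gamma>_def algebra_simps)
        also have "\<bar>\<dots>\<bar> \<le> (1 - t) * \<bar>x$j - p$j\<bar> + t * \<bar>y$j - p$j\<bar>"
          using t by (intro order_trans[OF abs_triangle_ineq]) (simp add: abs_mult)
        also have "\<dots> \<le> (1 - t) * h + t * h"
          using \<open>x \<in> Q\<close> \<open>y \<in> Q\<close> t by (intro add_mono mult_left_mono) (auto simp: Q_def)
        finally show ?thesis by (simp add: algebra_simps)
      qed
      then show ?thesis by (simp add: Q_def)
    qed
    have "\<exists>z>0. z < 1 \<and> F1 (\<gamma> 1) - F1 (\<gamma> 0) = (1 - 0) * (\<Sum>i\<in>UNIV. (y - x)$i * G1 i (\<gamma> z))"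
    proof (rule MVT2)
      fix t :: real assume t: "0 \<le> t" "t \<le> 1"
      have "(\<gamma> has_derivative (\<lambda>s. s *\<^sub>R (y - x))) (at t)"
        unfolding \<gamma>_def by (auto intro!: derivative_eq_intros)
      from has_derivative_compose[OF this dF1[OF QU[OF gQ[OF t]]]]
      have "((\<lambda>t. F1 (\<gamma> t)) has_derivative (\<lambda>s. \<Sum>i\<in>UNIV. (s *\<^sub>R (y - x))$i * G1 i (\<gamma> t))) (at t)" .
      moreover have "(\<lambda>s. \<Sum>i\<in>UNIV. (s *\<^sub>R (y - x))$i * G1 i (\<gamma> t)) = (*) (\<Sum>i\<in>UNIV. (y - x)$i * G1 i (\<gamma> t))"
        by (rule ext) (simp add: sum_distrib_left mult_ac)
      ultimately show "((\<lambda>t. F1 (\<gamma> t)) has_real_derivative (\<Sum>i\<in>UNIV. (y - x)$i * G1 i (\<gamma> t))) (at t)"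
        by (simp only: has_field_derivative_def)
    qed simp
    then obtain z where z: "0 < z" "z < 1" "F1 (\<gamma> 1) - F1 (\<gamma> 0) = (\<Sum>i\<in>UNIV. (y - x)$i * G1 i (\<gamma> z))" by auto
    have "\<gamma> 1 = y" "\<gamma> 0 = x" by (simp_all add: \<gamma>_def)
    then show ?thesis using z gQ[of z] by (intro bexI[of _ "\<gamma> z"]) auto
  qed
  \<comment> \<open>Moving the other coordinates by at most \<open>r\<close> changes
    \<open>F1\<close> by at most \<open>h / 4\<close>, less than the change \<open>h / 2\<close>
    forced by moving the coordinate \<open>b\<close> by \<open>h\<close>. This produces the sign
    change that gives the root.\<close>
  define r where "r = h / (4 * CARD('n) * \<Lambda>0)"
  have n1: "real CARD('n) \<ge> 1" by (simp add: Suc_leI)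
  have r: "r > 0" using h L0 by (simp add: r_def)
  have rh: "r \<le> h"
  proof -
    have "1 * 1 \<le> real CARD('n) * \<Lambda>0" by (rule mult_mono[OF n1 L0]) auto
    then have "1 \<le> 4 * real CARD('n) * \<Lambda>0" by linarith
    then have "h / (4 * real CARD('n) * \<Lambda>0) \<le> h / 1" using h L0 by (intro divide_left_mono) auto
    then show ?thesis unfolding r_def by simp
  qed
  have nLr: "real CARD('n) * \<Lambda>0 * r = h / 4" using L0 by (simp add: r_def)
  define X where "X = (\<lambda>(x::real^'n) t. (\<chi> j. if j = b then t else x$j))"
  define dom where "dom = {x::real^'n. \<forall>j. j \<noteq> b \<longrightarrow> \<bar>x$j - p$j\<bar> \<le> r}"
  have XQ: "X x t \<in> Q" if "x \<in> dom" "\<bar>t - p$b\<bar> \<le> h" for x t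
    using that rh by (force simp: X_def Q_def dom_def)
  have F1p: "F1 p = 0" using UF(4) UF(2) p by (auto simp: F1_def)
  have pQ: "p \<in> Q" using h by (simp add: Q_def)
  have split: "(\<Sum>i\<in>UNIV. f i) = f b + (\<Sum>i\<in>UNIV - {b}. f i)" for f :: "'n \<Rightarrow> real"
    by (rule sum.remove) auto
  have small: "\<bar>\<Sum>i\<in>UNIV - {b}. (y - x)$i * G1 i \<xi>\<bar> \<le> \<Lambda>0 * (\<Sum>i\<in>UNIV - {b}. \<bar>y$i - x$i\<bar>)" if "\<xi> \<in> Q" for x y \<xi>
  proof -
    have "\<bar>\<Sum>i\<in>UNIV - {b}. (y - x)$i * G1 i \<xi>\<bar> \<le> (\<Sum>i\<in>UNIV - {b}. \<bar>(y - x)$i * G1 i \<xi>\<bar>)" by (rule sum_abs)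
    also have "\<dots> \<le> (\<Sum>i\<in>UNIV - {b}. \<Lambda>0 * \<bar>y$i - x$i\<bar>)"
    proof (rule sum_mono)
      fix i
      have "\<bar>(y - x)$i\<bar> * \<bar>G1 i \<xi>\<bar> \<le> \<bar>(y - x)$i\<bar> * \<Lambda>0" by (intro mult_left_mono GL that) auto
      then show "\<bar>(y - x)$i * G1 i \<xi>\<bar> \<le> \<Lambda>0 * \<bar>y$i - x$i\<bar>" by (simp add: abs_mult mult.commute)
    qed
    finally show ?thesis by (simp add: sum_distrib_left)
  qed
  have root: "\<exists>t. \<bar>t - p$b\<bar> \<le> h \<and> F1 (X x t) = 0" if x: "x \<in> dom" for x
  proof -
    have sm: "\<Lambda>0 * (\<Sum>i\<in>UNIV - {b}. \<bar>X x t $ i - p$i\<bar>) \<le> h / 4" for t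
    proof -
      have "(\<Sum>i\<in>UNIV - {b}. \<bar>X x t $ i - p$i\<bar>) \<le> (\<Sum>i\<in>UNIV - {b}. r)"
        by (rule sum_mono) (use x in \<open>auto simp: X_def dom_def\<close>)
      also have "\<dots> \<le> CARD('n) * r" using r by (simp add: card_Diff_singleton mult_right_mono)
      finally have "\<Lambda>0 * (\<Sum>i\<in>UNIV - {b}. \<bar>X x t $ i - p$i\<bar>) \<le> \<Lambda>0 * (CARD('n) * r)"
        using L0 by (intro mult_left_mono) auto
      then show ?thesis using nLr by (simp add: mult_ac)
    qed
    have hi: "F1 (X x (p$b + h)) \<ge> 0"
    proof -
      have inQ: "X x (p$b + h) \<in> Q" using h by (intro XQ x) auto
      then obtain \<xi> where xi: "\<xi> \<in> Q" "F1 (X x (p$b + h)) - F1 p = (\<Sum>i\<in>UNIV. (X x (p$b + h) - p)$i * G1 i \<xi>)"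
        using mvt[OF pQ inQ] by blast
      have hb: "(X x (p$b + h) - p)$b = h" by (simp add: X_def)
      have "F1 (X x (p$b + h)) = h * G1 b \<xi> + (\<Sum>i\<in>UNIV - {b}. (X x (p$b + h) - p)$i * G1 i \<xi>)"
        using xi(2) unfolding split[of "\<lambda>i. (X x (p$b + h) - p)$i * G1 i \<xi>"] F1p hb by linarith
      moreover have "h * G1 b \<xi> \<ge> h * (1/2)" using Gb[OF xi(1)] h by (intro mult_left_mono) auto
      ultimately show ?thesis using small[OF xi(1), where x = p and y = "X x (p$b + h)"] sm[of "p$b + h"] h by linarith
    qed
    have lo: "F1 (X x (p$b - h)) \<le> 0"
    proof -
      have inQ: "X x (p$b - h) \<in> Q" using h by (intro XQ x) auto
      then obtain \<xi> where xi: "\<xi> \<in> Q" "F1 (X x (p$b - h)) - F1 p = (\<Sum>i\<in>UNIV. (X x (p$b - h) - p)$i * G1 i \<xi>)"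
        using mvt[OF pQ inQ] by blast
      have hb: "(X x (p$b - h) - p)$b = - h" by (simp add: X_def)
      have "F1 (X x (p$b - h)) = - h * G1 b \<xi> + (\<Sum>i\<in>UNIV - {b}. (X x (p$b - h) - p)$i * G1 i \<xi>)"
        using xi(2) unfolding split[of "\<lambda>i. (X x (p$b - h) - p)$i * G1 i \<xi>"] F1p hb by linarith
      moreover have "h * G1 b \<xi> \<ge> h * (1/2)" using Gb[OF xi(1)] h by (intro mult_left_mono) auto
      ultimately show ?thesis using small[OF xi(1), where x = p and y = "X x (p$b - h)"] sm[of "p$b - h"] h by linarith
    qed
    have "continuous_on {p$b - h..p$b + h} (\<lambda>t. F1 (X x t))"
    proof (rule continuous_on_compose2[of Q F1])
      show "continuous_on Q F1"
        by (intro continuous_at_imp_continuous_on ballI has_derivative_continuous[OF dF1] QU)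
      show "continuous_on {p$b - h..p$b + h} (X x)"
      proof (rule continuous_on_components)
        show "continuous_on {p$b - h..p$b + h} (\<lambda>t. X x t $ j)" for j
          by (cases "j = b") (auto simp: X_def)
      qed
      show "X x ` {p$b - h..p$b + h} \<subseteq> Q" using XQ[OF x] by (auto simp: abs_le_iff)
    qed
    then obtain t where "p$b - h \<le> t" "t \<le> p$b + h" "F1 (X x t) = 0"
      using IVT'[of "\<lambda>t. F1 (X x t)" "p$b - h" 0 "p$b + h"] lo hi h by auto
    then show ?thesis by (intro exI[of _ t]) (auto simp: abs_le_iff)
  qed
  define \<psi>0 where "\<psi>0 = (\<lambda>x. SOME t. \<bar>t - p$b\<bar> \<le> h \<and> F1 (X x t) = 0)"
  have psi0: "\<bar>\<psi>0 x - p$b\<bar> \<le> h" "F1 (X x (\<psi>0 x)) = 0" if "x \<in> dom" for x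
    using someI_ex[OF root[OF that]] unfolding \<psi>0_def by auto
  have lip0: "\<bar>\<psi>0 x - \<psi>0 y\<bar> \<le> 2 * \<Lambda>0 * (\<Sum>j\<in>UNIV - {b}. \<bar>x$j - y$j\<bar>)" if "x \<in> dom" "y \<in> dom" for x y
  proof -
    let ?P = "X x (\<psi>0 x)" and ?P' = "X y (\<psi>0 y)"
    have "?P \<in> Q" "?P' \<in> Q" using that psi0 by (auto intro: XQ)
    then obtain \<xi> where xi: "\<xi> \<in> Q" "F1 ?P - F1 ?P' = (\<Sum>i\<in>UNIV. (?P - ?P')$i * G1 i \<xi>)" using mvt by blast
    have "0 = (\<Sum>i\<in>UNIV. (?P - ?P')$i * G1 i \<xi>)" using xi(2) psi0(2) that by simp
    also have "\<dots> = (?P - ?P')$b * G1 b \<xi> + (\<Sum>i\<in>UNIV - {b}. (?P - ?P')$i * G1 i \<xi>)" by (rule split)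
    finally have "\<bar>(\<psi>0 x - \<psi>0 y) * G1 b \<xi>\<bar> = \<bar>\<Sum>i\<in>UNIV - {b}. (?P - ?P')$i * G1 i \<xi>\<bar>"
      by (simp add: X_def)
    also have "\<dots> \<le> \<Lambda>0 * (\<Sum>i\<in>UNIV - {b}. \<bar>?P$i - ?P'$i\<bar>)" by (rule small[OF xi(1)])
    also have "(\<Sum>i\<in>UNIV - {b}. \<bar>?P$i - ?P'$i\<bar>) = (\<Sum>i\<in>UNIV - {b}. \<bar>x$i - y$i\<bar>)"
      by (rule sum.cong) (auto simp: X_def)
    finally have "\<bar>\<psi>0 x - \<psi>0 y\<bar> * \<bar>G1 b \<xi>\<bar> \<le> \<Lambda>0 * (\<Sum>i\<in>UNIV - {b}. \<bar>x$i - y$i\<bar>)" by (simp add: abs_mult)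
    moreover have "\<bar>\<psi>0 x - \<psi>0 y\<bar> * (1/2) \<le> \<bar>\<psi>0 x - \<psi>0 y\<bar> * \<bar>G1 b \<xi>\<bar>"
      using Gb[OF xi(1)] by (intro mult_left_mono) auto
    ultimately have "\<bar>\<psi>0 x - \<psi>0 y\<bar> * (1/2) \<le> \<Lambda>0 * (\<Sum>j\<in>UNIV - {b}. \<bar>x$j - y$j\<bar>)" by (rule order_trans[rotated])
    then have "2 * (\<bar>\<psi>0 x - \<psi>0 y\<bar> * (1/2)) \<le> 2 * (\<Lambda>0 * (\<Sum>j\<in>UNIV - {b}. \<bar>x$j - y$j\<bar>))" by (rule mult_left_mono) simp
    then show ?thesis by simp
  qed
  \<comment> \<open>Coordinatewise projection onto the cube of half side \<open>r\<close> extends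
    the graph function to the whole space with the same Lipschitz constant, and leaves it unchanged
    over the cube.\<close>
  define clamp where "clamp = (\<lambda>x::real^'n. (\<chi> j. max (p$j - r) (min (p$j + r) (x$j))))"
  have clamp_dom: "clamp x \<in> dom" for x
    using r by (auto simp: clamp_def dom_def)
  define \<psi> where "\<psi> = (\<lambda>x. \<psi>0 (clamp x))"
  show thesis
  proof (rule that[of r "2 * \<Lambda>0" \<psi> b])
    show "0 < r" "r \<le> 1" "0 \<le> 2 * \<Lambda>0" using r rh h L0 by auto
    show "\<bar>\<psi> x - \<psi> y\<bar> \<le> 2 * \<Lambda>0 * (\<Sum>j\<in>UNIV - {b}. \<bar>x$j - y$j\<bar>)" for x y
    proof -
      have "\<bar>\<psi> x - \<psi> y\<bar> \<le> 2 * \<Lambda>0 * (\<Sum>j\<in>UNIV - {b}. \<bar>clamp x$j - clamp y$j\<bar>)"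
        unfolding \<psi>_def by (rule lip0[OF clamp_dom clamp_dom])
      also have "\<dots> \<le> 2 * \<Lambda>0 * (\<Sum>j\<in>UNIV - {b}. \<bar>x$j - y$j\<bar>)"
        using L0 by (intro mult_left_mono sum_mono) (auto simp: clamp_def)
      finally show ?thesis .
    qed
    show "\<bar>\<psi> x - p$b\<bar> \<le> 1" for x
      using psi0(1)[OF clamp_dom[of x]] h unfolding \<psi>_def by linarith
    show "(\<chi> j. if j = b then \<psi> x else x$j) \<in> \<Sigma>" if x: "\<And>j. j \<noteq> b \<Longrightarrow> \<bar>x$j - p$j\<bar> \<le> r" for x
    proof -
      have xd: "x \<in> dom" using x by (simp add: dom_def)
      have cx: "clamp x $ j = x$j" if "j \<noteq> b" for j
        using x[OF that] by (auto simp: clamp_def)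
      have eq: "X (clamp x) t = X x t" for t unfolding X_def using cx by (auto simp: vec_eq_iff)
      have "F1 (X x (\<psi> x)) = 0" using psi0(2)[OF clamp_dom[of x]] unfolding \<psi>_def eq .
      moreover have "X x (\<psi> x) \<in> Q"
        unfolding \<psi>_def by (rule XQ[OF xd psi0(1)[OF clamp_dom]])
      ultimately have "X x (\<psi> x) \<in> \<Sigma> \<inter> U" unfolding UF(4) using c QU by (simp add: F1_def)
      then show ?thesis by (simp add: X_def)
    qed
  qed
qed

section \<open>Lacunary chains\<close>

lemma card_int_between:
  fixes x y :: real
  assumes "x \<le> y + 1"
  shows "finite {z::int. x \<le> of_int z \<and> of_int z \<le> y}"
    and "real (card {z::int. x \<le> of_int z \<and> of_int z \<le> y}) \<le> y - x + 1"
proof -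
  have eq: "{z::int. x \<le> of_int z \<and> of_int z \<le> y} = {\<lceil>x\<rceil>..\<lfloor>y\<rfloor>}"
    by (auto simp: ceiling_le_iff le_floor_iff)
  then show "finite {z::int. x \<le> of_int z \<and> of_int z \<le> y}" by simp
  have "real (card {\<lceil>x\<rceil>..\<lfloor>y\<rfloor>}) = real (nat (\<lfloor>y\<rfloor> + 1 - \<lceil>x\<rceil>))" by simp
  also have "\<dots> \<le> y - x + 1"
  proof (cases "0 \<le> \<lfloor>y\<rfloor> + 1 - \<lceil>x\<rceil>")
    case True
    then have "real (nat (\<lfloor>y\<rfloor> + 1 - \<lceil>x\<rceil>)) = of_int (\<lfloor>y\<rfloor> + 1 - \<lceil>x\<rceil>)" by (rule of_nat_nat)
    then show ?thesis by simp linarith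
  qed (use assms in simp)
  finally show "real (card {z::int. x \<le> of_int z \<and> of_int z \<le> y}) \<le> y - x + 1" using eq by simp
qed

text \<open>The first condition leaves about \<open>a 0 * l / L\<close> intervals of length
  \<open>2 * C / a 0\<close>, a fraction of order \<open>1 / L\<close> of the whole. Since the next
  frequency is at least \<open>L\<close> times larger, each of these intervals is again at least one
  period of the next condition long, and the estimate iterates.\<close>

lemma emeasure_lacunary_le:
  fixes a \<beta> :: "nat \<Rightarrow> real" and L C l x :: real
  assumes L: "1 \<le> L" and C: "1 \<le> C"
  shows "0 < l \<Longrightarrow> (0 < q \<Longrightarrow> L \<le> a 0 * l) \<Longrightarrow> (\<And>j. Suc j < q \<Longrightarrow> L * a j \<le> a (Suc j)) \<Longrightarrow>
    emeasure lborel {s\<in>{x..x+l}. \<forall>j<q. \<exists>z::int. \<bar>a j * s + \<beta> j - L * of_int z\<bar> \<le> C}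
      \<le> ennreal (l * (2 * C * (2 + 2 * C) / L) ^ q)"
proof (induction q arbitrary: a \<beta> l x)
  case 0
  have "{s\<in>{x..x+l}. \<forall>j<0::nat. \<exists>z::int. \<bar>a j * s + \<beta> j - L * of_int z\<bar> \<le> C} = {x..x+l}" by auto
  then show ?case using 0 by simp
next
  case (Suc q)
  let ?K = "2 * C * (2 + 2 * C)"
  have al: "L \<le> a 0 * l" using Suc.prems by simp
  have a0: "0 < a 0" using al L Suc.prems(1) by (metis less_le_trans zero_less_mult_pos2 zero_less_one)
  define l' where "l' = 2 * C / a 0"
  have l': "l' > 0" using a0 C by (simp add: l'_def)
  define Z where "Z = {z::int. (a 0 * x + \<beta> 0 - C) / L \<le> of_int z \<and> of_int z \<le> (a 0 * (x + l) + \<beta> 0 + C) / L}"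
  define X where "X = (\<lambda>z::int. (L * of_int z - \<beta> 0 - C) / a 0)"
  define E where "E = (\<lambda>z. {s\<in>{X z..X z + l'}. \<forall>j<q. \<exists>z::int. \<bar>a (Suc j) * s + \<beta> (Suc j) - L * of_int z\<bar> \<le> C})"
  have q: "(a 0 * (x + l) + \<beta> 0 + C) / L - (a 0 * x + \<beta> 0 - C) / L = (a 0 * l + 2 * C) / L"
    unfolding diff_divide_distrib[symmetric] by (simp add: algebra_simps)
  have pos: "0 \<le> (a 0 * l + 2 * C) / L" using al L C by simp
  have Z: "finite Z" "real (card Z) \<le> (a 0 * l + 2 * C) / L + 1"
    using card_int_between[of "(a 0 * x + \<beta> 0 - C) / L" "(a 0 * (x + l) + \<beta> 0 + C) / L"] q pos
    unfolding Z_def by linarith+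
  have sub: "{s\<in>{x..x+l}. \<forall>j<Suc q. \<exists>z::int. \<bar>a j * s + \<beta> j - L * of_int z\<bar> \<le> C} \<subseteq> (\<Union>z\<in>Z. E z)"
  proof
    fix s assume s: "s \<in> {s\<in>{x..x+l}. \<forall>j<Suc q. \<exists>z::int. \<bar>a j * s + \<beta> j - L * of_int z\<bar> \<le> C}"
    then obtain z :: int where z: "\<bar>a 0 * s + \<beta> 0 - L * of_int z\<bar> \<le> C" by auto
    have "a 0 * x \<le> a 0 * s" "a 0 * s \<le> a 0 * (x + l)" using s a0 by auto
    then have "a 0 * x + \<beta> 0 - C \<le> of_int z * L" "of_int z * L \<le> a 0 * (x + l) + \<beta> 0 + C"
      using z unfolding mult.commute[of "of_int z"] by linarith+
    then have "z \<in> Z" using L unfolding Z_def by (simp add: pos_divide_le_eq pos_le_divide_eq)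
    moreover have "X z \<le> s" unfolding X_def using z a0
      by (simp add: pos_divide_le_eq mult.commute[of s])
    moreover have "s \<le> X z + l'" unfolding X_def l'_def add_divide_distrib[symmetric] using z a0
      by (simp add: pos_le_divide_eq mult.commute[of s])
    ultimately show "s \<in> (\<Union>z\<in>Z. E z)" using s unfolding E_def by auto
  qed
  have Em: "E z \<in> sets lborel" for z unfolding E_def by measurable
  have IH: "emeasure lborel (E z) \<le> ennreal (l' * (?K / L) ^ q)" for z
    unfolding E_def
  proof (rule Suc.IH[OF l'])
    show "L \<le> a (Suc 0) * l'" if "0 < q"
    proof -
      have "L * a 0 * 1 \<le> a (Suc 0) * (2 * C)"
        using Suc.prems(3)[of 0] that C L a0 order_trans[of 0 "L * a 0" "a (Suc 0)"] by (intro mult_mono) auto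
      then show ?thesis using a0 by (simp add: l'_def pos_le_divide_eq)
    qed
    show "L * a (Suc j) \<le> a (Suc (Suc j))" if "Suc j < q" for j using Suc.prems(3) that by simp
  qed
  have "emeasure lborel {s\<in>{x..x+l}. \<forall>j<Suc q. \<exists>z::int. \<bar>a j * s + \<beta> j - L * of_int z\<bar> \<le> C}
      \<le> emeasure lborel (\<Union>z\<in>Z. E z)"
    by (rule emeasure_mono[OF sub]) (use Em Z in auto)
  also have "\<dots> \<le> (\<Sum>z\<in>Z. emeasure lborel (E z))"
    by (rule emeasure_subadditive_finite) (use Em Z in auto)
  also have "\<dots> \<le> (\<Sum>z\<in>Z. ennreal (l' * (?K / L) ^ q))" by (intro sum_mono IH)
  also have "\<dots> = ennreal (real (card Z) * (l' * (?K / L) ^ q))"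
    using l' C L by (subst sum_ennreal) auto
  also have "\<dots> \<le> ennreal (l * (?K / L) ^ Suc q)"
  proof (rule ennreal_leI)
    \<comment> \<open>Both \<open>L\<close> and 1 are at most \<open>a 0 * l\<close>, so the
      boundary terms of the count are absorbed into the factor \<open>2 + 2 * C\<close>.\<close>
    have "a 0 * l + 2 * C + L \<le> a 0 * l * (2 + 2 * C)"
    proof -
      have "2 * C * 1 \<le> 2 * C * (a 0 * l)" using al L C by (intro mult_left_mono) auto
      then show ?thesis using al by (simp add: algebra_simps)
    qed
    then have "(a 0 * l + 2 * C + L) * (2 * C) \<le> a 0 * l * (2 + 2 * C) * (2 * C)"
      using C by (intro mult_right_mono) auto
    then have "(a 0 * l + 2 * C + L) * (2 * C) / (L * a 0) \<le> a 0 * l * (2 + 2 * C) * (2 * C) / (L * a 0)"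
      using a0 L by (intro divide_right_mono) auto
    moreover have "((a 0 * l + 2 * C) / L + 1) * (2 * C / a 0) = (a 0 * l + 2 * C + L) * (2 * C) / (L * a 0)"
      using a0 L by (simp add: field_simps)
    moreover have "l * (?K / L) = a 0 * l * (2 + 2 * C) * (2 * C) / (L * a 0)"
      using a0 L by (simp add: field_simps)
    ultimately have "((a 0 * l + 2 * C) / L + 1) * (2 * C / a 0) \<le> l * (?K / L)" by simp
    then have "real (card Z) * l' \<le> l * (?K / L)"
      using mult_right_mono[OF Z(2), of l'] l' unfolding l'_def by linarith
    then have "real (card Z) * l' * (?K / L) ^ q \<le> l * (?K / L) * (?K / L) ^ q"
      using C L by (intro mult_right_mono) auto
    then show "real (card Z) * (l' * (?K / L) ^ q) \<le> l * (?K / L) ^ Suc q" by (simp add: mult_ac)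
  qed
  finally show ?case .
qed

lemma int_div_eq_imp_close:
  fixes u v e :: int
  assumes eq: "u div e = v div e" and e: "0 < e"
  shows "\<bar>u - v\<bar> < e"
proof -
  have "v div e * e + u mod e = u" using div_mult_mod_eq[of u e] unfolding eq .
  moreover have "v div e * e + v mod e = v" by (rule div_mult_mod_eq)
  ultimately show ?thesis
    using pos_mod_sign[OF e, of u] pos_mod_bound[OF e, of u] pos_mod_sign[OF e, of v] pos_mod_bound[OF e, of v]
    by linarith
qed

text \<open>The chain is built from its shortest distance upwards. A short subinterval still rich in
  points supplies a chain of length \<open>q\<close> with its base point; the extreme point of
  \<open>S\<close> farther from the base then exceeds all its distances by the factor
  \<open>L\<close>.\<close>

lemma exists_lacunary_differences:
  fixes S :: "int set" and L :: nat
  assumes L: "1 \<le> L"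
  shows "finite S \<Longrightarrow> (9 * L) ^ q \<le> card S \<Longrightarrow>
    \<exists>s0\<in>S. \<exists>s::nat \<Rightarrow> int. (\<forall>j<q. s j \<in> S \<and> 4 * int L \<le> \<bar>s j - s0\<bar>) \<and>
      (\<forall>j. Suc j < q \<longrightarrow> int L * \<bar>s j - s0\<bar> \<le> \<bar>s (Suc j) - s0\<bar>)"
proof (induction q arbitrary: S)
  case 0
  then have "S \<noteq> {}" by auto
  then show ?case by auto
next
  case (Suc q)
  have cS: "9 * L \<le> card S"
  proof -
    have "9 * L * 1 \<le> 9 * L * (9 * L) ^ q" using L by (intro mult_left_mono) auto
    then show ?thesis using Suc.prems(2) unfolding power_Suc by linarith
  qed
  then have ne: "S \<noteq> {}" using L by auto
  define m where "m = Min S"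
  define D where "D = Max S - m"
  have mS: "m \<in> S" "\<And>s. s \<in> S \<Longrightarrow> m \<le> s" using Suc.prems(1) ne by (auto simp: m_def)
  have MS: "m + D \<in> S" "\<And>s. s \<in> S \<Longrightarrow> s \<le> m + D" using Suc.prems(1) ne by (auto simp: D_def)
  have "S \<subseteq> {m..m + D}" using mS MS by auto
  then have "card S \<le> card {m..m + D}" by (intro card_mono) auto
  then have "card S \<le> nat (D + 1)" by simp
  then have D: "8 * int L \<le> D" using cS L by linarith
  \<comment> \<open>Divides the range of \<open>S\<close> into \<open>2 * L\<close> classes, so that
    differences within a class are at most \<open>D / (2 * L)\<close>. As \<open>9 * L\<close>
    exceeds the number of classes, the fullest class retains \<open>(9 * L) ^ q\<close> points. The
    same 9 forced \<open>D \<ge> 8 * L\<close> above, which makes the added distance, at least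
    \<open>D / 2\<close>, at least \<open>4 * L\<close>.\<close>
  define cl where "cl = (\<lambda>s. (s - m) * (2 * int L) div (D + 1))"
  have cl_range: "cl s \<in> {0..<2 * int L}" if "s \<in> S" for s
  proof -
    have "0 \<le> s - m" "s - m < D + 1" using mS(2)[OF that] MS(2)[OF that] by auto
    then have "(s - m) * (2 * int L) < (D + 1) * (2 * int L)" using L by (intro mult_strict_right_mono) auto
    moreover have "cl s * (D + 1) \<le> (s - m) * (2 * int L)"
      using div_mult_mod_eq[of "(s - m) * (2 * int L)" "D + 1"] pos_mod_sign[of "D + 1" "(s - m) * (2 * int L)"] D L
      unfolding cl_def by linarith
    ultimately have "cl s * (D + 1) < (2 * int L) * (D + 1)" unfolding mult.commute[of "D + 1"] by linarith
    then have "cl s < 2 * int L" using D L by (simp only: mult_less_cancel_right)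
    moreover have "0 \<le> cl s" unfolding cl_def using \<open>0 \<le> s - m\<close> D L by (simp add: pos_imp_zdiv_nonneg_iff)
    ultimately show ?thesis by simp
  qed
  have "\<exists>c\<in>{0..<2 * int L}. (9 * L) ^ q \<le> card {s\<in>S. cl s = c}"
  proof (rule ccontr)
    assume neg: "\<not> ?thesis"
    have eq: "S = (\<Union>c\<in>{0..<2 * int L}. {s\<in>S. cl s = c})" using cl_range by auto
    have "card S = card (\<Union>c\<in>{0..<2 * int L}. {s\<in>S. cl s = c})" by (rule arg_cong[OF eq])
    also have "\<dots> \<le> (\<Sum>c\<in>{0..<2 * int L}. card {s\<in>S. cl s = c})" by (rule card_UN_le) simp
    also have "\<dots> \<le> (\<Sum>c\<in>{0..<2 * int L}. (9 * L) ^ q)"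
      by (rule sum_mono) (use neg in \<open>auto simp: not_le intro: less_imp_le\<close>)
    also have "\<dots> = 2 * L * (9 * L) ^ q" by (simp add: nat_mult_distrib)
    also have "\<dots> < 9 * L * (9 * L) ^ q" using L by simp
    finally show False using Suc.prems(2) unfolding power_Suc by linarith
  qed
  then obtain c where c: "(9 * L) ^ q \<le> card {s\<in>S. cl s = c}" by blast
  let ?S = "{s\<in>S. cl s = c}"
  obtain s0 s where s: "s0 \<in> ?S" "\<And>j. j < q \<Longrightarrow> s j \<in> ?S \<and> 4 * int L \<le> \<bar>s j - s0\<bar>"
    "\<And>j. Suc j < q \<Longrightarrow> int L * \<bar>s j - s0\<bar> \<le> \<bar>s (Suc j) - s0\<bar>"
    using Suc.IH[of ?S] c Suc.prems(1) by auto
  have close: "2 * int L * \<bar>x - s0\<bar> \<le> D" if "x \<in> ?S" for x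
  proof -
    let ?u = "(x - m) * (2 * int L)" and ?v = "(s0 - m) * (2 * int L)"
    have "\<bar>?u - ?v\<bar> < D + 1"
      by (rule int_div_eq_imp_close) (use that s(1) D L in \<open>auto simp: cl_def\<close>)
    moreover have "?u - ?v = 2 * int L * (x - s0)" by (simp add: algebra_simps)
    ultimately show ?thesis using L by (simp add: abs_mult)
  qed
  define far where "far = (if D \<le> 2 * (s0 - m) then m else m + D)"
  have far: "far \<in> S" "D \<le> 2 * \<bar>far - s0\<bar>"
    using mS MS s(1) by (auto simp: far_def)
  define s' where "s' = (\<lambda>j. if j < q then s j else far)"
  show ?case
  proof (intro bexI[of _ s0] exI[of _ s'] conjI allI impI)
    show "s0 \<in> S" using s(1) by simp
    show "s' j \<in> S" if "j < Suc q" for j using s(2) far that by (auto simp: s'_def)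
    show "4 * int L \<le> \<bar>s' j - s0\<bar>" if "j < Suc q" for j
      using s(2)[of j] far(2) D that by (auto simp: s'_def)
    show "int L * \<bar>s' j - s0\<bar> \<le> \<bar>s' (Suc j) - s0\<bar>" if "Suc j < Suc q" for j
    proof (cases "Suc j < q")
      case True then show ?thesis using s(3) by (simp add: s'_def)
    next
      case False
      then have "s' (Suc j) = far" "s' j = s j" "s j \<in> ?S" using that s(2)[of j] by (auto simp: s'_def)
      then show ?thesis using close[of "s j"] far(2) by simp
    qed
  qed
qed

lemma nn_integral_lborel_translate:
  fixes f :: "'a::euclidean_space \<Rightarrow> ennreal"
  assumes [measurable]: "f \<in> borel_measurable borel"
  shows "(\<integral>\<^sup>+ x. f (x + c) \<partial>lborel) = (\<integral>\<^sup>+ x. f x \<partial>lborel)"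
proof -
  have "(\<integral>\<^sup>+ x. f x \<partial>lborel) = (\<integral>\<^sup>+ x. f x \<partial>distr lborel borel ((+) c))" by (simp add: lborel_distr_plus)
  also have "\<dots> = (\<integral>\<^sup>+ x. f (c + x) \<partial>lborel)" by (subst nn_integral_distr) auto
  finally show ?thesis by (simp add: add.commute)
qed

text \<open>Averaging over translations along \<nu> reduces the estimate to a one-dimensional one
  with frequencies \<open>k j * (\<nu> \<bullet> \<nu>)\<close>; the 4 in the bound on
  \<open>k 0\<close> compensates \<open>1/4 \<le> \<nu> \<bullet> \<nu>\<close>. The base points
  that matter stay in a cube of volume 3^n.\<close>

lemma emeasure_lacunary_vectors_le:
  fixes \<nu> :: "real^'n" and k :: "nat \<Rightarrow> real" and L C :: real
  assumes L: "1 \<le> L" and C: "1 \<le> C"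
    and nu: "1/4 \<le> \<nu> \<bullet> \<nu>" "\<And>j. \<bar>\<nu>$j\<bar> \<le> 1"
    and k: "4 * L \<le> k 0" "\<And>j. Suc j < q \<Longrightarrow> L * k j \<le> k (Suc j)"
  shows "emeasure lborel (cbox 0 1 \<inter> {u. \<forall>j<q. \<exists>z::int. \<bar>k j * (\<nu> \<bullet> u) - L * of_int z\<bar> \<le> C})
    \<le> ennreal (3 ^ CARD('n) * (2 * C * (2 + 2 * C) / L) ^ q)"
proof -
  let ?A = "{u. \<forall>j<q. \<exists>z::int. \<bar>k j * (\<nu> \<bullet> u) - L * of_int z\<bar> \<le> C} :: (real^'n) set"
  let ?K = "(2 * C * (2 + 2 * C) / L) ^ q"
  let ?Q' = "cbox (\<chi> j. -1) (\<chi> j. 2) :: (real^'n) set"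
  have A[measurable]: "?A \<in> sets borel" by measurable
  have Am: "(\<lambda>(s::real, u). indicator (cbox 0 1 \<inter> ?A) (u + s *\<^sub>R \<nu>) * indicator {0..1::real} s :: ennreal)
      \<in> borel_measurable (lborel \<Otimes>\<^sub>M lborel)"
    by measurable
  have "emeasure lborel (cbox 0 1 \<inter> ?A) = (\<integral>\<^sup>+ s. emeasure lborel (cbox 0 1 \<inter> ?A) * indicator {0..1::real} s \<partial>lborel)"
    by (simp add: nn_integral_cmult)
  also have "\<dots> = (\<integral>\<^sup>+ s. (\<integral>\<^sup>+ u. indicator (cbox 0 1 \<inter> ?A) (u + s *\<^sub>R \<nu>) * indicator {0..1::real} s \<partial>lborel) \<partial>lborel)"
  proof (rule nn_integral_cong)
    fix s :: real
    have "(\<integral>\<^sup>+ u. indicator (cbox 0 1 \<inter> ?A) (u + s *\<^sub>R \<nu>) * indicator {0..1::real} s \<partial>lborel)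
      = (\<integral>\<^sup>+ u. indicator (cbox 0 1 \<inter> ?A) (u + s *\<^sub>R \<nu>) \<partial>lborel) * indicator {0..1::real} s"
      by (rule nn_integral_multc) measurable
    also have "(\<integral>\<^sup>+ u. indicator (cbox 0 1 \<inter> ?A) (u + s *\<^sub>R \<nu>) \<partial>lborel) = (\<integral>\<^sup>+ u. indicator (cbox 0 1 \<inter> ?A) u \<partial>lborel)"
      by (rule nn_integral_lborel_translate) measurable
    also have "\<dots> = emeasure lborel (cbox 0 1 \<inter> ?A)" by (rule nn_integral_indicator) measurable
    finally show "emeasure lborel (cbox 0 1 \<inter> ?A) * indicator {0..1::real} s =
      (\<integral>\<^sup>+ u. indicator (cbox 0 1 \<inter> ?A) (u + s *\<^sub>R \<nu>) * indicator {0..1::real} s \<partial>lborel)" by simp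
  qed
  also have "\<dots> = (\<integral>\<^sup>+ u. (\<integral>\<^sup>+ s. indicator (cbox 0 1 \<inter> ?A) (u + s *\<^sub>R \<nu>) * indicator {0..1::real} s \<partial>lborel) \<partial>lborel)"
    using lborel_pair.Fubini'[OF Am] by simp
  also have "\<dots> \<le> (\<integral>\<^sup>+ u. ennreal ?K * indicator ?Q' u \<partial>lborel)"
  proof (rule nn_integral_mono)
    fix u :: "real^'n"
    show "(\<integral>\<^sup>+ s. indicator (cbox 0 1 \<inter> ?A) (u + s *\<^sub>R \<nu>) * indicator {0..1::real} s \<partial>lborel) \<le> ennreal ?K * indicator ?Q' u"
    proof (cases "u \<in> ?Q'")
      case True
      let ?E = "{s\<in>{0..0+1}. \<forall>j<q. \<exists>z::int. \<bar>(k j * (\<nu> \<bullet> \<nu>)) * s + k j * (\<nu> \<bullet> u) - L * of_int z\<bar> \<le> C}"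
      have "(\<integral>\<^sup>+ s. indicator (cbox 0 1 \<inter> ?A) (u + s *\<^sub>R \<nu>) * indicator {0..1::real} s \<partial>lborel)
        \<le> (\<integral>\<^sup>+ s. indicator ?E s \<partial>lborel)"
        by (intro nn_integral_mono) (auto simp: indicator_def algebra_simps inner_add_right)
      also have "\<dots> = emeasure lborel ?E" by (rule nn_integral_indicator) measurable
      also have "\<dots> \<le> ennreal (1 * ?K)"
      proof (rule emeasure_lacunary_le[OF L C])
        show "L \<le> k 0 * (\<nu> \<bullet> \<nu>) * 1"
          using mult_mono[OF k(1) nu(1)] k(1) L by simp
        show "L * (k j * (\<nu> \<bullet> \<nu>)) \<le> k (Suc j) * (\<nu> \<bullet> \<nu>)" if "Suc j < q" for j
          using mult_right_mono[OF k(2)[OF that], of "\<nu> \<bullet> \<nu>"] by (simp add: mult_ac)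
      qed simp
      finally show ?thesis using True by simp
    next
      case False
      have "u + s *\<^sub>R \<nu> \<notin> cbox 0 1" if s: "s \<in> {0..1}" for s
      proof
        assume in01: "u + s *\<^sub>R \<nu> \<in> cbox 0 1"
        have "-1 \<le> u$j \<and> u$j \<le> 2" for j
        proof -
          have "\<bar>s * \<nu>$j\<bar> \<le> 1 * 1" unfolding abs_mult using s nu(2)[of j] by (intro mult_mono) auto
          moreover have "0 \<le> u$j + s * \<nu>$j" "u$j + s * \<nu>$j \<le> 1" using in01 by (auto simp: mem_box_cart)
          ultimately show ?thesis by linarith
        qed
        then show False using False by (auto simp: mem_box_cart)
      qed
      then have z: "indicator (cbox 0 1 \<inter> ?A) (u + s *\<^sub>R \<nu>) * indicator {0..1::real} s = (0::ennreal)" for s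
        by (auto simp: indicator_def)
      have "(\<integral>\<^sup>+ s. indicator (cbox 0 1 \<inter> ?A) (u + s *\<^sub>R \<nu>) * indicator {0..1::real} s \<partial>lborel) = (\<integral>\<^sup>+ s. 0 \<partial>(lborel :: real measure))"
        by (rule nn_integral_cong) (rule z)
      also have "\<dots> = 0" by simp
      finally show ?thesis by (simp only: zero_le)
    qed
  qed
  also have "\<dots> = ennreal ?K * emeasure lborel ?Q'" by (rule nn_integral_cmult_indicator) simp
  also have "emeasure lborel ?Q' = ennreal (3 ^ CARD('n))" by (subst emeasure_cbox_cart) auto
  also have "ennreal ?K * \<dots> = ennreal (3 ^ CARD('n) * ?K)"
    using C L by (subst ennreal_mult[symmetric]) (auto simp: mult.commute)
  finally show ?thesis .
qed

section \<open>Random progressions\<close>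

lemma nn_integral_lborel_affine:
  fixes f :: "real^'n \<Rightarrow> ennreal"
  assumes f[measurable]: "f \<in> borel_measurable borel" and c: "c \<noteq> 0"
  shows "ennreal (\<bar>c\<bar> ^ CARD('n)) * (\<integral>\<^sup>+ y. f (b + c *\<^sub>R y) \<partial>lborel) = (\<integral>\<^sup>+ y. f y \<partial>lborel)"
proof -
  have "(\<integral>\<^sup>+ y. f y \<partial>lborel) =
     (\<integral>\<^sup>+ y. f y \<partial>density (distr lborel borel (\<lambda>x. b + c *\<^sub>R x)) (\<lambda>_. ennreal (\<bar>c\<bar> ^ DIM(real^'n))))"
    using lborel_affine[OF c, of b] by simp
  also have "\<dots> = (\<integral>\<^sup>+ y. ennreal (\<bar>c\<bar> ^ CARD('n)) * f (b + c *\<^sub>R y) \<partial>lborel)"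
    by (subst nn_integral_density) (auto simp: nn_integral_distr)
  also have "\<dots> = ennreal (\<bar>c\<bar> ^ CARD('n)) * (\<integral>\<^sup>+ y. f (b + c *\<^sub>R y) \<partial>lborel)"
    by (rule nn_integral_cmult) measurable
  finally show ?thesis by simp
qed

text \<open>Pair correlation of two points whose coefficients at the generator \<open>y\<close>
  differ by at least \<open>1 / L\<close>. With the first point fixed, the second is an affine image
  of \<open>y\<close>, and undoing this map costs at most \<open>L ^ n\<close>.\<close>

lemma nn_integral_overlap_le:
  fixes S :: "(real^'n) set"
  assumes S[measurable]: "S \<in> sets borel" and v: "emeasure lborel S = ennreal v" "0 \<le> v"
    and L: "1 \<le> L" and c: "1 / L \<le> \<bar>c' - c\<bar>"
  shows "(\<integral>\<^sup>+ y. (\<integral>\<^sup>+ \<tau>. indicator S (\<tau> + (a + c *\<^sub>R y)) * indicator S (\<tau> + (a' + c' *\<^sub>R y)) \<partial>lborel) \<partial>lborel)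
    \<le> ennreal (L ^ CARD('n) * v\<^sup>2)"
proof -
  let ?c = "c' - c"
  have c0: "?c \<noteq> 0" using c L by auto
  have m[measurable]: "(\<lambda>(\<tau>, y). indicator S \<tau> * indicator S (\<tau> + (a' - a) + ?c *\<^sub>R y) :: ennreal) \<in> borel_measurable (lborel \<Otimes>\<^sub>M lborel)"
    by measurable
  have shift: "(\<integral>\<^sup>+ \<tau>. indicator S (\<tau> + (a + c *\<^sub>R y)) * indicator S (\<tau> + (a' + c' *\<^sub>R y)) \<partial>lborel)
      = (\<integral>\<^sup>+ \<tau>. indicator S \<tau> * indicator S (\<tau> + (a' - a) + ?c *\<^sub>R y) \<partial>lborel)" (is "?l = ?r") for y
  proof -
    have "?r = (\<integral>\<^sup>+ \<tau>. indicator S (\<tau> + (a + c *\<^sub>R y)) * indicator S (\<tau> + (a + c *\<^sub>R y) + (a' - a) + ?c *\<^sub>R y) \<partial>lborel)"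
      by (rule nn_integral_lborel_translate[symmetric]) measurable
    also have "\<dots> = ?l" by (intro nn_integral_cong) (simp add: algebra_simps)
    finally show ?thesis ..
  qed
  have "(\<integral>\<^sup>+ y. (\<integral>\<^sup>+ \<tau>. indicator S (\<tau> + (a + c *\<^sub>R y)) * indicator S (\<tau> + (a' + c' *\<^sub>R y)) \<partial>lborel) \<partial>lborel)
    = (\<integral>\<^sup>+ y. (\<integral>\<^sup>+ \<tau>. indicator S \<tau> * indicator S (\<tau> + (a' - a) + ?c *\<^sub>R y) \<partial>lborel) \<partial>lborel)"
    unfolding shift ..
  also have "\<dots> = (\<integral>\<^sup>+ \<tau>. (\<integral>\<^sup>+ y. indicator S \<tau> * indicator S (\<tau> + (a' - a) + ?c *\<^sub>R y) \<partial>lborel) \<partial>lborel)"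
    using lborel_pair.Fubini'[OF m] by simp
  also have "\<dots> \<le> (\<integral>\<^sup>+ \<tau>. indicator S \<tau> * ennreal (L ^ CARD('n) * v) \<partial>lborel)"
  proof (rule nn_integral_mono)
    fix \<tau> :: "real^'n"
    let ?i = "\<integral>\<^sup>+ y. indicator S (\<tau> + (a' - a) + ?c *\<^sub>R y) \<partial>lborel"
    have "ennreal (\<bar>?c\<bar> ^ CARD('n)) * ?i = (\<integral>\<^sup>+ y. indicator S y \<partial>lborel)"
      by (rule nn_integral_lborel_affine[OF _ c0]) measurable
    then have e: "ennreal (\<bar>?c\<bar> ^ CARD('n)) * ?i = ennreal v" using v by simp
    have "1 \<le> (L * \<bar>?c\<bar>) ^ CARD('n)"
      using c L by (intro one_le_power) (simp add: field_simps)
    then have "ennreal 1 * ?i \<le> ennreal ((L * \<bar>?c\<bar>) ^ CARD('n)) * ?i"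
      by (intro mult_right_mono ennreal_leI) auto
    also have "\<dots> = ennreal (L ^ CARD('n)) * (ennreal (\<bar>?c\<bar> ^ CARD('n)) * ?i)"
      using L by (simp add: power_mult_distrib ennreal_mult mult.assoc)
    also have "\<dots> = ennreal (L ^ CARD('n) * v)" unfolding e using L v by (simp add: ennreal_mult)
    finally have le: "?i \<le> ennreal (L ^ CARD('n) * v)" by simp
    have "(\<integral>\<^sup>+ y. indicator S \<tau> * indicator S (\<tau> + (a' - a) + ?c *\<^sub>R y) \<partial>lborel) = indicator S \<tau> * ?i"
      by (rule nn_integral_cmult) measurable
    then show "(\<integral>\<^sup>+ y. indicator S \<tau> * indicator S (\<tau> + (a' - a) + ?c *\<^sub>R y) \<partial>lborel) \<le> indicator S \<tau> * ennreal (L ^ CARD('n) * v)"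
      using le by (simp add: mult_left_mono)
  qed
  also have "\<dots> = ennreal v * ennreal (L ^ CARD('n) * v)"
    using v by (subst nn_integral_multc) auto
  also have "\<dots> = ennreal (L ^ CARD('n) * v\<^sup>2)"
    using L v by (simp add: ennreal_mult[symmetric] power2_eq_square mult_ac)
  finally show ?thesis .
qed

text \<open>\<open>gap\<close> abbreviates generalised arithmetic progression. With coefficients
  \<open>m i / L\<close> below 1 and generators in the unit cube, all points stay bounded by
  \<open>d\<close> in each coordinate, whatever \<open>L\<close> is.\<close>

definition gap_point :: "nat \<Rightarrow> nat \<Rightarrow> (nat \<Rightarrow> real^'n) \<Rightarrow> (nat \<Rightarrow> nat) \<Rightarrow> real^'n" where
  "gap_point d L u m = (\<Sum>i<d. (real (m i) / real L) *\<^sub>R u i)"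

definition gap_index :: "nat \<Rightarrow> nat \<Rightarrow> (nat \<Rightarrow> nat) set" where
  "gap_index d L = PiE {..<d} (\<lambda>_. {..<L})"

lemma finite_gap_index [simp]: "finite (gap_index d L)"
  and card_gap_index: "card (gap_index d L) = L ^ d"
  by (auto simp: gap_index_def finite_PiE card_PiE)

lemma ennreal_power_mono: "(a::ennreal) \<le> b \<Longrightarrow> a ^ n \<le> b ^ n"
  by (induction n) (auto intro: mult_mono)

text \<open>First moment method for independent uniform generators. Each index \<open>c\<close> is
  bad with probability at most \<open>\<alpha> ^ d\<close>, so the expected number of bad indices is
  at most 1/4; the expected pair sum is at most half of the allowed bound. Hence some sample meets
  both demands.\<close>

lemma exists_good_generators:
  fixes S :: "'j \<Rightarrow> (real^'n) set" and \<A> :: "'c \<Rightarrow> (real^'n) set" and v \<alpha> :: real and d L :: nat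
  assumes L: "1 \<le> L" and I: "finite I" and J: "finite J" "J \<noteq> {}"
    and A: "\<And>c. c \<in> I \<Longrightarrow> \<A> c \<in> sets borel"
      "\<And>c. c \<in> I \<Longrightarrow> emeasure lborel (cbox 0 1 \<inter> \<A> c) \<le> ennreal \<alpha>"
    and alpha: "0 \<le> \<alpha>" "real (card I) * \<alpha> ^ d \<le> 1/4"
    and S: "\<And>j. j \<in> J \<Longrightarrow> S j \<in> sets borel" "\<And>j. j \<in> J \<Longrightarrow> emeasure lborel (S j) = ennreal v"
    and v: "0 < v" "real L ^ (d + CARD('n)) * v \<le> 1/4"
  shows "\<exists>u. (\<forall>i<d. u i \<in> cbox 0 1) \<and> (\<forall>c\<in>I. \<exists>i<d. u i \<notin> \<A> c) \<and>
    (\<Sum>j\<in>J. \<Sum>m\<in>gap_index d L. \<Sum>m'\<in>gap_index d L - {m}.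
      \<integral>\<^sup>+ \<tau>. indicator (S j) (\<tau> + gap_point d L u m) * indicator (S j) (\<tau> + gap_point d L u m') \<partial>lborel)
      \<le> ennreal (real (card J) * real L ^ d * v / 2)"
proof -
  define N where "N = restrict_space (lborel :: (real^'n) measure) (cbox 0 1)"
  have spN: "space N = cbox 0 1" by (simp add: N_def space_restrict_space)
  have emN: "emeasure N X = emeasure lborel X" if "X \<subseteq> cbox 0 1" for X
    unfolding N_def by (rule emeasure_restrict_space) (use that in auto)
  have "emeasure lborel (cbox 0 1 :: (real^'n) set) = ennreal (\<Prod>i\<in>(UNIV::'n set). 1)"
    by (subst emeasure_cbox_cart) auto
  then have "emeasure N (space N) = 1" by (simp add: emN spN)
  then have pN: "prob_space N" by (rule prob_spaceI)
  interpret P: prob_space N by (rule pN)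
  interpret PP: product_sigma_finite "\<lambda>_::nat. N"
    by (rule product_sigma_finite.intro) (rule P.sigma_finite_measure_axioms)
  have pPi: "prob_space (PiM K (\<lambda>_. N))" for K :: "nat set"
    by (rule prob_space_PiM) (rule pN)
  have idN: "(\<lambda>x. x) \<in> measurable N borel"
    unfolding N_def by (rule measurable_restrict_space1) auto
  have comp: "(\<lambda>u. u i) \<in> measurable (PiM K (\<lambda>_. N)) borel" if "i \<in> K" for i :: nat and K
    by (rule measurable_compose[OF measurable_component_singleton[OF that] idN])
  let ?P = "PiM {..<d} (\<lambda>_. N)"
  have gp: "(\<lambda>u. gap_point d L u m) \<in> measurable ?P borel" for m
    unfolding gap_point_def by (intro borel_measurable_sum borel_measurable_scaleR borel_measurable_const comp) auto
  let ?f = "\<lambda>j m m' u. \<integral>\<^sup>+ \<tau>. indicator (S j) (\<tau> + gap_point d L u m) * indicator (S j) (\<tau> + gap_point d L u m') \<partial>lborel"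
  have fm: "?f j m m' \<in> borel_measurable ?P" if "j \<in> J" for j m m'
  proof -
    note [measurable] = S(1)[OF that] gp[of m] gp[of m']
    show ?thesis by measurable
  qed
  let ?T = "ennreal (real (card J) * real L ^ d * v / 2)"
  let ?X1 = "\<lambda>u. \<Sum>c\<in>I. indicator (PiE {..<d} (\<lambda>_. cbox 0 1 \<inter> \<A> c)) u :: ennreal"
  let ?X2 = "\<lambda>u. \<Sum>j\<in>J. \<Sum>m\<in>gap_index d L. \<Sum>m'\<in>gap_index d L - {m}. ?f j m m' u"
  have Nsets: "cbox 0 1 \<inter> \<A> c \<in> sets N" if "c \<in> I" for c
    using A(1)[OF that] by (auto simp: N_def sets_restrict_space)
  have PiEm: "PiE {..<d} (\<lambda>_. cbox 0 1 \<inter> \<A> c) \<in> sets ?P" if "c \<in> I" for c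
    by (rule sets_PiM_I_finite) (use Nsets[OF that] in auto)
  have X1m: "?X1 \<in> borel_measurable ?P" by (intro borel_measurable_sum borel_measurable_indicator PiEm)
  have X2m: "?X2 \<in> borel_measurable ?P" by (intro borel_measurable_sum fm)
  have EX1: "(\<integral>\<^sup>+ u. ?X1 u \<partial>?P) \<le> ennreal (1/4)"
  proof -
    have "(\<integral>\<^sup>+ u. ?X1 u \<partial>?P) = (\<Sum>c\<in>I. emeasure ?P (PiE {..<d} (\<lambda>_. cbox 0 1 \<inter> \<A> c)))"
      by (subst nn_integral_sum) (use PiEm in auto)
    also have "\<dots> \<le> (\<Sum>c\<in>I. ennreal (\<alpha> ^ d))"
    proof (rule sum_mono)
      fix c assume c: "c \<in> I"
      have "emeasure ?P (PiE {..<d} (\<lambda>_. cbox 0 1 \<inter> \<A> c)) = (\<Prod>i<d. emeasure N (cbox 0 1 \<inter> \<A> c))"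
        by (rule PP.emeasure_PiM) (use Nsets[OF c] in auto)
      also have "\<dots> \<le> (\<Prod>i<d. ennreal \<alpha>)"
        unfolding prod_constant by (rule ennreal_power_mono) (use A(2)[OF c] in \<open>auto simp: emN\<close>)
      also have "\<dots> = ennreal (\<alpha> ^ d)" using alpha by (simp add: ennreal_power)
      finally show "emeasure ?P (PiE {..<d} (\<lambda>_. cbox 0 1 \<inter> \<A> c)) \<le> ennreal (\<alpha> ^ d)" .
    qed
    also have "\<dots> = ennreal (real (card I) * \<alpha> ^ d)" using alpha by (subst sum_ennreal) auto
    also have "\<dots> \<le> ennreal (1/4)" using alpha by (intro ennreal_leI)
    finally show ?thesis .
  qed
  have Ef: "(\<integral>\<^sup>+ u. ?f j m m' u \<partial>?P) \<le> ennreal (real L ^ CARD('n) * v\<^sup>2)"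
    if j: "j \<in> J" and m: "m \<in> gap_index d L" "m' \<in> gap_index d L" "m' \<noteq> m" for j m m'
  proof -
    have "\<exists>i<d. m i \<noteq> m' i"
    proof (rule ccontr)
      assume "\<not> ?thesis"
      then have "m = m'" using m(1,2) unfolding gap_index_def by (intro PiE_ext[of m "{..<d}" _ m']) auto
      then show False using m(3) by simp
    qed
    then obtain i0 where i0: "i0 < d" "m i0 \<noteq> m' i0" by blast
    \<comment> \<open>Two different indices differ at some \<open>i0\<close>. Integration over the
      generator \<open>u i0\<close> alone, with the others frozen, is the situation of
      \<open>nn_integral_overlap_le\<close>.\<close>
    let ?K = "{..<d} - {i0}"
    have ins: "insert i0 ?K = {..<d}" using i0 by auto
    have "(\<integral>\<^sup>+ u. ?f j m m' u \<partial>?P) = (\<integral>\<^sup>+ x. (\<integral>\<^sup>+ y. ?f j m m' (x(i0 := y)) \<partial>N) \<partial>PiM ?K (\<lambda>_. N))"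
      using PP.product_nn_integral_insert[of ?K i0 "?f j m m'"] fm[OF j, of m m'] unfolding ins by simp
    also have "\<dots> \<le> (\<integral>\<^sup>+ x. ennreal (real L ^ CARD('n) * v\<^sup>2) \<partial>PiM ?K (\<lambda>_. N))"
    proof (rule nn_integral_mono)
      fix x :: "nat \<Rightarrow> real^'n"
      define a where "a = (\<lambda>m::nat\<Rightarrow>nat. \<Sum>i\<in>?K. (real (m i) / real L) *\<^sub>R x i)"
      have g: "gap_point d L (x(i0 := y)) m = a m + (real (m i0) / real L) *\<^sub>R y" for m y
      proof -
        have "gap_point d L (x(i0 := y)) m = (real (m i0) / real L) *\<^sub>R y + (\<Sum>i\<in>?K. (real (m i) / real L) *\<^sub>R (x(i0 := y)) i)"
          unfolding gap_point_def using i0 by (subst sum.remove[of _ i0]) auto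
        also have "(\<Sum>i\<in>?K. (real (m i) / real L) *\<^sub>R (x(i0 := y)) i) = a m"
          unfolding a_def by (rule sum.cong) auto
        finally show ?thesis unfolding add.commute[of "a m"] .
      qed
      have "(\<integral>\<^sup>+ y. ?f j m m' (x(i0 := y)) \<partial>N) = (\<integral>\<^sup>+ y. ?f j m m' (x(i0 := y)) * indicator (cbox 0 1) y \<partial>lborel)"
        unfolding N_def by (rule nn_integral_restrict_space) auto
      also have "\<dots> \<le> (\<integral>\<^sup>+ y. ?f j m m' (x(i0 := y)) \<partial>lborel)"
        by (rule nn_integral_mono) (auto simp: indicator_def)
      also have "\<dots> \<le> ennreal (real L ^ CARD('n) * v\<^sup>2)"
        unfolding g
      proof (rule nn_integral_overlap_le[OF S(1)[OF j] S(2)[OF j]])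
        have "1 \<le> \<bar>real (m' i0) - real (m i0)\<bar>" using i0(2) by linarith
        then show "1 / real L \<le> \<bar>real (m' i0) / real L - real (m i0) / real L\<bar>"
          using L by (simp add: diff_divide_distrib[symmetric] abs_divide divide_right_mono)
      qed (use v L in auto)
      finally show "(\<integral>\<^sup>+ y. ?f j m m' (x(i0 := y)) \<partial>N) \<le> ennreal (real L ^ CARD('n) * v\<^sup>2)" .
    qed
    also have "\<dots> = ennreal (real L ^ CARD('n) * v\<^sup>2)"
      using prob_space.emeasure_space_1[OF pPi[of ?K]] by simp
    finally show ?thesis .
  qed
  have EX2: "(\<integral>\<^sup>+ u. ?X2 u \<partial>?P) \<le> ennreal (real (card J) * real L ^ d * v / 4)"
  proof -
    have "(\<integral>\<^sup>+ u. ?X2 u \<partial>?P) = (\<Sum>j\<in>J. \<Sum>m\<in>gap_index d L. \<Sum>m'\<in>gap_index d L - {m}. \<integral>\<^sup>+ u. ?f j m m' u \<partial>?P)"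
      by (subst nn_integral_sum, (intro borel_measurable_sum fm; assumption)?, rule sum.cong[OF refl],
          subst nn_integral_sum, (intro borel_measurable_sum fm; assumption)?, rule sum.cong[OF refl],
          subst nn_integral_sum, (intro fm; assumption)?, rule refl)
    also have "\<dots> \<le> (\<Sum>j\<in>J. \<Sum>m\<in>gap_index d L. \<Sum>m'\<in>gap_index d L - {m}. ennreal (real L ^ CARD('n) * v\<^sup>2))"
      by (intro sum_mono Ef) auto
    also have "\<dots> \<le> (\<Sum>j\<in>J. \<Sum>m\<in>gap_index d L. \<Sum>m'\<in>gap_index d L. ennreal (real L ^ CARD('n) * v\<^sup>2))"
      by (intro sum_mono sum_mono2) auto
    also have "\<dots> = ennreal (real (card J) * (real L ^ d * (real L ^ d * (real L ^ CARD('n) * v\<^sup>2))))"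
      by (simp add: card_gap_index ennreal_of_nat_eq_real_of_nat ennreal_mult[symmetric])
    also have "\<dots> \<le> ennreal (real (card J) * real L ^ d * v / 4)"
    proof (rule ennreal_leI)
      have "(real (card J) * real L ^ d * v) * (real L ^ (d + CARD('n)) * v) \<le> (real (card J) * real L ^ d * v) * (1/4)"
        using v by (intro mult_left_mono) auto
      then show "real (card J) * (real L ^ d * (real L ^ d * (real L ^ CARD('n) * v\<^sup>2))) \<le> real (card J) * real L ^ d * v / 4"
        by (simp add: power_add power2_eq_square mult_ac)
    qed
    finally show ?thesis .
  qed
  define t where "t = real (card J) * real L ^ d * v / 2"
  have t: "t > 0" using J L v by (simp add: t_def card_gt_0_iff)
  \<comment> \<open>The weighted sum has expectation at most \<open>?T / 4 + ?T / 2\<close>. A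
    sample below \<open>?T\<close> has \<open>?X1 < 1\<close>, so this count is 0, and it also has
    \<open>?X2 \<le> ?T\<close>.\<close>
  have "\<exists>u\<in>space ?P. ?T * ?X1 u + ?X2 u < ?T"
  proof (rule ccontr)
    assume "\<not> ?thesis"
    then have ge: "?T \<le> ?T * ?X1 u + ?X2 u" if "u \<in> space ?P" for u using that by (auto simp: not_less)
    have "?T = (\<integral>\<^sup>+ u. ?T \<partial>?P)" using prob_space.emeasure_space_1[OF pPi[of "{..<d}"]] by simp
    also have "\<dots> \<le> (\<integral>\<^sup>+ u. ?T * ?X1 u + ?X2 u \<partial>?P)" by (rule nn_integral_mono) (rule ge)
    also have "\<dots> = ?T * (\<integral>\<^sup>+ u. ?X1 u \<partial>?P) + (\<integral>\<^sup>+ u. ?X2 u \<partial>?P)"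
      by (subst nn_integral_add, intro borel_measurable_times_ennreal borel_measurable_const X1m, rule X2m,
          subst nn_integral_cmult, rule X1m, rule refl)
    also have "\<dots> \<le> ?T * ennreal (1/4) + ennreal (real (card J) * real L ^ d * v / 4)"
      by (intro add_mono mult_left_mono EX1 EX2) auto
    also have "\<dots> = ennreal (t * (1/4)) + ennreal (t / 2)"
      using t unfolding t_def by (subst ennreal_mult) auto
    also have "\<dots> = ennreal (t * (1/4) + t / 2)" using t by (intro ennreal_plus[symmetric]) auto
    finally have "t \<le> t * (1/4) + t / 2" using t unfolding t_def[symmetric] by (subst (asm) ennreal_le_iff) auto
    then show False using t by simp
  qed
  then obtain u where u: "u \<in> space ?P" "?T * ?X1 u + ?X2 u < ?T" by blast
  have uc: "u i \<in> cbox 0 1" if "i < d" for i using u(1) that by (auto simp: space_PiM spN)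
  have no: "\<exists>i<d. u i \<notin> \<A> c" if c: "c \<in> I" for c
  proof (rule ccontr)
    assume "\<not> ?thesis"
    then have "u \<in> PiE {..<d} (\<lambda>_. cbox 0 1 \<inter> \<A> c)"
      using u(1) uc by (auto simp: space_PiM PiE_def)
    then have "1 \<le> ?X1 u"
      using sum_mono2[OF I, of "{c}" "\<lambda>c. indicator (PiE {..<d} (\<lambda>_. cbox 0 1 \<inter> \<A> c)) u :: ennreal"] c by simp
    then have "?T * 1 \<le> ?T * ?X1 u" by (rule mult_left_mono) simp
    also have "\<dots> \<le> ?T * ?X1 u + ?X2 u" by simp
    finally show False using u(2) by simp
  qed
  have "?X2 u \<le> ?T * ?X1 u + ?X2 u" by simp
  also have "\<dots> \<le> ?T" using u(2) by (rule less_imp_le)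
  finally show ?thesis using uc no by blast
qed

text \<open>Bonferroni's inequality integrated over translates: the translates hitting
  \<open>S j\<close> have measure at least the integrated number of hits minus the pair sum. All of
  them lie in a cube of side \<open>2 * D\<close>, so some translate hits at least the average
  number of sets.\<close>

lemma exists_good_translate:
  fixes S :: "'j \<Rightarrow> (real^'n) set" and u :: "nat \<Rightarrow> real^'n" and v D :: real and d L :: nat
  assumes L: "1 \<le> L" and J: "finite J"
    and S: "\<And>j. j \<in> J \<Longrightarrow> S j \<in> sets borel" "\<And>j. j \<in> J \<Longrightarrow> emeasure lborel (S j) = ennreal v"
    and v: "0 < v"
    and u: "\<And>i. i < d \<Longrightarrow> u i \<in> cbox 0 1"
    and D: "0 < D" "\<And>j x i. j \<in> J \<Longrightarrow> x \<in> S j \<Longrightarrow> \<bar>x$i\<bar> \<le> D - real d"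
    and pairs: "(\<Sum>j\<in>J. \<Sum>m\<in>gap_index d L. \<Sum>m'\<in>gap_index d L - {m}.
      \<integral>\<^sup>+ \<tau>. indicator (S j) (\<tau> + gap_point d L u m) * indicator (S j) (\<tau> + gap_point d L u m') \<partial>lborel)
      \<le> ennreal (real (card J) * real L ^ d * v / 2)"
  shows "\<exists>\<tau>. real (card J) * real L ^ d * v / (2 * (2 * D) ^ CARD('n))
    \<le> real (card {j\<in>J. \<exists>m\<in>gap_index d L. \<tau> + gap_point d L u m \<in> S j})"
proof -
  let ?y = "gap_point d L u" and ?M = "gap_index d L"
  define Hit where "Hit = (\<lambda>j. {\<tau>. \<exists>m\<in>?M. \<tau> + ?y m \<in> S j})"
  define t where "t = real (card J) * real L ^ d * v / 2"
  have t0: "0 \<le> t" using v by (simp add: t_def)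
  have Hm: "Hit j \<in> sets borel" if "j \<in> J" for j
  proof -
    have "Hit j = (\<Union>m\<in>?M. (\<lambda>\<tau>. \<tau> + ?y m) -` S j)" by (auto simp: Hit_def)
    also have "\<dots> \<in> sets borel"
    proof (rule sets.finite_UN)
      fix m
      have "(\<lambda>\<tau>. \<tau> + ?y m) \<in> borel_measurable borel" by measurable
      from measurable_sets[OF this S(1)[OF that]] show "(\<lambda>\<tau>. \<tau> + ?y m) -` S j \<in> sets borel" by simp
    qed simp
    finally show ?thesis .
  qed
  \<comment> \<open>With one hit \<open>m0\<close> fixed, every further hit is paid for by its pair
    with \<open>m0\<close>.\<close>
  have pt: "(\<Sum>m\<in>?M. indicator (S j) (\<tau> + ?y m) :: ennreal) \<le> indicator (Hit j) \<tau> +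
     (\<Sum>m\<in>?M. \<Sum>m'\<in>?M - {m}. indicator (S j) (\<tau> + ?y m) * indicator (S j) (\<tau> + ?y m'))" for j \<tau>
  proof (cases "\<exists>m0\<in>?M. \<tau> + ?y m0 \<in> S j")
    case True
    then obtain m0 where m0: "m0 \<in> ?M" "\<tau> + ?y m0 \<in> S j" by blast
    have "(\<Sum>m\<in>?M. indicator (S j) (\<tau> + ?y m) :: ennreal) = indicator (S j) (\<tau> + ?y m0) + (\<Sum>m\<in>?M - {m0}. indicator (S j) (\<tau> + ?y m))"
      by (rule sum.remove) (use m0 in auto)
    also have "\<dots> = indicator (Hit j) \<tau> + (\<Sum>m'\<in>?M - {m0}. indicator (S j) (\<tau> + ?y m0) * indicator (S j) (\<tau> + ?y m'))"
    proof -
      have "\<tau> \<in> Hit j" using m0 by (auto simp: Hit_def)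
      then have "indicator (Hit j) \<tau> = (1::ennreal)" "indicator (S j) (\<tau> + ?y m0) = (1::ennreal)"
        using m0(2) by simp_all
      then show ?thesis by (simp only: mult_1)
    qed
    also have "\<dots> \<le> indicator (Hit j) \<tau> + (\<Sum>m\<in>?M. \<Sum>m'\<in>?M - {m}. indicator (S j) (\<tau> + ?y m) * indicator (S j) (\<tau> + ?y m'))"
      by (intro add_left_mono member_le_sum[of m0 ?M "\<lambda>m. \<Sum>m'\<in>?M - {m}. indicator (S j) (\<tau> + ?y m) * indicator (S j) (\<tau> + ?y m')"]) (use m0 in auto)
    finally show ?thesis .
  next
    case False
    then have "(\<Sum>m\<in>?M. indicator (S j) (\<tau> + ?y m) :: ennreal) = 0" by (intro sum.neutral) auto
    then show ?thesis by simp
  qed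
  have meas: "(\<lambda>\<tau>. indicator (S j) (\<tau> + ?y m) :: ennreal) \<in> borel_measurable lborel" if "j \<in> J" for j m
  proof -
    note [measurable] = S(1)[OF that]
    show ?thesis by measurable
  qed
  have meas2: "(\<lambda>\<tau>. indicator (S j) (\<tau> + ?y m) * indicator (S j) (\<tau> + ?y m') :: ennreal) \<in> borel_measurable lborel" if "j \<in> J" for j m m'
    by (intro borel_measurable_times_ennreal meas that)
  have one: "ennreal (real L ^ d * v) \<le> emeasure lborel (Hit j) + (\<Sum>m\<in>?M. \<Sum>m'\<in>?M - {m}.
      \<integral>\<^sup>+ \<tau>. indicator (S j) (\<tau> + ?y m) * indicator (S j) (\<tau> + ?y m') \<partial>lborel)" if j: "j \<in> J" for j
  proof -
    have "(\<integral>\<^sup>+ \<tau>. indicator (S j) (\<tau> + ?y m) \<partial>lborel) = ennreal v" for m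
    proof -
      note [measurable] = S(1)[OF j]
      have "(\<integral>\<^sup>+ \<tau>. indicator (S j) (\<tau> + ?y m) \<partial>lborel) = (\<integral>\<^sup>+ \<tau>. indicator (S j) \<tau> \<partial>lborel)"
        by (rule nn_integral_lborel_translate) measurable
      then show ?thesis using S[OF j] by simp
    qed
    then have "(\<Sum>m\<in>?M. \<integral>\<^sup>+ \<tau>. indicator (S j) (\<tau> + ?y m) \<partial>lborel) = (\<Sum>m\<in>?M. ennreal v)" by simp
    also have "\<dots> = ennreal (real L ^ d * v)"
      using v by (subst sum_ennreal) (auto simp: card_gap_index)
    finally have "ennreal (real L ^ d * v) = (\<integral>\<^sup>+ \<tau>. (\<Sum>m\<in>?M. indicator (S j) (\<tau> + ?y m)) \<partial>lborel)"
      by (subst nn_integral_sum) (use meas[OF j] in auto)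
    also have "\<dots> \<le> (\<integral>\<^sup>+ \<tau>. indicator (Hit j) \<tau> +
     (\<Sum>m\<in>?M. \<Sum>m'\<in>?M - {m}. indicator (S j) (\<tau> + ?y m) * indicator (S j) (\<tau> + ?y m')) \<partial>lborel)"
      by (rule nn_integral_mono) (rule pt)
    also have "\<dots> = (\<integral>\<^sup>+ \<tau>. indicator (Hit j) \<tau> \<partial>lborel) +
     (\<integral>\<^sup>+ \<tau>. (\<Sum>m\<in>?M. \<Sum>m'\<in>?M - {m}. indicator (S j) (\<tau> + ?y m) * indicator (S j) (\<tau> + ?y m')) \<partial>lborel)"
      by (rule nn_integral_add, use Hm[OF j] in simp, intro borel_measurable_sum meas2[OF j])
    also have "(\<integral>\<^sup>+ \<tau>. indicator (Hit j) \<tau> \<partial>lborel) = emeasure lborel (Hit j)" using Hm[OF j] by simp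
    also have "(\<integral>\<^sup>+ \<tau>. (\<Sum>m\<in>?M. \<Sum>m'\<in>?M - {m}. indicator (S j) (\<tau> + ?y m) * indicator (S j) (\<tau> + ?y m')) \<partial>lborel)
      = (\<Sum>m\<in>?M. \<integral>\<^sup>+ \<tau>. (\<Sum>m'\<in>?M - {m}. indicator (S j) (\<tau> + ?y m) * indicator (S j) (\<tau> + ?y m')) \<partial>lborel)"
      by (rule nn_integral_sum) (intro borel_measurable_sum meas2[OF j])
    also have "\<dots> = (\<Sum>m\<in>?M. \<Sum>m'\<in>?M - {m}. \<integral>\<^sup>+ \<tau>. indicator (S j) (\<tau> + ?y m) * indicator (S j) (\<tau> + ?y m') \<partial>lborel)"
      by (intro sum.cong refl nn_integral_sum meas2[OF j])
    finally show ?thesis .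
  qed
  have sumH: "ennreal t \<le> (\<Sum>j\<in>J. emeasure lborel (Hit j))"
  proof -
    have "ennreal (t + t) = (\<Sum>j\<in>J. ennreal (real L ^ d * v))"
      using v by (subst sum_ennreal) (auto simp: t_def)
    also have "\<dots> \<le> (\<Sum>j\<in>J. emeasure lborel (Hit j)) + ennreal t"
      using sum_mono[of J, OF one] pairs unfolding t_def sum.distrib by (rule order_trans[OF _ add_left_mono])
    finally have "ennreal t + ennreal t \<le> ennreal t + (\<Sum>j\<in>J. emeasure lborel (Hit j))"
      unfolding ennreal_plus[OF t0 t0] by (simp only: add.commute)
    then show ?thesis unfolding ennreal_add_left_cancel_le by auto
  qed
  let ?Q = "cbox (\<chi> i. - D) (\<chi> i. D) :: (real^'n) set"
  have Hsub: "Hit j \<subseteq> ?Q" if "j \<in> J" for j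
  proof
    fix \<tau> assume "\<tau> \<in> Hit j"
    then obtain m where m: "m \<in> ?M" "\<tau> + ?y m \<in> S j" by (auto simp: Hit_def)
    have "\<bar>?y m $ i\<bar> \<le> real d" for i
    proof -
      have "\<bar>?y m $ i\<bar> \<le> (\<Sum>l<d. \<bar>(real (m l) / real L) * u l $ i\<bar>)"
      proof -
        have "?y m $ i = (\<Sum>l<d. (real (m l) / real L) * u l $ i)" by (simp add: gap_point_def)
        then show ?thesis by (simp only: sum_abs)
      qed
      also have "\<dots> \<le> (\<Sum>l<d. 1)"
      proof (rule sum_mono)
        fix l assume l: "l \<in> {..<d}"
        then have "m l < L" using m(1) by (auto simp: gap_index_def)
        then have "real (m l) / real L \<le> 1" using L by simp
        moreover have "\<bar>u l $ i\<bar> \<le> 1" using u[of l] l by (auto simp: mem_box_cart abs_le_iff dest!: spec[of _ i])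
        ultimately have "(real (m l) / real L) * \<bar>u l $ i\<bar> \<le> 1 * 1" by (intro mult_mono) auto
        then show "\<bar>(real (m l) / real L) * u l $ i\<bar> \<le> 1" by (simp add: abs_mult)
      qed
      finally show ?thesis by simp
    qed
    note yb = this
    have "\<bar>\<tau>$i\<bar> \<le> D" for i
      using D(2)[OF that m(2), of i] yb[of i] unfolding vector_add_component by linarith
    then show "\<tau> \<in> ?Q" by (auto simp: mem_box_cart abs_le_iff minus_le_iff)
  qed
  have volQ: "emeasure lborel ?Q = ennreal ((2 * D) ^ CARD('n))"
    using D by (subst emeasure_cbox_cart) auto
  let ?h = "\<lambda>\<tau>. card {j\<in>J. \<tau> \<in> Hit j}"
  have "\<exists>\<tau>. t / (2 * D) ^ CARD('n) \<le> real (?h \<tau>)"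
  proof (rule ccontr)
    assume neg: "\<not> ?thesis"
    obtain hmax where hmax: "\<And>\<tau>. ?h \<tau> \<le> hmax" "\<exists>\<tau>. ?h \<tau> = hmax"
    proof -
      have fin: "finite (range ?h)"
        by (rule finite_subset[of _ "{..card J}"]) (auto intro!: card_mono J)
      have "Max (range ?h) \<in> range ?h" by (rule Max_in[OF fin]) simp
      then obtain \<tau>0 where t0: "Max (range ?h) = ?h \<tau>0" by (rule imageE)
      have "?h \<tau> \<le> ?h \<tau>0" for \<tau> unfolding t0[symmetric] by (rule Max_ge[OF fin]) simp
      then show thesis using that[of "?h \<tau>0"] by blast
    qed
    have lt: "real hmax < t / (2 * D) ^ CARD('n)" using neg hmax(2) by (auto simp: not_le)
    have "(\<Sum>j\<in>J. emeasure lborel (Hit j)) = (\<Sum>j\<in>J. \<integral>\<^sup>+ \<tau>. indicator (Hit j) \<tau> \<partial>lborel)"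
      using Hm by simp
    also have "\<dots> = (\<integral>\<^sup>+ \<tau>. (\<Sum>j\<in>J. indicator (Hit j) \<tau>) \<partial>lborel)"
      by (rule nn_integral_sum[symmetric]) (use Hm in auto)
    also have "\<dots> \<le> (\<integral>\<^sup>+ \<tau>. ennreal (real hmax) * indicator ?Q \<tau> \<partial>lborel)"
    proof (rule nn_integral_mono)
      fix \<tau>
      have "(\<Sum>j\<in>J. indicator (Hit j) \<tau> :: ennreal) = of_nat (?h \<tau>)"
        using J by (simp add: indicator_def sum.If_cases Int_def)
      also have "\<dots> \<le> ennreal (real hmax) * indicator ?Q \<tau>"
      proof (cases "\<tau> \<in> ?Q")
        case True
        then show ?thesis using hmax(1)[of \<tau>] by (simp add: ennreal_of_nat_eq_real_of_nat)
      next
        case False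
        then have e: "{j\<in>J. \<tau> \<in> Hit j} = {}" using Hsub by auto
        show ?thesis unfolding e by simp
      qed
      finally show "(\<Sum>j\<in>J. indicator (Hit j) \<tau>) \<le> ennreal (real hmax) * indicator ?Q \<tau>" .
    qed
    also have "\<dots> = ennreal (real hmax * (2 * D) ^ CARD('n))"
      using D by (subst nn_integral_cmult_indicator) (auto simp: volQ ennreal_mult)
    finally have "ennreal t \<le> ennreal (real hmax * (2 * D) ^ CARD('n))" using sumH by (rule order_trans[rotated])
    then have "t \<le> real hmax * (2 * D) ^ CARD('n)" using D by (subst (asm) ennreal_le_iff) auto
    then show False using lt D by (simp add: field_simps)
  qed
  then show ?thesis by (simp add: t_def Hit_def)
qed

section \<open>The model set\<close>

text \<open>The spacing \<open>L\<close> cancels the denominator in \<open>gap_point\<close>, and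
  the errors of the \<open>d\<close> generators add up to at most 1/16 in the phase. This is half of
  the 1/8 allowed in \<open>extension_lower_bound\<close>; the other half is reserved for the size
  of the caps.\<close>

definition model_set :: "nat \<Rightarrow> nat \<Rightarrow> real \<Rightarrow> (nat \<Rightarrow> real^'n) \<Rightarrow> (real^'n) set" where
  "model_set d L R u = {x. norm x < R \<and> (\<forall>i<d. \<exists>z::int. \<bar>x \<bullet> u i - real L * of_int z\<bar> < 1 / (16 * real d))}"

lemma norm_le_CARD:
  fixes u :: "real^'n"
  assumes "\<And>j. \<bar>u$j\<bar> \<le> c"
  shows "norm u \<le> real CARD('n) * c"
proof -
  have "norm u \<le> (\<Sum>j\<in>UNIV. \<bar>u$j\<bar>)" by (rule norm_le_l1_cart)
  also have "\<dots> \<le> (\<Sum>j\<in>(UNIV::'n set). c)" by (intro sum_mono assms)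
  finally show ?thesis by simp
qed

lemma norm_cube_le: "u \<in> cbox 0 1 \<Longrightarrow> norm (u::real^'n) \<le> real CARD('n)"
  using norm_le_CARD[of u 1] by (simp add: mem_box_cart abs_le_iff)

lemma model_set_borel: "model_set d L R u \<in> sets borel"
  unfolding model_set_def by measurable

lemma ball_subset_model_set:
  fixes u :: "nat \<Rightarrow> real^'n"
  assumes d: "1 \<le> d" and R: "0 < R" and u: "\<And>i. i < d \<Longrightarrow> u i \<in> cbox 0 1"
  shows "\<exists>\<eta>>0. ball 0 \<eta> \<subseteq> model_set d L R u"
proof (intro exI conjI subsetI)
  let ?e = "min R (1 / (16 * real d * real CARD('n)))"
  show "0 < ?e" using d R by simp
  fix x :: "real^'n" assume x: "x \<in> ball 0 ?e"
  have "\<bar>x \<bullet> u i\<bar> < 1 / (16 * real d)" if "i < d" for i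
  proof -
    have "\<bar>x \<bullet> u i\<bar> \<le> norm x * norm (u i)" by (rule Cauchy_Schwarz_ineq2)
    also have "\<dots> \<le> norm x * real CARD('n)" by (intro mult_left_mono norm_cube_le u that) auto
    also have "\<dots> < 1 / (16 * real d * real CARD('n)) * real CARD('n)" using x by (intro mult_strict_right_mono) auto
    finally show ?thesis by simp
  qed
  then show "x \<in> model_set d L R u" using x unfolding model_set_def by (auto intro!: exI[of _ 0])
qed

lemma model_set_phase:
  fixes u :: "nat \<Rightarrow> real^'n"
  assumes x: "x \<in> model_set d L R u" and m: "m \<in> gap_index d L" and L: "1 \<le> L"
  shows "\<exists>z::int. \<bar>x \<bullet> gap_point d L u m - of_int z\<bar> \<le> 1/16"
proof -
  have "\<forall>i. \<exists>z::int. i < d \<longrightarrow> \<bar>x \<bullet> u i - real L * of_int z\<bar> < 1 / (16 * real d)"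
    using x by (auto simp: model_set_def)
  then obtain z :: "nat \<Rightarrow> int" where z: "\<And>i. i < d \<Longrightarrow> \<bar>x \<bullet> u i - real L * of_int (z i)\<bar> < 1 / (16 * real d)" by metis
  have "x \<bullet> gap_point d L u m - of_int (\<Sum>i<d. int (m i) * z i)
      = (\<Sum>i<d. (real (m i) / real L) * (x \<bullet> u i - real L * of_int (z i)))"
    using L by (simp add: gap_point_def inner_sum_right right_diff_distrib sum_subtractf)
  also have "\<bar>\<dots>\<bar> \<le> (\<Sum>i<d. \<bar>(real (m i) / real L) * (x \<bullet> u i - real L * of_int (z i))\<bar>)" by (rule sum_abs)
  also have "\<dots> \<le> (\<Sum>i<d. 1 / (16 * real d))"
  proof (rule sum_mono)
    fix i assume i: "i \<in> {..<d}"
    then have "m i < L" using m by (auto simp: gap_index_def)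
    then have "real (m i) / real L \<le> 1" using L by simp
    then have "real (m i) / real L * \<bar>x \<bullet> u i - real L * of_int (z i)\<bar> \<le> 1 * (1 / (16 * real d))"
      using z[of i] i by (intro mult_mono) auto
    then show "\<bar>(real (m i) / real L) * (x \<bullet> u i - real L * of_int (z i))\<bar> \<le> 1 / (16 * real d)"
      by (simp add: abs_mult)
  qed
  also have "\<dots> \<le> 1/16" by simp
  finally show ?thesis by blast
qed

text \<open>Pigeonhole on the torus, followed by a translation of the fullest cell to the origin.\<close>

lemma measure_model_set_ge:
  fixes u :: "nat \<Rightarrow> real^'n"
  assumes d: "1 \<le> d" and L: "1 \<le> L" and R: "0 < R"
  shows "measure lborel (ball (0::real^'n) (R/2)) / real (16 * d * L) ^ d \<le> measure lborel (model_set d L R u)"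
proof -
  let ?n = "16 * d * L"
  \<comment> \<open>\<open>16 * d * L\<close> intervals for the fractional part of
    \<open>x \<bullet> u i / L\<close> amount to a length \<open>1 / (16 * d)\<close> in
    \<open>x \<bullet> u i\<close>, the tolerance of \<open>model_set\<close>. The points are taken
    from the ball of radius \<open>R / 2\<close> so that their differences have norm below
    \<open>R\<close>.\<close>
  define \<kappa> where "\<kappa> = (\<lambda>(x::real^'n) i. \<lfloor>real ?n * frac (x \<bullet> u i / real L)\<rfloor>)"
  define I where "I = PiE {..<d} (\<lambda>_. {0..<int ?n})"
  define E where "E = (\<lambda>m. {x\<in>ball 0 (R/2). \<forall>i<d. \<kappa> x i = m i})"
  have "card {0..<int ?n} = ?n" by (simp only: card_atLeastLessThan_int diff_0_right nat_int)
  then have I: "finite I" "card I = ?n ^ d"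
    by (simp_all only: I_def finite_PiE finite_lessThan finite_atLeastLessThan_int card_PiE prod_constant card_lessThan)
  have "(\<lambda>x. \<kappa> x i) \<in> measurable borel (count_space UNIV)" for i
    unfolding \<kappa>_def frac_def by measurable
  from measurable_sets[OF this] have km: "(\<lambda>x. \<kappa> x i) -` {c} \<in> sets borel" for i c by simp
  have Em: "E m \<in> sets lborel" for m
  proof -
    have "E m = ball 0 (R/2) \<inter> (\<Inter>i\<in>{..<d}. (\<lambda>x. \<kappa> x i) -` {m i})" by (auto simp: E_def)
    moreover have "(\<Inter>i\<in>{..<d}. (\<lambda>x. \<kappa> x i) -` {m i}) \<in> sets borel"
      by (rule sets.finite_INT) (use km d in \<open>auto simp: lessThan_empty_iff\<close>)
    ultimately show ?thesis by simp
  qed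
  have Ef: "emeasure lborel (E m) < \<infinity>" for m
    by (rule emeasure_bounded_finite) (rule bounded_subset[OF bounded_ball[of 0 "R/2"]], auto simp: E_def)
  have cov: "ball 0 (R/2) \<subseteq> (\<Union>m\<in>I. E m)"
  proof
    fix x :: "real^'n" assume x: "x \<in> ball 0 (R/2)"
    have "\<kappa> x i \<in> {0..<int ?n}" for i
    proof -
      have "0 \<le> real ?n * frac (x \<bullet> u i / real L)" by simp
      moreover have "real ?n * frac (x \<bullet> u i / real L) < real ?n * 1"
        using d L frac_lt_1 by (intro mult_strict_left_mono) auto
      ultimately show ?thesis unfolding \<kappa>_def by (simp add: floor_less_iff)
    qed
    then have "restrict (\<kappa> x) {..<d} \<in> I" unfolding I_def by auto
    moreover have "x \<in> E (restrict (\<kappa> x) {..<d})" using x by (auto simp: E_def)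
    ultimately show "x \<in> (\<Union>m\<in>I. E m)" by blast
  qed
  have "measure lborel (ball (0::real^'n) (R/2)) \<le> measure lborel (\<Union>m\<in>I. E m)"
  proof (rule measure_mono_fmeasurable[OF cov])
    show "(\<Union>m\<in>I. E m) \<in> fmeasurable lborel"
      by (rule fmeasurable.finite_UN[OF I(1)]) (use Em Ef in \<open>auto simp: fmeasurable_def\<close>)
  qed simp
  also have "\<dots> \<le> (\<Sum>m\<in>I. measure lborel (E m))"
    by (rule measure_UNION_le[OF I(1)]) (rule Em)
  finally have sum_ge: "measure lborel (ball (0::real^'n) (R/2)) \<le> (\<Sum>m\<in>I. measure lborel (E m))" .
  have "\<exists>m\<in>I. measure lborel (ball (0::real^'n) (R/2)) / real ?n ^ d \<le> measure lborel (E m)"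
  proof (rule ccontr)
    assume neg: "\<not> ?thesis"
    have "I \<noteq> {}" using I(2) d L by auto
    then have "(\<Sum>m\<in>I. measure lborel (E m)) < (\<Sum>m\<in>I. measure lborel (ball (0::real^'n) (R/2)) / real ?n ^ d)"
      using neg by (intro sum_strict_mono I) (auto simp: not_le)
    also have "\<dots> = measure lborel (ball (0::real^'n) (R/2))" using I(2) d L by simp
    finally show False using sum_ge by simp
  qed
  then obtain m where m: "measure lborel (ball (0::real^'n) (R/2)) / real ?n ^ d \<le> measure lborel (E m)" by blast
  have "0 < measure lborel (ball (0::real^'n) (R/2)) / real ?n ^ d"
    using R d L content_ball_pos[of "R/2" "0::real^'n"] by simp
  then have "E m \<noteq> {}" using m by auto
  then obtain x0 where x0: "x0 \<in> E m" by blast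
  define V where "V = (\<lambda>x. x + x0) -` E m"
  have Vm: "V \<in> sets lborel"
  proof -
    have "(\<lambda>x. x + x0) \<in> borel_measurable borel" by measurable
    from measurable_sets[OF this] Em show ?thesis by (simp add: V_def)
  qed
  have sub: "V \<subseteq> model_set d L R u"
  proof
    fix w assume "w \<in> V"
    then obtain x where x: "x \<in> E m" "w = x - x0" unfolding V_def by (metis add_diff_cancel_right' vimage_eq)
    have "norm w \<le> norm x + norm x0" unfolding x(2) by (rule norm_triangle_ineq4)
    also have "\<dots> < R" using x(1) x0 by (auto simp: E_def)
    finally have nw: "norm w < R" .
    have "\<exists>z::int. \<bar>w \<bullet> u i - real L * of_int z\<bar> < 1 / (16 * real d)" if "i < d" for i
    proof -
      let ?p = "x \<bullet> u i / real L" and ?q = "x0 \<bullet> u i / real L"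
      have "\<lfloor>real ?n * frac ?p\<rfloor> = \<lfloor>real ?n * frac ?q\<rfloor>"
        using x(1) x0 that unfolding E_def \<kappa>_def by simp
      then have "\<bar>real ?n * frac ?p - real ?n * frac ?q\<bar> < 1" by linarith
      then have "\<bar>real ?n * (frac ?p - frac ?q)\<bar> < 1" by (simp only: right_diff_distrib)
      then have "real ?n * \<bar>frac ?p - frac ?q\<bar> < 1" by (simp only: abs_mult abs_of_nat)
      then have 1: "real L * \<bar>frac ?p - frac ?q\<bar> < 1 / (16 * real d)" using d by (simp add: field_simps)
      have "w \<bullet> u i = real L * (?p - ?q)" using L by (simp add: x(2) inner_diff_left field_simps)
      then have "w \<bullet> u i - real L * of_int (\<lfloor>?p\<rfloor> - \<lfloor>?q\<rfloor>) = real L * (frac ?p - frac ?q)"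
        by (simp add: frac_def algebra_simps)
      then have "\<bar>w \<bullet> u i - real L * of_int (\<lfloor>?p\<rfloor> - \<lfloor>?q\<rfloor>)\<bar> = real L * \<bar>frac ?p - frac ?q\<bar>"
        by (simp only: abs_mult abs_of_nat)
      then show ?thesis using 1 by metis
    qed
    then show "w \<in> model_set d L R u" using nw by (simp add: model_set_def)
  qed
  have "emeasure lborel V = (\<integral>\<^sup>+ x. indicator (E m) (x + x0) \<partial>lborel)"
    unfolding nn_integral_indicator[OF Vm, symmetric] by (rule nn_integral_cong) (simp add: V_def indicator_def)
  also have "\<dots> = (\<integral>\<^sup>+ x. indicator (E m) x \<partial>lborel)"
    by (rule nn_integral_lborel_translate) (use Em in auto)
  also have "\<dots> = emeasure lborel (E m)" by (rule nn_integral_indicator[OF Em])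
  finally have "measure lborel (E m) = measure lborel V" by (simp add: measure_def)
  also have "\<dots> \<le> measure lborel (model_set d L R u)"
  proof (rule measure_mono_fmeasurable[OF sub Vm])
    have "bounded (model_set d L R u)" by (rule bounded_subset[OF bounded_ball[of 0 R]]) (auto simp: model_set_def)
    then show "model_set d L R u \<in> fmeasurable lborel"
      using emeasure_bounded_finite model_set_borel by (auto simp: fmeasurable_def)
  qed
  finally show ?thesis using m by simp
qed

text \<open>The discretised directions and distance chains over which the union bound runs; a generator lies in
  \<open>chain_set q L \<nu> k\<close> if it does not exclude that the tube direction \<open>\<nu>\<close> carries the chain \<open>k\<close>.\<close>

definition chain_dirs :: "nat \<Rightarrow> (real^'n) set" where
  "chain_dirs H = {\<nu>. (\<forall>j. \<exists>z::int. \<bar>z\<bar> \<le> int H \<and> \<nu>$j = of_int z / real H) \<and> 1/4 \<le> \<nu> \<bullet> \<nu>}"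

definition chain_lengths :: "nat \<Rightarrow> nat \<Rightarrow> real \<Rightarrow> (nat \<Rightarrow> nat) set" where
  "chain_lengths q L R = {k \<in> PiE {..<q} (\<lambda>j. {k. 1 \<le> k \<and> real (k * L ^ (q - 1 - j)) \<le> 8 * R}).
     4 * L \<le> k 0 \<and> (\<forall>j. Suc j < q \<longrightarrow> L * k j \<le> k (Suc j))}"

definition chain_set :: "nat \<Rightarrow> nat \<Rightarrow> real^'n \<Rightarrow> (nat \<Rightarrow> nat) \<Rightarrow> (real^'n) set" where
  "chain_set q L \<nu> k = {u. \<forall>j<q. \<exists>z::int. \<bar>real (k j) * (\<nu> \<bullet> u) - real L * of_int z\<bar> \<le> 5 * real CARD('n) + 1}"

section \<open>Counting directions and chains, and the bound for tubes\<close>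

lemma card_chain_dirs:
  shows "finite (chain_dirs H :: (real^'n) set)" "card (chain_dirs H :: (real^'n) set) \<le> (2 * H + 1) ^ CARD('n)"
proof -
  let ?F = "PiE (UNIV::'n set) (\<lambda>_. {- int H..int H})"
  let ?g = "\<lambda>z::'n \<Rightarrow> int. \<chi> j. of_int (z j) / real H"
  have "card {- int H..int H} = 2 * H + 1" by simp
  then have F: "finite ?F" "card ?F = (2 * H + 1) ^ CARD('n)"
    by (simp_all only: finite_PiE finite finite_atLeastAtMost_int card_PiE prod_constant)
  have sub: "chain_dirs H \<subseteq> ?g ` ?F"
  proof
    fix \<nu> :: "real^'n" assume "\<nu> \<in> chain_dirs H"
    then have "\<forall>j. \<exists>z::int. \<bar>z\<bar> \<le> int H \<and> \<nu>$j = of_int z / real H" by (simp add: chain_dirs_def)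
    then obtain z where z: "\<And>j. \<bar>z j\<bar> \<le> int H" "\<And>j. \<nu>$j = of_int (z j) / real H" by metis
    have "- int H \<le> z j" "z j \<le> int H" for j using z(1)[of j] by linarith+
    then have "z \<in> ?F" by (intro PiE_I) simp_all
    moreover have "\<nu> = ?g z" using z(2) by (simp add: vec_eq_iff)
    ultimately show "\<nu> \<in> ?g ` ?F" by blast
  qed
  show "finite (chain_dirs H :: (real^'n) set)" by (rule finite_subset[OF sub finite_imageI[OF F(1)]])
  show "card (chain_dirs H :: (real^'n) set) \<le> (2 * H + 1) ^ CARD('n)"
    using order_trans[OF card_mono[OF finite_imageI[OF F(1)] sub] card_image_le[OF F(1)]] unfolding F(2) .
qed

lemma card_nat_upto_real:
  fixes x :: real
  assumes "0 \<le> x"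
  shows "finite {k::nat. 1 \<le> k \<and> real k \<le> x}" "real (card {k::nat. 1 \<le> k \<and> real k \<le> x}) \<le> x"
proof -
  have "{k::nat. 1 \<le> k \<and> real k \<le> x} = {1..nat \<lfloor>x\<rfloor>}"
    using assms by (auto simp: le_nat_floor le_floor_iff nat_le_iff) (metis le_nat_floor of_nat_floor order_trans of_nat_le_iff)
  then show "finite {k::nat. 1 \<le> k \<and> real k \<le> x}" "real (card {k::nat. 1 \<le> k \<and> real k \<le> x}) \<le> x"
    using assms by (auto simp: of_nat_floor)
qed

text \<open>The entry \<open>k j\<close> has at most \<open>8 * R / L ^ (q - 1 - j)\<close> values.
  The product of these savings is a power of \<open>L\<close> with exponent about q^2/2, and it pays
  for the number of directions in the union bound.\<close>

lemma card_chain_lengths: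
  assumes L: "1 \<le> L" and R: "0 \<le> R"
  shows "finite (chain_lengths q L R)"
    "real (card (chain_lengths q L R)) * real L ^ (\<Sum>j<q. q - 1 - j) \<le> (8 * R) ^ q"
proof -
  let ?G = "\<lambda>j. {k::nat. 1 \<le> k \<and> real (k * L ^ (q - 1 - j)) \<le> 8 * R}"
  let ?F = "PiE {..<q} ?G"
  have eq: "?G j = {k. 1 \<le> k \<and> real k \<le> 8 * R / real L ^ (q - 1 - j)}" for j
    using L by (simp add: field_simps)
  have G: "finite (?G j)" "real (card (?G j)) \<le> 8 * R / real L ^ (q - 1 - j)" for j
    unfolding eq by (rule card_nat_upto_real; use R L in simp)+
  have F: "finite ?F" by (intro finite_PiE G) auto
  have sub: "chain_lengths q L R \<subseteq> ?F" by (auto simp: chain_lengths_def)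
  show "finite (chain_lengths q L R)" by (rule finite_subset[OF sub F])
  have "real (card (chain_lengths q L R)) \<le> real (card ?F)" using card_mono[OF F sub] by simp
  also have "\<dots> = (\<Prod>j<q. real (card (?G j)))" by (simp add: card_PiE)
  also have "\<dots> \<le> (\<Prod>j<q. 8 * R / real L ^ (q - 1 - j))" by (intro prod_mono conjI G) auto
  also have "\<dots> = (8 * R) ^ q / real L ^ (\<Sum>j<q. q - 1 - j)" by (simp add: prod_dividef power_sum)
  finally show "real (card (chain_lengths q L R)) * real L ^ (\<Sum>j<q. q - 1 - j) \<le> (8 * R) ^ q"
    using L by (simp add: pos_le_divide_eq)
qed

text \<open>The tube axis is cut into unit slots. If \<open>(9 * L) ^ q\<close> of them were
  occupied, they would contain a lacunary chain of distances. Differences of points of the model set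
  still have products with \<open>u i\<close> close to multiples of \<open>L\<close>, so no
  generator would exclude this chain.\<close>

lemma model_set_tube_le:
  fixes u :: "nat \<Rightarrow> real^'n"
  assumes d: "1 \<le> d" and L: "1 \<le> L" and q: "1 \<le> q" and R: "0 < R" "R \<le> real L ^ d"
    and u: "\<And>i. i < d \<Longrightarrow> u i \<in> cbox 0 1"
    and nochain: "\<And>\<nu> k. \<nu> \<in> chain_dirs (4 * CARD('n) * L ^ d) \<Longrightarrow> k \<in> chain_lengths q L R \<Longrightarrow>
       \<exists>i<d. u i \<notin> chain_set q L \<nu> k"
    and nu: "norm \<nu>' = 1"
  shows "emeasure lborel (model_set d L R u \<inter> tube \<nu>' a)
    \<le> ennreal (real ((9 * L) ^ q) * measure lborel (ball (0::real^'n) 2))"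
proof -
  let ?W = "model_set d L R u" and ?n = "real CARD('n)"
  define S where "S = {k::int. \<exists>x\<in>?W. \<exists>t. \<lfloor>t\<rfloor> = k \<and> dist x (a + t *\<^sub>R \<nu>') < 1}"
  have diff: "\<bar>t - t'\<bar> \<le> 2 * R + 2" if "x \<in> ?W" "x' \<in> ?W" "dist x (a + t *\<^sub>R \<nu>') < 1" "dist x' (a + t' *\<^sub>R \<nu>') < 1" for x x' t t'
  proof -
    have "norm ((t - t') *\<^sub>R \<nu>') = norm ((x - x') - (x - (a + t *\<^sub>R \<nu>')) + (x' - (a + t' *\<^sub>R \<nu>')))"
      by (simp add: algebra_simps)
    also have "\<dots> \<le> norm x + norm x' + norm (x - (a + t *\<^sub>R \<nu>')) + norm (x' - (a + t' *\<^sub>R \<nu>'))"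
      using norm_triangle_ineq[of "(x - x') - (x - (a + t *\<^sub>R \<nu>'))" "x' - (a + t' *\<^sub>R \<nu>')"]
        norm_triangle_ineq4[of "x - x'" "x - (a + t *\<^sub>R \<nu>')"] norm_triangle_ineq4[of x x'] by linarith
    also have "\<dots> \<le> 2 * R + 2" using that by (auto simp: model_set_def dist_norm)
    finally show ?thesis using nu by simp
  qed
  have kdiff: "real_of_int \<bar>k - k'\<bar> \<le> 2 * R + 3" if kk: "k \<in> S" "k' \<in> S" for k k'
  proof -
    obtain x t where 1: "x \<in> ?W" "\<lfloor>t\<rfloor> = k" "dist x (a + t *\<^sub>R \<nu>') < 1" using kk(1) by (auto simp: S_def)
    obtain x' t' where 2: "x' \<in> ?W" "\<lfloor>t'\<rfloor> = k'" "dist x' (a + t' *\<^sub>R \<nu>') < 1" using kk(2) by (auto simp: S_def)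
    have "\<bar>t - t'\<bar> \<le> 2 * R + 2" using diff[OF 1(1) 2(1) 1(3) 2(3)] .
    then show ?thesis using 1(2) 2(2) by linarith
  qed
  have finS: "finite S"
  proof (cases "S = {}")
    case False
    then obtain k0 where k0: "k0 \<in> S" by blast
    have "S \<subseteq> {k0 - \<lceil>2 * R + 3\<rceil>..k0 + \<lceil>2 * R + 3\<rceil>}"
    proof
      fix k assume "k \<in> S"
      then have "real_of_int \<bar>k - k0\<bar> \<le> 2 * R + 3" using kdiff k0 by blast
      then show "k \<in> {k0 - \<lceil>2 * R + 3\<rceil>..k0 + \<lceil>2 * R + 3\<rceil>}" by simp linarith
    qed
    then show ?thesis by (rule finite_subset) simp
  qed simp
  have cardS: "card S < (9 * L) ^ q"
  proof (rule ccontr)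
    assume "\<not> ?thesis"
    then have "(9 * L) ^ q \<le> card S" by simp
    from exists_lacunary_differences[OF L finS this]
    obtain s0 s where s: "s0 \<in> S" "\<And>j. j < q \<Longrightarrow> s j \<in> S" "\<And>j. j < q \<Longrightarrow> 4 * int L \<le> \<bar>s j - s0\<bar>"
      "\<And>j. Suc j < q \<Longrightarrow> int L * \<bar>s j - s0\<bar> \<le> \<bar>s (Suc j) - s0\<bar>" by blast
    \<comment> \<open>Rounding to this grid moves the direction by at most
      \<open>1 / (4 * L ^ d)\<close>, so the error stays bounded even over a length of
      \<open>5 * L ^ d\<close>.\<close>
    let ?H = "4 * CARD('n) * L ^ d"
    have H: "0 < real ?H" using L by simp
    define \<nu> :: "real^'n" where "\<nu> = (\<chi> j. of_int \<lfloor>real ?H * \<nu>'$j\<rfloor> / real ?H)"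
    have nuj: "\<bar>\<nu>'$j\<bar> \<le> 1" for j using component_le_norm_cart[of \<nu>' j] nu by simp
    have close: "norm (\<nu> - \<nu>') \<le> 1 / (4 * real L ^ d)"
    proof -
      have "\<bar>(\<nu> - \<nu>')$j\<bar> \<le> 1 / real ?H" for j
      proof -
        have "(\<nu> - \<nu>')$j = of_int \<lfloor>real ?H * \<nu>'$j\<rfloor> / real ?H - \<nu>'$j"
          by (simp only: \<nu>_def vector_minus_component vec_lambda_beta)
        also have "\<dots> = of_int \<lfloor>real ?H * \<nu>'$j\<rfloor> / real ?H - real ?H * \<nu>'$j / real ?H"
          using H by (subst nonzero_mult_div_cancel_left) (simp_all only: less_imp_neq[symmetric] refl not_False_eq_True)
        also have "\<dots> = (of_int \<lfloor>real ?H * \<nu>'$j\<rfloor> - real ?H * \<nu>'$j) / real ?H" by (rule diff_divide_distrib[symmetric])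
        finally have "(\<nu> - \<nu>')$j = (of_int \<lfloor>real ?H * \<nu>'$j\<rfloor> - real ?H * \<nu>'$j) / real ?H" .
        moreover have "\<bar>of_int \<lfloor>real ?H * \<nu>'$j\<rfloor> - real ?H * \<nu>'$j\<bar> \<le> 1" by linarith
        ultimately show ?thesis using H by (simp only: abs_divide) (simp add: divide_right_mono)
      qed
      then have "norm (\<nu> - \<nu>') \<le> ?n * (1 / real ?H)" by (rule norm_le_CARD)
      also have "\<dots> = 1 / (4 * real L ^ d)" using L by (simp add: field_simps)
      finally show ?thesis .
    qed
    have Ld: "1 \<le> real L ^ d" using L by simp
    then have "1 / (4 * real L ^ d) \<le> 1/4" by (simp add: divide_le_eq)
    then have "3/4 \<le> norm \<nu>" using close nu norm_triangle_ineq2[of \<nu>' \<nu>] by (simp add: norm_minus_commute)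
    then have "(3/4)\<^sup>2 \<le> (norm \<nu>)\<^sup>2" by (intro power_mono) auto
    then have nn: "1/4 \<le> \<nu> \<bullet> \<nu>" by (simp add: dot_square_norm power2_eq_square)
    have dirs: "\<nu> \<in> chain_dirs ?H"
      unfolding chain_dirs_def
    proof (intro CollectI conjI allI nn)
      fix j
      have "\<bar>real ?H * \<nu>'$j\<bar> \<le> real ?H * 1" unfolding abs_mult using nuj H by (intro mult_mono) auto
      then have "\<bar>\<lfloor>real ?H * \<nu>'$j\<rfloor>\<bar> \<le> int ?H"
        by (simp only: abs_le_iff mult_1_right) linarith
      then show "\<exists>z::int. \<bar>z\<bar> \<le> int ?H \<and> \<nu>$j = of_int z / real ?H"
        by (intro exI[of _ "\<lfloor>real ?H * \<nu>'$j\<rfloor>"] conjI) (simp_all only: \<nu>_def vec_lambda_beta)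
    qed
    define k where "k = restrict (\<lambda>j. nat \<bar>s j - s0\<bar>) {..<q}"
    have kj: "k j = nat \<bar>s j - s0\<bar>" "real (k j) = real_of_int \<bar>s j - s0\<bar>" if "j < q" for j
      using that by (auto simp: k_def)
    \<comment> \<open>All distances lie between 4 and \<open>2 * R + 3\<close>. This forces
      \<open>1/2 \<le> R\<close>, and then \<open>2 * R + 3 \<le> 8 * R\<close>.\<close>
    have k8: "real (k j) \<le> 8 * R" if "j < q" for j
    proof -
      have "real (k j) \<le> 2 * R + 3" using kdiff[OF s(2)[OF that] s(1)] kj[OF that] by simp
      moreover have "4 \<le> real (k j)" using s(3)[OF that] L kj(2)[OF that] by linarith
      ultimately show ?thesis by linarith
    qed
    have kstep: "L * k j \<le> k (Suc j)" if "Suc j < q" for j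
    proof -
      have "int (L * k j) \<le> int (k (Suc j))" using s(4)[OF that] kj(1)[of j] kj(1)[OF that] that by simp
      then show ?thesis by (simp only: of_nat_le_iff)
    qed
    have kpow: "k j * L ^ (q - 1 - j) \<le> k (q - 1)" if "j < q" for j
      using that
    proof (induction "q - 1 - j" arbitrary: j)
      case 0
      then have "j = q - 1" by simp
      then show ?case by simp
    next
      case (Suc e)
      then have sj: "Suc j < q" by simp
      have "q - 1 - j = Suc (q - 1 - Suc j)" using sj by simp
      then have "k j * L ^ (q - 1 - j) = (L * k j) * L ^ (q - 1 - Suc j)" by (simp add: mult_ac)
      also have "\<dots> \<le> k (Suc j) * L ^ (q - 1 - Suc j)" by (intro mult_right_mono kstep sj) auto
      also have "\<dots> \<le> k (q - 1)" using Suc.hyps(1)[of "Suc j"] Suc.hyps(2) sj by simp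
      finally show ?case .
    qed
    have lens: "k \<in> chain_lengths q L R"
      unfolding chain_lengths_def
    proof (intro CollectI conjI allI impI kstep)
      show "k \<in> PiE {..<q} (\<lambda>j. {k. 1 \<le> k \<and> real (k * L ^ (q - 1 - j)) \<le> 8 * R})"
      proof (rule PiE_I)
        fix j assume "j \<in> {..<q}"
        then have j: "j < q" by simp
        have "1 \<le> k j" using s(3)[OF j] L kj(1)[OF j] by linarith
        moreover have "real (k j * L ^ (q - 1 - j)) \<le> 8 * R"
          using kpow[OF j] k8[of "q - 1"] q by (meson diff_less of_nat_le_iff order_trans zero_less_one less_le_trans)
        ultimately show "k j \<in> {k. 1 \<le> k \<and> real (k * L ^ (q - 1 - j)) \<le> 8 * R}" by simp
      qed (simp add: k_def)
      show "4 * L \<le> k 0" using s(3)[of 0] q kj(1)[of 0] by linarith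
    qed
    have "u i \<in> chain_set q L \<nu> k" if i: "i < d" for i
      unfolding chain_set_def
    proof (intro CollectI allI impI)
      fix j assume j: "j < q"
      obtain x t where 1: "x \<in> ?W" "\<lfloor>t\<rfloor> = s j" "dist x (a + t *\<^sub>R \<nu>') < 1" using s(2)[OF j] by (auto simp: S_def)
      obtain x0 t0 where 2: "x0 \<in> ?W" "\<lfloor>t0\<rfloor> = s0" "dist x0 (a + t0 *\<^sub>R \<nu>') < 1" using s(1) by (auto simp: S_def)
      define \<kappa> where "\<kappa> = real_of_int (s j - s0)"
      \<comment> \<open>Collects the errors of replacing the difference of two points by a multiple
        of the grid direction: rounding of the direction, rounding of the axis parameters, and the
        distances of both points from the axis. Paired with \<open>u i\<close>, whose norm is at
        most n, and with the tolerances of the model set added, they give the bound 5 n + 1 in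
        \<open>chain_set\<close>.\<close>
      define E where "E = \<kappa> *\<^sub>R (\<nu> - \<nu>') + (\<kappa> - (t - t0)) *\<^sub>R \<nu>' - (x - (a + t *\<^sub>R \<nu>')) + (x0 - (a + t0 *\<^sub>R \<nu>'))"
      have E: "\<kappa> *\<^sub>R \<nu> = (x - x0) + E" by (simp add: E_def algebra_simps)
      have "\<bar>\<kappa>\<bar> \<le> 2 * R + 3" using kdiff[OF s(2)[OF j] s(1)] by (simp add: \<kappa>_def)
      then have "\<bar>\<kappa>\<bar> \<le> 5 * real L ^ d" using R(2) Ld by linarith
      then have "\<bar>\<kappa>\<bar> * norm (\<nu> - \<nu>') \<le> 5 * real L ^ d * (1 / (4 * real L ^ d))" using close by (intro mult_mono) auto
      also have "\<dots> = 5/4" using L by simp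
      finally have e1: "norm (\<kappa> *\<^sub>R (\<nu> - \<nu>')) \<le> 5/4" by simp
      have "\<bar>\<kappa> - (t - t0)\<bar> \<le> 1" using 1(2) 2(2) unfolding \<kappa>_def by linarith
      then have e2: "norm ((\<kappa> - (t - t0)) *\<^sub>R \<nu>') \<le> 1" using nu by simp
      have e3: "norm (x - (a + t *\<^sub>R \<nu>')) < 1" "norm (x0 - (a + t0 *\<^sub>R \<nu>')) < 1" using 1(3) 2(3) by (auto simp: dist_norm)
      have nE: "norm E \<le> 5"
        using e1 e2 e3 unfolding E_def
          norm_triangle_ineq[of "\<kappa> *\<^sub>R (\<nu> - \<nu>') + (\<kappa> - (t - t0)) *\<^sub>R \<nu>' - (x - (a + t *\<^sub>R \<nu>'))" "x0 - (a + t0 *\<^sub>R \<nu>')"]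
        using norm_triangle_ineq[of "\<kappa> *\<^sub>R (\<nu> - \<nu>') + (\<kappa> - (t - t0)) *\<^sub>R \<nu>' - (x - (a + t *\<^sub>R \<nu>'))" "x0 - (a + t0 *\<^sub>R \<nu>')"]
          norm_triangle_ineq4[of "\<kappa> *\<^sub>R (\<nu> - \<nu>') + (\<kappa> - (t - t0)) *\<^sub>R \<nu>'" "x - (a + t *\<^sub>R \<nu>')"]
          norm_triangle_ineq[of "\<kappa> *\<^sub>R (\<nu> - \<nu>')" "(\<kappa> - (t - t0)) *\<^sub>R \<nu>'"]
        by linarith
      have "\<bar>E \<bullet> u i\<bar> \<le> norm E * norm (u i)" by (rule Cauchy_Schwarz_ineq2)
      also have "\<dots> \<le> 5 * ?n" by (intro mult_mono nE norm_cube_le u i) auto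
      finally have Eu: "\<bar>E \<bullet> u i\<bar> \<le> 5 * ?n" .
      obtain z1 z2 :: int where z: "\<bar>x \<bullet> u i - real L * of_int z1\<bar> < 1 / (16 * real d)" "\<bar>x0 \<bullet> u i - real L * of_int z2\<bar> < 1 / (16 * real d)"
        using 1(1) 2(1) i unfolding model_set_def by blast
      have d16: "1 / (16 * real d) \<le> 1/16" using d by (simp add: field_simps)
      have "\<kappa> * (\<nu> \<bullet> u i) = (x \<bullet> u i - x0 \<bullet> u i) + E \<bullet> u i"
        using arg_cong[OF E, of "\<lambda>v. v \<bullet> u i"] by (simp add: inner_add_left inner_diff_left)
      moreover have "real L * of_int (z1 - z2) = real L * of_int z1 - real L * of_int z2" by (simp add: algebra_simps)
      ultimately have main: "\<bar>\<kappa> * (\<nu> \<bullet> u i) - real L * of_int (z1 - z2)\<bar> \<le> 5 * ?n + 1"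
        using Eu z d16 by linarith
      show "\<exists>z::int. \<bar>real (k j) * (\<nu> \<bullet> u i) - real L * of_int z\<bar> \<le> 5 * ?n + 1"
      proof (cases "0 \<le> \<kappa>")
        case True
        then have "real (k j) = \<kappa>" using kj(2)[OF j] by (simp add: \<kappa>_def)
        then show ?thesis using main by (intro exI[of _ "z1 - z2"]) simp
      next
        case False
        then have "real (k j) = - \<kappa>" using kj(2)[OF j] by (simp add: \<kappa>_def)
        then have "real (k j) * (\<nu> \<bullet> u i) - real L * of_int (z2 - z1) = - (\<kappa> * (\<nu> \<bullet> u i) - real L * of_int (z1 - z2))"
          by (simp add: algebra_simps)
        then show ?thesis using main by (intro exI[of _ "z2 - z1"]) (simp only: abs_minus_cancel)
      qed
    qed
    then show False using nochain[OF dirs lens] by blast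
  qed
  \<comment> \<open>A point is within 1 of the axis, and rounding its parameter down costs at most
    another 1; hence balls of radius 2.\<close>
  have "?W \<inter> tube \<nu>' a \<subseteq> (\<Union>k\<in>S. ball (a + of_int k *\<^sub>R \<nu>') 2)"
  proof
    fix x assume x: "x \<in> ?W \<inter> tube \<nu>' a"
    then obtain t where t: "dist x (a + t *\<^sub>R \<nu>') < 1" by (auto simp: tube_def)
    then have "\<lfloor>t\<rfloor> \<in> S" using x by (auto simp: S_def)
    moreover have "dist (a + of_int \<lfloor>t\<rfloor> *\<^sub>R \<nu>') x < 2"
    proof -
      have "dist (a + of_int \<lfloor>t\<rfloor> *\<^sub>R \<nu>') (a + t *\<^sub>R \<nu>') = \<bar>of_int \<lfloor>t\<rfloor> - t\<bar>"
        using nu by (simp add: dist_norm scaleR_diff_left[symmetric])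
      also have "\<dots> \<le> 1" by linarith
      finally show ?thesis using t dist_triangle[of "a + of_int \<lfloor>t\<rfloor> *\<^sub>R \<nu>'" x "a + t *\<^sub>R \<nu>'"] by (simp add: dist_commute)
    qed
    ultimately show "x \<in> (\<Union>k\<in>S. ball (a + of_int k *\<^sub>R \<nu>') 2)" by auto
  qed
  then have "emeasure lborel (?W \<inter> tube \<nu>' a) \<le> emeasure lborel (\<Union>k\<in>S. ball (a + of_int k *\<^sub>R \<nu>') 2)"
    using finS by (intro emeasure_mono) auto
  also have "\<dots> \<le> (\<Sum>k\<in>S. emeasure lborel (ball (a + of_int k *\<^sub>R \<nu>') 2))"
    by (rule emeasure_subadditive_finite[OF finS]) auto
  also have "\<dots> = (\<Sum>k\<in>S. ennreal (measure lborel (ball (0::real^'n) 2)))"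
  proof (rule sum.cong[OF refl])
    fix k
    have "emeasure lborel (ball (a + of_int k *\<^sub>R \<nu>') 2) = ennreal (measure lborel (ball (a + of_int k *\<^sub>R \<nu>') 2))"
      using emeasure_bounded_finite[OF bounded_ball, of "a + of_int k *\<^sub>R \<nu>'" 2] by (intro emeasure_eq_ennreal_measure) auto
    then show "emeasure lborel (ball (a + of_int k *\<^sub>R \<nu>') 2) = ennreal (measure lborel (ball (0::real^'n) 2))"
      by (simp add: content_ball)
  qed
  also have "\<dots> = ennreal (real (card S) * measure lborel (ball (0::real^'n) 2))"
    by (subst sum_ennreal) auto
  also have "\<dots> \<le> ennreal (real ((9 * L) ^ q) * measure lborel (ball (0::real^'n) 2))"
    by (intro ennreal_leI mult_right_mono of_nat_mono less_imp_le[OF cardS]) simp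
  finally show ?thesis .
qed

lemma chain_set_borel: "chain_set q L \<nu> k \<in> sets borel"
  unfolding chain_set_def by measurable

text \<open>The factor of the union bound that is free of \<open>L\<close>: from the directions,
  from the chains, and from the probability for one generator raised to the power \<open>d\<close>
  by independence.\<close>

definition chain_const :: "nat \<Rightarrow> nat \<Rightarrow> nat \<Rightarrow> real" where
  "chain_const n d q = (9 * real n) ^ n * 8 ^ q *
     (3 ^ n * (2 * (5 * real n + 1) * (2 + 2 * (5 * real n + 1))) ^ q) ^ d"

text \<open>At radius \<open>c * L ^ d\<close> the factor \<open>L ^ (d * q)\<close> in the count of
  chains cancels against the probability. The factor \<open>L ^ (d * n)\<close> from the directions
  is compensated by the lacunary saving through \<open>expo\<close>. What remains is a constant, and
  shrinking the radius by \<open>c\<close> makes it small.\<close>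

lemma exists_scale_configuration:
  fixes S :: "'j \<Rightarrow> (real^'n) set" and v D c :: real and d q L :: nat
  assumes dLq: "1 \<le> d" "1 \<le> L" "1 \<le> q" and c: "0 < c" "c \<le> 1"
    and expo: "d * CARD('n) \<le> (\<Sum>j<q. q - 1 - j)"
    and cc: "chain_const CARD('n) d q * c \<le> 1/4"
    and J: "finite J" "J \<noteq> {}"
    and S: "\<And>j. j \<in> J \<Longrightarrow> S j \<in> sets borel" "\<And>j. j \<in> J \<Longrightarrow> emeasure lborel (S j) = ennreal v"
    and v: "0 < v" "real L ^ (d + CARD('n)) * v \<le> 1/4"
    and D: "0 < D" "\<And>j x i. j \<in> J \<Longrightarrow> x \<in> S j \<Longrightarrow> \<bar>x$i\<bar> \<le> D - real d"
  shows "\<exists>u \<tau>. (\<forall>i<d. u i \<in> cbox 0 1) \<and>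
    (\<forall>\<nu> a. norm \<nu> = 1 \<longrightarrow> emeasure lborel (model_set d L (c * real L ^ d) u \<inter> tube \<nu> a)
      \<le> ennreal (real ((9 * L) ^ q) * measure lborel (ball (0::real^'n) 2))) \<and>
    real (card J) * real L ^ d * v / (2 * (2 * D) ^ CARD('n))
      \<le> real (card {j\<in>J. \<exists>m\<in>gap_index d L. \<tau> + gap_point d L u m \<in> S j})"
proof -
  let ?n = "CARD('n)" and ?C = "5 * real CARD('n) + 1"
  define R where "R = c * real L ^ d"
  have L1: "1 \<le> real L" using dLq by simp
  have Ld: "1 \<le> real L ^ d" using L1 by simp
  have R: "0 < R" "R \<le> real L ^ d" using c Ld L1 by (auto simp: R_def mult_left_le_one_le intro!: mult_pos_pos)
  let ?H = "4 * ?n * L ^ d"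
  let ?K = "2 * ?C * (2 + 2 * ?C)"
  define I where "I = (chain_dirs ?H :: (real^'n) set) \<times> chain_lengths q L R"
  define \<A> where "\<A> = (\<lambda>(\<nu>::real^'n, k). chain_set q L \<nu> k)"
  define \<alpha> where "\<alpha> = 3 ^ ?n * (?K / real L) ^ q"
  have I: "finite I"
    unfolding I_def
    by (intro finite_cartesian_product card_chain_dirs(1) card_chain_lengths(1)[OF dLq(2)]) (use R in simp)
  have A1: "\<A> i \<in> sets borel" for i by (auto simp: \<A>_def chain_set_borel split: prod.split)
  have A2: "emeasure lborel (cbox 0 1 \<inter> \<A> i) \<le> ennreal \<alpha>" if iI: "i \<in> I" for i
  proof -
    obtain \<nu> k where i: "i = (\<nu>, k)" "\<nu> \<in> chain_dirs ?H" "k \<in> chain_lengths q L R" using iI by (auto simp: I_def)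
    have nu1: "\<bar>\<nu>$j\<bar> \<le> 1" for j
    proof -
      obtain z :: int where z: "\<bar>z\<bar> \<le> int ?H" "\<nu>$j = of_int z / real ?H" using i(2) unfolding chain_dirs_def by blast
      have "real_of_int \<bar>z\<bar> \<le> real ?H" using z(1) by linarith
      then show ?thesis using dLq by (simp only: z(2) abs_divide of_int_abs abs_of_nat) (simp add: divide_le_eq)
    qed
    show ?thesis
      unfolding \<alpha>_def \<A>_def i(1) prod.case chain_set_def
    proof (rule emeasure_lacunary_vectors_le[OF L1 _ _ nu1])
      show "1/4 \<le> \<nu> \<bullet> \<nu>" using i(2) by (simp add: chain_dirs_def)
      have "4 * L \<le> k 0" using i(3) by (simp add: chain_lengths_def)
      then have "real (4 * L) \<le> real (k 0)" by (simp only: of_nat_le_iff)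
      then show "4 * real L \<le> real (k 0)" by simp
      show "real L * real (k j) \<le> real (k (Suc j))" if "Suc j < q" for j
      proof -
        have "L * k j \<le> k (Suc j)" using i(3) that by (simp add: chain_lengths_def)
        then have "real (L * k j) \<le> real (k (Suc j))" by (simp only: of_nat_le_iff)
        then show ?thesis by simp
      qed
    qed simp
  qed
  have a0: "0 \<le> \<alpha>" by (simp add: \<alpha>_def)
  have cardI: "real (card I) * \<alpha> ^ d \<le> 1/4"
  proof -
    let ?E = "\<Sum>j<q. q - 1 - j"
    have nat1: "2 * ?H + 1 \<le> 9 * ?n * L ^ d" using dLq by (simp add: Suc_leI)
    have dirs: "real (card (chain_dirs ?H :: (real^'n) set)) \<le> (9 * real ?n) ^ ?n * real L ^ (d * ?n)"
    proof -
      have "card (chain_dirs ?H :: (real^'n) set) \<le> (9 * ?n * L ^ d) ^ ?n"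
        using card_chain_dirs(2)[of ?H, where 'n = 'n] power_mono[OF nat1, of ?n] by linarith
      then have "real (card (chain_dirs ?H :: (real^'n) set)) \<le> real ((9 * ?n * L ^ d) ^ ?n)" by (simp only: of_nat_le_iff)
      also have "\<dots> = (9 * real ?n) ^ ?n * real L ^ (d * ?n)" by (simp add: power_mult_distrib power_mult)
      finally show ?thesis .
    qed
    have Lpos: "0 < real L" using L1 by simp
    have lens: "real (card (chain_lengths q L R)) \<le> (8 * R) ^ q / real L ^ ?E"
      using card_chain_lengths(2)[OF dLq(2), of R q] R Lpos by (simp add: pos_le_divide_eq)
    have "real (card I) * \<alpha> ^ d = real (card (chain_dirs ?H :: (real^'n) set)) * real (card (chain_lengths q L R)) * \<alpha> ^ d"
      by (simp only: I_def card_cartesian_product of_nat_mult)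
    also have "\<dots> \<le> ((9 * real ?n) ^ ?n * real L ^ (d * ?n)) * ((8 * R) ^ q / real L ^ ?E) * \<alpha> ^ d"
      by (intro mult_mono dirs lens) (use a0 R in auto)
    also have "\<dots> = ((9 * real ?n) ^ ?n * 8 ^ q * (3 ^ ?n * ?K ^ q) ^ d) * c ^ q *
        (real L ^ (d * ?n) * ((real L ^ d) ^ q) / (real L ^ ?E * (real L ^ q) ^ d))"
      by (simp add: R_def \<alpha>_def power_mult_distrib power_divide)
    also have "real L ^ (d * ?n) * ((real L ^ d) ^ q) / (real L ^ ?E * (real L ^ q) ^ d) = real L ^ (d * ?n) / real L ^ ?E"
    proof -
      have "(real L ^ d) ^ q = (real L ^ q) ^ d" by (simp add: power_mult[symmetric] mult.commute)
      then show ?thesis using Lpos by simp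
    qed
    also have "((9 * real ?n) ^ ?n * 8 ^ q * (3 ^ ?n * ?K ^ q) ^ d) = chain_const ?n d q" by (simp add: chain_const_def)
    also have "chain_const ?n d q * c ^ q * (real L ^ (d * ?n) / real L ^ ?E) \<le> chain_const ?n d q * c * 1"
    proof (intro mult_mono)
      show "c ^ q \<le> c" using power_decreasing[of 1 q c] dLq(3) c by simp
      show "real L ^ (d * ?n) / real L ^ ?E \<le> 1"
        using power_increasing[OF expo L1] Lpos by (simp add: divide_le_eq)
    qed (use c in \<open>auto simp: chain_const_def\<close>)
    finally show ?thesis using cc by simp
  qed
  have "\<exists>u. (\<forall>i<d. u i \<in> cbox 0 1) \<and> (\<forall>c\<in>I. \<exists>i<d. u i \<notin> \<A> c) \<and>
    (\<Sum>j\<in>J. \<Sum>m\<in>gap_index d L. \<Sum>m'\<in>gap_index d L - {m}.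
      \<integral>\<^sup>+ \<tau>. indicator (S j) (\<tau> + gap_point d L u m) * indicator (S j) (\<tau> + gap_point d L u m') \<partial>lborel)
      \<le> ennreal (real (card J) * real L ^ d * v / 2)"
    by (rule exists_good_generators[where \<alpha> = \<alpha>]) (use dLq(2) I J A1 A2 a0 cardI S v in blast)+
  then obtain u where u: "\<And>i. i < d \<Longrightarrow> u i \<in> cbox 0 1" "\<And>i. i \<in> I \<Longrightarrow> \<exists>j<d. u j \<notin> \<A> i"
    "(\<Sum>j\<in>J. \<Sum>m\<in>gap_index d L. \<Sum>m'\<in>gap_index d L - {m}.
      \<integral>\<^sup>+ \<tau>. indicator (S j) (\<tau> + gap_point d L u m) * indicator (S j) (\<tau> + gap_point d L u m') \<partial>lborel)
      \<le> ennreal (real (card J) * real L ^ d * v / 2)"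
    by blast
  have "\<exists>\<tau>. real (card J) * real L ^ d * v / (2 * (2 * D) ^ CARD('n))
      \<le> real (card {j\<in>J. \<exists>m\<in>gap_index d L. \<tau> + gap_point d L u m \<in> S j})"
    by (rule exists_good_translate) (use dLq(2) J(1) S v(1) u(1) D u(3) in blast)+
  then obtain \<tau> where \<tau>: "real (card J) * real L ^ d * v / (2 * (2 * D) ^ CARD('n))
      \<le> real (card {j\<in>J. \<exists>m\<in>gap_index d L. \<tau> + gap_point d L u m \<in> S j})"
    by blast
  have "emeasure lborel (model_set d L R u \<inter> tube \<nu> a) \<le> ennreal (real ((9 * L) ^ q) * measure lborel (ball (0::real^'n) 2))"
    if "norm \<nu> = 1" for \<nu> a
  proof (rule model_set_tube_le[OF dLq R u(1) _ that])
    fix \<nu> :: "real^'n" and k assume "\<nu> \<in> chain_dirs ?H" "k \<in> chain_lengths q L R"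
    then have "(\<nu>, k) \<in> I" by (simp add: I_def)
    from u(2)[OF this] show "\<exists>i<d. u i \<notin> chain_set q L \<nu> k" by (simp add: \<A>_def)
  qed
  then show ?thesis using u(1) \<tau> unfolding R_def by blast
qed

section \<open>Test functions at a single scale\<close>

text \<open>Double counting of the pairs of a point of \<open>Q\<close> and a shift along the axis
  that carries it into \<open>S\<close>: a point of \<open>Q\<close> admits shifts of total length
  \<open>2 * A\<close>, while a point of \<open>S\<close> is reached by shifts of total length 1.
  This replaces a splitting of the space into a product.\<close>

lemma graph_slab:
  fixes \<psi> :: "real^'n \<Rightarrow> real" and \<zeta> :: "real^'n"
  assumes cont: "continuous_on UNIV \<psi>" and inv: "\<And>x y. (\<And>j. j \<noteq> b \<Longrightarrow> x$j = y$j) \<Longrightarrow> \<psi> x = \<psi> y"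
    and h: "0 \<le> h" and A: "0 \<le> A"
  defines "S \<equiv> {y. (\<forall>j. j \<noteq> b \<longrightarrow> \<bar>y$j - \<zeta>$j\<bar> \<le> h) \<and> \<bar>y$b - \<psi> y\<bar> \<le> A}"
  shows "S \<in> sets borel" "emeasure lborel S = ennreal ((2 * h) ^ (CARD('n) - 1) * (2 * A))"
proof -
  let ?e = "axis b 1 :: real^'n"
  have psim[measurable]: "\<psi> \<in> borel_measurable borel" by (rule borel_measurable_continuous_onI[OF cont])
  show Sm[measurable]: "S \<in> sets borel" unfolding S_def by measurable
  define Q where "Q = cbox (\<chi> j. if j = b then 0 else \<zeta>$j - h) (\<chi> j. if j = b then 1 else \<zeta>$j + h)"
  have Qiff: "y \<in> Q \<longleftrightarrow> (0 \<le> y$b \<and> y$b \<le> 1) \<and> (\<forall>j. j \<noteq> b \<longrightarrow> \<bar>y$j - \<zeta>$j\<bar> \<le> h)" for y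
  proof -
    have "y \<in> Q \<longleftrightarrow> (\<forall>j. (if j = b then 0 else \<zeta>$j - h) \<le> y$j \<and> y$j \<le> (if j = b then 1 else \<zeta>$j + h))"
      by (simp add: Q_def mem_box_cart)
    also have "\<dots> \<longleftrightarrow> (0 \<le> y$b \<and> y$b \<le> 1) \<and> (\<forall>j. j \<noteq> b \<longrightarrow> \<zeta>$j - h \<le> y$j \<and> y$j \<le> \<zeta>$j + h)"
      by (auto split: if_splits)
    also have "\<dots> \<longleftrightarrow> (0 \<le> y$b \<and> y$b \<le> 1) \<and> (\<forall>j. j \<noteq> b \<longrightarrow> \<bar>y$j - \<zeta>$j\<bar> \<le> h)"
      by (simp add: abs_diff_le_iff)
    finally show ?thesis .
  qed
  have volQ: "emeasure lborel Q = ennreal ((2 * h) ^ (CARD('n) - 1))"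
  proof -
    have "emeasure lborel Q = ennreal (\<Prod>j\<in>UNIV. (if j = b then 1 else 2 * h))"
      unfolding Q_def using h
      by (subst emeasure_cbox_cart) (auto intro!: arg_cong[where f=ennreal] prod.cong)
    also have "(\<Prod>j\<in>UNIV. (if j = b then 1 else 2 * h)) = (2 * h) ^ (CARD('n) - 1)"
      by (subst prod.remove[of _ b]) (auto simp: card_Diff_singleton)
    finally show ?thesis .
  qed
  have Qm[measurable]: "Q \<in> sets borel" by (simp add: Q_def)
  have F: "(\<lambda>(s, y). indicator Q y * indicator S (y + s *\<^sub>R ?e) :: ennreal) \<in> borel_measurable (lborel \<Otimes>\<^sub>M lborel)"
    by measurable
  have F': "(\<lambda>(s, y). indicator Q (y + (- s) *\<^sub>R ?e) * indicator S y :: ennreal) \<in> borel_measurable (lborel \<Otimes>\<^sub>M lborel)"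
    by measurable
  have "(\<integral>\<^sup>+ y. (\<integral>\<^sup>+ s. indicator Q y * indicator S (y + s *\<^sub>R ?e) \<partial>lborel) \<partial>lborel) = (\<integral>\<^sup>+ y. ennreal (2 * A) * indicator Q y \<partial>lborel)"
  proof (rule nn_integral_cong)
    fix y :: "real^'n"
    show "(\<integral>\<^sup>+ s. indicator Q y * indicator S (y + s *\<^sub>R ?e) \<partial>lborel) = ennreal (2 * A) * indicator Q y"
    proof (cases "y \<in> Q")
      case True
      have "y + s *\<^sub>R ?e \<in> S \<longleftrightarrow> s \<in> {\<psi> y - y$b - A .. \<psi> y - y$b + A}" for s
      proof -
        have "\<psi> (y + s *\<^sub>R ?e) = \<psi> y" by (rule inv) (simp add: axis_def)
        then show ?thesis using True unfolding Qiff S_def by (auto simp: axis_def abs_le_iff)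
      qed
      then have "(\<integral>\<^sup>+ s. indicator Q y * indicator S (y + s *\<^sub>R ?e) \<partial>lborel) = (\<integral>\<^sup>+ s. indicator {\<psi> y - y$b - A .. \<psi> y - y$b + A} s \<partial>lborel)"
        using True by (intro nn_integral_cong) (simp add: indicator_def)
      also have "\<dots> = ennreal (2 * A)" using A by simp
      finally show ?thesis using True by simp
    qed simp
  qed
  also have "\<dots> = ennreal (2 * A) * emeasure lborel Q" by (rule nn_integral_cmult_indicator) simp
  finally have 1: "(\<integral>\<^sup>+ y. (\<integral>\<^sup>+ s. indicator Q y * indicator S (y + s *\<^sub>R ?e) \<partial>lborel) \<partial>lborel) = ennreal (2 * A) * emeasure lborel Q" .
  have "(\<integral>\<^sup>+ y. (\<integral>\<^sup>+ s. indicator Q y * indicator S (y + s *\<^sub>R ?e) \<partial>lborel) \<partial>lborel) =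
      (\<integral>\<^sup>+ s. (\<integral>\<^sup>+ y. indicator Q y * indicator S (y + s *\<^sub>R ?e) \<partial>lborel) \<partial>lborel)"
    using lborel_pair.Fubini'[OF F] by simp
  also have "\<dots> = (\<integral>\<^sup>+ s. (\<integral>\<^sup>+ y. indicator Q (y + (- s) *\<^sub>R ?e) * indicator S y \<partial>lborel) \<partial>lborel)"
  proof (rule nn_integral_cong)
    fix s :: real
    have "(\<integral>\<^sup>+ y. (\<lambda>y. indicator Q (y + (- s) *\<^sub>R ?e) * indicator S y) (y + s *\<^sub>R ?e) \<partial>lborel) = (\<integral>\<^sup>+ y. indicator Q (y + (- s) *\<^sub>R ?e) * indicator S y \<partial>lborel)"
      by (rule nn_integral_lborel_translate) measurable
    then show "(\<integral>\<^sup>+ y. indicator Q y * indicator S (y + s *\<^sub>R ?e) \<partial>lborel) = (\<integral>\<^sup>+ y. indicator Q (y + (- s) *\<^sub>R ?e) * indicator S y \<partial>lborel)"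
      by simp
  qed
  also have "\<dots> = (\<integral>\<^sup>+ y. (\<integral>\<^sup>+ s. indicator Q (y + (- s) *\<^sub>R ?e) * indicator S y \<partial>lborel) \<partial>lborel)"
    using lborel_pair.Fubini'[OF F'] by simp
  also have "\<dots> = (\<integral>\<^sup>+ y. indicator S y \<partial>lborel)"
  proof (rule nn_integral_cong)
    fix y :: "real^'n"
    show "(\<integral>\<^sup>+ s. indicator Q (y + (- s) *\<^sub>R ?e) * indicator S y \<partial>lborel) = indicator S y"
    proof (cases "y \<in> S")
      case True
      have "y + (- s) *\<^sub>R ?e \<in> Q \<longleftrightarrow> s \<in> {y$b - 1 .. y$b}" for s
        using True unfolding Qiff S_def by (auto simp: axis_def)
      then have "(\<integral>\<^sup>+ s. indicator Q (y + (- s) *\<^sub>R ?e) * indicator S y \<partial>lborel) = (\<integral>\<^sup>+ s. indicator {y$b - 1 .. y$b} s \<partial>lborel)"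
        using True by (intro nn_integral_cong) (simp add: indicator_def)
      also have "\<dots> = 1" by simp
      finally show ?thesis using True by simp
    qed simp
  qed
  also have "\<dots> = emeasure lborel S" by simp
  finally have "emeasure lborel S = ennreal (2 * A) * emeasure lborel Q" using 1 by simp
  also have "\<dots> = ennreal ((2 * h) ^ (CARD('n) - 1) * (2 * A))"
    unfolding volQ using h A by (simp add: ennreal_mult[symmetric] mult.commute)
  finally show "emeasure lborel S = ennreal ((2 * h) ^ (CARD('n) - 1) * (2 * A))" .
qed

lemma graph_dist_le:
  fixes \<phi> :: "real^'n \<Rightarrow> real"
  assumes lip: "\<And>x y. \<bar>\<phi> x - \<phi> y\<bar> \<le> \<Lambda> * (\<Sum>j\<in>UNIV - {b}. \<bar>x$j - y$j\<bar>)"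
    and x: "x$b = \<phi> x" and y: "y$b = \<phi> y"
  shows "norm (x - y) \<le> (1 + \<Lambda>) * (\<Sum>j\<in>UNIV - {b}. \<bar>x$j - y$j\<bar>)"
proof -
  have "norm (x - y) \<le> (\<Sum>j\<in>UNIV. \<bar>(x - y)$j\<bar>)" by (rule norm_le_l1_cart)
  also have "\<dots> = \<bar>(x - y)$b\<bar> + (\<Sum>j\<in>UNIV - {b}. \<bar>(x - y)$j\<bar>)" by (rule sum.remove) auto
  also have "\<bar>(x - y)$b\<bar> \<le> \<Lambda> * (\<Sum>j\<in>UNIV - {b}. \<bar>x$j - y$j\<bar>)" using lip[of x y] x y by simp
  finally show ?thesis by (simp add: algebra_simps)
qed

text \<open>\<open>B\<close> consists of graph pieces of radius \<open>rB\<close> over the nodes.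
  The bound on \<open>rB * R0\<close> keeps the pieces so small that their size adds at most 1/16 to
  the phase, while \<open>rB < h\<close> keeps their projections disjoint, which bounds the measure
  of \<open>B\<close> from below.\<close>

lemma scale_test_functions:
  fixes \<Sigma>' :: "(real^'n) set" and \<phi> :: "real^'n \<Rightarrow> real" and y :: "'h \<Rightarrow> real^'n"
    and u :: "nat \<Rightarrow> real^'n" and d L :: nat and \<tau> :: "real^'n"
  assumes n2: "CARD('n) \<ge> 2" and Sig: "\<Sigma>' \<in> sets borel"
    and graph: "\<And>x \<kappa>. \<kappa> \<in> H \<Longrightarrow> (\<And>j. j \<noteq> b \<Longrightarrow> \<bar>x$j - y \<kappa>$j\<bar> \<le> rB) \<Longrightarrow> x$b = \<phi> x \<Longrightarrow> x \<in> \<Sigma>'"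
    and lip: "\<And>x y. \<bar>\<phi> x - \<phi> y\<bar> \<le> \<Lambda> * (\<Sum>j\<in>UNIV - {b}. \<bar>x$j - y$j\<bar>)" and Lam: "0 \<le> \<Lambda>"
    and H: "finite H" "H \<noteq> {}"
    and sep: "\<And>\<kappa> \<kappa>'. \<kappa> \<in> H \<Longrightarrow> \<kappa>' \<in> H \<Longrightarrow> \<kappa> \<noteq> \<kappa>' \<Longrightarrow> \<exists>j. j \<noteq> b \<and> 2 * h \<le> \<bar>y \<kappa>$j - y \<kappa>'$j\<bar>"
    and rB: "0 < rB" "rB < h"
    and y: "\<And>\<kappa>. \<kappa> \<in> H \<Longrightarrow> y \<kappa>$b = \<phi> (y \<kappa>)"
      "\<And>\<kappa>. \<kappa> \<in> H \<Longrightarrow> \<exists>m\<in>gap_index d L. y \<kappa> = \<tau> + gap_point d L u m"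
    and dL: "1 \<le> d" "1 \<le> L" and u: "\<And>i. i < d \<Longrightarrow> u i \<in> cbox 0 1"
    and R0: "0 < R0" "R0 \<le> R" "16 * real CARD('n) * (1 + \<Lambda>) * rB * R0 \<le> 1"
    and tubes: "\<And>\<nu> a. norm \<nu> = 1 \<Longrightarrow> emeasure lborel (model_set d L R0 u \<inter> tube \<nu> a) \<le> ennreal T"
    and K: "0 \<le> K" "0 \<le> T"
      "4 * K * T \<le> (real (card H) * (2 * rB) ^ (CARD('n) - 1) / (2 ^ (CARD('n) - 1) / hausdorff_const (real CARD('n) - 1)))
         * (measure lborel (ball (0::real^'n) (R0 / 2)) / real (16 * d * L) ^ d)"
  shows "\<exists>(f :: real^'n \<Rightarrow> complex) (w :: real^'n \<Rightarrow> real).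
              f \<in> borel_measurable (surface_measure \<Sigma>') \<and>
              (\<integral>\<^sup>+ s. ennreal ((cmod (f s))\<^sup>2) \<partial>surface_measure \<Sigma>') < \<infinity> \<and>
              (\<integral>\<^sup>+ s. ennreal ((cmod (f s))\<^sup>2) \<partial>surface_measure \<Sigma>') > 0 \<and>
              w \<in> borel_measurable lborel \<and> (\<forall>x. 0 \<le> w x \<and> w x \<le> 1) \<and>
              Linf_sphere (tube_max w) > 0 \<and>
              (\<integral>\<^sup>+ x\<in>ball 0 R. ennreal ((cmod (fourier_ext (surface_measure \<Sigma>') f x))\<^sup>2 * w x) \<partial>lborel)
                \<ge> ennreal K * (\<integral>\<^sup>+ s. ennreal ((cmod (f s))\<^sup>2) \<partial>surface_measure \<Sigma>') * Linf_sphere (tube_max w)"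
proof -
  let ?n = "CARD('n)"
  let ?KH = "2 ^ (?n - 1) / hausdorff_const (real ?n - 1)"
  have KH: "0 < ?KH" using n2 by (intro divide_pos_pos hausdorff_const_pos) auto
  have inv: "\<phi> x = \<phi> z" if "\<And>j. j \<noteq> b \<Longrightarrow> x$j = z$j" for x z
  proof -
    have "(\<Sum>j\<in>UNIV - {b}. \<bar>x$j - z$j\<bar>) = 0" using that by (intro sum.neutral) auto
    then show ?thesis using lip[of x z] by simp
  qed
  have cont: "continuous_on UNIV \<phi>"
  proof -
    have "\<bar>\<phi> x - \<phi> z\<bar> \<le> (\<Lambda> * real ?n) * dist x z" for x z
    proof -
      have "(\<Sum>j\<in>UNIV - {b}. \<bar>x$j - z$j\<bar>) \<le> (\<Sum>j\<in>UNIV - {b}. dist x z)"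
        by (intro sum_mono) (metis component_le_norm_cart dist_norm vector_minus_component)
      also have "\<dots> \<le> real ?n * dist x z" by (simp add: card_Diff_singleton mult_right_mono)
      finally have "\<Lambda> * (\<Sum>j\<in>UNIV - {b}. \<bar>x$j - z$j\<bar>) \<le> \<Lambda> * (real ?n * dist x z)" using Lam by (rule mult_left_mono)
      then show ?thesis using lip[of x z] by (simp add: mult.assoc)
    qed
    then have "(\<Lambda> * real ?n)-lipschitz_on UNIV \<phi>" using Lam by (intro lipschitz_onI) (auto simp: dist_real_def)
    then show ?thesis by (rule lipschitz_on_continuous_on)
  qed
  have phim[measurable]: "\<phi> \<in> borel_measurable borel" by (rule borel_measurable_continuous_onI[OF cont])
  define Bk where "Bk = (\<lambda>\<kappa>. {x. (\<forall>j. j \<noteq> b \<longrightarrow> \<bar>x$j - y \<kappa>$j\<bar> \<le> rB) \<and> x$b = \<phi> x})"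
  define B where "B = (\<Union>\<kappa>\<in>H. Bk \<kappa>)"
  have Bm: "B \<in> sets borel"
    unfolding B_def
  proof (rule sets.finite_UN[OF H(1)])
    fix \<kappa> show "Bk \<kappa> \<in> sets borel" unfolding Bk_def by measurable
  qed
  have BS: "B \<subseteq> \<Sigma>'" unfolding B_def Bk_def using graph by blast
  have near: "norm (x - y \<kappa>) \<le> (1 + \<Lambda>) * (real ?n * rB)" if "\<kappa> \<in> H" "x \<in> Bk \<kappa>" for x \<kappa>
  proof -
    have "norm (x - y \<kappa>) \<le> (1 + \<Lambda>) * (\<Sum>j\<in>UNIV - {b}. \<bar>x$j - y \<kappa>$j\<bar>)"
      by (rule graph_dist_le[OF lip]) (use that y(1) in \<open>auto simp: Bk_def\<close>)
    also have "\<dots> \<le> (1 + \<Lambda>) * (\<Sum>j\<in>UNIV - {b}. rB)"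
      using Lam that by (intro mult_left_mono sum_mono) (auto simp: Bk_def)
    also have "\<dots> \<le> (1 + \<Lambda>) * (real ?n * rB)"
      using Lam rB by (intro mult_left_mono) (auto simp: card_Diff_singleton mult_right_mono)
    finally show ?thesis .
  qed
  define \<sigma> where "\<sigma> = surface_measure \<Sigma>'"
  have em: "emeasure \<sigma> B = hausdorff_outer (real ?n - 1) B"
    unfolding \<sigma>_def emeasure_surface_measure[OF Sig Bm] using BS by (simp add: Int_absorb2)
  have fin: "emeasure \<sigma> B < \<infinity>"
    unfolding em
  proof (rule hausdorff_lipschitz_graph_finite[OF n2])
    let ?M = "nat \<lceil>(\<Sum>\<kappa>\<in>H. norm (y \<kappa>)) + (1 + \<Lambda>) * (real ?n * rB)\<rceil>"
    fix x j assume "x \<in> B"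
    then obtain \<kappa> where k: "\<kappa> \<in> H" "x \<in> Bk \<kappa>" by (auto simp: B_def)
    have "\<bar>x$j\<bar> \<le> norm x" by (rule component_le_norm_cart)
    also have "norm x \<le> norm (y \<kappa>) + norm (x - y \<kappa>)" using norm_triangle_ineq[of "y \<kappa>" "x - y \<kappa>"] by simp
    also have "norm (y \<kappa>) \<le> (\<Sum>\<kappa>\<in>H. norm (y \<kappa>))" by (rule member_le_sum) (use k H in auto)
    also have "norm (x - y \<kappa>) \<le> (1 + \<Lambda>) * (real ?n * rB)" by (rule near[OF k])
    also have "(\<Sum>\<kappa>\<in>H. norm (y \<kappa>)) + (1 + \<Lambda>) * (real ?n * rB) \<le> real ?M" by (rule real_nat_ceiling_ge)
    finally show "\<bar>x$j\<bar> \<le> real ?M" by simp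
  next
    fix x z assume "x \<in> B" "z \<in> B"
    then have "x$b = \<phi> x" "z$b = \<phi> z" by (auto simp: B_def Bk_def)
    then show "dist x z \<le> (1 + \<Lambda>) * (\<Sum>j\<in>UNIV - {b}. \<bar>x$j - z$j\<bar>)"
      unfolding dist_norm by (rule graph_dist_le[OF lip])
  qed (use Lam in simp)
  have emm: "emeasure \<sigma> B = ennreal (measure \<sigma> B)" using fin by (intro emeasure_eq_ennreal_measure) auto
  \<comment> \<open>Cylinders of height 1 over the disjoint projections;
    \<open>emeasure_shadow_le_hausdorff\<close> turns their total volume into a lower bound for the
    measure of \<open>B\<close>.\<close>
  define Q where "Q = (\<lambda>\<kappa>. cbox (\<chi> j. if j = b then 0 else y \<kappa>$j - rB) (\<chi> j. if j = b then 1 else y \<kappa>$j + rB))"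
  have Qin: "0 \<le> x$b \<and> x$b \<le> 1 \<and> (\<forall>j. j \<noteq> b \<longrightarrow> \<bar>x$j - y \<kappa>$j\<bar> \<le> rB)" if "x \<in> Q \<kappa>" for x \<kappa>
  proof -
    have a: "(if j = b then 0 else y \<kappa>$j - rB) \<le> x$j \<and> x$j \<le> (if j = b then 1 else y \<kappa>$j + rB)" for j
      using that by (simp add: Q_def mem_box_cart)
    have "\<bar>x$j - y \<kappa>$j\<bar> \<le> rB" if "j \<noteq> b" for j using a[of j] that by (simp add: abs_diff_le_iff)
    then show ?thesis using a[of b] by simp
  qed
  have volQ: "emeasure lborel (Q \<kappa>) = ennreal ((2 * rB) ^ (?n - 1))" for \<kappa>
  proof -
    have "emeasure lborel (Q \<kappa>) = ennreal (\<Prod>j\<in>UNIV. (if j = b then 1 else 2 * rB))"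
      unfolding Q_def using rB
      by (subst emeasure_cbox_cart) (auto intro!: arg_cong[where f=ennreal] prod.cong)
    also have "(\<Prod>j\<in>UNIV. (if j = b then 1 else 2 * rB)) = (2 * rB) ^ (?n - 1)"
      by (subst prod.remove[of _ b]) (auto simp: card_Diff_singleton)
    finally show ?thesis .
  qed
  have disj: "disjoint_family_on Q H"
    unfolding disjoint_family_on_def
  proof (intro ballI impI)
    fix \<kappa> \<kappa>' assume k: "\<kappa> \<in> H" "\<kappa>' \<in> H" "\<kappa> \<noteq> \<kappa>'"
    then obtain j where j: "j \<noteq> b" "2 * h \<le> \<bar>y \<kappa>$j - y \<kappa>'$j\<bar>" using sep by blast
    show "Q \<kappa> \<inter> Q \<kappa>' = {}"
    proof (rule ccontr)
      assume "Q \<kappa> \<inter> Q \<kappa>' \<noteq> {}"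
      then obtain x where "x \<in> Q \<kappa>" "x \<in> Q \<kappa>'" by blast
      then have "\<bar>x$j - y \<kappa>$j\<bar> \<le> rB" "\<bar>x$j - y \<kappa>'$j\<bar> \<le> rB" using Qin j(1) by blast+
      then show False using j(2) rB(2) by linarith
    qed
  qed
  have "ennreal (real (card H) * (2 * rB) ^ (?n - 1)) = (\<Sum>\<kappa>\<in>H. emeasure lborel (Q \<kappa>))"
    unfolding volQ using rB by (subst sum_ennreal) auto
  also have "\<dots> = emeasure lborel (\<Union>\<kappa>\<in>H. Q \<kappa>)"
    by (rule sum_emeasure[OF _ disj H(1)]) (auto simp: Q_def)
  also have "\<dots> \<le> ennreal ?KH * hausdorff_outer (real ?n - 1) B"
  proof (rule emeasure_shadow_le_hausdorff[OF n2, where b = b])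
    show "(\<Union>\<kappa>\<in>H. Q \<kappa>) \<in> sets borel" by (rule sets.finite_UN[OF H(1)]) (simp add: Q_def)
    fix x assume "x \<in> (\<Union>\<kappa>\<in>H. Q \<kappa>)"
    then obtain \<kappa> where k: "\<kappa> \<in> H" "x \<in> Q \<kappa>" by blast
    define z where "z = (\<chi> j. if j = b then \<phi> x else x$j)"
    have "\<phi> z = \<phi> x" by (rule inv) (simp add: z_def)
    then have "z \<in> Bk \<kappa>" using Qin[OF k(2)] by (simp add: Bk_def z_def)
    then have "z \<in> B" using k(1) by (auto simp: B_def)
    moreover have "\<forall>j. j \<noteq> b \<longrightarrow> z$j = x$j" by (simp add: z_def)
    ultimately show "0 \<le> x$b \<and> x$b \<le> 1 \<and> (\<exists>a\<in>B. \<forall>j. j \<noteq> b \<longrightarrow> a$j = x$j)" using Qin[OF k(2)] by blast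
  qed
  also have "\<dots> = ennreal (?KH * measure \<sigma> B)"
    unfolding em[symmetric] emm by (rule ennreal_mult[symmetric]) (use KH in auto)
  finally have "real (card H) * (2 * rB) ^ (?n - 1) \<le> ?KH * measure \<sigma> B"
    by (subst (asm) ennreal_le_iff) (rule mult_nonneg_nonneg[OF less_imp_le[OF KH] measure_nonneg])
  then have mB: "real (card H) * (2 * rB) ^ (?n - 1) / ?KH \<le> measure \<sigma> B"
    using KH by (simp only: pos_divide_le_eq mult.commute)
  have "0 < real (card H) * (2 * rB) ^ (?n - 1) / ?KH"
    using H rB by (intro divide_pos_pos KH mult_pos_pos) (auto simp: card_gt_0_iff)
  then have pos: "0 < measure \<sigma> B" using mB by linarith
  obtain \<eta> where eta: "0 < \<eta>" "ball 0 \<eta> \<subseteq> model_set d L R0 u"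
    using ball_subset_model_set[OF dL(1) R0(1), of u L] u by blast
  have WR: "model_set d L R0 u \<subseteq> ball 0 R" using R0(2) by (auto simp: model_set_def)
  show ?thesis
    unfolding \<sigma>_def[symmetric]
  proof (rule extension_weight_pair[of B \<Sigma>' "model_set d L R0 u" R \<eta> \<tau> T K, folded \<sigma>_def])
    fix x s assume x: "x \<in> model_set d L R0 u" and "s \<in> B"
    then obtain \<kappa> where k: "\<kappa> \<in> H" "s \<in> Bk \<kappa>" by (auto simp: B_def)
    then obtain m where m: "m \<in> gap_index d L" "y \<kappa> = \<tau> + gap_point d L u m" using y(2) by blast
    obtain z :: int where z: "\<bar>x \<bullet> gap_point d L u m - of_int z\<bar> \<le> 1/16" using model_set_phase[OF x m(1) dL(2)] by blast
    have "x \<bullet> (s - \<tau>) = x \<bullet> gap_point d L u m + x \<bullet> (s - y \<kappa>)" by (simp add: m(2) inner_diff_right inner_add_right)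
    moreover have "\<bar>x \<bullet> (s - y \<kappa>)\<bar> \<le> 1/16"
    proof -
      have "\<bar>x \<bullet> (s - y \<kappa>)\<bar> \<le> norm x * norm (s - y \<kappa>)" by (rule Cauchy_Schwarz_ineq2)
      also have "\<dots> \<le> R0 * ((1 + \<Lambda>) * (real ?n * rB))"
        using x near[OF k] R0(1) by (intro mult_mono) (auto simp: model_set_def)
      also have "\<dots> \<le> 1/16" using R0(3) by (simp add: mult_ac)
      finally show ?thesis .
    qed
    ultimately have "\<bar>x \<bullet> (s - \<tau>) - of_int z\<bar> \<le> 1/8" using z by linarith
    then show "\<exists>z::int. \<bar>x \<bullet> (s - \<tau>) - of_int z\<bar> \<le> 1/8" by blast
  next
    have "measure lborel (ball (0::real^'n) (R0 / 2)) / real (16 * d * L) ^ d \<le> measure lborel (model_set d L R0 u)"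
      by (rule measure_model_set_ge[OF dL R0(1)])
    then have "(real (card H) * (2 * rB) ^ (?n - 1) / ?KH) * (measure lborel (ball (0::real^'n) (R0 / 2)) / real (16 * d * L) ^ d)
      \<le> measure \<sigma> B * measure lborel (model_set d L R0 u)"
      using mB by (intro mult_mono) auto
    then show "4 * K * T \<le> measure \<sigma> B * measure lborel (model_set d L R0 u)" using K(3) by (rule order_trans[rotated])
  qed (use n2 Bm fin pos model_set_borel WR eta tubes K in auto)
qed

section \<open>The multiscale perturbation\<close>

text \<open>The scales are indexed by pairs \<open>(P, L)\<close>. A progression with \<open>(P + 1)\<^sup>2\<close> generators and chains of length
  \<open>2 n (P + 1)\<close> make the union bound work while keeping the chain length of smaller order than the number of
  generators; the weights are summable over all scales and keep the patches of different scales disjoint.\<close>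

definition cells_per_axis :: "nat \<Rightarrow> nat \<Rightarrow> nat \<Rightarrow> nat \<Rightarrow> nat" where
  "cells_per_axis n k d L = nat \<lceil>real L powr (real (d + n) / real (n - 1 + k))\<rceil>"

definition scale_dim :: "nat \<Rightarrow> nat" where
  "scale_dim P = (P + 1)\<^sup>2"

definition scale_chain :: "nat \<Rightarrow> nat \<Rightarrow> nat" where
  "scale_chain n P = 2 * n * (P + 1)"

definition scale_shrink :: "nat \<Rightarrow> nat \<Rightarrow> real" where
  "scale_shrink n P = 1 / (4 * chain_const n (scale_dim P) (scale_chain n P))"

definition scale_weight :: "nat \<Rightarrow> nat \<Rightarrow> real" where
  "scale_weight P L = 1 / (real (prod_encode (P, L - 1)) + 1)\<^sup>2"

text \<open>\<open>cells_per_axis\<close> many cells with a spacing of four radii fill a patch of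
  width \<open>r * scale_weight P L / 8\<close>; this is the origin of 32.\<close>

definition bump_radius :: "real \<Rightarrow> nat \<Rightarrow> nat \<Rightarrow> nat \<Rightarrow> nat \<Rightarrow> real" where
  "bump_radius r n k P L = r * scale_weight P L / (32 * real (cells_per_axis n k (scale_dim P) L))"

text \<open>A slab over one cell has volume at most of order \<open>h ^ (n - 1 + k)\<close>, with
  \<open>h\<close> at most of order \<open>1 / cells_per_axis\<close>. The exponent is chosen so
  that this volume times \<open>L ^ (d + n)\<close> stays bounded, as the pair correlation estimate
  demands; this is how \<open>n - 1 + k\<close> enters the gain.\<close>

lemma cells_per_axis_bounds:
  assumes L: "1 \<le> L" and N: "0 < n - 1 + k"
  shows "1 \<le> cells_per_axis n k d L"
    "real L powr (real (d + n) / real (n - 1 + k)) \<le> real (cells_per_axis n k d L)"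
    "real (cells_per_axis n k d L) \<le> 2 * real L powr (real (d + n) / real (n - 1 + k))"
    "real L ^ (d + n) \<le> real (cells_per_axis n k d L) ^ (n - 1 + k)"
    "real (cells_per_axis n k d L) ^ (n - 1 + k) \<le> 2 ^ (n - 1 + k) * real L ^ (d + n)"
proof -
  let ?x = "real L powr (real (d + n) / real (n - 1 + k))" and ?N = "n - 1 + k"
  have x1: "1 \<le> ?x" using L by (intro ge_one_powr_ge_zero) auto
  show ge: "?x \<le> real (cells_per_axis n k d L)" unfolding cells_per_axis_def by (rule real_nat_ceiling_ge)
  then show "1 \<le> cells_per_axis n k d L" using x1 by linarith
  have "real (cells_per_axis n k d L) \<le> ?x + 1"
    unfolding cells_per_axis_def using x1 by (simp add: of_nat_nat)
  then show le: "real (cells_per_axis n k d L) \<le> 2 * ?x" using x1 by linarith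
  have "real ?N \<noteq> 0" using N by linarith
  then have "real (d + n) / real ?N * real ?N = real (d + n)" by (metis nonzero_eq_divide_eq)
  then have "?x powr real ?N = real L powr real (d + n)" by (simp only: powr_powr)
  moreover have "?x powr real ?N = ?x ^ ?N" using x1 by (intro powr_realpow) linarith
  moreover have "real L powr real (d + n) = real L ^ (d + n)" using L by (intro powr_realpow) auto
  ultimately have xN: "?x ^ ?N = real L ^ (d + n)" by simp
  show "real L ^ (d + n) \<le> real (cells_per_axis n k d L) ^ ?N"
    unfolding xN[symmetric] using x1 by (intro power_mono ge) auto
  have "real (cells_per_axis n k d L) ^ ?N \<le> (2 * ?x) ^ ?N" by (intro power_mono le) auto
  then show "real (cells_per_axis n k d L) ^ ?N \<le> 2 ^ ?N * real L ^ (d + n)" by (simp only: power_mult_distrib xN)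
qed

text \<open>The sum is q (q - 1) / 2 with q = 2 n (P + 1), and q - 1 is at least P + 1.\<close>

lemma scale_chain_expo:
  assumes "1 \<le> n"
  shows "scale_dim P * n \<le> (\<Sum>j<scale_chain n P. scale_chain n P - 1 - j)"
proof -
  let ?q = "scale_chain n P" and ?x = "P + 1"
  have "(\<Sum>j<?q. ?q - 1 - j) = (\<Sum>j<?q. j)" using sum.nat_diff_reindex[of "\<lambda>j. j" ?q] by simp
  moreover have "2 * (\<Sum>j<m. j) = m * (m - 1)" for m :: nat
    by (induction m) (auto simp: algebra_simps)
  moreover have "2 * (scale_dim P * n) \<le> ?q * (?q - 1)"
  proof -
    have "?x \<le> 2 * n * ?x - 1"
    proof -
      have "2 * ?x \<le> 2 * n * ?x" by (rule mult_le_mono1) (use assms in simp)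
      moreover have "x \<le> z - 1" if "1 \<le> x" "2 * x \<le> z" for x z :: nat using that by linarith
      ultimately show ?thesis by simp
    qed
    then have "2 * n * ?x * ?x \<le> 2 * n * ?x * (2 * n * ?x - 1)" by (rule mult_left_mono) simp
    moreover have "2 * (scale_dim P * n) = 2 * n * ?x * ?x" by (simp only: scale_dim_def power2_eq_square mult_ac)
    moreover have "?q * (?q - 1) = 2 * n * ?x * (2 * n * ?x - 1)" by (simp only: scale_chain_def)
    ultimately show ?thesis by (simp only:)
  qed
  ultimately show ?thesis by (metis mult_le_cancel1 zero_less_numeral)
qed

lemma chain_const_ge_1: "1 \<le> n \<Longrightarrow> 1 \<le> chain_const n d q"
proof -
  assume n: "1 \<le> n"
  have a: "1 \<le> 2 * (5 * real n + 1) * (2 + 2 * (5 * real n + 1))"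
    using mult_mono[of 1 "2 * (5 * real n + 1)" 1 "2 + 2 * (5 * real n + 1)"] by simp
  have b: "1 \<le> 3 ^ n * (2 * (5 * real n + 1) * (2 + 2 * (5 * real n + 1))) ^ q"
    using mult_mono[of 1 "3 ^ n" 1 "(2 * (5 * real n + 1) * (2 + 2 * (5 * real n + 1))) ^ q"] one_le_power[OF a, of q] by simp
  have p: "1 \<le> (9 * real n) ^ n" using n by (intro one_le_power) simp
  have "1 * 1 \<le> (9 * real n) ^ n * 8 ^ q" by (intro mult_mono p one_le_power) auto
  then have "1 \<le> (9 * real n) ^ n * 8 ^ q" by (simp only: mult_1)
  then show ?thesis unfolding chain_const_def
    using mult_mono[of 1 "(9 * real n) ^ n * 8 ^ q" 1 "(3 ^ n * (2 * (5 * real n + 1) * (2 + 2 * (5 * real n + 1))) ^ q) ^ d"]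
      one_le_power[OF b, of d] by simp
qed

lemma scale_shrink_bounds:
  assumes "1 \<le> n"
  shows "0 < scale_shrink n P" "scale_shrink n P \<le> 1"
    "chain_const n (scale_dim P) (scale_chain n P) * scale_shrink n P \<le> 1/4"
  using chain_const_ge_1[OF assms, of "scale_dim P" "scale_chain n P"]
  by (auto simp: scale_shrink_def divide_le_eq)

text \<open>In units of \<open>r\<close>, patch \<open>m\<close> has centre
  \<open>1 / (m + 2)\<close> and half width \<open>1 / (16 * (m + 1)^2)\<close>. Consecutive centres
  differ by \<open>1 / ((m + 2) * (m + 3))\<close>, which exceeds the sum of the half widths, so
  infinitely many patches fit into a bounded interval.\<close>

lemma patch_gap:
  fixes m m' :: nat
  assumes "m \<noteq> m'"
  shows "1 / (16 * (real m + 1)\<^sup>2) + 1 / (16 * (real m' + 1)\<^sup>2) \<le> \<bar>1 / (real m + 2) - 1 / (real m' + 2)\<bar>"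
proof -
  have *: "1 / (16 * (real m + 1)\<^sup>2) + 1 / (16 * (real m' + 1)\<^sup>2) \<le> 1 / (real m + 2) - 1 / (real m' + 2)" if "m < m'" for m m' :: nat
  proof -
    have le: "1 / (16 * (real m' + 1)\<^sup>2) \<le> 1 / (16 * (real m + 1)\<^sup>2)"
      using that by (intro divide_left_mono mult_left_mono power_mono) auto
    have "1 / (16 * (real m + 1)\<^sup>2) + 1 / (16 * (real m' + 1)\<^sup>2) \<le> 1 / (8 * (real m + 1)\<^sup>2)"
    proof -
      have "1 / (8 * (real m + 1)\<^sup>2) = 1 / (16 * (real m + 1)\<^sup>2) + 1 / (16 * (real m + 1)\<^sup>2)" by simp
      then show ?thesis using le by linarith
    qed
    also have "\<dots> \<le> 1 / ((real m + 2) * (real m + 3))"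
    proof (rule divide_left_mono)
      show "(real m + 2) * (real m + 3) \<le> 8 * (real m + 1)\<^sup>2" by (simp add: power2_eq_square algebra_simps)
    qed auto
    also have "\<dots> = 1 / (real m + 2) - 1 / (real m + 3)" by (simp add: field_simps)
    also have "\<dots> \<le> 1 / (real m + 2) - 1 / (real m' + 2)"
      using that by (intro diff_left_mono divide_left_mono) auto
    finally show ?thesis .
  qed
  from assms consider "m < m'" | "m' < m" by linarith
  then show ?thesis using *[of m m'] *[of m' m] by cases (auto simp: abs_if)
qed

text \<open>At each scale a progression is made to hit slabs around the graph of \<psi>, as thick as
  the correction a bump may make; the points hit become nodes at which \<open>g\<close> is
  prescribed. The configurations refer to the unperturbed \<psi>, so all scales are chosen
  independently before one \<open>g\<close> interpolates them together.\<close>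

lemma exists_multiscale_perturbation:
  fixes \<psi> :: "real^'n \<Rightarrow> real" and p :: "real^'n" and b :: 'n and r \<Lambda> \<rho> :: real and k :: nat
  assumes n2: "CARD('n) \<ge> 2" and k: "k \<ge> 1" and rho: "0 < \<rho>" and r: "0 < r" "r \<le> 1"
    and Lam: "0 \<le> \<Lambda>" and lip: "\<And>x y. \<bar>\<psi> x - \<psi> y\<bar> \<le> \<Lambda> * (\<Sum>j\<in>UNIV - {b}. \<bar>x$j - y$j\<bar>)"
    and psip: "\<And>x. \<bar>\<psi> x - p$b\<bar> \<le> 1"
  shows "\<exists>a0>0. \<exists>g D. Ck_derivs k UNIV g D \<and> (\<forall>al x. length al \<le> k \<longrightarrow> \<bar>D al x\<bar> \<le> \<rho>) \<and>
    (\<forall>x x'. (\<forall>j. j \<noteq> b \<longrightarrow> x$j = x'$j) \<longrightarrow> g x = g x') \<and>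
    (\<forall>P L. 1 \<le> L \<longrightarrow> (\<exists>(H :: ('n \<Rightarrow> nat) set) y u \<tau>. finite H \<and> (\<forall>i<scale_dim P. u i \<in> cbox 0 1) \<and>
      (\<forall>\<nu> a. norm \<nu> = 1 \<longrightarrow>
        emeasure lborel (model_set (scale_dim P) L (scale_shrink CARD('n) P * real L ^ scale_dim P) u \<inter> tube \<nu> a)
        \<le> ennreal (real ((9 * L) ^ scale_chain CARD('n) P) * measure lborel (ball (0::real^'n) 2))) \<and>
      real (cells_per_axis CARD('n) k (scale_dim P) L) ^ (CARD('n) - 1) * real L ^ scale_dim P *
        ((2 * bump_radius r CARD('n) k P L) ^ (CARD('n) - 1) * (2 * (a0 * scale_weight P L * bump_radius r CARD('n) k P L ^ k)))
        / (2 * (2 * (norm p + 2 + real (scale_dim P))) ^ CARD('n)) \<le> real (card H) \<and>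
      (\<forall>\<kappa>\<in>H. \<exists>m\<in>gap_index (scale_dim P) L. y \<kappa> = \<tau> + gap_point (scale_dim P) L u m) \<and>
      (\<forall>\<kappa>\<in>H. y \<kappa>$b = \<psi> (y \<kappa>) + g (y \<kappa>)) \<and>
      (\<forall>\<kappa>\<in>H. \<forall>\<kappa>'\<in>H. \<kappa> \<noteq> \<kappa>' \<longrightarrow> (\<exists>j. j \<noteq> b \<and> 2 * bump_radius r CARD('n) k P L \<le> \<bar>y \<kappa>$j - y \<kappa>'$j\<bar>)) \<and>
      (\<forall>\<kappa>\<in>H. \<forall>j. j \<noteq> b \<longrightarrow> \<bar>y \<kappa>$j - p$j\<bar> \<le> r - bump_radius r CARD('n) k P L)))"
proof -
  let ?n = "CARD('n)"
  obtain B where B: "1 \<le> B"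
    "\<And>(H :: nat \<Rightarrow> ('n \<Rightarrow> nat) set) (y :: nat \<Rightarrow> ('n \<Rightarrow> nat) \<Rightarrow> real^'n) a \<mu> A \<rho>.
      0 < \<rho> \<Longrightarrow> (\<And>m. finite (H m)) \<Longrightarrow> (\<And>m. 1 \<le> \<mu> m) \<Longrightarrow> (\<And>m. 0 \<le> A m) \<Longrightarrow>
      (\<And>m. B * A m * \<mu> m ^ k \<le> \<rho> / (real m + 1)\<^sup>2) \<Longrightarrow>
      (\<And>m h. h \<in> H m \<Longrightarrow> \<bar>a m h\<bar> \<le> A m) \<Longrightarrow>
      (\<And>m h h'. h \<in> H m \<Longrightarrow> h' \<in> H m \<Longrightarrow> h \<noteq> h' \<Longrightarrow> \<exists>j. j \<noteq> b \<and> 2 / \<mu> m \<le> \<bar>y m h $ j - y m h' $ j\<bar>) \<Longrightarrow>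
      (\<And>m m' h h'. m \<noteq> m' \<Longrightarrow> h \<in> H m \<Longrightarrow> h' \<in> H m' \<Longrightarrow> \<exists>j. j \<noteq> b \<and> 1 / \<mu> m' \<le> \<bar>y m h $ j - y m' h' $ j\<bar>) \<Longrightarrow>
      \<exists>g D. Ck_derivs k UNIV g D \<and> (\<forall>al x. length al \<le> k \<longrightarrow> \<bar>D al x\<bar> \<le> \<rho>) \<and>
        (\<forall>m. \<forall>h\<in>H m. \<forall>x. (\<forall>j. j \<noteq> b \<longrightarrow> x $ j = y m h $ j) \<longrightarrow> g x = a m h) \<and>
        (\<forall>x x'. (\<forall>j. j \<noteq> b \<longrightarrow> x $ j = x' $ j) \<longrightarrow> g x = g x')"
    by (rule exists_interpolating_perturbation[where k = k and b = b and 'h = "'n \<Rightarrow> nat"]) blast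
  \<comment> \<open>The bound \<open>\<rho> / B\<close> respects the budget for the derivatives, and
    the second bound makes the slabs thin enough for \<open>vle\<close>.\<close>
  define a0 where "a0 = min (\<rho> / B) (1 / 2 ^ (?n + 2))"
  have a0: "0 < a0" "a0 \<le> \<rho> / B" "a0 \<le> 1 / 2 ^ (?n + 2)" using rho B(1) by (auto simp: a0_def)
  have n1: "1 \<le> ?n" using n2 by simp
  define PP where "PP = (\<lambda>m. fst (prod_decode m))"
  define LL where "LL = (\<lambda>m. Suc (snd (prod_decode m)))"
  define dd where "dd = (\<lambda>m. scale_dim (PP m))"
  define qq where "qq = (\<lambda>m. scale_chain ?n (PP m))"
  define cc where "cc = (\<lambda>m. scale_shrink ?n (PP m))"
  define gg where "gg = (\<lambda>m. cells_per_axis ?n k (dd m) (LL m))"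
  define ss where "ss = (\<lambda>m::nat. 1 / (real m + 1)\<^sup>2)"
  define hh where "hh = (\<lambda>m. r * ss m / (32 * real (gg m)))"
  \<comment> \<open>The correction allowed at scale \<open>m\<close>: a bump of radius
    \<open>hh m\<close> and height \<open>AA m\<close> has derivatives up to order \<open>k\<close>
    bounded by \<open>B * a0 * ss m\<close>, hence by \<open>\<rho> * ss m\<close>.\<close>
  define AA where "AA = (\<lambda>m. a0 * ss m * hh m ^ k)"
  define vv where "vv = (\<lambda>m. (2 * hh m) ^ (?n - 1) * (2 * AA m))"
  define DD where "DD = (\<lambda>m. norm p + 2 + real (dd m))"
  define JJ where "JJ = (\<lambda>m. PiE (UNIV - {b}) (\<lambda>_. {..<gg m}))"
  \<comment> \<open>The cell centres of patch \<open>m\<close> are spaced by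
    \<open>4 * hh m\<close>, which leaves a distance of \<open>2 * hh m\<close> between points of
    different cells.\<close>
  define \<zeta> where "\<zeta> = (\<lambda>m (\<kappa>::'n \<Rightarrow> nat). \<chi> j. p$j + r / (real m + 2) - r * ss m / 16 + (4 * real (\<kappa> j) + 2) * hh m)"
  define S where "S = (\<lambda>m \<kappa>. {y. (\<forall>j. j \<noteq> b \<longrightarrow> \<bar>y$j - \<zeta> m \<kappa> $ j\<bar> \<le> hh m) \<and> \<bar>y$b - \<psi> y\<bar> \<le> AA m})"
  have L1: "1 \<le> LL m" for m by (simp add: LL_def)
  have N0: "0 < ?n - 1 + k" using k by linarith
  note cb = cells_per_axis_bounds[OF L1 N0]
  have g1: "1 \<le> gg m" for m unfolding gg_def by (rule cb)
  have s: "0 < ss m" "ss m \<le> 1" for m by (auto simp: ss_def divide_le_eq)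
  have h: "0 < hh m" for m using r s g1[of m] by (auto simp: hh_def intro!: divide_pos_pos mult_pos_pos)
  have hg: "hh m * real (gg m) = r * ss m / 32" for m using g1[of m] by (simp add: hh_def)
  have rs: "r * ss m \<le> 1" for m using mult_mono[of r 1 "ss m" 1] r s[of m] by simp
  have h1: "hh m \<le> r * ss m / 32" for m
  proof -
    have "hh m * 1 \<le> hh m * real (gg m)" using g1[of m] h[of m] by (intro mult_left_mono) auto
    then show ?thesis using hg by simp
  qed
  have hle1: "hh m \<le> 1" for m using h1[of m] rs[of m] by linarith
  have A: "0 < AA m" for m using a0 s h by (simp add: AA_def)
  have "a0 \<le> 1"
  proof -
    have "(1 / 2 :: real) ^ (?n + 2) \<le> 1" by (rule power_le_one) auto
    then show ?thesis using a0(3) unfolding power_one_over by linarith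
  qed
  then have A1: "AA m \<le> 1" for m
  proof -
    have "hh m ^ k \<le> 1" using hle1 h by (simp add: power_le_one less_imp_le)
    then have "a0 * ss m * hh m ^ k \<le> 1 * 1 * 1" using \<open>a0 \<le> 1\<close> s[of m] a0 h[of m] by (intro mult_mono) auto
    then show ?thesis by (simp add: AA_def)
  qed
  have v0: "0 < vv m" for m using h A by (simp add: vv_def)
  have vle: "real (LL m) ^ (dd m + ?n) * vv m \<le> 1/4" for m
  proof -
    have "Suc (?n - 1) = ?n" using n1 by simp
    then have two: "(2::real) ^ ?n = 2 * 2 ^ (?n - 1)" by (metis power_Suc)
    have "vv m = 2 ^ ?n * a0 * ss m * hh m ^ (?n - 1 + k)"
      unfolding vv_def AA_def power_mult_distrib power_add two by (simp only: mult_ac)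
    moreover have "real (LL m) ^ (dd m + ?n) * hh m ^ (?n - 1 + k) \<le> 1"
    proof -
      have "real (LL m) ^ (dd m + ?n) * hh m ^ (?n - 1 + k) \<le> real (gg m) ^ (?n - 1 + k) * hh m ^ (?n - 1 + k)"
        unfolding gg_def using h[of m] by (intro mult_right_mono cb) auto
      also have "\<dots> = (hh m * real (gg m)) ^ (?n - 1 + k)" by (simp add: power_mult_distrib mult.commute)
      also have "\<dots> \<le> 1" unfolding hg using r s[of m] rs[of m] by (intro power_le_one) auto
      finally show ?thesis .
    qed
    moreover have "2 ^ ?n * a0 * ss m \<le> 1/4"
    proof -
      have "2 ^ ?n * a0 \<le> 2 ^ ?n * (1 / 2 ^ (?n + 2))" by (intro mult_left_mono a0) auto
      then have "2 ^ ?n * a0 \<le> 1/4" by (simp add: power_add)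
      then show ?thesis using mult_mono[of "2 ^ ?n * a0" "1/4" "ss m" 1] s[of m] a0 by simp
    qed
    ultimately show ?thesis
      using mult_mono[of "2 ^ ?n * a0 * ss m" "1/4" "real (LL m) ^ (dd m + ?n) * hh m ^ (?n - 1 + k)" 1] h[of m] by (simp add: mult_ac)
  qed
  have inv: "\<psi> x = \<psi> z" if "\<And>j. j \<noteq> b \<Longrightarrow> x$j = z$j" for x z
  proof -
    have "(\<Sum>j\<in>UNIV - {b}. \<bar>x$j - z$j\<bar>) = 0" using that by (intro sum.neutral) auto
    then show ?thesis using lip[of x z] by simp
  qed
  have cont: "continuous_on UNIV \<psi>"
  proof -
    have "\<bar>\<psi> x - \<psi> z\<bar> \<le> (\<Lambda> * real ?n) * dist x z" for x z
    proof -
      have "(\<Sum>j\<in>UNIV - {b}. \<bar>x$j - z$j\<bar>) \<le> (\<Sum>j\<in>UNIV - {b}. dist x z)"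
        by (intro sum_mono) (metis component_le_norm_cart dist_norm vector_minus_component)
      also have "\<dots> \<le> real ?n * dist x z" by (simp add: card_Diff_singleton mult_right_mono)
      finally have "\<Lambda> * (\<Sum>j\<in>UNIV - {b}. \<bar>x$j - z$j\<bar>) \<le> \<Lambda> * (real ?n * dist x z)" using Lam by (rule mult_left_mono)
      then show ?thesis using lip[of x z] by (simp add: mult.assoc)
    qed
    then have "(\<Lambda> * real ?n)-lipschitz_on UNIV \<psi>" using Lam by (intro lipschitz_onI) (auto simp: dist_real_def)
    then show ?thesis by (rule lipschitz_on_continuous_on)
  qed
  have Sm: "S m \<kappa> \<in> sets borel" and Sv: "emeasure lborel (S m \<kappa>) = ennreal (vv m)" for m \<kappa>
    unfolding S_def vv_def
    by (rule graph_slab[OF cont inv]; (assumption | rule less_imp_le[OF h] less_imp_le[OF A]))+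
  have J: "finite (JJ m)" "JJ m \<noteq> {}" "card (JJ m) = gg m ^ (?n - 1)" for m
    using g1[of m] by (auto simp: JJ_def finite_PiE card_PiE card_Diff_singleton PiE_eq_empty_iff lessThan_empty_iff)
  have zrange: "\<bar>\<zeta> m \<kappa> $ j - (p$j + r / (real m + 2))\<bar> \<le> r * ss m / 16 - 2 * hh m" if "\<kappa> \<in> JJ m" "j \<noteq> b" for m \<kappa> j
  proof -
    have "\<kappa> j < gg m" using that by (auto simp: JJ_def)
    then have "real (\<kappa> j) + 1 \<le> real (gg m)" by simp
    then have "(real (\<kappa> j) + 1) * hh m \<le> real (gg m) * hh m" using h[of m] by (intro mult_right_mono) auto
    then have a: "real (\<kappa> j) * hh m + hh m \<le> r * ss m / 32" using hg[of m] by (simp add: algebra_simps)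
    have bb: "0 \<le> real (\<kappa> j) * hh m" using h[of m] by simp
    have "\<zeta> m \<kappa> $ j - (p$j + r / (real m + 2)) = 4 * (real (\<kappa> j) * hh m) + 2 * hh m - r * ss m / 16"
      by (simp add: \<zeta>_def algebra_simps)
    then show ?thesis using a bb h[of m] by linarith
  qed
  have Srange: "\<bar>x$j - (p$j + r / (real m + 2))\<bar> \<le> r * ss m / 16 - hh m" if "\<kappa> \<in> JJ m" "x \<in> S m \<kappa>" "j \<noteq> b" for m \<kappa> x j
  proof -
    have "\<bar>x$j - \<zeta> m \<kappa> $ j\<bar> \<le> hh m" using that by (simp add: S_def)
    then show ?thesis using zrange[OF that(1,3)] by linarith
  qed
  have rm: "0 < r / (real m + 2)" "r / (real m + 2) \<le> r / 2" for m
    using r by (auto intro!: divide_left_mono simp del: divide_le_eq_numeral1 le_divide_eq_numeral1)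
  have rs16: "r * ss m / 16 \<le> r / 16" for m using mult_left_mono[OF s(2)[of m], of r] r by simp
  have Sp: "\<bar>x$j - p$j\<bar> \<le> r - hh m" if "\<kappa> \<in> JJ m" "x \<in> S m \<kappa>" "j \<noteq> b" for m \<kappa> x j
    using Srange[OF that] rm[of m] rs16[of m] r by linarith
  have SD: "\<bar>x$i\<bar> \<le> DD m - real (dd m)" if "\<kappa> \<in> JJ m" "x \<in> S m \<kappa>" for m \<kappa> x i
  proof (cases "i = b")
    case True
    have "\<bar>x$b - \<psi> x\<bar> \<le> 1" using that A1[of m] by (auto simp: S_def)
    then show ?thesis using psip[of x] component_le_norm_cart[of p b] unfolding DD_def True by linarith
  next
    case False
    then show ?thesis using Sp[OF that False] component_le_norm_cart[of p i] r h[of m] unfolding DD_def by linarith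
  qed
  define Cf where "Cf = (\<lambda>m (u :: nat \<Rightarrow> real^'n) \<tau>. (\<forall>i<dd m. u i \<in> cbox 0 1) \<and>
    (\<forall>\<nu> a. norm \<nu> = 1 \<longrightarrow> emeasure lborel (model_set (dd m) (LL m) (cc m * real (LL m) ^ dd m) u \<inter> tube \<nu> a)
      \<le> ennreal (real ((9 * LL m) ^ qq m) * measure lborel (ball (0::real^'n) 2))) \<and>
    real (card (JJ m)) * real (LL m) ^ dd m * vv m / (2 * (2 * DD m) ^ ?n)
      \<le> real (card {j\<in>JJ m. \<exists>mm\<in>gap_index (dd m) (LL m). \<tau> + gap_point (dd m) (LL m) u mm \<in> S m j}))"
  have "\<exists>u \<tau>. Cf m u \<tau>" for m
    unfolding Cf_def
  proof (rule exists_scale_configuration)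
    show "1 \<le> dd m" by (simp add: dd_def scale_dim_def)
    have "0 < 2 * ?n * (PP m + 1)" using n1 by (intro mult_pos_pos) auto
    then show "1 \<le> qq m" by (simp only: qq_def scale_chain_def One_nat_def Suc_le_eq)
    show "0 < cc m" "cc m \<le> 1" "chain_const ?n (dd m) (qq m) * cc m \<le> 1/4"
      unfolding cc_def dd_def qq_def by (rule scale_shrink_bounds[OF n1])+
    show "dd m * ?n \<le> (\<Sum>j<qq m. qq m - 1 - j)" unfolding dd_def qq_def by (rule scale_chain_expo[OF n1])
    show "0 < DD m" by (simp add: DD_def add_nonneg_pos add_pos_nonneg)
  qed (use L1 J Sm Sv v0 vle SD in blast)+
  then obtain u \<tau> where Cfm: "\<And>m. Cf m (u m) (\<tau> m)" by metis
  define H where "H = (\<lambda>m. {\<kappa>\<in>JJ m. \<exists>mm\<in>gap_index (dd m) (LL m). \<tau> m + gap_point (dd m) (LL m) (u m) mm \<in> S m \<kappa>})"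
  \<comment> \<open>One point of the progression is kept for each slab that is hit, since the nodes
    must keep a distance of \<open>2 * hh m\<close>.\<close>
  define y where "y = (\<lambda>m \<kappa>. SOME z. (\<exists>mm\<in>gap_index (dd m) (LL m). z = \<tau> m + gap_point (dd m) (LL m) (u m) mm) \<and> z \<in> S m \<kappa>)"
  have y: "(\<exists>mm\<in>gap_index (dd m) (LL m). y m \<kappa> = \<tau> m + gap_point (dd m) (LL m) (u m) mm) \<and> y m \<kappa> \<in> S m \<kappa>" if "\<kappa> \<in> H m" for m \<kappa>
  proof -
    have "\<exists>z. (\<exists>mm\<in>gap_index (dd m) (LL m). z = \<tau> m + gap_point (dd m) (LL m) (u m) mm) \<and> z \<in> S m \<kappa>"
      using that by (auto simp: H_def)
    then show ?thesis unfolding y_def by (rule someI_ex)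
  qed
  have HJ: "\<kappa> \<in> JJ m" if "\<kappa> \<in> H m" for m \<kappa> using that by (simp add: H_def)
  have sep: "\<exists>j. j \<noteq> b \<and> 2 * hh m \<le> \<bar>y m \<kappa> $ j - y m \<kappa>' $ j\<bar>" if k: "\<kappa> \<in> H m" "\<kappa>' \<in> H m" "\<kappa> \<noteq> \<kappa>'" for m \<kappa> \<kappa>'
  proof -
    have "\<exists>j. j \<noteq> b \<and> \<kappa> j \<noteq> \<kappa>' j"
    proof (rule ccontr)
      assume "\<not> ?thesis"
      then have "\<kappa> = \<kappa>'" using HJ[OF k(1)] HJ[OF k(2)] unfolding JJ_def by (intro PiE_ext[of \<kappa> _ _ \<kappa>']) auto
      then show False using k(3) by simp
    qed
    then obtain j where j: "j \<noteq> b" "\<kappa> j \<noteq> \<kappa>' j" by blast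
    have "\<bar>real (\<kappa> j) - real (\<kappa>' j)\<bar> \<ge> 1" using j(2) by linarith
    then have "1 * hh m \<le> \<bar>real (\<kappa> j) - real (\<kappa>' j)\<bar> * hh m" using h[of m] by (intro mult_right_mono) auto
    then have "4 * hh m \<le> 4 * \<bar>(real (\<kappa> j) - real (\<kappa>' j)) * hh m\<bar>" using h[of m] by (simp add: abs_mult)
    moreover have "\<zeta> m \<kappa> $ j - \<zeta> m \<kappa>' $ j = 4 * ((real (\<kappa> j) - real (\<kappa>' j)) * hh m)"
      by (simp add: \<zeta>_def algebra_simps)
    moreover have "\<bar>y m \<kappa> $ j - \<zeta> m \<kappa> $ j\<bar> \<le> hh m" "\<bar>y m \<kappa>' $ j - \<zeta> m \<kappa>' $ j\<bar> \<le> hh m"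
      using y[OF k(1)] y[OF k(2)] j(1) by (auto simp: S_def)
    ultimately have "2 * hh m \<le> \<bar>y m \<kappa> $ j - y m \<kappa>' $ j\<bar>" by linarith
    then show ?thesis using j(1) by blast
  qed
  \<comment> \<open>Patches of different scales are apart in every coordinate other than
    \<open>b\<close>; such a coordinate exists because n is at least 2.\<close>
  obtain j0 :: 'n where j0: "j0 \<noteq> b"
  proof -
    have "\<exists>j::'n. j \<noteq> b"
    proof (rule ccontr)
      assume "\<not> ?thesis"
      then have "(UNIV :: 'n set) = {b}" by auto
      then have "?n = 1" by (metis card_1_singleton_iff One_nat_def)
      then show False using n2 by simp
    qed
    then show thesis using that by blast
  qed
  have sep': "\<exists>j. j \<noteq> b \<and> hh m' \<le> \<bar>y m \<kappa> $ j - y m' \<kappa>' $ j\<bar>" if k: "m \<noteq> m'" "\<kappa> \<in> H m" "\<kappa>' \<in> H m'" for m m' \<kappa> \<kappa>'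
  proof -
    have "r * (1 / (16 * (real m + 1)\<^sup>2) + 1 / (16 * (real m' + 1)\<^sup>2)) \<le> r * \<bar>1 / (real m + 2) - 1 / (real m' + 2)\<bar>"
      using patch_gap[OF k(1)] r by (intro mult_left_mono) auto
    then have gap: "r * ss m / 16 + r * ss m' / 16 \<le> \<bar>r / (real m + 2) - r / (real m' + 2)\<bar>"
    proof -
      have "r * \<bar>1 / (real m + 2) - 1 / (real m' + 2)\<bar> = \<bar>r * (1 / (real m + 2) - 1 / (real m' + 2))\<bar>" using r by (simp add: abs_mult)
      also have "\<dots> = \<bar>r / (real m + 2) - r / (real m' + 2)\<bar>" by (simp add: right_diff_distrib)
      finally show ?thesis using \<open>r * (1 / (16 * (real m + 1)\<^sup>2) + 1 / (16 * (real m' + 1)\<^sup>2)) \<le> r * \<bar>1 / (real m + 2) - 1 / (real m' + 2)\<bar>\<close>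
        by (simp add: ss_def distrib_left mult.commute)
    qed
    have "hh m' \<le> \<bar>y m \<kappa> $ j0 - y m' \<kappa>' $ j0\<bar>"
      using Srange[OF HJ[OF k(2)] conjunct2[OF y[OF k(2)]] j0] Srange[OF HJ[OF k(3)] conjunct2[OF y[OF k(3)]] j0] gap h[of m] h[of m']
      by linarith
    then show ?thesis using j0 by blast
  qed
  define a where "a = (\<lambda>m \<kappa>. y m \<kappa> $ b - \<psi> (y m \<kappa>))"
  have "\<exists>g D. Ck_derivs k UNIV g D \<and> (\<forall>al x. length al \<le> k \<longrightarrow> \<bar>D al x\<bar> \<le> \<rho>) \<and>
        (\<forall>m. \<forall>h\<in>H m. \<forall>x. (\<forall>j. j \<noteq> b \<longrightarrow> x $ j = y m h $ j) \<longrightarrow> g x = a m h) \<and>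
        (\<forall>x x'. (\<forall>j. j \<noteq> b \<longrightarrow> x $ j = x' $ j) \<longrightarrow> g x = g x')"
  proof (rule B(2)[where \<mu> = "\<lambda>m. 1 / hh m" and A = AA])
    show "finite (H m)" for m using J(1) by (simp add: H_def)
    show "1 \<le> 1 / hh m" for m using h hle1 by (simp add: le_divide_eq)
    show "0 \<le> AA m" for m using A[of m] by simp
    show "B * AA m * (1 / hh m) ^ k \<le> \<rho> / (real m + 1)\<^sup>2" for m
    proof -
      have "B * AA m * (1 / hh m) ^ k = B * a0 * ss m" using h[of m] by (simp add: AA_def power_divide)
      also have "\<dots> \<le> \<rho> * ss m"
        using a0(2) B(1) s[of m] by (intro mult_right_mono) (auto simp: field_simps)
      finally show ?thesis by (simp add: ss_def)
    qed
    show "\<bar>a m \<kappa>\<bar> \<le> AA m" if "\<kappa> \<in> H m" for m \<kappa> using y[OF that] by (simp add: a_def S_def)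
    show "\<exists>j. j \<noteq> b \<and> 2 / (1 / hh m) \<le> \<bar>y m \<kappa> $ j - y m \<kappa>' $ j\<bar>" if "\<kappa> \<in> H m" "\<kappa>' \<in> H m" "\<kappa> \<noteq> \<kappa>'" for m \<kappa> \<kappa>'
      using sep[OF that] by simp
    show "\<exists>j. j \<noteq> b \<and> 1 / (1 / hh m') \<le> \<bar>y m \<kappa> $ j - y m' \<kappa>' $ j\<bar>" if "m \<noteq> m'" "\<kappa> \<in> H m" "\<kappa>' \<in> H m'" for m m' \<kappa> \<kappa>'
      using sep'[OF that] by simp
  qed (rule rho)
  then obtain g D where gD: "Ck_derivs k UNIV g D" "\<forall>al x. length al \<le> k \<longrightarrow> \<bar>D al x\<bar> \<le> \<rho>"
    "\<And>m \<kappa> x. \<kappa> \<in> H m \<Longrightarrow> (\<forall>j. j \<noteq> b \<longrightarrow> x $ j = y m \<kappa> $ j) \<Longrightarrow> g x = a m \<kappa>"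
    "\<forall>x x'. (\<forall>j. j \<noteq> b \<longrightarrow> x $ j = x' $ j) \<longrightarrow> g x = g x'" by blast
  show ?thesis
  proof (rule exI[of _ a0], rule conjI[OF a0(1)], rule exI[of _ g], rule exI[of _ D], intro conjI gD(1) gD(2) gD(4), intro allI impI)
    fix P L :: nat assume L: "1 \<le> L"
    define m where "m = prod_encode (P, L - 1)"
    have m: "PP m = P" "LL m = L" using L by (simp_all add: PP_def LL_def m_def)
    have e1: "scale_dim P = dd m" "scale_shrink ?n P = cc m" "scale_chain ?n P = qq m"
      by (simp_all add: dd_def cc_def qq_def m)
    have e2: "cells_per_axis ?n k (dd m) L = gg m" "scale_weight P L = ss m" by (simp add: gg_def m, simp add: scale_weight_def ss_def m_def)
    have e3: "bump_radius r ?n k P L = hh m" unfolding bump_radius_def e1 e2 hh_def ..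
    have e4: "norm p + 2 + real (dd m) = DD m" by (simp add: DD_def)
    have e5: "(2 * hh m) ^ (?n - 1) * (2 * (a0 * ss m * hh m ^ k)) = vv m" by (simp add: vv_def AA_def)
    have e6: "real (gg m) ^ (?n - 1) = real (card (JJ m))" by (simp add: J(3))
    show "\<exists>(H :: ('n \<Rightarrow> nat) set) y u \<tau>. finite H \<and> (\<forall>i<scale_dim P. u i \<in> cbox 0 1) \<and>
      (\<forall>\<nu> a. norm \<nu> = 1 \<longrightarrow>
        emeasure lborel (model_set (scale_dim P) L (scale_shrink ?n P * real L ^ scale_dim P) u \<inter> tube \<nu> a)
        \<le> ennreal (real ((9 * L) ^ scale_chain ?n P) * measure lborel (ball (0::real^'n) 2))) \<and>
      real (cells_per_axis ?n k (scale_dim P) L) ^ (?n - 1) * real L ^ scale_dim P *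
        ((2 * bump_radius r ?n k P L) ^ (?n - 1) * (2 * (a0 * scale_weight P L * bump_radius r ?n k P L ^ k)))
        / (2 * (2 * (norm p + 2 + real (scale_dim P))) ^ ?n) \<le> real (card H) \<and>
      (\<forall>\<kappa>\<in>H. \<exists>m\<in>gap_index (scale_dim P) L. y \<kappa> = \<tau> + gap_point (scale_dim P) L u m) \<and>
      (\<forall>\<kappa>\<in>H. y \<kappa>$b = \<psi> (y \<kappa>) + g (y \<kappa>)) \<and>
      (\<forall>\<kappa>\<in>H. \<forall>\<kappa>'\<in>H. \<kappa> \<noteq> \<kappa>' \<longrightarrow> (\<exists>j. j \<noteq> b \<and> 2 * bump_radius r ?n k P L \<le> \<bar>y \<kappa>$j - y \<kappa>'$j\<bar>)) \<and>
      (\<forall>\<kappa>\<in>H. \<forall>j. j \<noteq> b \<longrightarrow> \<bar>y \<kappa>$j - p$j\<bar> \<le> r - bump_radius r ?n k P L)"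
      unfolding e3 e1 e2 e4 e5 e6
    proof (rule exI[of _ "H m"], rule exI[of _ "y m"], rule exI[of _ "u m"], rule exI[of _ "\<tau> m"], intro conjI ballI)
      show "finite (H m)" using J(1) by (simp add: H_def)
      have C: "Cf m (u m) (\<tau> m)" by (rule Cfm)
      show "\<forall>i<dd m. u m i \<in> cbox 0 1"
        "\<forall>\<nu> a. norm \<nu> = 1 \<longrightarrow> emeasure lborel (model_set (dd m) L (cc m * real L ^ dd m) (u m) \<inter> tube \<nu> a)
          \<le> ennreal (real ((9 * L) ^ qq m) * measure lborel (ball (0::real^'n) 2))"
        "real (card (JJ m)) * real L ^ dd m * vv m / (2 * (2 * DD m) ^ ?n) \<le> real (card (H m))"
        using C unfolding Cf_def H_def m by blast+
      fix \<kappa> assume kH: "\<kappa> \<in> H m"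
      show "\<exists>mm\<in>gap_index (dd m) L. y m \<kappa> = \<tau> m + gap_point (dd m) L (u m) mm" using y[OF kH] unfolding m by blast
      show "y m \<kappa> $ b = \<psi> (y m \<kappa>) + g (y m \<kappa>)" using gD(3)[OF kH, of "y m \<kappa>"] by (simp add: a_def)
      show "\<forall>j. j \<noteq> b \<longrightarrow> \<bar>y m \<kappa>$j - p$j\<bar> \<le> r - hh m" using Sp[OF HJ[OF kH] conjunct2[OF y[OF kH]]] by blast
      fix \<kappa>' assume "\<kappa>' \<in> H m"
      then show "\<kappa> \<noteq> \<kappa>' \<longrightarrow> (\<exists>j. j \<noteq> b \<and> 2 * hh m \<le> \<bar>y m \<kappa>$j - y m \<kappa>'$j\<bar>)" using sep[OF kH] by blast
    qed
  qed
qed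

section \<open>Quantitative bounds for the scale parameters\<close>

lemma scale_weight_ge:
  assumes L: "1 \<le> L"
  shows "1 / (4 * (real P + 1) ^ 4) / real L ^ 4 \<le> scale_weight P L"
proof -
  let ?m = "prod_encode (P, L - 1)"
  \<comment> \<open>The pairing function grows quadratically, so for fixed \<open>P\<close> the
    weight loses only the fourth power of \<open>L\<close>.\<close>
  have tri: "triangle x \<le> x * (x + 1)" for x by (induction x) (auto simp: triangle_def)
  have "?m = triangle (P + (L - 1)) + P" by (simp add: prod_encode_def)
  also have "\<dots> \<le> (P + (L - 1)) * (P + (L - 1) + 1) + P" using tri by simp
  also have "P + (L - 1) + 1 = P + L" using L by simp
  finally have "?m + 1 \<le> (P + L) * (P + L) + (P + 1)"
  proof -
    assume a: "?m \<le> (P + (L - 1)) * (P + L) + P"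
    have "(P + (L - 1)) * (P + L) \<le> (P + L) * (P + L)" by (rule mult_le_mono1) simp
    then show ?thesis using a by linarith
  qed
  also have "\<dots> \<le> ((P + 1) * L) * ((P + 1) * L) + ((P + 1) * L) * ((P + 1) * L)"
  proof (rule add_mono)
    have PL: "P * 1 \<le> P * L" by (rule mult_le_mono2) (rule L)
    then have "P + L \<le> (P + 1) * L" by simp
    then show "(P + L) * (P + L) \<le> ((P + 1) * L) * ((P + 1) * L)" by (rule mult_le_mono) fact
    have "P + 1 \<le> (P + 1) * L" using mult_le_mono2[OF L, of "P + 1"] by simp
    also have "\<dots> \<le> ((P + 1) * L) * ((P + 1) * L)" by (rule le_square)
    finally show "P + 1 \<le> ((P + 1) * L) * ((P + 1) * L)" .
  qed
  finally have "real (?m + 1) \<le> real (((P + 1) * L) * ((P + 1) * L) + ((P + 1) * L) * ((P + 1) * L))" by (simp only: of_nat_le_iff)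
  then have m: "real ?m + 1 \<le> 2 * ((real P + 1) * real L)\<^sup>2" by (simp add: power2_eq_square algebra_simps)
  have "(real ?m + 1)\<^sup>2 \<le> (2 * ((real P + 1) * real L)\<^sup>2)\<^sup>2" by (intro power_mono m) auto
  also have "\<dots> = 4 * (real P + 1) ^ 4 * real L ^ 4" by (simp add: power_mult_distrib flip: power_mult)
  finally have "1 / (4 * (real P + 1) ^ 4 * real L ^ 4) \<le> 1 / (real ?m + 1)\<^sup>2"
    using L by (intro divide_left_mono) auto
  then show ?thesis by (simp add: scale_weight_def)
qed

lemma scale_weight_pos: "0 < scale_weight P L"
  by (simp add: scale_weight_def)

text \<open>The loss exponent \<open>5 * n + 4 * k\<close> does not depend on \<open>P\<close>: one
  \<open>n\<close> comes from the surplus in \<open>L ^ (d + n)\<close>, and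
  \<open>4 * (n + k)\<close> from the \<open>n + k\<close> factors of the weight. So the loss
  becomes negligible relative to the dimension as \<open>P\<close> grows.\<close>

lemma hits_lower_bound:
  fixes n k P :: nat and r a0 D :: real
  assumes n: "2 \<le> n" and r: "0 < r" and a0: "0 < a0" and D: "0 < D"
  shows "\<exists>c>0. \<forall>L\<ge>1. c * (real L powr (real (n - 1) / real (n - 1 + k) * real (scale_dim P)) / real L ^ (5 * n + 4 * k)) \<le>
     real (cells_per_axis n k (scale_dim P) L) ^ (n - 1) * real L ^ scale_dim P *
        ((2 * bump_radius r n k P L) ^ (n - 1) * (2 * (a0 * scale_weight P L * bump_radius r n k P L ^ k)))
        / (2 * (2 * D) ^ n)"
proof -
  define N where "N = n - 1 + k"
  have N: "0 < N" "N + 1 = n + k" using n by (auto simp: N_def)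
  define cw where "cw = 1 / (4 * (real P + 1) ^ 4)"
  have cw: "0 < cw" by (simp add: cw_def add_nonneg_pos)
  let ?d = "scale_dim P"
  let ?\<gamma> = "real (n - 1) / real N"
  define c where "c = 2 ^ n * a0 * (r / 64) ^ N * cw ^ (n + k) / (2 * (2 * D) ^ n)"
  have c: "0 < c" using a0 r cw D by (simp add: c_def)
  have "c * (real L powr (?\<gamma> * real ?d) / real L ^ (5 * n + 4 * k)) \<le>
     real (cells_per_axis n k ?d L) ^ (n - 1) * real L ^ ?d *
        ((2 * bump_radius r n k P L) ^ (n - 1) * (2 * (a0 * scale_weight P L * bump_radius r n k P L ^ k)))
        / (2 * (2 * D) ^ n)" if L: "1 \<le> L" for L
  proof -
    define g where "g = real (cells_per_axis n k ?d L)"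
    define w where "w = scale_weight P L"
    define h where "h = bump_radius r n k P L"
    have N': "0 < n - 1 + k" using N(1) unfolding N_def .
    note cb = cells_per_axis_bounds[OF L N', of ?d, folded N_def g_def]
    have L0: "0 < real L" and L1: "1 \<le> real L" using L by auto
    have g1: "1 \<le> g" using cb(1) by (simp add: g_def)
    have w: "0 < w" "cw / real L ^ 4 \<le> w" unfolding w_def cw_def by (rule scale_weight_pos, rule scale_weight_ge[OF L])
    have h: "h = r * w / (32 * g)" by (simp add: h_def bump_radius_def w_def g_def)
    have h0: "0 < h" using r w g1 by (simp add: h)
    have hN: "(r * w / 64) ^ N / real L ^ (?d + n) \<le> h ^ N"
    proof -
      have "(r * w / 64) ^ N / real L ^ (?d + n) = (r * w / 32) ^ N / (2 ^ N * real L ^ (?d + n))"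
        by (simp add: power_divide power_mult_distrib[symmetric])
      also have "\<dots> \<le> (r * w / 32) ^ N / g ^ N"
        using cb(5) r w g1 L0 by (intro divide_left_mono) auto
      also have "\<dots> = h ^ N" by (simp add: h power_divide power_mult_distrib)
      finally show ?thesis .
    qed
    have gn: "real L powr (?\<gamma> * real ?d) \<le> g ^ (n - 1)"
    proof -
      have "real L powr (?\<gamma> * real ?d) \<le> real L powr (real (?d + n) / real N * real (n - 1))"
      proof (rule powr_mono)
        have "real (n - 1) * real ?d \<le> real (?d + n) * real (n - 1)" by (simp add: algebra_simps)
        then have "real (n - 1) * real ?d / real N \<le> real (?d + n) * real (n - 1) / real N" by (rule divide_right_mono) simp
        then show "?\<gamma> * real ?d \<le> real (?d + n) / real N * real (n - 1)" by simp
      qed (rule L1)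
      also have "\<dots> = (real L powr (real (?d + n) / real N)) ^ (n - 1)"
      proof -
        have pg: "0 < real L powr (real (?d + n) / real N)" using L0 by simp
        show ?thesis by (simp only: powr_powr[symmetric] powr_realpow[OF pg])
      qed
      also have "\<dots> \<le> g ^ (n - 1)" by (intro power_mono cb(2)) auto
      finally show ?thesis .
    qed
    have wN: "cw ^ (n + k) / real L ^ (4 * (n + k)) \<le> w ^ (n + k)"
    proof -
      have "(cw / real L ^ 4) ^ (n + k) \<le> w ^ (n + k)" using cw L0 by (intro power_mono w) auto
      then show ?thesis by (simp only: power_divide power_mult)
    qed
    have X: "g ^ (n - 1) * real L ^ ?d * ((2 * h) ^ (n - 1) * (2 * (a0 * w * h ^ k))) = 2 ^ n * a0 * g ^ (n - 1) * real L ^ ?d * w * h ^ N"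
    proof -
      have "Suc (n - 1) = n" using n by simp
      then have two: "(2::real) ^ n = 2 * 2 ^ (n - 1)" by (metis power_Suc)
      show ?thesis unfolding N_def power_mult_distrib power_add two by (simp only: mult_ac)
    qed
    have "c * (real L powr (?\<gamma> * real ?d) / real L ^ (5 * n + 4 * k)) * (2 * (2 * D) ^ n)
      = 2 ^ n * a0 * (r / 64) ^ N * cw ^ (n + k) * (real L powr (?\<gamma> * real ?d) / real L ^ (5 * n + 4 * k))"
      using D by (simp add: c_def)
    also have "\<dots> = 2 ^ n * a0 * real L powr (?\<gamma> * real ?d) * real L ^ ?d * ((r / 64) ^ N * (cw ^ (n + k) / real L ^ (4 * (n + k))) / real L ^ (?d + n))"
    proof -
      have "real L ^ (5 * n + 4 * k) = real L ^ n * real L ^ (4 * (n + k))" by (simp add: power_add[symmetric] algebra_simps)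
      then show ?thesis using L0 by (simp add: power_add mult_ac)
    qed
    also have "\<dots> \<le> 2 ^ n * a0 * g ^ (n - 1) * real L ^ ?d * ((r / 64) ^ N * w ^ (n + k) / real L ^ (?d + n))"
      using a0 r cw L0 g1 by (intro mult_mono divide_right_mono gn wN order_refl mult_nonneg_nonneg) auto
    also have "(r / 64) ^ N * w ^ (n + k) / real L ^ (?d + n) = w * ((r * w / 64) ^ N / real L ^ (?d + n))"
      unfolding N(2)[symmetric] by (simp add: power_divide power_mult_distrib power_add)
    also have "2 ^ n * a0 * g ^ (n - 1) * real L ^ ?d * \<dots> \<le> 2 ^ n * a0 * g ^ (n - 1) * real L ^ ?d * (w * h ^ N)"
      using a0 g1 w by (intro mult_left_mono hN) auto
    also have "\<dots> = g ^ (n - 1) * real L ^ ?d * ((2 * h) ^ (n - 1) * (2 * (a0 * w * h ^ k)))" unfolding X by (simp only: mult_ac)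
    finally have fin: "c * (real L powr (?\<gamma> * real ?d) / real L ^ (5 * n + 4 * k)) * (2 * (2 * D) ^ n)
      \<le> g ^ (n - 1) * real L ^ ?d * ((2 * h) ^ (n - 1) * (2 * (a0 * w * h ^ k)))" .
    have "0 < 2 * (2 * D) ^ n" using D by simp
    then show ?thesis using fin unfolding g_def w_def h_def by (simp only: pos_le_divide_eq)
  qed
  then show ?thesis using c unfolding N_def by blast
qed

text \<open>Caps of radius of order \<open>1 / L ^ d\<close> have to fit into the bumps. Since
  \<open>n - 1 + k\<close> is at least 3, the bump radius is at least of order \<open>L\<close> to
  the power -(d + n)/3 - 4, and \<open>d\<close> is large enough for this to dominate.\<close>

lemma piece_radius_lower_bound:
  fixes n k P :: nat and r \<Lambda> :: real
  assumes n: "2 \<le> n" and k: "2 \<le> k" and r: "0 < r" and Lam: "0 \<le> \<Lambda>" and d: "12 + n \<le> scale_dim P"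
  shows "\<exists>c>0. \<forall>L\<ge>1. c / real L ^ scale_dim P \<le> min (bump_radius r n k P L / 2) (1 / (16 * real n * (1 + \<Lambda>) * real L ^ scale_dim P))"
proof -
  define cw where "cw = 1 / (4 * (real P + 1) ^ 4)"
  have cw: "0 < cw" by (simp add: cw_def add_nonneg_pos)
  let ?d = "scale_dim P"
  define c where "c = min (r * cw / 128) (1 / (16 * real n * (1 + \<Lambda>)))"
  have c: "0 < c" using r cw n Lam by (simp add: c_def)
  have "c / real L ^ ?d \<le> min (bump_radius r n k P L / 2) (1 / (16 * real n * (1 + \<Lambda>) * real L ^ ?d))" if L: "1 \<le> L" for L
  proof (rule min.boundedI)
    have L0: "0 < real L" and L1: "1 \<le> real L" using L by auto
    have N': "0 < n - 1 + k" using k by linarith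
    let ?g = "real (cells_per_axis n k ?d L)" and ?e = "real (?d + n) / real (n - 1 + k)"
    note cb = cells_per_axis_bounds[OF L N', of ?d]
    have g0: "0 < ?g" using cb(1) by linarith
    have "?e \<le> real (?d + n) / 3" using n k by (intro divide_left_mono) auto
    also have "\<dots> \<le> real ?d - 4"
    proof -
      have "real (12 + n) \<le> real ?d" using d by (simp only: of_nat_le_iff)
      then show ?thesis by simp
    qed
    finally have e: "?e + 4 \<le> real ?d" by simp
    have "real L powr ?e * real L ^ 4 = real L powr (?e + 4)" using L0 by (simp add: powr_add powr_numeral)
    also have "\<dots> \<le> real L powr real ?d" by (intro powr_mono e L1)
    also have "\<dots> = real L ^ ?d" using L0 by (simp add: powr_realpow)
    finally have Le: "real L powr ?e * real L ^ 4 \<le> real L ^ ?d" .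
    have "c / real L ^ ?d \<le> (r * cw / 128) / real L ^ ?d" by (intro divide_right_mono) (auto simp: c_def)
    also have "\<dots> \<le> (r * cw / 128) / (real L powr ?e * real L ^ 4)"
      using Le r cw L0 by (intro divide_left_mono) auto
    also have "\<dots> = r * (cw / real L ^ 4) / (64 * (2 * real L powr ?e))" by simp
    also have "\<dots> \<le> r * scale_weight P L / (64 * ?g)"
    proof (rule frac_le)
      show "r * (cw / real L ^ 4) \<le> r * scale_weight P L" using scale_weight_ge[OF L, of P] r unfolding cw_def by (intro mult_left_mono) auto
      show "64 * ?g \<le> 64 * (2 * real L powr ?e)" using cb(3) by simp
    qed (use r g0 scale_weight_pos[of P L] in auto)
    also have "\<dots> = bump_radius r n k P L / 2" by (simp add: bump_radius_def)
    finally show "c / real L ^ ?d \<le> bump_radius r n k P L / 2" .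
    have "c / real L ^ ?d \<le> (1 / (16 * real n * (1 + \<Lambda>))) / real L ^ ?d" by (intro divide_right_mono) (auto simp: c_def)
    then show "c / real L ^ ?d \<le> 1 / (16 * real n * (1 + \<Lambda>) * real L ^ ?d)" by simp
  qed
  then show ?thesis using c by blast
qed

text \<open>\<open>L\<close> is the largest length with \<open>c * L ^ d\<close> at most
  \<open>R\<close>; its successor is at most \<open>2 * L\<close>.\<close>

lemma exists_scale_length:
  fixes R c :: real
  assumes R: "1 < R" and c: "0 < c" "c \<le> 1" and d: "1 \<le> d"
  shows "\<exists>L\<ge>1. c * real L ^ d \<le> R \<and> R \<le> (2 * real L) ^ d"
proof -
  have ex: "\<exists>L. R < c * real (Suc L) ^ d"
  proof -
    obtain L :: nat where L: "R / c < real L" using reals_Archimedean2 by blast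
    have "real L \<le> real (Suc L) ^ 1" by simp
    also have "\<dots> \<le> real (Suc L) ^ d" by (rule power_increasing[OF d]) simp
    finally have "R / c < real (Suc L) ^ d" using L by linarith
    then show ?thesis using c by (auto simp: field_simps)
  qed
  define L where "L = (LEAST L. R < c * real (Suc L) ^ d)"
  have L: "R < c * real (Suc L) ^ d" unfolding L_def using ex by (rule LeastI_ex)
  have L1: "1 \<le> L"
  proof (rule ccontr)
    assume "\<not> ?thesis"
    then have "L = 0" by simp
    then show False using L R c by simp
  qed
  then obtain L' where L': "L = Suc L'" by (cases L) auto
  have "L' < L" using L' by simp
  then have "\<not> R < c * real (Suc L') ^ d" unfolding L_def by (rule not_less_Least)
  then have le: "c * real L ^ d \<le> R" using L' by simp
  have "c * real (Suc L) ^ d \<le> 1 * real (Suc L) ^ d" by (rule mult_right_mono[OF c(2)]) simp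
  then have "R \<le> 1 * real (Suc L) ^ d" using L by linarith
  also have "\<dots> \<le> (2 * real L) ^ d" unfolding mult_1 using L1 by (intro power_mono) auto
  finally show ?thesis using L1 le by blast
qed

text \<open>\<epsilon> is first lowered to \<open>e0 \<le> \<gamma>\<close>, which makes the
  exponent of \<open>R\<close> nonnegative, so that \<open>R\<close> may be replaced by its upper
  bound. The surplus \<open>L ^ (d * e0)\<close> then absorbs the tube loss \<open>q\<close> and the
  counting loss \<open>s\<close>.\<close>

lemma scale_exponent_bound:
  fixes R \<gamma> \<epsilon> e0 :: real and d q s L :: nat
  assumes R: "1 < R" "R \<le> (2 * real L) ^ d" and L: "1 \<le> L"
    and g: "0 < \<gamma>" "\<gamma> \<le> 1" and e: "e0 \<le> \<epsilon>" "e0 \<le> \<gamma>" "real (q + s) \<le> real d * e0"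
  shows "R powr (\<gamma> - \<epsilon>) * real L ^ q \<le> 2 ^ d * (real L powr (\<gamma> * real d) / real L ^ s)"
proof -
  have L0: "0 < real L" and L1: "1 \<le> real L" using L by auto
  have "R powr (\<gamma> - \<epsilon>) \<le> R powr (\<gamma> - e0)" using R e by (intro powr_mono) auto
  also have "\<dots> \<le> ((2 * real L) ^ d) powr (\<gamma> - e0)" using R e by (intro powr_mono2) auto
  also have "\<dots> = (2 * real L) powr (real d * (\<gamma> - e0))" using L0 by (simp add: powr_powr[symmetric] powr_realpow)
  also have "\<dots> = 2 powr (real d * (\<gamma> - e0)) * real L powr (real d * (\<gamma> - e0))" using L0 by (simp add: powr_mult)
  also have "2 powr (real d * (\<gamma> - e0)) \<le> 2 powr real d"
  proof (rule powr_mono)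
    have "0 \<le> e0"
    proof (rule ccontr)
      assume "\<not> 0 \<le> e0"
      then have "real d * e0 \<le> 0" by (intro mult_nonneg_nonpos) auto
      then have "real d * e0 = 0" using e(3) by linarith
      then have "R \<le> 1" using R(2) \<open>\<not> 0 \<le> e0\<close> by auto
      then show False using R(1) by simp
    qed
    then have "real d * (\<gamma> - e0) \<le> real d * 1" using g by (intro mult_left_mono) auto
    then show "real d * (\<gamma> - e0) \<le> real d" by simp
  qed simp
  also have "2 powr real d = 2 ^ d" by (simp add: powr_realpow)
  finally have 1: "R powr (\<gamma> - \<epsilon>) \<le> 2 ^ d * real L powr (real d * (\<gamma> - e0))" by (simp add: mult_right_mono)
  have "real L powr (real d * (\<gamma> - e0)) * real L ^ q * real L ^ s = real L powr (real d * (\<gamma> - e0) + real q + real s)"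
    using L0 by (simp add: powr_add powr_realpow)
  also have "\<dots> \<le> real L powr (\<gamma> * real d)" using e(3) by (intro powr_mono L1) (simp add: algebra_simps)
  finally have 2: "real L powr (real d * (\<gamma> - e0)) * real L ^ q \<le> real L powr (\<gamma> * real d) / real L ^ s"
    using L0 by (simp add: pos_le_divide_eq)
  have "R powr (\<gamma> - \<epsilon>) * real L ^ q \<le> 2 ^ d * real L powr (real d * (\<gamma> - e0)) * real L ^ q"
    by (rule mult_right_mono[OF 1]) simp
  also have "\<dots> \<le> 2 ^ d * (real L powr (\<gamma> * real d) / real L ^ s)"
    unfolding mult.assoc by (intro mult_left_mono 2) simp
  finally show ?thesis .
qed

text \<open>The chain length is linear in \<open>P\<close> and the number of generators quadratic,
  so any fixed proportion \<open>e0\<close> of the latter eventually exceeds the losses.\<close>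

lemma exists_scale_parameter:
  fixes e0 :: real
  assumes "0 < e0"
  shows "\<exists>P. real (scale_chain n P + (5 * n + 4 * k)) \<le> real (scale_dim P) * e0 \<and> 12 + n \<le> scale_dim P"
proof -
  let ?P = "nat \<lceil>real (7 * n + 4 * k) / e0\<rceil> + 12 + n"
  define x where "x = real ?P + 1"
  have x1: "1 \<le> x" by (simp add: x_def)
  have "real (7 * n + 4 * k) / e0 \<le> x" unfolding x_def using real_nat_ceiling_ge[of "real (7 * n + 4 * k) / e0"] by simp
  then have a: "real (7 * n + 4 * k) \<le> x * e0" using assms by (simp add: pos_divide_le_eq)
  have "real (scale_chain n ?P + (5 * n + 4 * k)) = 2 * real n * x + real (5 * n + 4 * k) * 1"
    by (simp add: scale_chain_def x_def algebra_simps)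
  also have "\<dots> \<le> 2 * real n * x + real (5 * n + 4 * k) * x" by (intro add_left_mono mult_left_mono x1) auto
  also have "\<dots> = real (7 * n + 4 * k) * x" by (simp add: algebra_simps)
  also have "\<dots> \<le> x * e0 * x" using a x1 by (intro mult_right_mono) auto
  also have "\<dots> = real (scale_dim ?P) * e0" by (simp add: scale_dim_def x_def power2_eq_square algebra_simps)
  finally have 1: "real (scale_chain n ?P + (5 * n + 4 * k)) \<le> real (scale_dim ?P) * e0" .
  have "12 + n \<le> (?P + 1)" by simp
  also have "\<dots> \<le> scale_dim ?P" unfolding scale_dim_def power2_eq_square by (rule le_square)
  finally show ?thesis using 1 by blast
qed

section \<open>Properties of the shear, final constants and conclusion\<close>

lemma Ck_derivs_lipschitz:
  fixes g :: "real^'n \<Rightarrow> real"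
  assumes D: "Ck_derivs k UNIV g D" and k: "1 \<le> k" and bd: "\<And>al x. length al \<le> k \<Longrightarrow> \<bar>D al x\<bar> \<le> \<rho>"
    and inv: "\<And>x x'. (\<And>j. j \<noteq> b \<Longrightarrow> x$j = x'$j) \<Longrightarrow> g x = g x'"
  shows "\<bar>g x - g y\<bar> \<le> (real CARD('n) * \<rho>) * (\<Sum>j\<in>UNIV - {b}. \<bar>x$j - y$j\<bar>)"
proof -
  have rho: "0 \<le> \<rho>" using bd[of "[]" 0] by simp
  have gD: "D [] = g" using D by (auto simp: Ck_derivs_def)
  have dg: "(g has_derivative (\<lambda>h. \<Sum>i\<in>UNIV. h$i * D [i] x)) (at x)" for x
  proof (rule has_derivative_of_continuous_partials[OF open_UNIV UNIV_I])
    show "((\<lambda>t. g (y + t *\<^sub>R axis i 1)) has_real_derivative D [i] y) (at 0)" for i y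
      using D k unfolding Ck_derivs_def gD[symmetric] by (metis UNIV_I gD less_le_trans list.size(3) zero_less_one)
    show "continuous_on UNIV (D [i])" for i using D k by (simp add: Ck_derivs_def)
  qed
  have glob: "norm (g x - g z) \<le> (real CARD('n) * \<rho>) * norm (x - z)" for x z
  proof (rule differentiable_bound[OF convex_UNIV _ _ UNIV_I UNIV_I])
    show "(g has_derivative (\<lambda>h. \<Sum>i\<in>UNIV. h$i * D [i] w)) (at w within UNIV)" for w using dg[of w] by simp
    show "onorm (\<lambda>h. \<Sum>i\<in>UNIV. h$i * D [i] w) \<le> real CARD('n) * \<rho>" for w
    proof (rule onorm_le)
      fix h :: "real^'n"
      have "norm (\<Sum>i\<in>UNIV. h$i * D [i] w) \<le> (\<Sum>i\<in>(UNIV::'n set). norm h * \<rho>)"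
      proof (rule sum_norm_le)
        fix i
        have "\<bar>h$i\<bar> * \<bar>D [i] w\<bar> \<le> norm h * \<rho>"
          using bd[of "[i]" w] k by (intro mult_mono component_le_norm_cart) auto
        then show "norm (h$i * D [i] w) \<le> norm h * \<rho>" by (simp add: abs_mult)
      qed
      then show "norm (\<Sum>i\<in>UNIV. h$i * D [i] w) \<le> real CARD('n) * \<rho> * norm h" by (simp add: mult_ac)
    qed
  qed
  \<comment> \<open>Giving \<open>y\<close> the coordinate \<open>b\<close> of \<open>x\<close> does
    not change \<open>g\<close>, and removes this coordinate from the Lipschitz bound.\<close>
  define z where "z = (\<chi> j. if j = b then x$b else y$j)"
  have "g y = g z" by (rule inv) (simp add: z_def)
  then have "\<bar>g x - g y\<bar> \<le> (real CARD('n) * \<rho>) * norm (x - z)" using glob[of x z] by simp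
  also have "norm (x - z) \<le> (\<Sum>j\<in>UNIV. \<bar>(x - z)$j\<bar>)" by (rule norm_le_l1_cart)
  also have "(\<Sum>j\<in>UNIV. \<bar>(x - z)$j\<bar>) = (\<Sum>j\<in>UNIV - {b}. \<bar>x$j - y$j\<bar>)"
    by (subst sum.remove[of _ b]) (auto simp: z_def)
  finally show ?thesis using rho by (simp add: mult_left_mono)
qed

lemma Ck_close_to_id_shear:
  assumes D: "Ck_derivs k UNIV g D" and bd: "\<And>al x. length al \<le> k \<Longrightarrow> \<bar>D al x\<bar> \<le> \<rho>"
  shows "Ck_close_to_id k \<rho> (\<lambda>x. x + g x *\<^sub>R axis b 1)"
  unfolding Ck_close_to_id_def
proof
  fix j
  show "\<exists>D. Ck_derivs k UNIV (\<lambda>x. (x + g x *\<^sub>R axis b 1) $ j - x $ j) D \<and> (\<forall>al x. length al \<le> k \<longrightarrow> \<bar>D al x\<bar> \<le> \<rho>)"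
  proof (cases "j = b")
    case True
    then have "(\<lambda>x. (x + g x *\<^sub>R axis b 1) $ j - x $ j) = g" by (auto simp: axis_def)
    then show ?thesis using D bd by auto
  next
    case False
    have "0 \<le> \<rho>" using order_trans[OF abs_ge_zero bd[of "[]" 0]] by simp
    moreover have "(\<lambda>x. (x + g x *\<^sub>R axis b 1) $ j - x $ j) = (\<lambda>_. 0)" using False by (auto simp: axis_def)
    moreover have "Ck_derivs k UNIV (\<lambda>_. 0) (\<lambda>_ _. 0)" by (simp add: Ck_derivs_def)
    ultimately show ?thesis by (intro exI[of _ "\<lambda>_ _. 0"]) simp
  qed
qed

text \<open>With caps of radius of order \<open>1 / L ^ d\<close>, the powers of \<open>L\<close> in
  the cap measure and in the volume of the model set cancel. The number of hits is then compared
  only with the gain \<open>Rp\<close> and the tube loss \<open>L ^ q\<close>.\<close>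

lemma scale_constants:
  fixes c c1 c2 KH V2 \<omega> cardH rB Rp :: real and d q s n L :: nat
  assumes pos: "0 < c" "0 < c1" "0 < c2" "0 < KH" "0 < V2" "0 < \<omega>" and n: "1 \<le> n" and L: "1 \<le> L" and d: "1 \<le> d"
    and X: "0 \<le> X" "c1 * X \<le> cardH" and rB: "c2 / real L ^ d \<le> rB"
    and Rp: "Rp * real L ^ q \<le> 2 ^ d * X"
  shows "4 * (Rp / (4 * 2 ^ d * 9 ^ q * V2 / (c1 * (2 * c2) ^ (n - 1) / KH * (\<omega> * (c / 2) ^ n / (16 * real d) ^ d)))) * (real ((9 * L) ^ q) * V2)
    \<le> (cardH * (2 * rB) ^ (n - 1) / KH) * (\<omega> * (c * real L ^ d / 2) ^ n / real (16 * d * L) ^ d)"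
proof -
  define c3 where "c3 = \<omega> * (c / 2) ^ n / (16 * real d) ^ d"
  define c5 where "c5 = c1 * (2 * c2) ^ (n - 1) / KH * c3"
  have c3: "0 < c3" using pos d by (simp add: c3_def)
  have c5: "0 < c5" using pos c3 by (simp add: c5_def)
  have L0: "0 < real L" using L by simp
  have "4 * (Rp / (4 * 2 ^ d * 9 ^ q * V2 / c5)) * (real ((9 * L) ^ q) * V2) = c5 * (Rp * real L ^ q) / 2 ^ d"
    using pos c5 by (simp add: power_mult_distrib)
  also have "\<dots> \<le> c5 * (2 ^ d * X) / 2 ^ d" using c5 Rp by (intro divide_right_mono mult_left_mono) auto
  also have "\<dots> = c5 * X" by simp
  also have "\<dots> = (c1 * X) * (2 * c2 / real L ^ d) ^ (n - 1) / KH * (c3 * (real L ^ d) ^ (n - 1))"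
    using L0 by (simp add: c5_def power_divide)
  also have "\<dots> \<le> cardH * (2 * rB) ^ (n - 1) / KH * (c3 * (real L ^ d) ^ (n - 1))"
  proof (intro mult_right_mono divide_right_mono mult_mono power_mono X)
    show "2 * c2 / real L ^ d \<le> 2 * rB" using rB by simp
    show "0 \<le> cardH" using X pos by (meson less_imp_le mult_nonneg_nonneg order_trans)
  qed (use pos c3 L0 in auto)
  also have "c3 * (real L ^ d) ^ (n - 1) = \<omega> * (c * real L ^ d / 2) ^ n / real (16 * d * L) ^ d"
  proof -
    have "Suc (n - 1) = n" using n by simp
    then have "(real L ^ d) ^ n = real L ^ d * (real L ^ d) ^ (n - 1)" by (metis power_Suc)
    moreover have "(c * real L ^ d / 2) ^ n = (c / 2) ^ n * (real L ^ d) ^ n" by (simp add: power_mult_distrib power_divide)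
    moreover have "real (16 * d * L) ^ d = (16 * real d) ^ d * real L ^ d" by (simp add: power_mult_distrib)
    ultimately show ?thesis using L0 d by (simp add: c3_def)
  qed
  finally show ?thesis unfolding c5_def c3_def .
qed

text \<open>\<Phi> is fixed before \<epsilon> and \<open>R\<close>; \<epsilon> then selects
  \<open>P\<close> and with it the constant, and \<open>R\<close> selects \<open>L\<close>. This
  order is possible because the perturbation already contains all pairs \<open>(P, L)\<close>.
  Positivity of the two factors on the right rules out degenerate choices of \<open>f\<close> and
  \<open>w\<close>.\<close>

theorem theorem1p3:
  fixes \<Sigma> :: "(real^'n) set" and k :: nat
  assumes n2: "CARD('n) \<ge> 2"
    and k2: "k \<ge> 2"
    and cpt: "compact \<Sigma>"
    and ne: "\<Sigma> \<noteq> {}"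
    and hyp: "Ck_hypersurface k \<Sigma>"
  shows "\<forall>\<rho>>0. \<exists>\<Phi>. Ck_close_to_id k \<rho> \<Phi> \<and> Ck_hypersurface k (\<Phi> ` \<Sigma>) \<and>
           (\<forall>\<epsilon>>0. \<exists>C>0. \<forall>R>1. \<exists>(f :: real^'n \<Rightarrow> complex) (w :: real^'n \<Rightarrow> real).
              f \<in> borel_measurable (surface_measure (\<Phi> ` \<Sigma>)) \<and>
              (\<integral>\<^sup>+ s. ennreal ((cmod (f s))\<^sup>2) \<partial>surface_measure (\<Phi> ` \<Sigma>)) < \<infinity> \<and>
              (\<integral>\<^sup>+ s. ennreal ((cmod (f s))\<^sup>2) \<partial>surface_measure (\<Phi> ` \<Sigma>)) > 0 \<and>
              w \<in> borel_measurable lborel \<and> (\<forall>x. 0 \<le> w x \<and> w x \<le> 1) \<and>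
              Linf_sphere (tube_max w) > 0 \<and>
              (\<integral>\<^sup>+ x\<in>ball 0 R. ennreal ((cmod (fourier_ext (surface_measure (\<Phi> ` \<Sigma>)) f x))\<^sup>2 * w x) \<partial>lborel)
                \<ge> ennreal (R powr ((real CARD('n) - 1) / (real CARD('n) - 1 + real k) - \<epsilon>) / C)
                   * (\<integral>\<^sup>+ s. ennreal ((cmod (f s))\<^sup>2) \<partial>surface_measure (\<Phi> ` \<Sigma>))
                   * Linf_sphere (tube_max w))"
proof (intro allI impI)
  fix \<rho> :: real assume rho: "0 < \<rho>"
  let ?n = "CARD('n)"
  have n1: "1 \<le> ?n" and k1: "1 \<le> k" using n2 k2 by auto
  obtain p where p: "p \<in> \<Sigma>" using ne by blast
  obtain b r \<Lambda> \<psi> where G: "0 < r" "r \<le> 1" "0 \<le> \<Lambda>"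
    "\<And>x y. \<bar>\<psi> x - \<psi> y\<bar> \<le> \<Lambda> * (\<Sum>j\<in>UNIV - {b}. \<bar>x$j - y$j\<bar>)"
    "\<And>x. \<bar>\<psi> x - p$b\<bar> \<le> 1"
    "\<And>x. (\<And>j. j \<noteq> b \<Longrightarrow> \<bar>x$j - p$j\<bar> \<le> r) \<Longrightarrow> (\<chi> j. if j = b then \<psi> x else x$j) \<in> \<Sigma>"
    by (rule hypersurface_local_graph[OF hyp k1 p]) blast
  obtain a0 g D where a0: "0 < a0" and g: "Ck_derivs k UNIV g D" "\<And>al x. length al \<le> k \<Longrightarrow> \<bar>D al x\<bar> \<le> \<rho>"
    "\<And>x x'. (\<And>j. j \<noteq> b \<Longrightarrow> x$j = x'$j) \<Longrightarrow> g x = g x'"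
    and scales: "\<forall>P L. 1 \<le> L \<longrightarrow> (\<exists>(H :: ('n \<Rightarrow> nat) set) y u \<tau>. finite H \<and> (\<forall>i<scale_dim P. u i \<in> cbox 0 1) \<and>
      (\<forall>\<nu> a. norm \<nu> = 1 \<longrightarrow>
        emeasure lborel (model_set (scale_dim P) L (scale_shrink ?n P * real L ^ scale_dim P) u \<inter> tube \<nu> a)
        \<le> ennreal (real ((9 * L) ^ scale_chain ?n P) * measure lborel (ball (0::real^'n) 2))) \<and>
      real (cells_per_axis ?n k (scale_dim P) L) ^ (?n - 1) * real L ^ scale_dim P *
        ((2 * bump_radius r ?n k P L) ^ (?n - 1) * (2 * (a0 * scale_weight P L * bump_radius r ?n k P L ^ k)))
        / (2 * (2 * (norm p + 2 + real (scale_dim P))) ^ ?n) \<le> real (card H) \<and>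
      (\<forall>\<kappa>\<in>H. \<exists>m\<in>gap_index (scale_dim P) L. y \<kappa> = \<tau> + gap_point (scale_dim P) L u m) \<and>
      (\<forall>\<kappa>\<in>H. y \<kappa>$b = \<psi> (y \<kappa>) + g (y \<kappa>)) \<and>
      (\<forall>\<kappa>\<in>H. \<forall>\<kappa>'\<in>H. \<kappa> \<noteq> \<kappa>' \<longrightarrow> (\<exists>j. j \<noteq> b \<and> 2 * bump_radius r ?n k P L \<le> \<bar>y \<kappa>$j - y \<kappa>'$j\<bar>)) \<and>
      (\<forall>\<kappa>\<in>H. \<forall>j. j \<noteq> b \<longrightarrow> \<bar>y \<kappa>$j - p$j\<bar> \<le> r - bump_radius r ?n k P L))"
    using exists_multiscale_perturbation[OF n2 k1 rho G(1-5)] by blast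
  define \<Phi> where "\<Phi> = (\<lambda>x. x + g x *\<^sub>R (axis b 1 :: real^'n))"
  \<comment> \<open>The shear carries the graph of \<psi> over the cube around \<open>p\<close> to
    the graph of \<phi>.\<close>
  define \<phi> where "\<phi> = (\<lambda>x. \<psi> x + g x)"
  define \<Lambda>' where "\<Lambda>' = \<Lambda> + real ?n * \<rho>"
  have Lam': "0 \<le> \<Lambda>'" using G(3) rho by (simp add: \<Lambda>'_def)
  have Ckg: "Ck_on k UNIV g" using g(1) by (auto simp: Ck_on_def)
  have close: "Ck_close_to_id k \<rho> \<Phi>" unfolding \<Phi>_def by (rule Ck_close_to_id_shear[OF g(1)]) (rule g(2))
  have surf: "Ck_hypersurface k (\<Phi> ` \<Sigma>)"
    unfolding \<Phi>_def
  proof (rule Ck_hypersurface_shear[OF k1 hyp Ckg])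
    show "g (x + t *\<^sub>R axis b 1) = g x" for x t by (rule g(3)) (simp add: axis_def)
  qed
  have "continuous_on UNIV \<Phi>" unfolding \<Phi>_def by (intro continuous_intros Ck_on_continuous[OF Ckg])
  then have "compact (\<Phi> ` \<Sigma>)" by (intro compact_continuous_image cpt) (rule continuous_on_subset, auto)
  then have Sig: "\<Phi> ` \<Sigma> \<in> sets borel" by (intro borel_closed compact_imp_closed)
  have lip: "\<bar>\<phi> x - \<phi> y\<bar> \<le> \<Lambda>' * (\<Sum>j\<in>UNIV - {b}. \<bar>x$j - y$j\<bar>)" for x y
  proof -
    have "\<bar>g x - g y\<bar> \<le> (real ?n * \<rho>) * (\<Sum>j\<in>UNIV - {b}. \<bar>x$j - y$j\<bar>)"
      by (rule Ck_derivs_lipschitz[OF g(1) k1]) (rule g(2), assumption, rule g(3), blast)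
    then show ?thesis using G(4)[of x y] unfolding \<phi>_def \<Lambda>'_def distrib_right by linarith
  qed
  have graph: "x \<in> \<Phi> ` \<Sigma>" if "\<And>j. j \<noteq> b \<Longrightarrow> \<bar>x$j - p$j\<bar> \<le> r" "x$b = \<phi> x" for x
  proof -
    define z where "z = (\<chi> j. if j = b then \<psi> x else x$j)"
    have "z \<in> \<Sigma>" unfolding z_def by (rule G(6)) (rule that(1))
    moreover have "g z = g x" by (rule g(3)) (simp add: z_def)
    then have "\<Phi> z = x" using that(2) by (simp add: \<Phi>_def \<phi>_def z_def vec_eq_iff axis_def)
    ultimately show ?thesis by force
  qed
  have main: "\<exists>C>0. \<forall>R>1. \<exists>(f :: real^'n \<Rightarrow> complex) (w :: real^'n \<Rightarrow> real).
              f \<in> borel_measurable (surface_measure (\<Phi> ` \<Sigma>)) \<and>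
              (\<integral>\<^sup>+ s. ennreal ((cmod (f s))\<^sup>2) \<partial>surface_measure (\<Phi> ` \<Sigma>)) < \<infinity> \<and>
              (\<integral>\<^sup>+ s. ennreal ((cmod (f s))\<^sup>2) \<partial>surface_measure (\<Phi> ` \<Sigma>)) > 0 \<and>
              w \<in> borel_measurable lborel \<and> (\<forall>x. 0 \<le> w x \<and> w x \<le> 1) \<and>
              Linf_sphere (tube_max w) > 0 \<and>
              (\<integral>\<^sup>+ x\<in>ball 0 R. ennreal ((cmod (fourier_ext (surface_measure (\<Phi> ` \<Sigma>)) f x))\<^sup>2 * w x) \<partial>lborel)
                \<ge> ennreal (R powr ((real ?n - 1) / (real ?n - 1 + real k) - \<epsilon>) / C)
                   * (\<integral>\<^sup>+ s. ennreal ((cmod (f s))\<^sup>2) \<partial>surface_measure (\<Phi> ` \<Sigma>))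
                   * Linf_sphere (tube_max w)" if eps: "0 < \<epsilon>" for \<epsilon>
  proof -
    define \<gamma> where "\<gamma> = (real ?n - 1) / (real ?n - 1 + real k)"
    have gam: "0 < \<gamma>" "\<gamma> \<le> 1" using n2 k2 by (auto simp: \<gamma>_def divide_le_eq)
    have "real (?n - 1) = real ?n - 1" using n1 by (simp add: of_nat_diff)
    then have gam': "real (?n - 1) / real (?n - 1 + k) = \<gamma>" by (simp only: \<gamma>_def of_nat_add)
    define e0 where "e0 = min \<epsilon> \<gamma>"
    have e0: "0 < e0" "e0 \<le> \<epsilon>" "e0 \<le> \<gamma>" using eps gam by (auto simp: e0_def)
    obtain P where P: "real (scale_chain ?n P + (5 * ?n + 4 * k)) \<le> real (scale_dim P) * e0" "12 + ?n \<le> scale_dim P"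
      using exists_scale_parameter[OF e0(1), of ?n k] by blast
    define d where "d = scale_dim P"
    define q where "q = scale_chain ?n P"
    define c where "c = scale_shrink ?n P"
    have d1: "1 \<le> d" using P(2) by (simp add: d_def)
    have c: "0 < c" "c \<le> 1" unfolding c_def by (rule scale_shrink_bounds[OF n1])+
    have D0: "0 < norm p + 2 + real d" by (simp add: add_nonneg_pos add_pos_nonneg)
    obtain c1 where c1: "0 < c1" "\<And>L. 1 \<le> L \<Longrightarrow> c1 * (real L powr (\<gamma> * real d) / real L ^ (5 * ?n + 4 * k)) \<le>
       real (cells_per_axis ?n k d L) ^ (?n - 1) * real L ^ d *
        ((2 * bump_radius r ?n k P L) ^ (?n - 1) * (2 * (a0 * scale_weight P L * bump_radius r ?n k P L ^ k)))
        / (2 * (2 * (norm p + 2 + real d)) ^ ?n)"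
      using hits_lower_bound[OF n2 G(1) a0 D0, of k P] unfolding gam' d_def by blast
    obtain c2 where c2: "0 < c2" "\<And>L. 1 \<le> L \<Longrightarrow> c2 / real L ^ d \<le> min (bump_radius r ?n k P L / 2) (1 / (16 * real ?n * (1 + \<Lambda>') * real L ^ d))"
      using piece_radius_lower_bound[OF n2 k2 G(1) Lam' P(2)] unfolding d_def by blast
    define KH where "KH = 2 ^ (?n - 1) / hausdorff_const (real ?n - 1)"
    have KH: "0 < KH" unfolding KH_def using n2 by (intro divide_pos_pos hausdorff_const_pos) auto
    define V2 where "V2 = measure lborel (ball (0::real^'n) 2)"
    have V2: "0 < V2" unfolding V2_def by (rule content_ball_pos) simp
    define \<omega> where "\<omega> = unit_ball_vol (real ?n)"
    have om: "0 < \<omega>" unfolding \<omega>_def by (rule unit_ball_vol_pos) simp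
    \<comment> \<open>Depends on \<epsilon> only through \<open>P\<close>, and on neither
      \<open>L\<close> nor \<open>R\<close>.\<close>
    define C where "C = 4 * 2 ^ d * 9 ^ q * V2 / (c1 * (2 * c2) ^ (?n - 1) / KH * (\<omega> * (c / 2) ^ ?n / (16 * real d) ^ d))"
    have C: "0 < C" unfolding C_def using V2 c1(1) c2(1) KH om c(1) d1 by simp
    show ?thesis
    proof (rule exI[of _ C], rule conjI[OF C], intro allI impI)
      fix R :: real assume R: "1 < R"
      obtain L where L: "1 \<le> L" "c * real L ^ d \<le> R" "R \<le> (2 * real L) ^ d"
        using exists_scale_length[OF R c d1] by blast
      have L0: "0 < real L" using L(1) by simp
      define h where "h = bump_radius r ?n k P L"
      have h0: "0 < h"
      proof -
        have "0 < ?n - 1 + k" using k2 by linarith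
        from cells_per_axis_bounds(1)[OF L(1) this] show ?thesis
          using G(1) scale_weight_pos[of P L] by (auto simp: h_def bump_radius_def Suc_le_eq intro!: divide_pos_pos)
      qed
      \<comment> \<open>Small enough to keep the caps inside disjoint cells, and to keep the phase
        error from the cap size within 1/16 up to the radius \<open>c * L ^ d\<close>.\<close>
      define rB where "rB = min (h / 2) (1 / (16 * real ?n * (1 + \<Lambda>') * real L ^ d))"
      have rB0: "0 < rB" using h0 n1 Lam' L0 by (auto simp: rB_def intro!: divide_pos_pos mult_pos_pos)
      have rBh: "rB < h" "rB \<le> h" using h0 by (auto simp: rB_def)
      have rBc: "c2 / real L ^ d \<le> rB" using c2(2)[OF L(1)] by (simp add: rB_def h_def)
      obtain H :: "('n \<Rightarrow> nat) set" and y u \<tau> where S0: "finite H \<and> (\<forall>i<d. u i \<in> cbox 0 1) \<and>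
        (\<forall>\<nu> a. norm \<nu> = 1 \<longrightarrow> emeasure lborel (model_set d L (c * real L ^ d) u \<inter> tube \<nu> a) \<le> ennreal (real ((9 * L) ^ q) * V2)) \<and>
        real (cells_per_axis ?n k d L) ^ (?n - 1) * real L ^ d *
        ((2 * h) ^ (?n - 1) * (2 * (a0 * scale_weight P L * h ^ k)))
        / (2 * (2 * (norm p + 2 + real d)) ^ ?n) \<le> real (card H) \<and>
        (\<forall>\<kappa>\<in>H. \<exists>m\<in>gap_index d L. y \<kappa> = \<tau> + gap_point d L u m) \<and>
        (\<forall>\<kappa>\<in>H. y \<kappa>$b = \<psi> (y \<kappa>) + g (y \<kappa>)) \<and>
        (\<forall>\<kappa>\<in>H. \<forall>\<kappa>'\<in>H. \<kappa> \<noteq> \<kappa>' \<longrightarrow> (\<exists>j. j \<noteq> b \<and> 2 * h \<le> \<bar>y \<kappa>$j - y \<kappa>'$j\<bar>)) \<and>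
        (\<forall>\<kappa>\<in>H. \<forall>j. j \<noteq> b \<longrightarrow> \<bar>y \<kappa>$j - p$j\<bar> \<le> r - h)"
        using scales[THEN spec, THEN spec, THEN mp, of L P, OF L(1)]
        unfolding d_def[symmetric] q_def[symmetric] c_def[symmetric] h_def[symmetric] V2_def[symmetric]
        by (elim exE) (rule that)
      note S1 = S0[THEN conjunct2] note S2 = S1[THEN conjunct2] note S3 = S2[THEN conjunct2]
      note S4 = S3[THEN conjunct2] note S5 = S4[THEN conjunct2] note S6 = S5[THEN conjunct2]
      note S = S0[THEN conjunct1] S1[THEN conjunct1, rule_format] S2[THEN conjunct1, rule_format] S3[THEN conjunct1]
        S4[THEN conjunct1, rule_format] S5[THEN conjunct1, rule_format] S6[THEN conjunct1, rule_format] S6[THEN conjunct2, rule_format]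
      define X where "X = real L powr (\<gamma> * real d) / real L ^ (5 * ?n + 4 * k)"
      have X: "0 < X" using L0 by (simp add: X_def)
      have cX: "c1 * X \<le> real (card H)" using c1(2)[OF L(1)] S(4) unfolding X_def h_def by (rule order_trans)
      have "0 < real (card H)" using cX mult_pos_pos[OF c1(1) X] by linarith
      then have Hne: "H \<noteq> {}" by auto
      have Rp: "R powr (\<gamma> - \<epsilon>) * real L ^ q \<le> 2 ^ d * X"
        unfolding X_def by (rule scale_exponent_bound[OF R L(3) L(1) gam e0(2,3)]) (use P(1) in \<open>simp only: d_def q_def\<close>)
      have R0pos: "0 < c * real L ^ d" using c L0 by simp
      have ball: "measure lborel (ball (0::real^'n) (c * real L ^ d / 2)) = \<omega> * (c * real L ^ d / 2) ^ ?n"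
        using R0pos by (subst content_ball) (auto simp: \<omega>_def)
      show "\<exists>(f :: real^'n \<Rightarrow> complex) (w :: real^'n \<Rightarrow> real).
              f \<in> borel_measurable (surface_measure (\<Phi> ` \<Sigma>)) \<and>
              (\<integral>\<^sup>+ s. ennreal ((cmod (f s))\<^sup>2) \<partial>surface_measure (\<Phi> ` \<Sigma>)) < \<infinity> \<and>
              (\<integral>\<^sup>+ s. ennreal ((cmod (f s))\<^sup>2) \<partial>surface_measure (\<Phi> ` \<Sigma>)) > 0 \<and>
              w \<in> borel_measurable lborel \<and> (\<forall>x. 0 \<le> w x \<and> w x \<le> 1) \<and>
              Linf_sphere (tube_max w) > 0 \<and>
              (\<integral>\<^sup>+ x\<in>ball 0 R. ennreal ((cmod (fourier_ext (surface_measure (\<Phi> ` \<Sigma>)) f x))\<^sup>2 * w x) \<partial>lborel)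
                \<ge> ennreal (R powr ((real ?n - 1) / (real ?n - 1 + real k) - \<epsilon>) / C)
                   * (\<integral>\<^sup>+ s. ennreal ((cmod (f s))\<^sup>2) \<partial>surface_measure (\<Phi> ` \<Sigma>))
                   * Linf_sphere (tube_max w)"
        unfolding \<gamma>_def[symmetric]
      proof (rule scale_test_functions[OF n2 Sig _ lip Lam' S(1) Hne S(7) rB0 rBh(1) _ S(5) d1 L(1) S(2) R0pos L(2) _ S(3)])
        fix x \<kappa> assume xk: "\<kappa> \<in> H" "\<And>j. j \<noteq> b \<Longrightarrow> \<bar>x$j - y \<kappa>$j\<bar> \<le> rB" "x$b = \<phi> x"
        show "x \<in> \<Phi> ` \<Sigma>"
        proof (rule graph)
          show "\<bar>x$j - p$j\<bar> \<le> r" if "j \<noteq> b" for j using S(8)[OF xk(1) that] xk(2)[OF that] rBh(2) by linarith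
        qed (rule xk(3))
      next
        show "y \<kappa>$b = \<phi> (y \<kappa>)" if "\<kappa> \<in> H" for \<kappa> using S(6)[OF that] by (simp add: \<phi>_def)
        have "16 * real ?n * (1 + \<Lambda>') * rB * (c * real L ^ d) \<le> 16 * real ?n * (1 + \<Lambda>') * (1 / (16 * real ?n * (1 + \<Lambda>') * real L ^ d)) * (1 * real L ^ d)"
          using n1 Lam' L0 c rB0 by (intro mult_mono mult_nonneg_nonneg) (auto simp: rB_def)
        also have "\<dots> = 1" using n1 Lam' L0 by simp
        finally show "16 * real ?n * (1 + \<Lambda>') * rB * (c * real L ^ d) \<le> 1" .
        show "0 \<le> R powr (\<gamma> - \<epsilon>) / C" using C by simp
        show "0 \<le> real ((9 * L) ^ q) * V2" using V2 by simp
        show "4 * (R powr (\<gamma> - \<epsilon>) / C) * (real ((9 * L) ^ q) * V2) \<le>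
          (real (card H) * (2 * rB) ^ (?n - 1) / (2 ^ (?n - 1) / hausdorff_const (real ?n - 1)))
           * (measure lborel (ball (0::real^'n) (c * real L ^ d / 2)) / real (16 * d * L) ^ d)"
          unfolding ball KH_def[symmetric] C_def
          by (rule scale_constants[OF c(1) c1(1) c2(1) KH V2 om n1 L(1) d1 less_imp_le[OF X] cX rBc Rp])
      qed
    qed
  qed
  show "\<exists>\<Phi>. Ck_close_to_id k \<rho> \<Phi> \<and> Ck_hypersurface k (\<Phi> ` \<Sigma>) \<and>
           (\<forall>\<epsilon>>0. \<exists>C>0. \<forall>R>1. \<exists>(f :: real^'n \<Rightarrow> complex) (w :: real^'n \<Rightarrow> real).
              f \<in> borel_measurable (surface_measure (\<Phi> ` \<Sigma>)) \<and>
              (\<integral>\<^sup>+ s. ennreal ((cmod (f s))\<^sup>2) \<partial>surface_measure (\<Phi> ` \<Sigma>)) < \<infinity> \<and>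
              (\<integral>\<^sup>+ s. ennreal ((cmod (f s))\<^sup>2) \<partial>surface_measure (\<Phi> ` \<Sigma>)) > 0 \<and>
              w \<in> borel_measurable lborel \<and> (\<forall>x. 0 \<le> w x \<and> w x \<le> 1) \<and>
              Linf_sphere (tube_max w) > 0 \<and>
              (\<integral>\<^sup>+ x\<in>ball 0 R. ennreal ((cmod (fourier_ext (surface_measure (\<Phi> ` \<Sigma>)) f x))\<^sup>2 * w x) \<partial>lborel)
                \<ge> ennreal (R powr ((real CARD('n) - 1) / (real CARD('n) - 1 + real k) - \<epsilon>) / C)
                   * (\<integral>\<^sup>+ s. ennreal ((cmod (f s))\<^sup>2) \<partial>surface_measure (\<Phi> ` \<Sigma>))
                   * Linf_sphere (tube_max w))"
    by (rule exI[of _ \<Phi>], intro conjI close surf allI impI) (rule main)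
qed

end
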